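(* Let $X$ be a simplicial complex on $[n]$ with Stanley-Reisner ring $A_X$, and let $\mathbf c=\mathbf a-\mathbf b$ with $\mathbf a,\mathbf b\in\mathbb N^{n+1}$ having disjoint supports $a,b\subseteq[n]$. The homogeneous pieces $T^i_{\mathbf c}(X)$ ($i=1,2$) in degree $\mathbf c$ of the cotangent cohomology of $A_X$ vanish unless $\mathbf b\in\{0,1\}^{n+1}$, i.e. unless $\mathbf b=b$. Assuming $\mathbf b=b$, these modules depend only on the supports $a,b$, and there are isomorphisms $$T^i_{\mathbf c}(X)\;\simeq\;H^{i-1}\big(\langle N_{a-b}\rangle,\langle\widetilde N_{a-b}\rangle,\mathbb C\big)\quad\text{for } i=1,2,$$ unless $b$ consists of a single vertex. If $b$ consists of only one vertex (in which case $\widetilde N_{a-b}=\emptyset$), then these formulae become true if reduced cohomology is used instead. Moreover, if $T^1_{\mathbf c}(X)$ is replaced by $\mathrm{Hom}_P(I_X,A_X)_{\mathbf c}$, then the (non-reduced) formula $$\mathrm{Hom}_P(I_X,A_X)_{\mathbf c}\;\simeq\;H^{0}\big(\langle N_{a-b}\rangle,\langle\widetilde N_{a-b}\rangle,\mathbb C\big)$$ holds without any need to distinguish between cases.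
   Context: Let $[n]=\{0,\dots,n\}$ and $P=\mathbb C[x_0,\dots,x_n]$. A simplicial complex $X$ on $[n]$ is a family of subsets of $[n]$ closed under taking subsets, with $\emptyset\in X$ (elements of $[n]$ need not be vertices of $X$). A subset $p\subseteq[n]$ is identified with its characteristic vector in $\{0,1\}^{n+1}$; the support of a vector $\mathbf p\in\mathbb N^{n+1}$ is $p=\{i:\mathbf p_i\neq0\}$. Put $I_X=\langle \mathbf x^p : p\subseteq[n],\,p\notin X\rangle$ and $A_X=P/I_X$. For $A=P/I$: $T^1_A$ is the cokernel of the natural map $\mathrm{Der}_{\mathbb C}(P,P)\to\mathrm{Hom}_P(I,A)$. If $0\to R\to P^m\xrightarrow{j}P\to A\to0$ is exact and $R_0=\langle j(f)e-j(e)f : e,f\in P^m\rangle\subseteq R$ (Koszul relations), then $T^2_A$ is the cokernel of the induced map $\mathrm{Hom}_P(P^m,A)\to\mathrm{Hom}_A(R/R_0,A)$. For $A=A_X$ all these modules are $\mathbb Z^{n+1}$-graded ($\deg x_i$ is the $i$-th unit vector); a subscript $\mathbf c$ denotes the homogeneous part of degree $\mathbf c\in\mathbb Z^{n+1}$, and $T^i_{\mathbf c}(X):=T^i_{A_X,\mathbf c}$. For disjoint $a,b\subseteq[n]$: $N_{a-b}=N_{a-b}(X):=\{f\in X : a\subseteq f,\ f\cap b=\emptyset,\ f\cup b\notin X\}$, and $\widetilde N_{a-b}=\widetilde N_{a-b}(X):=\{f\in N_{a-b}: f\cup b'\notin X\text{ for some proper subset } b'\subsetneq b\}$. Geometric realization: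 $|X|=\{\alpha:[n]\to[0,1] : \{i:\alpha(i)\ne0\}\in X,\ \sum_i\alpha(i)=1\}$. For $\emptyset\neq f\in X$, $\langle f\rangle=\{\alpha\in|X| : \alpha(i)\neq0\Leftrightarrow i\in f\}$. For any subset $Y\subseteq X$, $\langle Y\rangle=\bigcup_{f\in Y}\langle f\rangle\subseteq|X|$ if $\emptyset\notin Y$, and $\langle Y\rangle=\mathrm{cone}\big(\bigcup_{\emptyset\ne f\in Y}\langle f\rangle\big)$ if $\emptyset\in Y$, regarded as a subspace of $|\Delta_0*X|$, the geometric cone over $|X|$ (the cone over the empty set is the one-point space consisting of the apex). $H^\bullet(\cdot,\cdot,\mathbb C)$ is singular cohomology of pairs; the reduced cohomology of the empty space is taken to be $0$ in degrees $\ge0$. *)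

theory Defs
  imports "HOL-Homology.Homology" "HOL-Algebra.QuotRing" "HOL-Algebra.Module" "HOL-Library.Poly_Mapping"
begin

section \<open>Modules: homomorphisms, quotients, change of scalars\<close>

text \<open>The type of module records extends that of ring records; the fields for the
  multiplication and the unit play no role for a module and are left undefined.\<close>

definition self_module :: "('r, 'x) ring_scheme \<Rightarrow> ('r, 'r) module" where
  "self_module R = \<lparr>carrier = carrier R, monoid.mult = monoid.mult R, one = one R,
     zero = zero R, add = add R, smult = monoid.mult R\<rparr>"

definition restrict_scalars :: "('s \<Rightarrow> 'r) \<Rightarrow> ('r, 'm) module \<Rightarrow> ('s, 'm) module" where
  "restrict_scalars \<phi> M = \<lparr>carrier = carrier M, monoid.mult = undefined, one = undefined,
     zero = zero M, add = add M, smult = (\<lambda>s x. \<phi> s \<odot>\<^bsub>M\<^esub> x)\<rparr>"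

definition mod_hom :: "('r, 'x) ring_scheme \<Rightarrow> ('r, 'm) module \<Rightarrow> ('r, 'k) module \<Rightarrow> ('m \<Rightarrow> 'k) set" where
  "mod_hom R M N = {h \<in> carrier M \<rightarrow>\<^sub>E carrier N.
     (\<forall>x\<in>carrier M. \<forall>y\<in>carrier M. h (x \<oplus>\<^bsub>M\<^esub> y) = h x \<oplus>\<^bsub>N\<^esub> h y) \<and>
     (\<forall>r\<in>carrier R. \<forall>x\<in>carrier M. h (r \<odot>\<^bsub>M\<^esub> x) = r \<odot>\<^bsub>N\<^esub> h x)}"

definition hom_module :: "('r, 'x) ring_scheme \<Rightarrow> ('r, 'm) module \<Rightarrow> ('r, 'k) module \<Rightarrow> ('r, 'm \<Rightarrow> 'k) module" where
  "hom_module R M N = \<lparr>carrier = mod_hom R M N, monoid.mult = undefined, one = undefined,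
     zero = (\<lambda>x\<in>carrier M. \<zero>\<^bsub>N\<^esub>),
     add = (\<lambda>g h. \<lambda>x\<in>carrier M. g x \<oplus>\<^bsub>N\<^esub> h x),
     smult = (\<lambda>r h. \<lambda>x\<in>carrier M. r \<odot>\<^bsub>N\<^esub> h x)\<rparr>"

definition mod_iso :: "('r, 'x) ring_scheme \<Rightarrow> ('r, 'm) module \<Rightarrow> ('r, 'k) module \<Rightarrow> bool" where
  "mod_iso R M N \<longleftrightarrow> (\<exists>h\<in>mod_hom R M N. bij_betw h (carrier M) (carrier N))"

definition quot_module :: "('r, 'm) module \<Rightarrow> 'm set \<Rightarrow> ('r, 'm set) module" where
  "quot_module M N = \<lparr>carrier = a_rcosets\<^bsub>M\<^esub> N, monoid.mult = undefined, one = undefined,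
     zero = N, add = set_add M,
     smult = (\<lambda>r A. \<Union>x\<in>A. N +>\<^bsub>M\<^esub> (r \<odot>\<^bsub>M\<^esub> x))\<rparr>"

text \<open>A module over \<open>R\<close> that is annihilated by an ideal \<open>I\<close> is a module over \<open>R Quot I\<close>:
  a coset acts by any of its representatives.\<close>

definition descend_scalars :: "('r, 'm) module \<Rightarrow> ('r set, 'm) module" where
  "descend_scalars M = \<lparr>carrier = carrier M, monoid.mult = undefined, one = undefined,
     zero = zero M, add = add M, smult = (\<lambda>A x. the_elem ((\<lambda>r. r \<odot>\<^bsub>M\<^esub> x) ` A))\<rparr>"

definition free_module :: "('r, 'x) ring_scheme \<Rightarrow> nat \<Rightarrow> ('r, nat \<Rightarrow> 'r) module" where
  "free_module R m = \<lparr>carrier = {..<m} \<rightarrow>\<^sub>E carrier R, monoid.mult = undefined, one = undefined,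
     zero = (\<lambda>k\<in>{..<m}. \<zero>\<^bsub>R\<^esub>),
     add = (\<lambda>v w. \<lambda>k\<in>{..<m}. v k \<oplus>\<^bsub>R\<^esub> w k),
     smult = (\<lambda>r v. \<lambda>k\<in>{..<m}. r \<otimes>\<^bsub>R\<^esub> v k)\<rparr>"

definition unit_vec :: "('r, 'x) ring_scheme \<Rightarrow> nat \<Rightarrow> nat \<Rightarrow> nat \<Rightarrow> 'r" where
  "unit_vec R m k = (\<lambda>i\<in>{..<m}. if i = k then \<one>\<^bsub>R\<^esub> else \<zero>\<^bsub>R\<^esub>)"


section \<open>The polynomial ring and its grading\<close>

type_synonym cpoly = "(nat \<Rightarrow>\<^sub>0 nat) \<Rightarrow>\<^sub>0 complex"

definition complex_ring :: "complex ring" where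
  "complex_ring = \<lparr>carrier = UNIV, monoid.mult = (*), one = 1, zero = 0, add = (+)\<rparr>"

text \<open>Polynomials in the variables \<open>x\<^sub>0, \<dots>, x\<^sub>n\<close> are finitely supported functions from exponent
  vectors to coefficients.\<close>

definition poly_ring_upto :: "nat \<Rightarrow> cpoly ring" where
  "poly_ring_upto n = \<lparr>carrier = {p. \<forall>\<mu>\<in>Poly_Mapping.keys p. Poly_Mapping.keys \<mu> \<subseteq> {0..n}},
     monoid.mult = (*), one = 1, zero = 0, add = (+)\<rparr>"

definition const_poly :: "complex \<Rightarrow> cpoly" where
  "const_poly z = Poly_Mapping.single 0 z"

definition sqfree_monom :: "nat set \<Rightarrow> cpoly" where
  "sqfree_monom p = (\<Prod>i\<in>p. Poly_Mapping.single (Poly_Mapping.single i 1) 1)"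

text \<open>Degrees in \<open>\<int>\<^sup>n\<^sup>+\<^sup>1\<close> are functions \<open>nat \<Rightarrow> int\<close> that vanish above \<open>n\<close>. If \<open>d\<close> has a negative
  entry or does not vanish above \<open>n\<close>, then the part of degree \<open>d\<close> is zero.\<close>

definition poly_part :: "nat \<Rightarrow> (nat \<Rightarrow> int) \<Rightarrow> cpoly set" where
  "poly_part n d = {p \<in> carrier (poly_ring_upto n).
     \<forall>\<mu>\<in>Poly_Mapping.keys p. \<forall>i. int (Poly_Mapping.lookup \<mu> i) = d i}"

definition quot_part :: "nat \<Rightarrow> cpoly set \<Rightarrow> (nat \<Rightarrow> int) \<Rightarrow> cpoly set set" where
  "quot_part n I d = (\<lambda>p. I +>\<^bsub>poly_ring_upto n\<^esub> p) ` poly_part n d"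

definition hom_part :: "((nat \<Rightarrow> int) \<Rightarrow> 'm set) \<Rightarrow> ((nat \<Rightarrow> int) \<Rightarrow> 'k set) \<Rightarrow>
    ('m \<Rightarrow> 'k) set \<Rightarrow> (nat \<Rightarrow> int) \<Rightarrow> ('m \<Rightarrow> 'k) set" where
  "hom_part Mdeg Ndeg H c = {h \<in> H. \<forall>d. h ` Mdeg d \<subseteq> Ndeg (\<lambda>i. d i + c i)}"


section \<open>Cotangent cohomology of \<open>A = P / I\<close>\<close>

definition ideal_module :: "nat \<Rightarrow> cpoly set \<Rightarrow> (cpoly, cpoly) module" where
  "ideal_module n I = (self_module (poly_ring_upto n))\<lparr>carrier := I\<rparr>"

definition quot_as_module :: "nat \<Rightarrow> cpoly set \<Rightarrow> (cpoly, cpoly set) module" where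
  "quot_as_module n I = restrict_scalars (\<lambda>p. I +>\<^bsub>poly_ring_upto n\<^esub> p)
     (self_module (poly_ring_upto n Quot I))"

definition derivations :: "nat \<Rightarrow> (cpoly \<Rightarrow> cpoly) set" where
  "derivations n = {D \<in> carrier (poly_ring_upto n) \<rightarrow>\<^sub>E carrier (poly_ring_upto n).
     (\<forall>p\<in>carrier (poly_ring_upto n). \<forall>q\<in>carrier (poly_ring_upto n).
        D (p + q) = D p + D q \<and> D (p * q) = p * D q + q * D p) \<and>
     (\<forall>z. \<forall>p\<in>carrier (poly_ring_upto n). D (const_poly z * p) = const_poly z * D p)}"

definition hom_I_A :: "nat \<Rightarrow> cpoly set \<Rightarrow> (cpoly, cpoly \<Rightarrow> cpoly set) module" where
  "hom_I_A n I = hom_module (poly_ring_upto n) (ideal_module n I) (quot_as_module n I)"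

definition hom_I_A_part :: "nat \<Rightarrow> cpoly set \<Rightarrow> (nat \<Rightarrow> int) \<Rightarrow> (complex, cpoly \<Rightarrow> cpoly set) module" where
  "hom_I_A_part n I c = restrict_scalars const_poly ((hom_I_A n I)
     \<lparr>carrier := hom_part (\<lambda>d. I \<inter> poly_part n d) (quot_part n I) (carrier (hom_I_A n I)) c\<rparr>)"

definition der_image :: "nat \<Rightarrow> cpoly set \<Rightarrow> (cpoly \<Rightarrow> cpoly set) set" where
  "der_image n I = (\<lambda>D. \<lambda>p\<in>I. I +>\<^bsub>poly_ring_upto n\<^esub> D p) ` derivations n"

definition T1 :: "nat \<Rightarrow> cpoly set \<Rightarrow> (cpoly, (cpoly \<Rightarrow> cpoly set) set) module" where
  "T1 n I = quot_module (hom_I_A n I) (der_image n I)"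

text \<open>The degree \<open>c\<close> part of a cokernel consists of the classes of the elements of degree \<open>c\<close>;
  it is a vector space over \<open>\<complex>\<close>.\<close>

definition T1_part :: "nat \<Rightarrow> cpoly set \<Rightarrow> (nat \<Rightarrow> int) \<Rightarrow> (complex, (cpoly \<Rightarrow> cpoly set) set) module" where
  "T1_part n I c = restrict_scalars const_poly ((T1 n I)
     \<lparr>carrier := (\<lambda>h. der_image n I +>\<^bsub>hom_I_A n I\<^esub> h) ` carrier (hom_I_A_part n I c)\<rparr>)"

text \<open>A homogeneous presentation \<open>0 \<rightarrow> R \<rightarrow> P\<^sup>m \<rightarrow> P \<rightarrow> P/I \<rightarrow> 0\<close>: the map \<open>j\<close> has image \<open>I\<close> and
  preserves degrees when the \<open>k\<close>-th unit vector of \<open>P\<^sup>m\<close> is given the degree \<open>\<delta> k\<close>.\<close>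

definition graded_presentation ::
    "nat \<Rightarrow> cpoly set \<Rightarrow> nat \<Rightarrow> (nat \<Rightarrow> nat \<Rightarrow> int) \<Rightarrow> ((nat \<Rightarrow> cpoly) \<Rightarrow> cpoly) \<Rightarrow> bool" where
  "graded_presentation n I m \<delta> j \<longleftrightarrow>
     j \<in> mod_hom (poly_ring_upto n) (free_module (poly_ring_upto n) m) (self_module (poly_ring_upto n)) \<and>
     j ` carrier (free_module (poly_ring_upto n) m) = I \<and>
     (\<forall>k<m. (\<forall>i>n. \<delta> k i = 0) \<and> j (unit_vec (poly_ring_upto n) m k) \<in> poly_part n (\<delta> k))"

definition free_part :: "nat \<Rightarrow> nat \<Rightarrow> (nat \<Rightarrow> nat \<Rightarrow> int) \<Rightarrow> (nat \<Rightarrow> int) \<Rightarrow> (nat \<Rightarrow> cpoly) set" where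
  "free_part n m \<delta> d = {v \<in> carrier (free_module (poly_ring_upto n) m).
     \<forall>k<m. v k \<in> poly_part n (\<lambda>i. d i - \<delta> k i)}"

definition relations :: "nat \<Rightarrow> nat \<Rightarrow> ((nat \<Rightarrow> cpoly) \<Rightarrow> cpoly) \<Rightarrow> (nat \<Rightarrow> cpoly) set" where
  "relations n m j = {v \<in> carrier (free_module (poly_ring_upto n) m). j v = 0}"

definition koszul_relations :: "nat \<Rightarrow> nat \<Rightarrow> ((nat \<Rightarrow> cpoly) \<Rightarrow> cpoly) \<Rightarrow> (nat \<Rightarrow> cpoly) set" where
  "koszul_relations n m j = (let F = free_module (poly_ring_upto n) m in
     (\<lambda>N. submodule N (poly_ring_upto n) F) hull
       {(j f \<odot>\<^bsub>F\<^esub> e) \<ominus>\<^bsub>F\<^esub> (j e \<odot>\<^bsub>F\<^esub> f) |e f. e \<in> carrier F \<and> f \<in> carrier F})"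

definition rel_module :: "nat \<Rightarrow> nat \<Rightarrow> ((nat \<Rightarrow> cpoly) \<Rightarrow> cpoly) \<Rightarrow> (cpoly, nat \<Rightarrow> cpoly) module" where
  "rel_module n m j = (free_module (poly_ring_upto n) m)\<lparr>carrier := relations n m j\<rparr>"

definition rel_quot :: "nat \<Rightarrow> nat \<Rightarrow> ((nat \<Rightarrow> cpoly) \<Rightarrow> cpoly) \<Rightarrow> (cpoly set, (nat \<Rightarrow> cpoly) set) module" where
  "rel_quot n m j = descend_scalars (quot_module (rel_module n m j) (koszul_relations n m j))"

definition rel_quot_part :: "nat \<Rightarrow> nat \<Rightarrow> (nat \<Rightarrow> nat \<Rightarrow> int) \<Rightarrow> ((nat \<Rightarrow> cpoly) \<Rightarrow> cpoly) \<Rightarrow>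
    (nat \<Rightarrow> int) \<Rightarrow> (nat \<Rightarrow> cpoly) set set" where
  "rel_quot_part n m \<delta> j d =
     (\<lambda>v. koszul_relations n m j +>\<^bsub>rel_module n m j\<^esub> v) ` (relations n m j \<inter> free_part n m \<delta> d)"

definition hom_R_A :: "nat \<Rightarrow> cpoly set \<Rightarrow> nat \<Rightarrow> ((nat \<Rightarrow> cpoly) \<Rightarrow> cpoly) \<Rightarrow>
    (cpoly set, (nat \<Rightarrow> cpoly) set \<Rightarrow> cpoly set) module" where
  "hom_R_A n I m j = hom_module (poly_ring_upto n Quot I) (rel_quot n m j)
     (self_module (poly_ring_upto n Quot I))"

text \<open>The image of \<open>Hom\<^sub>P(P\<^sup>m, A)\<close>: a homomorphism is restricted to \<open>R\<close>, and the restriction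
  factors through \<open>R / R\<^sub>0\<close>, i.e. it is constant on each coset.\<close>

definition free_image :: "nat \<Rightarrow> cpoly set \<Rightarrow> nat \<Rightarrow> ((nat \<Rightarrow> cpoly) \<Rightarrow> cpoly) \<Rightarrow>
    ((nat \<Rightarrow> cpoly) set \<Rightarrow> cpoly set) set" where
  "free_image n I m j = (\<lambda>h. \<lambda>\<xi>\<in>carrier (rel_quot n m j). the_elem (h ` \<xi>)) `
     mod_hom (poly_ring_upto n) (free_module (poly_ring_upto n) m) (quot_as_module n I)"

definition T2 :: "nat \<Rightarrow> cpoly set \<Rightarrow> nat \<Rightarrow> ((nat \<Rightarrow> cpoly) \<Rightarrow> cpoly) \<Rightarrow>
    (cpoly set, ((nat \<Rightarrow> cpoly) set \<Rightarrow> cpoly set) set) module" where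
  "T2 n I m j = quot_module (hom_R_A n I m j) (free_image n I m j)"

definition T2_part :: "nat \<Rightarrow> cpoly set \<Rightarrow> nat \<Rightarrow> (nat \<Rightarrow> nat \<Rightarrow> int) \<Rightarrow> ((nat \<Rightarrow> cpoly) \<Rightarrow> cpoly) \<Rightarrow>
    (nat \<Rightarrow> int) \<Rightarrow> (complex, ((nat \<Rightarrow> cpoly) set \<Rightarrow> cpoly set) set) module" where
  "T2_part n I m \<delta> j c = restrict_scalars (\<lambda>z. I +>\<^bsub>poly_ring_upto n\<^esub> const_poly z) ((T2 n I m j)
     \<lparr>carrier := (\<lambda>h. free_image n I m j +>\<^bsub>hom_R_A n I m j\<^esub> h) `
        hom_part (rel_quot_part n m \<delta> j) (quot_part n I) (carrier (hom_R_A n I m j)) c\<rparr>)"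


section \<open>Simplicial complexes\<close>

definition simplicial_complex_on :: "nat \<Rightarrow> nat set set \<Rightarrow> bool" where
  "simplicial_complex_on n X \<longleftrightarrow> X \<subseteq> Pow {0..n} \<and> {} \<in> X \<and> (\<forall>f\<in>X. \<forall>g. g \<subseteq> f \<longrightarrow> g \<in> X)"

definition SR_ideal :: "nat \<Rightarrow> nat set set \<Rightarrow> cpoly set" where
  "SR_ideal n X = Idl\<^bsub>poly_ring_upto n\<^esub> {sqfree_monom p |p. p \<subseteq> {0..n} \<and> p \<notin> X}"

definition supp :: "(nat \<Rightarrow> nat) \<Rightarrow> nat set" where
  "supp v = {i. v i \<noteq> 0}"

definition N_set :: "nat set set \<Rightarrow> nat set \<Rightarrow> nat set \<Rightarrow> nat set set" where
  "N_set X a b = {f \<in> X. a \<subseteq> f \<and> f \<inter> b = {} \<and> f \<union> b \<notin> X}"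

definition N_tilde :: "nat set set \<Rightarrow> nat set \<Rightarrow> nat set \<Rightarrow> nat set set" where
  "N_tilde X a b = {f \<in> N_set X a b. \<exists>b'. b' \<subset> b \<and> f \<union> b' \<notin> X}"

definition realization :: "nat \<Rightarrow> nat set set \<Rightarrow> (nat \<Rightarrow> real) set" where
  "realization n X = {\<alpha> \<in> standard_simplex n. {i. \<alpha> i \<noteq> 0} \<in> X}"

definition cell :: "nat \<Rightarrow> nat set set \<Rightarrow> nat set \<Rightarrow> (nat \<Rightarrow> real) set" where
  "cell n X f = {\<alpha> \<in> realization n X. \<forall>i. \<alpha> i \<noteq> 0 \<longleftrightarrow> i \<in> f}"

text \<open>The cone vertex of \<open>\<Delta>\<^sub>0 * X\<close> is \<open>n + 1\<close>, so that \<open>|X|\<close> is the part of \<open>|\<Delta>\<^sub>0 * X|\<close> where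
  the last coordinate vanishes.\<close>

definition apex :: "nat \<Rightarrow> nat \<Rightarrow> real" where
  "apex n = (\<lambda>i. if i = Suc n then 1 else 0)"

definition geom_cone :: "nat \<Rightarrow> (nat \<Rightarrow> real) set \<Rightarrow> (nat \<Rightarrow> real) set" where
  "geom_cone n S = insert (apex n)
     {\<lambda>i. (1 - t) * \<alpha> i + t * apex n i |\<alpha> t. \<alpha> \<in> S \<and> 0 \<le> t \<and> t \<le> 1}"

definition space_of :: "nat \<Rightarrow> nat set set \<Rightarrow> nat set set \<Rightarrow> (nat \<Rightarrow> real) set" where
  "space_of n X Y = (let U = (\<Union>f\<in>Y - {{}}. cell n X f) in if {} \<in> Y then geom_cone n U else U)"


section \<open>Singular cohomology with complex coefficients\<close>

definition cochains :: "nat \<Rightarrow> 'a topology \<Rightarrow> 'a set \<Rightarrow> (complex, 'a chain \<Rightarrow> complex) module" where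
  "cochains p X S = \<lparr>carrier = {\<phi> \<in> extensional (singular_chain_set p X).
       \<phi> \<in> hom (chain_group p X) (add_monoid complex_ring) \<and>
       (\<forall>c\<in>singular_chain_set p (subtopology X S). \<phi> c = 0)},
     monoid.mult = undefined, one = undefined,
     zero = (\<lambda>c\<in>singular_chain_set p X. 0),
     add = (\<lambda>\<phi> \<psi>. \<lambda>c\<in>singular_chain_set p X. \<phi> c + \<psi> c),
     smult = (\<lambda>z \<phi>. \<lambda>c\<in>singular_chain_set p X. z * \<phi> c)\<rparr>"

definition coboundary :: "nat \<Rightarrow> 'a topology \<Rightarrow> ('a chain \<Rightarrow> complex) \<Rightarrow> 'a chain \<Rightarrow> complex" where
  "coboundary p X \<phi> = (\<lambda>c\<in>singular_chain_set (Suc p) X. \<phi> (chain_boundary (Suc p) c))"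

definition cocycles :: "nat \<Rightarrow> 'a topology \<Rightarrow> 'a set \<Rightarrow> (complex, 'a chain \<Rightarrow> complex) module" where
  "cocycles p X S = (cochains p X S)
     \<lparr>carrier := {\<phi> \<in> carrier (cochains p X S). coboundary p X \<phi> = \<zero>\<^bsub>cochains (Suc p) X S\<^esub>}\<rparr>"

definition coboundaries :: "nat \<Rightarrow> 'a topology \<Rightarrow> 'a set \<Rightarrow> ('a chain \<Rightarrow> complex) set" where
  "coboundaries p X S = (case p of 0 \<Rightarrow> {\<zero>\<^bsub>cochains 0 X S\<^esub>}
     | Suc q \<Rightarrow> coboundary q X ` carrier (cochains q X S))"

definition cohomology :: "nat \<Rightarrow> 'a topology \<Rightarrow> 'a set \<Rightarrow> (complex, ('a chain \<Rightarrow> complex) set) module" where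
  "cohomology p X S = quot_module (cocycles p X S) (coboundaries p X S)"

text \<open>Reduced cohomology in degrees \<open>\<ge> 0\<close>: in degree 0 the multiples of the augmentation are
  coboundaries. For the empty space this gives 0.\<close>

definition augmentation :: "'a topology \<Rightarrow> complex \<Rightarrow> 'a chain \<Rightarrow> complex" where
  "augmentation X z = (\<lambda>c\<in>singular_chain_set 0 X.
     z * of_int (\<Sum>\<sigma>\<in>Poly_Mapping.keys c. Poly_Mapping.lookup c \<sigma>))"

definition reduced_cohomology :: "nat \<Rightarrow> 'a topology \<Rightarrow> (complex, ('a chain \<Rightarrow> complex) set) module" where
  "reduced_cohomology p X = quot_module (cocycles p X {})
     (if p = 0 then range (augmentation X) else coboundaries p X {})"

end

theory Submission
  imports Defs
begin

text \<open>
  Everything rests on a coefficientwise description of the graded pieces. A homomorphism from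
  \<open>I\<close> to \<open>A\<close> of degree \<open>c\<close> sends each monomial \<open>x^d\<close> of \<open>I\<close> to a multiple \<open>u d\<close> of \<open>x^(d + c)\<close>, and
  only the degrees with \<open>x^d \<in> I\<close> and \<open>x^(d + c) \<noteq> 0\<close> in \<open>A\<close> matter. Linearity says that \<open>u\<close> does not
  change along \<open>d \<le> e\<close>, and that \<open>u e = 0\<close> as soon as some monomial of \<open>I\<close> dividing \<open>x^e\<close> has no room
  for its image, that is, if adding \<open>c\<close> to its exponent leaves a negative entry. The assignment \<open>d \<mapsto> supp (d + c) - b\<close> maps the degrees that matter monotonically to
  \<open>N_set\<close>. If \<open>bv\<close> has an entry greater than 1, the radical of \<open>x^d\<close> always lacks room, so nothing
  survives. If \<open>bv\<close> is squarefree, \<open>d\<close> is connected with the exponent of \<open>f \<union> b\<close>, \<open>f\<close> its face, through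
  the maximum of the two, and the faces at which some divisor lacks room are exactly those of
  \<open>N_tilde\<close>. So the homomorphisms of degree \<open>c\<close> are the functions on \<open>N_set\<close> that are constant along
  inclusions and vanish on \<open>N_tilde\<close>. A derivation of degree \<open>c\<close> induces a nonzero homomorphism only if
  \<open>b\<close> is a single vertex \<open>k\<close>, where \<open>x^av d/dx_k\<close> gives the constant functions. This is \<open>T1_part\<close>, and
  it explains why reduced cohomology appears.

  For \<open>T2_part\<close>, the relations of a graded presentation are spanned by generators mapped to 0 and by
  the relations between multiples of two generators (\<open>R_induct\<close>). A homomorphism that kills the
  Koszul relations has one coefficient \<open>val k l\<close> for each pair of generators with a common multiple that
  matters; these coefficients are additive. The essential point is that \<open>val k l = 0\<close> if neither
  generator has room for its image (\<open>val_not_L\<close>): a chain of auxiliary generators reduces this to pairs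
  with a common multiple that has no room, or to a Koszul relation. Choosing a generator below
  every \<open>f \<union> b\<close> turns the homomorphism, up to one that extends to the free module, into a 1-cocycle of
  the poset \<open>N_set\<close> that vanishes on \<open>N_tilde\<close>; conversely such a cocycle defines a homomorphism,
  which kills the Koszul relations because a nonface with room for its image, multiplied by another
  nonface, never gives a degree that matters.

  On the topological side, \<open>\<langle>N_set\<rangle>\<close> is covered by the open sets of points whose face contains a given
  \<open>f\<close>, and each of them is star-shaped around the barycentre of \<open>f\<close>. A function that is constant along
  inclusions is therefore locally constant on \<open>\<langle>N_set\<rangle>\<close>, and these are all 0-cocycles. A 1-cocycle of the
  poset assigns numbers to the paths inside one open star, and to all paths by subdivision; a singular
  1-cocycle is recovered up to a coboundary from its values on the segments between barycentres, since
  a path inside a star is homologous to a difference of two segments from the centre.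

  Both sides are thus the same quotient of a space of functions on faces or on pairs of faces. The
  relation \<open>presents\<close> expresses this, and \<open>presents_imp_mod_iso\<close> turns it into an isomorphism.
\<close>

section \<open>Comparing complex vector spaces through presentations\<close>

text \<open>The map is an epimorphism from the space of functions \<open>V\<close> onto \<open>M\<close> with kernel \<open>B\<close>. Working
  with \<open>V\<close> and \<open>B\<close> instead of a quotient \<open>V / B\<close> keeps the many modules below, which have
  unrelated types, comparable.\<close>

definition presentation_map ::
    "('x \<Rightarrow> complex) set \<Rightarrow> ('x \<Rightarrow> complex) set \<Rightarrow> (complex, 'm) module \<Rightarrow> (('x \<Rightarrow> complex) \<Rightarrow> 'm) \<Rightarrow> bool" where
  "presentation_map V B M \<theta> \<longleftrightarrow> \<theta> ` V = carrier M \<and>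
     (\<forall>u\<in>V. \<forall>v\<in>V. \<theta> (\<lambda>x. u x + v x) = \<theta> u \<oplus>\<^bsub>M\<^esub> \<theta> v) \<and>
     (\<forall>z. \<forall>u\<in>V. \<theta> (\<lambda>x. z * u x) = z \<odot>\<^bsub>M\<^esub> \<theta> u) \<and>
     (\<forall>u\<in>V. \<forall>v\<in>V. \<theta> u = \<theta> v \<longleftrightarrow> (\<lambda>x. u x - v x) \<in> B)"

definition presents :: "('x \<Rightarrow> complex) set \<Rightarrow> ('x \<Rightarrow> complex) set \<Rightarrow> (complex, 'm) module \<Rightarrow> bool" where
  "presents V B M \<longleftrightarrow> (\<exists>\<theta>. presentation_map V B M \<theta>)"

lemma presentation_mapD:
  assumes "presentation_map V B M \<theta>"
  shows "\<theta> ` V = carrier M"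
    "u \<in> V \<Longrightarrow> v \<in> V \<Longrightarrow> \<theta> (\<lambda>x. u x + v x) = \<theta> u \<oplus>\<^bsub>M\<^esub> \<theta> v"
    "u \<in> V \<Longrightarrow> \<theta> (\<lambda>x. z * u x) = z \<odot>\<^bsub>M\<^esub> \<theta> u"
    "u \<in> V \<Longrightarrow> v \<in> V \<Longrightarrow> \<theta> u = \<theta> v \<longleftrightarrow> (\<lambda>x. u x - v x) \<in> B"
  using assms by (simp_all add: presentation_map_def)

definition fun_subspace :: "('x \<Rightarrow> complex) set \<Rightarrow> bool" where
  "fun_subspace V \<longleftrightarrow> (\<lambda>x. 0) \<in> V \<and> (\<forall>u\<in>V. \<forall>v\<in>V. (\<lambda>x. u x + v x) \<in> V) \<and> (\<forall>z. \<forall>u\<in>V. (\<lambda>x. z * u x) \<in> V)"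

lemma fun_subspace_add: "fun_subspace V \<Longrightarrow> u \<in> V \<Longrightarrow> v \<in> V \<Longrightarrow> (\<lambda>x. u x + v x) \<in> V"
  by (simp add: fun_subspace_def)

lemma fun_subspace_scale: "fun_subspace V \<Longrightarrow> u \<in> V \<Longrightarrow> (\<lambda>x. z * u x) \<in> V"
  by (simp add: fun_subspace_def)

lemma fun_subspace_diff:
  assumes "fun_subspace V" "u \<in> V" "v \<in> V" shows "(\<lambda>x. u x - v x) \<in> V"
  using fun_subspace_add[OF assms(1,2) fun_subspace_scale[OF assms(1,3), of "- 1"]] by simp

text \<open>Two epimorphisms with the same kernel have isomorphic images.\<close>

lemma presents_imp_mod_iso:
  assumes V: "fun_subspace V" and M: "presents V B M" and N: "presents V B N"
  shows "mod_iso complex_ring M N"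
proof -
  obtain f where "presentation_map V B M f" using M unfolding presents_def by blast
  note f = presentation_mapD[OF this]
  \<comment> \<open>Elements of \<open>M\<close> are carried to \<open>N\<close> through arbitrary preimages in \<open>V\<close>; these differ by
    elements of \<open>B\<close>.\<close>
  obtain g where "presentation_map V B N g" using N unfolding presents_def by blast
  note g = presentation_mapD[OF this]
  define h where "h = (\<lambda>m\<in>carrier M. g (SOME u. u \<in> V \<and> f u = m))"
  have h: "h (f u) = g u" if "u \<in> V" for u
  proof -
    have "(SOME w. w \<in> V \<and> f w = f u) \<in> V \<and> f (SOME w. w \<in> V \<and> f w = f u) = f u"
      by (rule someI[where x=u]) (use that in simp)
    then have "g (SOME w. w \<in> V \<and> f w = f u) = g u"
      using f(4) g(4) that by blast
    moreover have "f u \<in> carrier M" using f(1) that by blast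
    ultimately show ?thesis by (simp add: h_def)
  qed
  have Vadd: "(\<lambda>x. u x + v x) \<in> V" if "u \<in> V" "v \<in> V" for u v
    by (rule fun_subspace_add[OF V that])
  have Vsm: "(\<lambda>x. z * u x) \<in> V" if "u \<in> V" for z u
    by (rule fun_subspace_scale[OF V that])
  have fE: "\<exists>u\<in>V. x = f u" if "x \<in> carrier M" for x using that f(1) by blast
  have hc: "h x \<in> carrier N" if "x \<in> carrier M" for x
    using fE[OF that] g(1) h by auto
  have "h (x \<oplus>\<^bsub>M\<^esub> y) = h x \<oplus>\<^bsub>N\<^esub> h y" if xy: "x \<in> carrier M" "y \<in> carrier M" for x y
  proof -
    obtain u v where uv: "u \<in> V" "x = f u" "v \<in> V" "y = f v" using fE[OF xy(1)] fE[OF xy(2)] by blast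
    have "x \<oplus>\<^bsub>M\<^esub> y = f (\<lambda>x. u x + v x)" using uv f(2) by simp
    then show ?thesis using h[OF Vadd[OF uv(1,3)]] h[OF uv(1)] h[OF uv(3)] g(2) uv by simp
  qed
  moreover have "h (z \<odot>\<^bsub>M\<^esub> x) = z \<odot>\<^bsub>N\<^esub> h x" if x: "x \<in> carrier M" for x z
  proof -
    obtain u where u: "u \<in> V" "x = f u" using fE[OF x] by blast
    have "z \<odot>\<^bsub>M\<^esub> x = f (\<lambda>x. z * u x)" using u f(3) by simp
    then show ?thesis using h[OF Vsm[OF u(1)]] h[OF u(1)] g(3) u by simp
  qed
  ultimately have "h \<in> mod_hom complex_ring M N"
    using hc by (auto simp: mod_hom_def h_def)
  moreover have "bij_betw h (carrier M) (carrier N)"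
  proof (rule bij_betwI')
    show "h x = h y \<longleftrightarrow> x = y" if "x \<in> carrier M" "y \<in> carrier M" for x y
    proof -
      obtain u v where uv: "u \<in> V" "x = f u" "v \<in> V" "y = f v" using fE \<open>x \<in> carrier M\<close> \<open>y \<in> carrier M\<close> by blast
      show ?thesis using h[OF uv(1)] h[OF uv(3)] f(4)[OF uv(1,3)] g(4)[OF uv(1,3)] uv by simp
    qed
    show "h x \<in> carrier N" if "x \<in> carrier M" for x using hc[OF that] .
    show "\<exists>x\<in>carrier M. y = h x" if y: "y \<in> carrier N" for y
    proof -
      obtain u where "u \<in> V" "y = g u" using y g(1) by blast
      then show ?thesis using h f(1) by (intro bexI[where x="f u"]) auto
    qed
  qed
  ultimately show ?thesis unfolding mod_iso_def by blast
qed

lemma (in abelian_group) a_rcos_eq_iff: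
  assumes "subgroup N (add_monoid G)" "x \<in> carrier G" "y \<in> carrier G"
  shows "N +> x = N +> y \<longleftrightarrow> x \<ominus> y \<in> N"
proof -
  have "N +> x = N +> y \<longleftrightarrow> x \<in> N +> y"
  proof
    assume "N +> x = N +> y"
    moreover have "x \<in> N +> x"
      using subgroup.one_closed[OF assms(1)] assms(2) by (force simp: a_r_coset_def')
    ultimately show "x \<in> N +> y" by simp
  next
    assume "x \<in> N +> y"
    then have "N +> y = N +> x"
      using a_repr_independence'[of x N y] assms by (simp add: a_r_coset_def)
    then show "N +> x = N +> y" by simp
  qed
  also have "\<dots> \<longleftrightarrow> x \<ominus> y \<in> N"
  proof
    assume "x \<in> N +> y"
    then obtain k where "k \<in> N" "x = k \<oplus> y" by (auto simp: a_r_coset_def')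
    moreover have "k \<in> carrier G" using \<open>k \<in> N\<close> assms(1) subgroup.subset by fastforce
    ultimately show "x \<ominus> y \<in> N" using assms by (simp add: a_minus_def a_assoc r_neg)
  next
    assume "x \<ominus> y \<in> N"
    moreover have "x = (x \<ominus> y) \<oplus> y" using assms by (simp add: a_minus_def a_assoc l_neg)
    ultimately show "x \<in> N +> y" by (auto simp: a_r_coset_def')
  qed
  finally show ?thesis .
qed

lemma (in abelian_group) a_rcos_add:
  assumes "subgroup N (add_monoid G)" "x \<in> carrier G" "y \<in> carrier G"
  shows "set_add G (N +> x) (N +> y) = N +> (x \<oplus> y)"
proof -
  have "N \<lhd> add_monoid G"
    using assms(1) a_comm_group by (simp add: comm_group.normal_iff_subgroup)
  then show ?thesis
    using normal.rcos_sum[of N "add_monoid G" x y] assms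
    by (simp add: a_r_coset_def set_add_def)
qed

text \<open>A presentation of a quotient can be checked on representatives \<open>t u\<close>. Scalars act through \<open>f\<close>,
  which covers the restriction of scalars from a ring to \<open>\<complex>\<close>.\<close>

lemma presents_quotient:
  fixes M :: "('r, 'm) module" and Q :: "(complex, 'm set) module"
    and f :: "complex \<Rightarrow> 'r" and t :: "('x \<Rightarrow> complex) \<Rightarrow> 'm"
  assumes M: "abelian_group M" and N: "subgroup N (add_monoid M)" and S: "S \<subseteq> carrier M"
    and carQ: "carrier Q = (\<lambda>h. N +>\<^bsub>M\<^esub> h) ` S" and addQ: "add Q = set_add M"
    and smQ: "\<And>z A. z \<odot>\<^bsub>Q\<^esub> A = (\<Union>x\<in>A. N +>\<^bsub>M\<^esub> (f z \<odot>\<^bsub>M\<^esub> x))"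
    and smc: "\<And>z x. x \<in> carrier M \<Longrightarrow> f z \<odot>\<^bsub>M\<^esub> x \<in> carrier M"
    and sma: "\<And>z x y. x \<in> carrier M \<Longrightarrow> y \<in> carrier M \<Longrightarrow> f z \<odot>\<^bsub>M\<^esub> (x \<oplus>\<^bsub>M\<^esub> y) = f z \<odot>\<^bsub>M\<^esub> x \<oplus>\<^bsub>M\<^esub> f z \<odot>\<^bsub>M\<^esub> y"
    and smN: "\<And>z x. x \<in> N \<Longrightarrow> f z \<odot>\<^bsub>M\<^esub> x \<in> N"
    and V: "fun_subspace V"
    and tS: "\<And>u. u \<in> V \<Longrightarrow> t u \<in> S"
    and tadd: "\<And>u v. u \<in> V \<Longrightarrow> v \<in> V \<Longrightarrow> t (\<lambda>x. u x + v x) = t u \<oplus>\<^bsub>M\<^esub> t v"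
    and tsm: "\<And>z u. u \<in> V \<Longrightarrow> t (\<lambda>x. z * u x) = f z \<odot>\<^bsub>M\<^esub> t u"
    and surj: "\<And>s. s \<in> S \<Longrightarrow> \<exists>u\<in>V. \<exists>k\<in>N. s = k \<oplus>\<^bsub>M\<^esub> t u"
    and ker: "\<And>u. u \<in> V \<Longrightarrow> t u \<in> N \<longleftrightarrow> u \<in> B"
  shows "presents V B Q"
proof -
  interpret abelian_group M by (rule M)
  have Nc: "N \<subseteq> carrier M" using N subgroup.subset by fastforce
  have tc: "t u \<in> carrier M" if "u \<in> V" for u using tS S that by blast
  have Vadd: "(\<lambda>x. u x + v x) \<in> V" if "u \<in> V" "v \<in> V" for u v
    by (rule fun_subspace_add[OF V that])
  have Vsm: "(\<lambda>x. z * u x) \<in> V" if "u \<in> V" for z u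
    by (rule fun_subspace_scale[OF V that])
  have canc: "k \<oplus>\<^bsub>M\<^esub> y \<ominus>\<^bsub>M\<^esub> y = k" if "k \<in> N" "y \<in> carrier M" for k y
  proof -
    have "k \<in> carrier M" using that Nc by blast
    then show ?thesis using that by (simp add: a_minus_def a_assoc r_neg)
  qed
  have tdiff: "t (\<lambda>x. u x - v x) = t u \<ominus>\<^bsub>M\<^esub> t v" if "u \<in> V" "v \<in> V" for u v
  proof -
    have d: "(\<lambda>x. u x - v x) \<in> V" by (rule fun_subspace_diff[OF V that])
    have "t u = t (\<lambda>x. u x - v x) \<oplus>\<^bsub>M\<^esub> t v" using tadd[OF d that(2)] by simp
    then show ?thesis using tc that d by (simp add: a_minus_def a_assoc r_neg)
  qed
  show ?thesis
    unfolding presents_def presentation_map_def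
  proof (intro exI[where x="\<lambda>u. N +>\<^bsub>M\<^esub> t u"] conjI ballI allI)
    show "(\<lambda>u. N +>\<^bsub>M\<^esub> t u) ` V = carrier Q"
    proof
      show "(\<lambda>u. N +>\<^bsub>M\<^esub> t u) ` V \<subseteq> carrier Q" using tS carQ by blast
      show "carrier Q \<subseteq> (\<lambda>u. N +>\<^bsub>M\<^esub> t u) ` V"
      proof
        fix A assume "A \<in> carrier Q"
        then obtain s where s: "s \<in> S" "A = N +>\<^bsub>M\<^esub> s" using carQ by blast
        obtain u k where u: "u \<in> V" "k \<in> N" "s = k \<oplus>\<^bsub>M\<^esub> t u" using surj s(1) by blast
        have "s \<ominus>\<^bsub>M\<^esub> t u \<in> N" using u tc canc by simp
        moreover have "s \<in> carrier M" using s(1) S by blast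
        ultimately have "A = N +>\<^bsub>M\<^esub> t u"
          using a_rcos_eq_iff[OF N, of s "t u"] tc[OF u(1)] s(2) by simp
        then show "A \<in> (\<lambda>u. N +>\<^bsub>M\<^esub> t u) ` V" using u by blast
      qed
    qed
    fix u assume u: "u \<in> V"
    {
      fix v assume v: "v \<in> V"
      show "N +>\<^bsub>M\<^esub> t (\<lambda>x. u x + v x) = (N +>\<^bsub>M\<^esub> t u) \<oplus>\<^bsub>Q\<^esub> (N +>\<^bsub>M\<^esub> t v)"
        using tadd[OF u v] a_rcos_add[OF N tc[OF u] tc[OF v]] addQ by simp
      show "(N +>\<^bsub>M\<^esub> t u = N +>\<^bsub>M\<^esub> t v) = ((\<lambda>x. u x - v x) \<in> B)"
        using a_rcos_eq_iff[OF N tc[OF u] tc[OF v]] tdiff[OF u v] ker[OF fun_subspace_diff[OF V u v]] by simp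
    }
    fix z
    have "N +>\<^bsub>M\<^esub> (f z \<odot>\<^bsub>M\<^esub> x) = N +>\<^bsub>M\<^esub> (f z \<odot>\<^bsub>M\<^esub> t u)" if xN: "x \<in> N +>\<^bsub>M\<^esub> t u" for x
    proof -
      obtain k where k: "k \<in> N" "x = k \<oplus>\<^bsub>M\<^esub> t u" using xN unfolding a_r_coset_def' by blast
      have kc: "k \<in> carrier M" using k Nc by blast
      have "f z \<odot>\<^bsub>M\<^esub> x = f z \<odot>\<^bsub>M\<^esub> k \<oplus>\<^bsub>M\<^esub> f z \<odot>\<^bsub>M\<^esub> t u" using sma kc tc u k by blast
      then have "f z \<odot>\<^bsub>M\<^esub> x \<ominus>\<^bsub>M\<^esub> f z \<odot>\<^bsub>M\<^esub> t u \<in> N"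
        using canc[OF smN[OF k(1)] smc[OF tc[OF u]]] smN[OF k(1)] by simp
      moreover have "f z \<odot>\<^bsub>M\<^esub> x \<in> carrier M" using smc k kc tc[OF u] by simp
      ultimately show ?thesis using a_rcos_eq_iff[OF N _ smc[OF tc[OF u]]] by simp
    qed
    moreover have "t u \<in> N +>\<^bsub>M\<^esub> t u"
      using a_r_coset_def'[of M N "t u"] subgroup.one_closed[OF N] tc[OF u] by force
    ultimately have "(\<Union>x\<in>N +>\<^bsub>M\<^esub> t u. N +>\<^bsub>M\<^esub> (f z \<odot>\<^bsub>M\<^esub> x)) = N +>\<^bsub>M\<^esub> (f z \<odot>\<^bsub>M\<^esub> t u)" by blast
    then show "N +>\<^bsub>M\<^esub> t (\<lambda>x. z * u x) = z \<odot>\<^bsub>Q\<^esub> (N +>\<^bsub>M\<^esub> t u)" using smQ tsm[OF u] by simp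
  qed
qed

section \<open>Polynomials by their coefficients\<close>

text \<open>Exponents are integer vectors, since the shifts by \<open>c\<close> and the differences of exponents leave
  the natural numbers. Those of monomials in \<open>x_0, \<dots>, x_n\<close> are singled out by \<open>vdeg\<close>; monomials
  and coefficients at other vectors are 0, so that coefficients can be taken at arbitrary
  differences.\<close>

definition vdeg :: "nat \<Rightarrow> (nat \<Rightarrow> int) \<Rightarrow> bool" where
  "vdeg n d \<longleftrightarrow> (\<forall>i. 0 \<le> d i) \<and> (\<forall>i>n. d i = 0)"

definition expo :: "(nat \<Rightarrow> int) \<Rightarrow> (nat \<Rightarrow>\<^sub>0 nat)" where
  "expo d = Abs_poly_mapping (\<lambda>i. nat (d i))"

definition mdeg :: "(nat \<Rightarrow>\<^sub>0 nat) \<Rightarrow> nat \<Rightarrow> int" where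
  "mdeg \<mu> = (\<lambda>i. int (Poly_Mapping.lookup \<mu> i))"

definition mterm :: "nat \<Rightarrow> (nat \<Rightarrow> int) \<Rightarrow> complex \<Rightarrow> cpoly" where
  "mterm n d z = (if vdeg n d then Poly_Mapping.single (expo d) z else 0)"

definition cf :: "nat \<Rightarrow> cpoly \<Rightarrow> (nat \<Rightarrow> int) \<Rightarrow> complex" where
  "cf n p d = (if vdeg n d then Poly_Mapping.lookup p (expo d) else 0)"

abbreviation polys :: "nat \<Rightarrow> cpoly set" where
  "polys n \<equiv> carrier (poly_ring_upto n)"

lemma polys_iff: "p \<in> polys n \<longleftrightarrow> (\<forall>\<mu>\<in>Poly_Mapping.keys p. Poly_Mapping.keys \<mu> \<subseteq> {0..n})"
  by (simp add: poly_ring_upto_def)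

lemma vdeg_finite: "vdeg n d \<Longrightarrow> finite {i. nat (d i) \<noteq> 0}"
  by (rule finite_subset[of _ "{0..n}"]) (auto simp: vdeg_def not_less[symmetric])

lemma lookup_expo: "vdeg n d \<Longrightarrow> Poly_Mapping.lookup (expo d) i = nat (d i)"
  using vdeg_finite[of n d] by (simp add: expo_def lookup_Abs_poly_mapping)

lemma mdeg_expo: "vdeg n d \<Longrightarrow> mdeg (expo d) = d"
  by (auto simp: mdeg_def lookup_expo vdeg_def fun_eq_iff)

lemma expo_mdeg [simp]: "expo (mdeg \<mu>) = \<mu>"
  by (simp add: expo_def mdeg_def)

lemma vdeg_mdeg: "vdeg n (mdeg \<mu>) \<longleftrightarrow> Poly_Mapping.keys \<mu> \<subseteq> {0..n}"
proof
  assume "vdeg n (mdeg \<mu>)"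
  then show "Poly_Mapping.keys \<mu> \<subseteq> {0..n}"
    by (auto simp: vdeg_def mdeg_def in_keys_iff) (metis less_numeral_extra(3) not_less)
next
  assume "Poly_Mapping.keys \<mu> \<subseteq> {0..n}"
  then show "vdeg n (mdeg \<mu>)"
    unfolding vdeg_def mdeg_def
    by (metis atLeastAtMost_iff in_keys_iff less_le_not_le of_nat_0 of_nat_0_le_iff subsetD)
qed

lemma keys_expo: "vdeg n d \<Longrightarrow> Poly_Mapping.keys (expo d) \<subseteq> {0..n}"
  by (metis mdeg_expo vdeg_mdeg)

lemma expo_eq: "vdeg n d \<Longrightarrow> vdeg n e \<Longrightarrow> expo d = expo e \<longleftrightarrow> d = e"
  by (metis mdeg_expo)

lemma vdeg_add: "vdeg n d \<Longrightarrow> vdeg n e \<Longrightarrow> vdeg n (\<lambda>i. d i + e i)"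
  by (auto simp: vdeg_def)

lemma expo_add:
  assumes "vdeg n d" "vdeg n e" shows "expo (\<lambda>i. d i + e i) = expo d + expo e"
  by (rule poly_mapping_eqI)
     (use assms in \<open>auto simp: lookup_expo[OF vdeg_add[OF assms]] lookup_expo lookup_add nat_add_distrib vdeg_def\<close>)

lemma polys_add [intro]: "p \<in> polys n \<Longrightarrow> q \<in> polys n \<Longrightarrow> p + q \<in> polys n"
  unfolding polys_iff using keys_add[of p q] by blast

lemma polys_0 [simp]: "0 \<in> polys n" by (simp add: polys_iff)

lemma polys_1 [simp]: "1 \<in> polys n" by (simp add: polys_iff)

lemma polys_uminus [intro]: "p \<in> polys n \<Longrightarrow> - p \<in> polys n"
  unfolding polys_iff by (auto simp: in_keys_iff)

lemma polys_diff [intro]: "p \<in> polys n \<Longrightarrow> q \<in> polys n \<Longrightarrow> p - q \<in> polys n"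
  by (metis polys_add polys_uminus diff_conv_add_uminus)

lemma keys_add_subset: "Poly_Mapping.keys (a + b) \<subseteq> Poly_Mapping.keys a \<union> Poly_Mapping.keys b"
  by (auto simp: in_keys_iff lookup_add)

lemma polys_mult [intro]: "p \<in> polys n \<Longrightarrow> q \<in> polys n \<Longrightarrow> p * q \<in> polys n"
  unfolding polys_iff
proof
  fix \<mu> assume p: "\<forall>\<mu>\<in>Poly_Mapping.keys p. Poly_Mapping.keys \<mu> \<subseteq> {0..n}"
    and q: "\<forall>\<mu>\<in>Poly_Mapping.keys q. Poly_Mapping.keys \<mu> \<subseteq> {0..n}"
    and "\<mu> \<in> Poly_Mapping.keys (p * q)"
  then obtain a b where "\<mu> = a + b" "a \<in> Poly_Mapping.keys p" "b \<in> Poly_Mapping.keys q"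
    using keys_mult[of p q] by blast
  then show "Poly_Mapping.keys \<mu> \<subseteq> {0..n}"
    using p q keys_add_subset[of a b] by blast
qed

lemma polys_sum [intro]: "(\<And>k. k \<in> K \<Longrightarrow> f k \<in> polys n) \<Longrightarrow> sum f K \<in> polys n"
  by (induction K rule: infinite_finite_induct) auto

lemma mterm_polys [simp]: "mterm n d z \<in> polys n"
  using keys_expo[of n d] by (auto simp: polys_iff mterm_def)

lemma const_poly_mterm: "const_poly z = mterm n (\<lambda>_. 0) z"
proof -
  have "expo (\<lambda>_. 0) = 0" by (simp add: expo_def)
  then show ?thesis by (simp add: const_poly_def mterm_def vdeg_def)
qed

lemma mterm_mult:
  assumes "vdeg n d" "vdeg n e"
  shows "mterm n d z * mterm n e w = mterm n (\<lambda>i. d i + e i) (z * w)"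
  using assms vdeg_add[OF assms] expo_add[OF assms] by (simp add: mterm_def mult_single)

lemma mterm_0 [simp]: "mterm n d 0 = 0" by (simp add: mterm_def)

lemma mterm_add: "mterm n d (z + w) = mterm n d z + mterm n d w"
  by (simp add: mterm_def single_add)

lemma cf_0 [simp]: "cf n 0 d = 0" by (simp add: cf_def)

lemma cf_add: "cf n (p + q) d = cf n p d + cf n q d"
  by (simp add: cf_def lookup_add)

lemma cf_diff: "cf n (p - q) d = cf n p d - cf n q d"
  by (simp add: cf_def lookup_minus)

lemma cf_uminus: "cf n (- p) d = - cf n p d"
  by (simp add: cf_def)

lemma cf_sum: "cf n (sum f K) d = (\<Sum>k\<in>K. cf n (f k) d)"
  by (simp add: cf_def lookup_sum)

lemma cf_mterm: "cf n (mterm n d z) e = (if e = d \<and> vdeg n d then z else 0)"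
  by (auto simp: cf_def mterm_def lookup_single when_def expo_eq)

lemma cf_invalid: "\<not> vdeg n d \<Longrightarrow> cf n p d = 0" by (simp add: cf_def)

lemma cf_ext:
  assumes "p \<in> polys n" "q \<in> polys n" "\<And>d. vdeg n d \<Longrightarrow> cf n p d = cf n q d"
  shows "p = q"
proof (rule poly_mapping_eqI)
  fix \<mu>
  show "Poly_Mapping.lookup p \<mu> = Poly_Mapping.lookup q \<mu>"
  proof (cases "Poly_Mapping.keys \<mu> \<subseteq> {0..n}")
    case True
    then have v: "vdeg n (mdeg \<mu>)" by (simp add: vdeg_mdeg)
    show ?thesis using assms(3)[OF v] v by (simp add: cf_def)
  next
    case False
    then have "\<mu> \<notin> Poly_Mapping.keys p" "\<mu> \<notin> Poly_Mapping.keys q"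
      using assms(1,2) by (auto simp: polys_iff)
    then show ?thesis by (simp add: in_keys_iff)
  qed
qed

text \<open>Removing one term at a time keeps the exponents of a polynomial inside the set \<open>S\<close>. This is
  needed for ideals, whose members are sums of monomials in the ideal.\<close>

lemma polys_induct_on [consumes 1, case_names supp zero mterm add]:
  assumes "p \<in> polys n" "\<And>d. vdeg n d \<Longrightarrow> cf n p d \<noteq> 0 \<Longrightarrow> S d" "Q 0"
    "\<And>d z. vdeg n d \<Longrightarrow> S d \<Longrightarrow> Q (mterm n d z)"
    "\<And>p q. p \<in> polys n \<Longrightarrow> q \<in> polys n \<Longrightarrow> (\<And>d. vdeg n d \<Longrightarrow> cf n p d \<noteq> 0 \<Longrightarrow> S d) \<Longrightarrow>
       (\<And>d. vdeg n d \<Longrightarrow> cf n q d \<noteq> 0 \<Longrightarrow> S d) \<Longrightarrow> Q p \<Longrightarrow> Q q \<Longrightarrow> Q (p + q)"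
  shows "Q p"
  using assms(1,2)
proof (induction "card (Poly_Mapping.keys p)" arbitrary: p rule: less_induct)
  case less
  show ?case
  proof (cases "p = 0")
    case True then show ?thesis using assms(3) by simp
  next
    case False
    then obtain \<mu> where \<mu>: "\<mu> \<in> Poly_Mapping.keys p" by (metis keys_eq_empty ex_in_conv)
    then have v: "vdeg n (mdeg \<mu>)" using less.prems(1) by (simp add: vdeg_mdeg polys_iff)
    define z where "z = Poly_Mapping.lookup p \<mu>"
    define q where "q = p - mterm n (mdeg \<mu>) z"
    have q: "q \<in> polys n" using less.prems by (auto simp: q_def)
    have zcf: "z = cf n p (mdeg \<mu>)" using v by (simp add: z_def cf_def)
    have S\<mu>: "S (mdeg \<mu>)" using less.prems(2)[OF v] \<mu> zcf by (auto simp: z_def in_keys_iff)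
    have Sq: "S d" if "vdeg n d" "cf n q d \<noteq> 0" for d
      using that less.prems(2)[of d] v zcf by (auto simp: q_def cf_diff cf_mterm split: if_splits)
    have "Poly_Mapping.keys q \<subseteq> Poly_Mapping.keys p - {\<mu>}"
      using \<mu> v by (auto simp: q_def mterm_def in_keys_iff lookup_minus lookup_single when_def z_def split: if_splits)
    then have "card (Poly_Mapping.keys q) < card (Poly_Mapping.keys p)"
      using \<mu> by (metis card_Diff1_less card_mono finite_Diff finite_keys order_le_less_trans)
    then have Qq: "Q q" by (rule less.hyps[OF _ q Sq])
    have "S d" if "vdeg n d" "cf n (mterm n (mdeg \<mu>) z) d \<noteq> 0" for d
      using that S\<mu> by (simp add: cf_mterm split: if_splits)
    from assms(5)[OF q mterm_polys Sq this Qq assms(4)[OF v S\<mu>]]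
    have "Q (q + mterm n (mdeg \<mu>) z)" by simp
    then show ?thesis by (simp add: q_def)
  qed
qed

lemma polys_induct [consumes 1, case_names zero mterm add]:
  assumes "p \<in> polys n" "Q 0" "\<And>d z. vdeg n d \<Longrightarrow> Q (mterm n d z)"
    "\<And>p q. p \<in> polys n \<Longrightarrow> q \<in> polys n \<Longrightarrow> Q p \<Longrightarrow> Q q \<Longrightarrow> Q (p + q)"
  shows "Q p"
proof (rule polys_induct_on[where S="\<lambda>_. True" and Q=Q, OF assms(1)])
  show "Q (mterm n d z)" if "vdeg n d" for d z by (rule assms(3)[OF that])
  show "Q (p + q)" if "p \<in> polys n" "q \<in> polys n" "Q p" "Q q" for p q by (rule assms(4)[OF that])
qed (simp_all add: assms(2))

lemma cf_mterm_mult: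
  assumes "p \<in> polys n" "vdeg n e"
  shows "cf n (mterm n e z * p) d = z * cf n p (\<lambda>i. d i - e i)"
  using assms(1)
proof (induction p rule: polys_induct)
  case (mterm d' w)
  have "d = (\<lambda>i. e i + d' i) \<longleftrightarrow> (\<lambda>i. d i - e i) = d'" by (auto simp: fun_eq_iff algebra_simps)
  then show ?case using mterm_mult[OF assms(2) mterm] vdeg_add[OF assms(2) mterm] mterm
    by (auto simp: cf_mterm)
qed (auto simp: cf_add algebra_simps)

lemma poly_part_eq: "poly_part n d = range (mterm n d)"
proof
  show "range (mterm n d) \<subseteq> poly_part n d"
    by (auto simp: poly_part_def) (auto simp: mterm_def lookup_expo vdeg_def split: if_splits)
  show "poly_part n d \<subseteq> range (mterm n d)"
  proof
    fix p assume p: "p \<in> poly_part n d"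
    then have pp: "p \<in> polys n" by (simp add: poly_part_def)
    have "p = mterm n d (cf n p d)"
    proof (rule cf_ext[OF pp mterm_polys])
      fix e assume e: "vdeg n e"
      have "cf n p e = 0" if "e \<noteq> d"
      proof (rule ccontr)
        assume "cf n p e \<noteq> 0"
        then have "expo e \<in> Poly_Mapping.keys p" using e by (simp add: cf_def in_keys_iff)
        then have "\<forall>i. int (Poly_Mapping.lookup (expo e) i) = d i" using p by (simp add: poly_part_def)
        then have "e = d" using mdeg_expo[OF e] by (auto simp: mdeg_def fun_eq_iff)
        with that show False by simp
      qed
      then show "cf n p e = cf n (mterm n d (cf n p d)) e" using e by (auto simp: cf_mterm)
    qed
    then show "p \<in> range (mterm n d)" by blast
  qed
qed

text \<open>Homomorphisms, derivations and syzygy maps of a fixed degree all act in this way: the monomial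
  of exponent \<open>d\<close> is multiplied by \<open>u d\<close> and its exponent is raised by \<open>e\<close>.\<close>

definition shift :: "nat \<Rightarrow> ((nat \<Rightarrow> int) \<Rightarrow> complex) \<Rightarrow> (nat \<Rightarrow> int) \<Rightarrow> cpoly \<Rightarrow> cpoly" where
  "shift n u e p = (\<Sum>\<mu>\<in>Poly_Mapping.keys p. mterm n (\<lambda>i. mdeg \<mu> i + e i) (Poly_Mapping.lookup p \<mu> * u (mdeg \<mu>)))"

lemma shift_polys [simp]: "shift n u e p \<in> polys n"
  unfolding shift_def by (rule polys_sum) simp

lemma cf_shift:
  assumes "p \<in> polys n"
  shows "cf n (shift n u e p) d = (if vdeg n d then u (\<lambda>i. d i - e i) * cf n p (\<lambda>i. d i - e i) else 0)"
proof (cases "vdeg n d")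
  case True
  let ?f = "\<lambda>\<mu>. Poly_Mapping.lookup p \<mu> * u (mdeg \<mu>)"
  have eq: "(d = (\<lambda>i. mdeg \<mu> i + e i)) \<longleftrightarrow> (mdeg \<mu> = (\<lambda>i. d i - e i))" for \<mu>
    by (auto simp: fun_eq_iff algebra_simps)
  have "cf n (shift n u e p) d = (\<Sum>\<mu>\<in>Poly_Mapping.keys p. if mdeg \<mu> = (\<lambda>i. d i - e i) then ?f \<mu> else 0)"
    unfolding shift_def cf_sum using True by (intro sum.cong) (auto simp: cf_mterm eq fun_eq_iff)
  also have "\<dots> = (\<Sum>\<mu>\<in>Poly_Mapping.keys p. if \<mu> = expo (\<lambda>i. d i - e i) \<and> vdeg n (\<lambda>i. d i - e i) then ?f \<mu> else 0)"
  proof (rule sum.cong[OF refl])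
    fix \<mu> assume "\<mu> \<in> Poly_Mapping.keys p"
    then have "vdeg n (mdeg \<mu>)" using assms by (simp add: polys_iff vdeg_mdeg)
    then have "mdeg \<mu> = (\<lambda>i. d i - e i) \<longleftrightarrow> \<mu> = expo (\<lambda>i. d i - e i) \<and> vdeg n (\<lambda>i. d i - e i)"
      by (metis expo_mdeg mdeg_expo)
    then show "(if mdeg \<mu> = (\<lambda>i. d i - e i) then ?f \<mu> else 0)
       = (if \<mu> = expo (\<lambda>i. d i - e i) \<and> vdeg n (\<lambda>i. d i - e i) then ?f \<mu> else 0)" by simp
  qed
  also have "\<dots> = u (\<lambda>i. d i - e i) * cf n p (\<lambda>i. d i - e i)"
  proof (cases "vdeg n (\<lambda>i. d i - e i)")
    case v: True
    then show ?thesis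
      by (auto simp: cf_def mdeg_expo[OF v] sum.delta in_keys_iff cong: conj_cong)
  qed (simp add: cf_def)
  finally show ?thesis using True by simp
qed (simp add: cf_def)

section \<open>The Stanley-Reisner ideal and its quotient\<close>

lemma poly_ring_simps [simp]:
  "monoid.mult (poly_ring_upto n) = (*)" "one (poly_ring_upto n) = 1"
  "zero (poly_ring_upto n) = 0" "add (poly_ring_upto n) = (+)"
  by (simp_all add: poly_ring_upto_def)

lemma poly_ring_cring: "cring (poly_ring_upto n)"
proof (rule cringI)
  show "abelian_group (poly_ring_upto n)"
  proof (rule abelian_groupI)
    fix p assume "p \<in> polys n"
    then show "\<exists>q\<in>polys n. q \<oplus>\<^bsub>poly_ring_upto n\<^esub> p = \<zero>\<^bsub>poly_ring_upto n\<^esub>"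
      by (intro bexI[where x="- p"]) auto
  qed (auto simp: algebra_simps)
  show "comm_monoid (poly_ring_upto n)"
    by (rule comm_monoidI) (auto simp: algebra_simps)
qed (auto simp: algebra_simps)

lemma poly_ring_a_inv: "p \<in> polys n \<Longrightarrow> \<ominus>\<^bsub>poly_ring_upto n\<^esub> p = - p"
proof -
  interpret cring "poly_ring_upto n" by (rule poly_ring_cring)
  assume p: "p \<in> polys n"
  show ?thesis by (rule minus_equality) (use p in auto)
qed

lemma poly_ring_minus: "p \<in> polys n \<Longrightarrow> q \<in> polys n \<Longrightarrow> p \<ominus>\<^bsub>poly_ring_upto n\<^esub> q = p - q"
  by (simp add: a_minus_def poly_ring_a_inv)

locale sr_ring =
  fixes n :: nat and X :: "nat set set"
  assumes complex: "simplicial_complex_on n X"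
begin

abbreviation P where "P \<equiv> poly_ring_upto n"
abbreviation I where "I \<equiv> SR_ideal n X"

text \<open>These are the exponents of the monomials that are nonzero in the Stanley-Reisner ring.\<close>

definition xl :: "(nat \<Rightarrow> int) \<Rightarrow> bool" where
  "xl d \<longleftrightarrow> vdeg n d \<and> {i. d i \<noteq> 0} \<in> X"

lemma X_down: "f \<in> X \<Longrightarrow> g \<subseteq> f \<Longrightarrow> g \<in> X"
  using complex by (auto simp: simplicial_complex_on_def)

lemma X_sub: "f \<in> X \<Longrightarrow> f \<subseteq> {0..n}"
  using complex by (auto simp: simplicial_complex_on_def)

lemma xl_vdeg: "xl d \<Longrightarrow> vdeg n d" by (simp add: xl_def)

lemma xl_down: "xl d \<Longrightarrow> vdeg n e \<Longrightarrow> {i. e i \<noteq> 0} \<subseteq> {i. d i \<noteq> 0} \<Longrightarrow> xl e"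
  unfolding xl_def using X_down by blast

lemma sqfree_monom_mterm:
  assumes "p \<subseteq> {0..n}"
  shows "sqfree_monom p = mterm n (\<lambda>i. if i \<in> p then 1 else 0) 1"
proof -
  have "finite p" using assms finite_subset by blast
  then show ?thesis using assms
  proof (induction p)
    case empty
    have "expo (\<lambda>_. 0) = 0" by (simp add: expo_def)
    then show ?case by (simp add: sqfree_monom_def mterm_def vdeg_def)
  next
    case (insert k p)
    let ?e = "\<lambda>i. if i = k then 1 else 0 :: int"
    have v: "vdeg n ?e" using insert by (auto simp: vdeg_def)
    have v2: "vdeg n (\<lambda>i. if i \<in> p then 1 else 0)" using insert by (auto simp: vdeg_def)
    have "Poly_Mapping.single k 1 = expo ?e"
      by (rule poly_mapping_eqI) (auto simp: lookup_expo[OF v] lookup_single when_def)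
    then have "sqfree_monom (insert k p) = mterm n ?e 1 * sqfree_monom p"
      using insert v by (simp add: sqfree_monom_def mterm_def)
    also have "\<dots> = mterm n (\<lambda>i. (if i = k then 1 else 0) + (if i \<in> p then 1 else 0)) 1"
      using insert mterm_mult[OF v v2, of 1 1] by simp
    also have "(\<lambda>i. (if i = k then 1 else 0) + (if i \<in> p then 1 else 0 :: int)) = (\<lambda>i. if i \<in> insert k p then 1 else 0)"
      using insert by (auto simp: fun_eq_iff)
    finally show ?case .
  qed
qed

lemma ideal_monomial: "ideal {p \<in> polys n. \<forall>d. xl d \<longrightarrow> cf n p d = 0} P" (is "ideal ?J P")
proof (rule idealI)
  show "ring P" using poly_ring_cring by (rule cring.axioms(1))
  show "subgroup ?J (add_monoid P)"
  proof (rule group.subgroupI)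
    show "Group.group (add_monoid P)" using poly_ring_cring abelian_group.a_group cring.axioms(1) ring.is_abelian_group by blast
    show "inv\<^bsub>add_monoid P\<^esub> a \<in> ?J" if "a \<in> ?J" for a
      using that poly_ring_a_inv[of a n] by (auto simp: a_inv_def cf_uminus)
  qed (auto simp: cf_add intro: exI[where x=0])
  show mult: "x \<otimes>\<^bsub>P\<^esub> a \<in> ?J" if "a \<in> ?J" "x \<in> carrier P" for a x
    using that(2)
  proof (induction x rule: polys_induct)
    case (mterm e z)
    have "cf n (mterm n e z * a) d = 0" if "xl d" for d
    proof -
      have "cf n a (\<lambda>i. d i - e i) = 0"
      proof (cases "vdeg n (\<lambda>i. d i - e i)")
        case True
        have "{i. d i - e i \<noteq> 0} \<subseteq> {i. d i \<noteq> 0}"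
          using mterm True by (auto simp: vdeg_def) (smt (verit))
        then have "xl (\<lambda>i. d i - e i)" using xl_down[OF \<open>xl d\<close> True] by simp
        then show ?thesis using \<open>a \<in> ?J\<close> by simp
      qed (simp add: cf_def)
      then show ?thesis using \<open>a \<in> ?J\<close> cf_mterm_mult[OF _ mterm, of a z d] by simp
    qed
    then show ?case using \<open>a \<in> ?J\<close> by auto
  next
    case (add p q)
    then show ?case using \<open>a \<in> ?J\<close> by (auto simp: cf_add distrib_right)
  qed auto
  show "a \<otimes>\<^bsub>P\<^esub> x \<in> ?J" if "a \<in> ?J" "x \<in> carrier P" for a x
    using mult[OF that] by (simp add: mult.commute)
qed

text \<open>A monomial whose support is not a face is a multiple of the squarefree monomial of its
  support, so the ideal is spanned by these monomials.\<close>

lemma I_eq: "I = {p \<in> polys n. \<forall>d. xl d \<longrightarrow> cf n p d = 0}" (is "I = ?J")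
proof
  interpret cring P by (rule poly_ring_cring)
  have gens: "{sqfree_monom p |p. p \<subseteq> {0..n} \<and> p \<notin> X} \<subseteq> carrier P"
    using sqfree_monom_mterm by auto
  have sub: "{sqfree_monom p |p. p \<subseteq> {0..n} \<and> p \<notin> X} \<subseteq> ?J"
  proof clarify
    fix p assume p: "p \<subseteq> {0..n}" "p \<notin> X"
    have "{i. (if i \<in> p then 1 else 0 :: int) \<noteq> 0} = p" by auto
    then show "sqfree_monom p \<in> polys n \<and> (\<forall>d. xl d \<longrightarrow> cf n (sqfree_monom p) d = 0)"
      unfolding sqfree_monom_mterm[OF p(1)] using p by (auto simp: cf_mterm xl_def)
  qed
  show "I \<subseteq> ?J" unfolding SR_ideal_def by (rule genideal_minimal[OF ideal_monomial sub])
  interpret idl: ideal "SR_ideal n X" P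
    unfolding SR_ideal_def by (rule genideal_ideal[OF gens])
  have mono_in: "mterm n d z \<in> I" if d: "vdeg n d" "{i. d i \<noteq> 0} \<notin> X" for d z
  proof -
    let ?s = "{i. d i \<noteq> 0}"
    let ?e = "\<lambda>i. if i \<in> ?s then 1 else 0 :: int"
    have s: "?s \<subseteq> {0..n}" using d(1) by (auto simp: vdeg_def) (meson not_less)
    have "sqfree_monom ?s \<in> I" unfolding SR_ideal_def
      using genideal_self[OF gens] s d(2) by blast
    then have "mterm n (\<lambda>i. d i - ?e i) z * sqfree_monom ?s \<in> I"
      using idl.I_l_closed[of "sqfree_monom ?s" "mterm n (\<lambda>i. d i - ?e i) z"] by simp
    moreover have v: "vdeg n ?e" using s by (auto simp: vdeg_def)
    have v2: "vdeg n (\<lambda>i. d i - ?e i)" using d(1) by (auto simp: vdeg_def) (smt (verit))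
    have "mterm n (\<lambda>i. d i - ?e i) z * sqfree_monom ?s = mterm n d z"
      unfolding sqfree_monom_mterm[OF s] using mterm_mult[OF v2 v, of z 1] by simp
    ultimately show ?thesis by simp
  qed
  show "?J \<subseteq> I"
  proof
    fix p assume p: "p \<in> ?J"
    have "p = (\<Sum>\<mu>\<in>Poly_Mapping.keys p. mterm n (mdeg \<mu>) (Poly_Mapping.lookup p \<mu>))"
    proof (rule cf_ext)
      fix d assume d: "vdeg n d"
      have "cf n (\<Sum>\<mu>\<in>Poly_Mapping.keys p. mterm n (mdeg \<mu>) (Poly_Mapping.lookup p \<mu>)) d
        = cf n (shift n (\<lambda>_. 1) (\<lambda>_. 0) p) d" by (simp add: shift_def)
      also have "\<dots> = cf n p d" using p d by (simp add: cf_shift)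
      finally show "cf n p d = cf n (\<Sum>\<mu>\<in>Poly_Mapping.keys p. mterm n (mdeg \<mu>) (Poly_Mapping.lookup p \<mu>)) d" by simp
    qed (use p in auto)
    moreover have "(\<Sum>\<mu>\<in>K. mterm n (mdeg \<mu>) (Poly_Mapping.lookup p \<mu>)) \<in> I" if "K \<subseteq> Poly_Mapping.keys p" "finite K" for K
      using that(2,1)
    proof (induction K)
      case empty
      then show ?case using idl.zero_closed by simp
    next
      case (insert \<mu> K)
      have v: "vdeg n (mdeg \<mu>)" using p insert by (auto simp: polys_iff vdeg_mdeg)
      have "cf n p (mdeg \<mu>) \<noteq> 0" using insert v by (auto simp: cf_def in_keys_iff)
      then have "{i. mdeg \<mu> i \<noteq> 0} \<notin> X" using p v by (auto simp: xl_def)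
      then have "mterm n (mdeg \<mu>) (Poly_Mapping.lookup p \<mu>) \<in> I" using mono_in v by blast
      then show ?case using insert idl.a_closed by simp
    qed
    ultimately show "p \<in> I" by (metis finite_keys order_refl)
  qed
qed

lemma I_iff: "p \<in> I \<longleftrightarrow> p \<in> polys n \<and> (\<forall>d. xl d \<longrightarrow> cf n p d = 0)"
  by (simp add: I_eq)

lemma I_ideal: "ideal I P" unfolding I_eq by (rule ideal_monomial)

end

sublocale sr_ring \<subseteq> P: cring P by (rule poly_ring_cring)
sublocale sr_ring \<subseteq> I: ideal I P by (rule I_ideal)

context sr_ring begin

abbreviation A where "A \<equiv> P Quot I"

definition cls :: "cpoly \<Rightarrow> cpoly set" where "cls p = I +>\<^bsub>P\<^esub> p"

lemma I_polys: "p \<in> I \<Longrightarrow> p \<in> polys n" by (simp add: I_iff)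

lemma cls_eq_iff: "p \<in> polys n \<Longrightarrow> q \<in> polys n \<Longrightarrow> cls p = cls q \<longleftrightarrow> p - q \<in> I"
  unfolding cls_def using P.a_rcos_eq_iff[OF I.a_subgroup] by (simp add: poly_ring_minus)

lemma A_carrier: "carrier A = cls ` polys n"
  by (auto simp: FactRing_def A_RCOSETS_def' cls_def)

lemma cls_carrier [simp, intro]: "p \<in> polys n \<Longrightarrow> cls p \<in> carrier A"
  by (auto simp: A_carrier)

lemma A_zero: "\<zero>\<^bsub>A\<^esub> = cls 0"
  using P.a_rcos_eq_iff[OF I.a_subgroup]
  by (simp add: FactRing_def cls_def I.a_subset P.a_coset_add_zero[OF I.a_subset, simplified])

lemma A_add: "p \<in> polys n \<Longrightarrow> q \<in> polys n \<Longrightarrow> cls p \<oplus>\<^bsub>A\<^esub> cls q = cls (p + q)"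
  using P.a_rcos_add[OF I.a_subgroup, of p q] by (simp add: FactRing_def cls_def)

lemma A_mult: "p \<in> polys n \<Longrightarrow> q \<in> polys n \<Longrightarrow> cls p \<otimes>\<^bsub>A\<^esub> cls q = cls (p * q)"
  using I.rcoset_mult_add[of p q] by (simp add: FactRing_def cls_def)

text \<open>The coefficient of a residue class is read off from any representative, because the ideal has
  no coefficients at exponents of faces.\<close>

definition acf :: "cpoly set \<Rightarrow> (nat \<Rightarrow> int) \<Rightarrow> complex" where
  "acf x d = (if xl d then cf n (SOME p. p \<in> polys n \<and> x = cls p) d else 0)"

lemma acf_cls: "p \<in> polys n \<Longrightarrow> acf (cls p) d = (if xl d then cf n p d else 0)"
proof -
  assume p: "p \<in> polys n"
  define q where "q = (SOME q. q \<in> polys n \<and> cls p = cls q)"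
  have "q \<in> polys n \<and> cls p = cls q" unfolding q_def
    by (rule someI[where x=p]) (use p in simp)
  then have "p - q \<in> I" using cls_eq_iff[of p q] p by simp
  then show ?thesis by (auto simp: acf_def I_iff cf_diff q_def[symmetric])
qed

lemma acf_ext:
  assumes "x \<in> carrier A" "y \<in> carrier A" "\<And>d. xl d \<Longrightarrow> acf x d = acf y d"
  shows "x = y"
proof -
  obtain p q where pq: "p \<in> polys n" "x = cls p" "q \<in> polys n" "y = cls q"
    using assms(1,2) by (auto simp: A_carrier)
  then have "p - q \<in> I" using assms(3) by (auto simp: I_iff cf_diff acf_cls)
  then show ?thesis using pq cls_eq_iff by simp
qed

lemma acf_not_xl: "\<not> xl d \<Longrightarrow> acf x d = 0" by (simp add: acf_def)

lemma acf_add: "x \<in> carrier A \<Longrightarrow> y \<in> carrier A \<Longrightarrow> acf (x \<oplus>\<^bsub>A\<^esub> y) d = acf x d + acf y d"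
  by (auto simp: A_carrier A_add acf_cls cf_add polys_add)

lemma acf_zero [simp]: "acf \<zero>\<^bsub>A\<^esub> d = 0"
  by (simp add: A_zero acf_cls)

lemma acf_mterm_mult:
  assumes "x \<in> carrier A" "vdeg n e"
  shows "acf (cls (mterm n e z) \<otimes>\<^bsub>A\<^esub> x) d = (if xl d then z * acf x (\<lambda>i. d i - e i) else 0)"
proof -
  obtain p where p: "p \<in> polys n" "x = cls p" using assms(1) by (auto simp: A_carrier)
  have "acf x (\<lambda>i. d i - e i) = cf n p (\<lambda>i. d i - e i)" if "xl d"
  proof (cases "vdeg n (\<lambda>i. d i - e i)")
    case True
    have "{i. d i - e i \<noteq> 0} \<subseteq> {i. d i \<noteq> 0}"
      using assms(2) True by (auto simp: vdeg_def) (smt (verit))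
    then have "xl (\<lambda>i. d i - e i)" using xl_down[OF that True] by simp
    then show ?thesis using p by (simp add: acf_cls)
  next
    case False
    then show ?thesis by (simp add: cf_def acf_def xl_def)
  qed
  then show ?thesis using p by (simp add: A_mult acf_cls cf_mterm_mult[OF _ assms(2)] polys_mult)
qed

lemma A_cring: "cring A" by (rule I.quotient_is_cring[OF P.is_cring])

end

sublocale sr_ring \<subseteq> A: cring A by (rule A_cring)

context sr_ring begin

abbreviation AP where "AP \<equiv> quot_as_module n I"

lemma AP_simps [simp]: "carrier AP = carrier A" "add AP = add A" "zero AP = zero A"
  "r \<odot>\<^bsub>AP\<^esub> x = cls r \<otimes>\<^bsub>A\<^esub> x"
  by (simp_all add: quot_as_module_def restrict_scalars_def self_module_def cls_def)

lemma quot_part_iff: "x \<in> quot_part n I d \<longleftrightarrow> (\<exists>z. x = cls (mterm n d z))"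
  by (auto simp: quot_part_def poly_part_eq cls_def)

lemma quot_part_iff_acf:
  assumes "x \<in> carrier A"
  shows "x \<in> quot_part n I d \<longleftrightarrow> (\<forall>e. e \<noteq> d \<longrightarrow> acf x e = 0)"
proof
  assume "x \<in> quot_part n I d"
  then show "\<forall>e. e \<noteq> d \<longrightarrow> acf x e = 0"
    by (auto simp: quot_part_iff acf_cls cf_mterm)
next
  assume h: "\<forall>e. e \<noteq> d \<longrightarrow> acf x e = 0"
  have "x = cls (mterm n d (acf x d))"
    by (rule acf_ext[OF assms]) (use h in \<open>auto simp: acf_cls cf_mterm xl_def\<close>)
  then show "x \<in> quot_part n I d" using quot_part_iff by blast
qed

lemma I_induct [consumes 1, case_names zero mterm add]:
  assumes "p \<in> I" "Q 0" "\<And>d z. vdeg n d \<Longrightarrow> \<not> xl d \<Longrightarrow> Q (mterm n d z)"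
    "\<And>p q. p \<in> I \<Longrightarrow> q \<in> I \<Longrightarrow> Q p \<Longrightarrow> Q q \<Longrightarrow> Q (p + q)"
  shows "Q p"
proof -
  show ?thesis
  proof (rule polys_induct_on[where S="\<lambda>d. \<not> xl d" and Q=Q and n=n and p=p])
    show "p \<in> polys n" using assms(1) by (simp add: I_iff)
    show "\<not> xl d" if "vdeg n d" "cf n p d \<noteq> 0" for d using assms(1) that by (auto simp: I_iff)
    show "Q 0" by (rule assms(2))
    show "Q (mterm n d z)" if "vdeg n d" "\<not> xl d" for d z by (rule assms(3)[OF that])
    fix p q
    assume p: "p \<in> polys n" "\<And>d. vdeg n d \<Longrightarrow> cf n p d \<noteq> 0 \<Longrightarrow> \<not> xl d"
      and q: "q \<in> polys n" "\<And>d. vdeg n d \<Longrightarrow> cf n q d \<noteq> 0 \<Longrightarrow> \<not> xl d" and Q: "Q p" "Q q"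
    have "p \<in> I" unfolding I_iff using p xl_vdeg by blast
    moreover have "q \<in> I" unfolding I_iff using q xl_vdeg by blast
    ultimately show "Q (p + q)" by (rule assms(4)[OF _ _ Q])
  qed
qed

lemma AP_abelian_group: "abelian_group AP"
proof (rule abelian_groupI)
  fix x assume "x \<in> carrier AP"
  then show "\<exists>y\<in>carrier AP. y \<oplus>\<^bsub>AP\<^esub> x = \<zero>\<^bsub>AP\<^esub>"
    using A.l_neg A.a_inv_closed by auto
next
  fix x y assume "x \<in> carrier AP" "y \<in> carrier AP"
  then show "x \<oplus>\<^bsub>AP\<^esub> y = y \<oplus>\<^bsub>AP\<^esub> x" using A.a_comm by simp
next
  fix x y z assume "x \<in> carrier AP" "y \<in> carrier AP" "z \<in> carrier AP"
  then show "x \<oplus>\<^bsub>AP\<^esub> y \<oplus>\<^bsub>AP\<^esub> z = x \<oplus>\<^bsub>AP\<^esub> (y \<oplus>\<^bsub>AP\<^esub> z)" using A.a_assoc by simp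
qed simp_all

end

section \<open>Groups of module homomorphisms\<close>

text \<open>These are the laws of a module on which the sum and the scalar multiples of homomorphisms
  rest. The scalars may come from any ring that acts on both modules.\<close>

locale hom_target =
  fixes R :: "('r, 'x) ring_scheme" and M :: "('r, 'm) module" and N :: "('r, 'k) module"
  assumes N: "abelian_group N"
    and smult_closed: "r \<in> carrier R \<Longrightarrow> x \<in> carrier N \<Longrightarrow> r \<odot>\<^bsub>N\<^esub> x \<in> carrier N"
    and smult_add: "r \<in> carrier R \<Longrightarrow> x \<in> carrier N \<Longrightarrow> y \<in> carrier N \<Longrightarrow>
       r \<odot>\<^bsub>N\<^esub> (x \<oplus>\<^bsub>N\<^esub> y) = r \<odot>\<^bsub>N\<^esub> x \<oplus>\<^bsub>N\<^esub> r \<odot>\<^bsub>N\<^esub> y"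
    and smult_commute: "r \<in> carrier R \<Longrightarrow> s \<in> carrier R \<Longrightarrow> x \<in> carrier N \<Longrightarrow>
       r \<odot>\<^bsub>N\<^esub> (s \<odot>\<^bsub>N\<^esub> x) = s \<odot>\<^bsub>N\<^esub> (r \<odot>\<^bsub>N\<^esub> x)"
    and M_add: "u \<in> carrier M \<Longrightarrow> v \<in> carrier M \<Longrightarrow> u \<oplus>\<^bsub>M\<^esub> v \<in> carrier M"
    and M_smult: "r \<in> carrier R \<Longrightarrow> u \<in> carrier M \<Longrightarrow> r \<odot>\<^bsub>M\<^esub> u \<in> carrier M"
begin

interpretation N: abelian_group N by (rule N)

lemma hom_module_simps:
  "carrier (hom_module R M N) = mod_hom R M N"
  "g \<oplus>\<^bsub>hom_module R M N\<^esub> h = (\<lambda>x\<in>carrier M. g x \<oplus>\<^bsub>N\<^esub> h x)"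
  "r \<odot>\<^bsub>hom_module R M N\<^esub> h = (\<lambda>x\<in>carrier M. r \<odot>\<^bsub>N\<^esub> h x)"
  "\<zero>\<^bsub>hom_module R M N\<^esub> = (\<lambda>x\<in>carrier M. \<zero>\<^bsub>N\<^esub>)"
  by (simp_all add: hom_module_def)

lemma mod_homD:
  assumes "h \<in> mod_hom R M N"
  shows "x \<in> carrier M \<Longrightarrow> h x \<in> carrier N" "h \<in> extensional (carrier M)"
    "x \<in> carrier M \<Longrightarrow> y \<in> carrier M \<Longrightarrow> h (x \<oplus>\<^bsub>M\<^esub> y) = h x \<oplus>\<^bsub>N\<^esub> h y"
    "r \<in> carrier R \<Longrightarrow> x \<in> carrier M \<Longrightarrow> h (r \<odot>\<^bsub>M\<^esub> x) = r \<odot>\<^bsub>N\<^esub> h x"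
  using assms by (auto simp: mod_hom_def PiE_def)

lemma mod_homI:
  assumes "\<And>x. x \<in> carrier M \<Longrightarrow> h x \<in> carrier N"
    "\<And>x y. x \<in> carrier M \<Longrightarrow> y \<in> carrier M \<Longrightarrow> h (x \<oplus>\<^bsub>M\<^esub> y) = h x \<oplus>\<^bsub>N\<^esub> h y"
    "\<And>r x. r \<in> carrier R \<Longrightarrow> x \<in> carrier M \<Longrightarrow> h (r \<odot>\<^bsub>M\<^esub> x) = r \<odot>\<^bsub>N\<^esub> h x"
  shows "(\<lambda>x\<in>carrier M. h x) \<in> mod_hom R M N"
  using assms M_add M_smult by (simp add: mod_hom_def)

lemma smult_zero: "r \<in> carrier R \<Longrightarrow> r \<odot>\<^bsub>N\<^esub> \<zero>\<^bsub>N\<^esub> = \<zero>\<^bsub>N\<^esub>"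
  using smult_add[of r "\<zero>\<^bsub>N\<^esub>" "\<zero>\<^bsub>N\<^esub>"] smult_closed[of r "\<zero>\<^bsub>N\<^esub>"] by (simp add: N.add.r_cancel_one')

lemma smult_a_inv: "r \<in> carrier R \<Longrightarrow> x \<in> carrier N \<Longrightarrow> r \<odot>\<^bsub>N\<^esub> (\<ominus>\<^bsub>N\<^esub> x) = \<ominus>\<^bsub>N\<^esub> (r \<odot>\<^bsub>N\<^esub> x)"
proof -
  assume r: "r \<in> carrier R" "x \<in> carrier N"
  have "r \<odot>\<^bsub>N\<^esub> (\<ominus>\<^bsub>N\<^esub> x) \<oplus>\<^bsub>N\<^esub> r \<odot>\<^bsub>N\<^esub> x = \<zero>\<^bsub>N\<^esub>"
    using smult_add[of r "\<ominus>\<^bsub>N\<^esub> x" x] r smult_zero by (simp add: N.l_neg)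
  then show ?thesis using r smult_closed by (metis N.a_inv_closed N.minus_equality)
qed

lemma hom_add_closed:
  assumes "g \<in> mod_hom R M N" "h \<in> mod_hom R M N"
  shows "(\<lambda>x\<in>carrier M. g x \<oplus>\<^bsub>N\<^esub> h x) \<in> mod_hom R M N"
  using mod_homD[OF assms(1)] mod_homD[OF assms(2)]
  by (intro mod_homI) (simp_all add: smult_add N.a_ac)

lemma hom_smult_closed:
  assumes "h \<in> mod_hom R M N" "r \<in> carrier R"
  shows "(\<lambda>x\<in>carrier M. r \<odot>\<^bsub>N\<^esub> h x) \<in> mod_hom R M N"
  using mod_homD[OF assms(1)] assms(2) smult_commute[OF _ assms(2)]
  by (intro mod_homI) (simp_all add: smult_add smult_closed)

lemma hom_zero_closed: "(\<lambda>x\<in>carrier M. \<zero>\<^bsub>N\<^esub>) \<in> mod_hom R M N"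
  by (intro mod_homI) (simp_all add: smult_zero)

lemma hom_neg_closed:
  assumes "h \<in> mod_hom R M N"
  shows "(\<lambda>x\<in>carrier M. \<ominus>\<^bsub>N\<^esub> h x) \<in> mod_hom R M N"
  using mod_homD[OF assms(1)]
  by (intro mod_homI) (simp_all add: smult_a_inv N.minus_add)

lemma hom_module_abelian_group: "abelian_group (hom_module R M N)"
proof (rule abelian_groupI, unfold hom_module_simps)
  fix g h k assume g: "g \<in> mod_hom R M N" and h: "h \<in> mod_hom R M N" and k: "k \<in> mod_hom R M N"
  show "(\<lambda>x\<in>carrier M. g x \<oplus>\<^bsub>N\<^esub> h x) \<in> mod_hom R M N" by (rule hom_add_closed[OF g h])
  show "(\<lambda>x\<in>carrier M. (\<lambda>x\<in>carrier M. g x \<oplus>\<^bsub>N\<^esub> h x) x \<oplus>\<^bsub>N\<^esub> k x) = (\<lambda>x\<in>carrier M. g x \<oplus>\<^bsub>N\<^esub> (\<lambda>x\<in>carrier M. h x \<oplus>\<^bsub>N\<^esub> k x) x)"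
    using mod_homD(1)[OF g] mod_homD(1)[OF h] mod_homD(1)[OF k] by (auto simp: N.a_assoc)
  show "(\<lambda>x\<in>carrier M. g x \<oplus>\<^bsub>N\<^esub> h x) = (\<lambda>x\<in>carrier M. h x \<oplus>\<^bsub>N\<^esub> g x)"
    using mod_homD(1)[OF g] mod_homD(1)[OF h] by (auto simp: N.a_comm)
  show "(\<lambda>x\<in>carrier M. (\<lambda>x\<in>carrier M. \<zero>\<^bsub>N\<^esub>) x \<oplus>\<^bsub>N\<^esub> g x) = g"
    using mod_homD(1,2)[OF g] by (auto simp: fun_eq_iff extensional_def)
  show "\<exists>g'\<in>mod_hom R M N. (\<lambda>x\<in>carrier M. g' x \<oplus>\<^bsub>N\<^esub> g x) = (\<lambda>x\<in>carrier M. \<zero>\<^bsub>N\<^esub>)"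
    by (rule bexI[OF _ hom_neg_closed[OF g]]) (use mod_homD(1)[OF g] in \<open>auto simp: N.l_neg\<close>)
next
  show "(\<lambda>x\<in>carrier M. \<zero>\<^bsub>N\<^esub>) \<in> mod_hom R M N" by (rule hom_zero_closed)
qed

lemma hom_smult_add:
  assumes "g \<in> mod_hom R M N" "h \<in> mod_hom R M N" "r \<in> carrier R"
  shows "r \<odot>\<^bsub>hom_module R M N\<^esub> (g \<oplus>\<^bsub>hom_module R M N\<^esub> h)
     = r \<odot>\<^bsub>hom_module R M N\<^esub> g \<oplus>\<^bsub>hom_module R M N\<^esub> r \<odot>\<^bsub>hom_module R M N\<^esub> h"
  using mod_homD(1)[OF assms(1)] mod_homD(1)[OF assms(2)] assms(3)
  by (auto simp: hom_module_simps smult_add)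

lemma hom_a_inv:
  assumes "h \<in> mod_hom R M N"
  shows "\<ominus>\<^bsub>hom_module R M N\<^esub> h = (\<lambda>x\<in>carrier M. \<ominus>\<^bsub>N\<^esub> h x)"
proof -
  interpret H: abelian_group "hom_module R M N" by (rule hom_module_abelian_group)
  show ?thesis
    by (rule H.minus_equality)
       (use assms hom_neg_closed mod_homD(1)[OF assms] in \<open>auto simp: hom_module_simps N.l_neg\<close>)
qed

lemma hom_subgroupI:
  assumes "S \<subseteq> mod_hom R M N" "(\<lambda>x\<in>carrier M. \<zero>\<^bsub>N\<^esub>) \<in> S"
    "\<And>g h. g \<in> S \<Longrightarrow> h \<in> S \<Longrightarrow> (\<lambda>x\<in>carrier M. g x \<oplus>\<^bsub>N\<^esub> h x) \<in> S"
    "\<And>h. h \<in> S \<Longrightarrow> (\<lambda>x\<in>carrier M. \<ominus>\<^bsub>N\<^esub> h x) \<in> S"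
  shows "subgroup S (add_monoid (hom_module R M N))"
proof -
  interpret H: abelian_group "hom_module R M N" by (rule hom_module_abelian_group)
  show ?thesis
  proof (rule H.add.subgroupI)
    show "S \<subseteq> carrier (hom_module R M N)" using assms(1) by (simp add: hom_module_simps)
    show "S \<noteq> {}" using assms(2) by blast
    show "\<ominus>\<^bsub>hom_module R M N\<^esub> h \<in> S" if "h \<in> S" for h
      using that assms(1,4) hom_a_inv by auto
    show "g \<oplus>\<^bsub>hom_module R M N\<^esub> h \<in> S" if "g \<in> S" "h \<in> S" for g h
      using assms(3)[OF that] by (simp add: hom_module_simps)
  qed
qed

end

section \<open>Homomorphisms from the Stanley-Reisner ideal\<close>

context sr_ring begin

lemma ideal_module_simps [simp]: "carrier (ideal_module n I) = I" "add (ideal_module n I) = (+)"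
  "zero (ideal_module n I) = 0" "r \<odot>\<^bsub>ideal_module n I\<^esub> x = r * x"
  by (simp_all add: ideal_module_def self_module_def)

lemma I_add: "p \<in> I \<Longrightarrow> q \<in> I \<Longrightarrow> p + q \<in> I" using I.a_closed by simp

lemma I_mult: "r \<in> polys n \<Longrightarrow> p \<in> I \<Longrightarrow> r * p \<in> I" using I.I_l_closed[of p r] by simp

lemma hom_I_target: "hom_target P (ideal_module n I) AP"
  by (rule hom_target.intro[OF AP_abelian_group])
     (simp_all add: A.r_distr A.m_lcomm I_add I_mult cls_carrier)

end

sublocale sr_ring \<subseteq> HI: hom_target P "ideal_module n I" AP by (rule hom_I_target)

context sr_ring begin

lemma hom_I_A_simps: "hom_I_A n I = hom_module P (ideal_module n I) AP"
  by (simp add: hom_I_A_def)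

lemma cls_add: "p \<in> polys n \<Longrightarrow> q \<in> polys n \<Longrightarrow> cls (p + q) = cls p \<oplus>\<^bsub>A\<^esub> cls q" by (simp add: A_add)

text \<open>Additivity reduces linearity over the polynomial ring to multiplication by monomials.\<close>

lemma linear_from_monomials:
  assumes add: "\<And>x y. x \<in> D \<Longrightarrow> y \<in> D \<Longrightarrow> h (x \<oplus>\<^bsub>M\<^esub> y) = h x \<oplus>\<^bsub>A\<^esub> h y"
    and car: "\<And>x. x \<in> D \<Longrightarrow> h x \<in> carrier A"
    and Dsm: "\<And>r x. r \<in> polys n \<Longrightarrow> x \<in> D \<Longrightarrow> r \<odot>\<^bsub>M\<^esub> x \<in> D"
    and sm0: "\<And>x. x \<in> D \<Longrightarrow> h (0 \<odot>\<^bsub>M\<^esub> x) = \<zero>\<^bsub>A\<^esub>"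
    and smadd: "\<And>r s x. r \<in> polys n \<Longrightarrow> s \<in> polys n \<Longrightarrow> x \<in> D \<Longrightarrow> (r + s) \<odot>\<^bsub>M\<^esub> x = r \<odot>\<^bsub>M\<^esub> x \<oplus>\<^bsub>M\<^esub> s \<odot>\<^bsub>M\<^esub> x"
    and monom: "\<And>e z x. vdeg n e \<Longrightarrow> x \<in> D \<Longrightarrow> h (mterm n e z \<odot>\<^bsub>M\<^esub> x) = cls (mterm n e z) \<otimes>\<^bsub>A\<^esub> h x"
    and r: "r \<in> polys n" and x: "x \<in> D"
  shows "h (r \<odot>\<^bsub>M\<^esub> x) = cls r \<otimes>\<^bsub>A\<^esub> h x"
  using r
proof (induction r rule: polys_induct)
  case zero
  show ?case using sm0[OF x] car[OF x] A.l_null by (simp add: A_zero[symmetric])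
next
  case (mterm d z) then show ?case using monom x by simp
next
  case (add p q)
  then show ?case using assms(1) Dsm smadd car x by (simp add: cls_add A.l_distr)
qed

end

section \<open>The combinatorics of a degree\<close>

locale sr_degree = sr_ring +
  fixes av bv :: "nat \<Rightarrow> nat"
  assumes av: "supp av \<subseteq> {0..n}" and bv: "supp bv \<subseteq> {0..n}" and disj: "supp av \<inter> supp bv = {}"
begin

definition a where "a = supp av"
definition b where "b = supp bv"
definition c :: "nat \<Rightarrow> int" where "c = (\<lambda>i. int (av i) - int (bv i))"

abbreviation N where "N \<equiv> N_set X a b"
abbreviation Nt where "Nt \<equiv> N_tilde X a b"

text \<open>The exponents for which the shift by \<open>c\<close> is nonzero in the Stanley-Reisner ring (\<open>L\<close>), those
  of the monomials in the ideal (\<open>ID\<close>), and the degrees in which a homomorphism of degree \<open>c\<close>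
  can be nonzero (\<open>M\<close>).\<close>

definition L where "L d \<longleftrightarrow> xl (\<lambda>i. d i + c i)"
definition ID where "ID d \<longleftrightarrow> vdeg n d \<and> {i. d i \<noteq> 0} \<notin> X"
definition M where "M d \<longleftrightarrow> ID d \<and> L d"
text \<open>The passage between degrees and faces: \<open>cell_of\<close> sends \<open>M\<close> monotonically to \<open>N\<close>, and for
  squarefree \<open>bv\<close> the exponent \<open>deg_of f\<close> of \<open>f \<union> b\<close> is a preimage of \<open>f\<close>.\<close>

definition cell_of :: "(nat \<Rightarrow> int) \<Rightarrow> nat set" where "cell_of d = {i. d i + c i \<noteq> 0} - b"
definition deg_of :: "nat set \<Rightarrow> nat \<Rightarrow> int" where "deg_of f = (\<lambda>i. if i \<in> f \<union> b then 1 else 0)"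

lemma in_a: "i \<in> a \<Longrightarrow> 0 < av i \<and> bv i = 0"
  using disj by (auto simp: a_def supp_def)
lemma in_b: "i \<in> b \<Longrightarrow> 0 < bv i \<and> av i = 0"
  using disj by (auto simp: b_def supp_def)
lemma not_in_b: "i \<notin> b \<Longrightarrow> bv i = 0" by (simp add: b_def supp_def)
lemma not_in_a: "i \<notin> a \<Longrightarrow> av i = 0" by (simp add: a_def supp_def)
lemma ab_disj: "a \<inter> b = {}" using disj by (simp add: a_def b_def)

lemma c_above: "n < i \<Longrightarrow> c i = 0"
  using av bv by (auto simp: c_def supp_def subset_iff) (metis gr0I leD)
lemma c_out: "i \<notin> b \<Longrightarrow> 0 \<le> c i" by (simp add: c_def not_in_b)
lemma c_a: "i \<in> a \<Longrightarrow> 0 < c i" using in_a[of i] by (simp add: c_def)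
lemma c_b: "i \<in> b \<Longrightarrow> c i = - int (bv i)" using in_b[of i] by (simp add: c_def)

lemma ID_iff: "ID d \<longleftrightarrow> vdeg n d \<and> \<not> xl d" by (auto simp: ID_def xl_def)
lemma ID_up: "ID d \<Longrightarrow> vdeg n e \<Longrightarrow> d \<le> e \<Longrightarrow> ID e"
  using X_down[of "{i. e i \<noteq> 0}" "{i. d i \<noteq> 0}"]
  by (auto simp: ID_def vdeg_def le_fun_def subset_iff) (metis order_antisym)

lemma L_nonneg: "L d \<Longrightarrow> 0 \<le> d i + c i" by (simp add: L_def xl_def vdeg_def)
lemma L_above: "L d \<Longrightarrow> n < i \<Longrightarrow> d i = 0" using c_above by (auto simp: L_def xl_def vdeg_def)
lemma L_in_X: "L d \<Longrightarrow> {i. d i + c i \<noteq> 0} \<in> X" by (simp add: L_def xl_def)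
lemma L_I: "(\<And>i. 0 \<le> d i + c i) \<Longrightarrow> (\<And>i. n < i \<Longrightarrow> d i = 0) \<Longrightarrow> {i. d i + c i \<noteq> 0} \<in> X \<Longrightarrow> L d"
  using c_above by (simp add: L_def xl_def vdeg_def)
lemma L_down: "L d \<Longrightarrow> e \<le> d \<Longrightarrow> (\<And>i. 0 \<le> e i + c i) \<Longrightarrow> (\<And>i. n < i \<Longrightarrow> e i = 0) \<Longrightarrow> L e"
proof (rule L_I)
  assume h: "L d" "e \<le> d" "\<And>i. 0 \<le> e i + c i"
  have "{i. e i + c i \<noteq> 0} \<subseteq> {i. d i + c i \<noteq> 0}"
    using h by (auto simp: le_fun_def) (smt (verit))
  then show "{i. e i + c i \<noteq> 0} \<in> X" using X_down L_in_X h(1) by blast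
qed

lemma L_ge_b: "L d \<Longrightarrow> i \<in> b \<Longrightarrow> int (bv i) \<le> d i"
  using L_nonneg[of d i] c_b[of i] by simp

lemma M_vdeg: "M d \<Longrightarrow> vdeg n d" by (simp add: M_def ID_def)

lemma M_support: "M d \<Longrightarrow> {i. d i \<noteq> 0} \<subseteq> cell_of d \<union> b"
proof
  fix i assume M: "M d" and i: "i \<in> {i. d i \<noteq> 0}"
  have d0: "0 \<le> d i" using M_vdeg[OF M] by (simp add: vdeg_def)
  show "i \<in> cell_of d \<union> b"
  proof (cases "i \<in> b")
    case False
    then have "0 < d i + c i" using i d0 c_out[of i] by simp
    then show ?thesis using False by (simp add: cell_of_def)
  qed simp
qed

lemma cell_of_N: "M d \<Longrightarrow> cell_of d \<in> N"
proof -
  assume M: "M d"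
  let ?F = "{i. d i + c i \<noteq> 0}"
  have F: "?F \<in> X" using M L_in_X by (simp add: M_def)
  have d0: "0 \<le> d i" for i using M_vdeg[OF M] by (simp add: vdeg_def)
  have 1: "cell_of d \<in> X" unfolding cell_of_def by (rule X_down[OF F]) auto
  have 2: "a \<subseteq> cell_of d"
  proof
    fix i assume i: "i \<in> a"
    then show "i \<in> cell_of d" using c_a[OF i] d0[of i] ab_disj by (auto simp: cell_of_def)
  qed
  have "{i. d i \<noteq> 0} \<subseteq> cell_of d \<union> b" by (rule M_support[OF M])
  then have "cell_of d \<union> b \<notin> X" using M X_down by (auto simp: M_def ID_def)
  then show ?thesis using 1 2 by (auto simp: N_set_def cell_of_def)
qed

lemma cell_of_mono: "M d \<Longrightarrow> M e \<Longrightarrow> d \<le> e \<Longrightarrow> cell_of d \<subseteq> cell_of e"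
  using L_nonneg[of d] by (auto simp: cell_of_def le_fun_def M_def) (smt (verit))

lemma N_D: "f \<in> N \<Longrightarrow> f \<in> X \<and> a \<subseteq> f \<and> f \<inter> b = {} \<and> f \<union> b \<notin> X" by (simp add: N_set_def)

lemma Nt_N: "f \<in> Nt \<Longrightarrow> f \<in> N" by (simp add: N_tilde_def)

lemma Nt_up: "f \<in> Nt \<Longrightarrow> f \<subseteq> g \<Longrightarrow> g \<in> N \<Longrightarrow> g \<in> Nt"
proof -
  assume h: "f \<in> Nt" "f \<subseteq> g" "g \<in> N"
  then obtain b' where b': "b' \<subset> b" "f \<union> b' \<notin> X" by (auto simp: N_tilde_def)
  then have "g \<union> b' \<notin> X" using h(2) X_down[of "g \<union> b'" "f \<union> b'"] by blast
  then show ?thesis using b' h by (auto simp: N_tilde_def)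
qed

text \<open>The proper subset in the definition can be enlarged until it omits a single vertex of \<open>b\<close>.\<close>

lemma Nt_iff: "f \<in> Nt \<longleftrightarrow> f \<in> N \<and> (\<exists>i\<in>b. f \<union> (b - {i}) \<notin> X)"
proof
  assume "f \<in> Nt"
  then obtain b' where b': "f \<in> N" "b' \<subset> b" "f \<union> b' \<notin> X" by (auto simp: N_tilde_def)
  then obtain i where i: "i \<in> b" "b' \<subseteq> b - {i}" by blast
  then have "f \<union> (b - {i}) \<notin> X" using b' X_down[of "f \<union> (b - {i})" "f \<union> b'"] by blast
  then show "f \<in> N \<and> (\<exists>i\<in>b. f \<union> (b - {i}) \<notin> X)" using b' i by blast
next
  assume "f \<in> N \<and> (\<exists>i\<in>b. f \<union> (b - {i}) \<notin> X)"
  then obtain i where "f \<in> N" "i \<in> b" "f \<union> (b - {i}) \<notin> X" by blast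
  moreover have "b - {i} \<subset> b" using \<open>i \<in> b\<close> by blast
  ultimately show "f \<in> Nt" by (auto simp: N_tilde_def)
qed

lemma b_sub: "b \<subseteq> {0..n}" using bv by (simp add: b_def)

lemma deg_of_vdeg: "f \<in> X \<Longrightarrow> vdeg n (deg_of f)"
  using X_sub[of f] b_sub by (auto simp: vdeg_def deg_of_def)

lemma deg_of_support: "{i. deg_of f i \<noteq> 0} = f \<union> b" by (auto simp: deg_of_def)

lemma deg_of_mono: "f \<subseteq> g \<Longrightarrow> deg_of f \<le> deg_of g" by (auto simp: deg_of_def le_fun_def)

text \<open>Below a degree of \<open>L\<close> the shifted support stays a face, so membership in \<open>L\<close> fails only
  through a negative coordinate, which can occur only on \<open>b\<close>.\<close>

lemma not_L_witness:
  assumes "ID p" "\<not> L p" "p \<le> d" "L d"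
  shows "\<exists>i\<in>b. p i < int (bv i)"
proof -
  have "\<exists>i. p i + c i < 0"
  proof (rule ccontr)
    assume "\<not> ?thesis"
    then have "\<And>i. 0 \<le> p i + c i" by (meson not_less)
    moreover have "\<And>i. n < i \<Longrightarrow> p i = 0" using assms(1) by (simp add: ID_def vdeg_def)
    ultimately have "L p" using L_down[OF assms(4,3)] by blast
    then show False using assms(2) by simp
  qed
  then obtain i where i: "p i + c i < 0" by blast
  moreover have "0 \<le> p i" using assms(1) by (simp add: ID_def vdeg_def)
  ultimately have "c i < 0" by simp
  then have "i \<in> b" using c_out[of i] by fastforce
  then show ?thesis using i c_b[of i] by auto
qed

lemma not_L_I: "i \<in> b \<Longrightarrow> p i < int (bv i) \<Longrightarrow> \<not> L p"
  using L_ge_b[of p i] by auto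

end

locale sr_sqfree_degree = sr_degree +
  assumes sqfree: "\<forall>i. bv i \<in> {0, 1}"
begin

lemma c_b1: "i \<in> b \<Longrightarrow> c i = - 1"
  using c_b[of i] in_b[of i] sqfree by (metis insertE of_nat_1 less_irrefl singletonD)

lemma bv_1: "i \<in> b \<Longrightarrow> bv i = 1"
  using in_b[of i] sqfree by (metis insertE less_irrefl singletonD)

lemma cell_of_deg_of: "f \<in> N \<Longrightarrow> cell_of (deg_of f) = f"
proof -
  assume f: "f \<in> N"
  have "deg_of f i + c i \<noteq> 0 \<and> i \<notin> b \<longleftrightarrow> i \<in> f" for i
  proof (cases "i \<in> b")
    case True then show ?thesis using N_D[OF f] by blast
  next
    case False
    then have "0 \<le> c i" using c_out by blast
    moreover have "c i = 0" if "i \<notin> f"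
      using that N_D[OF f] False not_in_a[of i] not_in_b[of i] by (auto simp: c_def)
    ultimately show ?thesis using False by (auto simp: deg_of_def)
  qed
  then show ?thesis by (auto simp: cell_of_def)
qed

lemma deg_of_L: "f \<in> N \<Longrightarrow> L (deg_of f)"
proof (rule L_I)
  assume f: "f \<in> N"
  show "0 \<le> deg_of f i + c i" for i
    using c_out[of i] c_b1[of i] by (cases "i \<in> b") (auto simp: deg_of_def)
  show "n < i \<Longrightarrow> deg_of f i = 0" for i using deg_of_vdeg N_D[OF f] by (simp add: vdeg_def)
  have "{i. deg_of f i + c i \<noteq> 0} \<subseteq> cell_of (deg_of f)"
    using c_b1 by (auto simp: cell_of_def deg_of_def)
  then show "{i. deg_of f i + c i \<noteq> 0} \<in> X"
    using cell_of_deg_of[OF f] N_D[OF f] X_down by metis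
qed

lemma deg_of_M: "f \<in> N \<Longrightarrow> M (deg_of f)"
  using deg_of_L[of f] deg_of_vdeg[of f] N_D[of f] by (simp add: M_def ID_def deg_of_support)

text \<open>If \<open>p\<close> has no room for its image, it omits some \<open>i \<in> b\<close>. The nonface \<open>supp p\<close> is contained in
  the union of the face of \<open>d\<close> with \<open>b - {i}\<close>, which therefore is not a face.\<close>

lemma not_L_imp_Nt:
  assumes "ID p" "\<not> L p" "p \<le> d" "M d"
  shows "cell_of d \<in> Nt"
proof -
  obtain i where i: "i \<in> b" "p i < int (bv i)"
    using not_L_witness[OF assms(1,2,3)] assms(4) by (auto simp: M_def)
  have p0: "0 \<le> p j" for j using assms(1) by (simp add: ID_def vdeg_def)
  have "p i = 0" using i bv_1[OF i(1)] p0[of i] by simp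
  have "{j. p j \<noteq> 0} \<subseteq> cell_of d \<union> (b - {i})"
  proof
    fix j assume j: "j \<in> {j. p j \<noteq> 0}"
    then have "j \<noteq> i" using \<open>p i = 0\<close> by auto
    have "p j \<le> d j" using assms(3) by (simp add: le_fun_def)
    then have "d j \<noteq> 0" using j p0[of j] by auto
    then show "j \<in> cell_of d \<union> (b - {i})" using M_support[OF assms(4)] \<open>j \<noteq> i\<close> by blast
  qed
  then have "cell_of d \<union> (b - {i}) \<notin> X" using assms(1) X_down by (auto simp: ID_def)
  then show ?thesis using Nt_iff cell_of_N[OF assms(4)] i(1) by blast
qed

text \<open>The maximum with the exponent of \<open>f \<union> b\<close> does not change the face \<open>f\<close> of a degree. It joins
  every degree of \<open>M\<close> to one that depends only on its face.\<close>

lemma sup_deg_of: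
  assumes "M d"
  defines "e \<equiv> (\<lambda>i. max (d i) (deg_of (cell_of d) i))"
  shows "M e" "d \<le> e" "deg_of (cell_of d) \<le> e" "cell_of e = cell_of d"
proof -
  have Ld: "L d" using assms by (simp add: M_def)
  have NN: "cell_of d \<in> N" using cell_of_N[OF assms(1)] .
  show le: "d \<le> e" "deg_of (cell_of d) \<le> e" by (auto simp: e_def le_fun_def)
  have v: "vdeg n e" using M_vdeg[OF assms(1)] M_vdeg[OF deg_of_M[OF NN]] by (auto simp: vdeg_def e_def max_def)
  have on_b: "e i = d i" if "i \<in> b" for i
    using L_ge_b[OF Ld that] bv_1[OF that] by (auto simp: e_def deg_of_def)
  have sup: "e i + c i \<noteq> 0 \<longleftrightarrow> d i + c i \<noteq> 0" for i
  proof (cases "i \<in> b")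
    case True then show ?thesis using on_b by simp
  next
    case False
    show ?thesis
    proof (cases "i \<in> cell_of d")
      case True
      then have "d i + c i > 0" using L_nonneg[OF Ld, of i] by (auto simp: cell_of_def)
      moreover have "d i \<le> e i" by (simp add: e_def)
      ultimately show ?thesis by simp
    next
      case f: False
      then have "e i = max (d i) 0" using False by (auto simp: e_def deg_of_def)
      then show ?thesis using M_vdeg[OF assms(1)] by (simp add: vdeg_def)
    qed
  qed
  have Le: "L e"
  proof (rule L_I)
    show "0 \<le> e i + c i" for i using L_nonneg[OF Ld, of i] by (auto simp: e_def)
    show "n < i \<Longrightarrow> e i = 0" for i using v by (simp add: vdeg_def)
    show "{i. e i + c i \<noteq> 0} \<in> X" using L_in_X[OF Ld] sup by simp
  qed
  show "M e" using Le ID_up[OF _ v le(1)] assms(1) by (simp add: M_def)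
  show "cell_of e = cell_of d" unfolding cell_of_def using sup by simp
qed

end

section \<open>Cochains on a pair of families of faces\<close>

text \<open>For \<open>N\<close> and its subset \<open>Nt\<close> these are the 0-cocycles of the order complex of \<open>F\<close> relative to
  the subset \<open>G\<close>.\<close>

definition face_constants :: "'a set set \<Rightarrow> 'a set set \<Rightarrow> ('a set \<Rightarrow> complex) set" where
  "face_constants F G = {\<mu>. (\<forall>f\<in>F. \<forall>g\<in>F. f \<subseteq> g \<longrightarrow> \<mu> f = \<mu> g) \<and> (\<forall>f\<in>G. \<mu> f = 0)}"

definition vanishing :: "'a set \<Rightarrow> ('a \<Rightarrow> complex) set" where
  "vanishing F = {\<mu>. \<forall>f\<in>F. \<mu> f = 0}"

definition constants :: "'a set \<Rightarrow> ('a \<Rightarrow> complex) set" where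
  "constants F = {\<mu>. \<exists>z. \<forall>f\<in>F. \<mu> f = z}"

lemma face_constants_eq: "\<mu> \<in> face_constants F G \<Longrightarrow> f \<in> F \<Longrightarrow> g \<in> F \<Longrightarrow> f \<subseteq> g \<Longrightarrow> \<mu> f = \<mu> g"
  unfolding face_constants_def by blast

lemma face_constants_zero: "\<mu> \<in> face_constants F G \<Longrightarrow> f \<in> G \<Longrightarrow> \<mu> f = 0"
  unfolding face_constants_def by blast

lemma face_constants_subspace: "fun_subspace (face_constants F G)"
proof -
  have add: "(\<lambda>x. u x + v x) \<in> face_constants F G" if u: "u \<in> face_constants F G" and v: "v \<in> face_constants F G" for u v
    unfolding face_constants_def
  proof (intro CollectI conjI ballI impI)
    fix f g assume "f \<in> F" "g \<in> F" "f \<subseteq> g"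
    then have "u f = u g" "v f = v g" using u v unfolding face_constants_def by blast+
    then show "u f + v f = u g + v g" by (rule arg_cong2)
  qed (use u v in \<open>simp add: face_constants_def\<close>)
  have scale: "(\<lambda>x. z * u x) \<in> face_constants F G" if u: "u \<in> face_constants F G" for u z
    unfolding face_constants_def
  proof (intro CollectI conjI ballI impI)
    fix f g assume "f \<in> F" "g \<in> F" "f \<subseteq> g"
    then have "u f = u g" using u unfolding face_constants_def by blast
    then show "z * u f = z * u g" by (rule arg_cong)
  qed (use u in \<open>simp add: face_constants_def\<close>)
  have zero: "(\<lambda>x. 0) \<in> face_constants F G" by (simp add: face_constants_def)
  show ?thesis unfolding fun_subspace_def by (intro conjI ballI allI zero add scale)
qed

section \<open>Homomorphisms of a fixed degree and their weights\<close>

context sr_degree begin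

definition hom_of :: "((nat \<Rightarrow> int) \<Rightarrow> complex) \<Rightarrow> cpoly \<Rightarrow> cpoly set" where
  "hom_of u = (\<lambda>p\<in>I. cls (shift n u c p))"

lemma acf_hom_of: "p \<in> I \<Longrightarrow> acf (hom_of u p) e = (if xl e then u (\<lambda>i. e i - c i) * cf n p (\<lambda>i. e i - c i) else 0)"
  using xl_vdeg by (auto simp: hom_of_def acf_cls cf_shift I_polys)

lemma hom_of_carrier: "p \<in> I \<Longrightarrow> hom_of u p \<in> carrier A"
  by (simp add: hom_of_def cls_carrier)

text \<open>Exactly these weights belong to homomorphisms. Multiplication by \<open>x^(e - d)\<close> compares \<open>u e\<close>
  with \<open>u d\<close>; if \<open>d\<close> is outside \<open>L\<close>, then the image of \<open>x^d\<close> is 0 and so \<open>u e\<close> must vanish.\<close>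

definition compat :: "((nat \<Rightarrow> int) \<Rightarrow> complex) \<Rightarrow> bool" where
  "compat u \<longleftrightarrow> (\<forall>d e. ID d \<longrightarrow> M e \<longrightarrow> d \<le> e \<longrightarrow> (if M d then u d = u e else u e = 0))"

lemma compat_eq: "compat u \<Longrightarrow> M d \<Longrightarrow> M e \<Longrightarrow> d \<le> e \<Longrightarrow> u d = u e"
  unfolding compat_def M_def by metis

lemma compat_zero: "compat u \<Longrightarrow> ID d \<Longrightarrow> \<not> L d \<Longrightarrow> M e \<Longrightarrow> d \<le> e \<Longrightarrow> u e = 0"
  unfolding compat_def M_def by metis

lemma compat_const_zero: "compat (\<lambda>_. 0)" by (simp add: compat_def)

lemma hom_I_A_part_carrier: "carrier (hom_I_A_part n I c) =
    hom_part (\<lambda>d. I \<inter> poly_part n d) (quot_part n I) (mod_hom P (ideal_module n I) AP) c"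
  by (simp add: hom_I_A_part_def restrict_scalars_def hom_I_A_simps HI.hom_module_simps)

lemma cf_in_I: "p \<in> I \<Longrightarrow> cf n p d \<noteq> 0 \<Longrightarrow> ID d"
  using cf_invalid[of n d p] by (auto simp: I_iff ID_iff)

lemma hom_of_mod_hom:
  assumes u: "compat u"
  shows "hom_of u \<in> mod_hom P (ideal_module n I) AP"
proof -
  have add: "hom_of u (p + q) = hom_of u p \<oplus>\<^bsub>A\<^esub> hom_of u q" if "p \<in> I" "q \<in> I" for p q
    by (rule acf_ext) (use that in \<open>auto simp: hom_of_carrier I_add acf_add acf_hom_of cf_add algebra_simps\<close>)
  have mon: "hom_of u (mterm n e z * p) = cls (mterm n e z) \<otimes>\<^bsub>A\<^esub> hom_of u p"
    if e: "vdeg n e" and p: "p \<in> I" for e z p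
  proof (rule acf_ext)
    have mp: "mterm n e z * p \<in> I" using I_mult p by simp
    show "hom_of u (mterm n e z * p) \<in> carrier A" using hom_of_carrier mp by simp
    show "cls (mterm n e z) \<otimes>\<^bsub>A\<^esub> hom_of u p \<in> carrier A" using hom_of_carrier[OF p] by auto
    fix d assume d: "xl d"
    define D where "D = (\<lambda>i. d i - c i)"
    define E where "E = (\<lambda>i. D i - e i)"
    have dD: "d = (\<lambda>i. D i + c i)" by (simp add: D_def)
    have LD: "L D" using d dD by (simp add: L_def)
    have e0: "0 \<le> e i" for i using e by (simp add: vdeg_def)
    have ED: "E \<le> D" using e0 by (auto simp: le_fun_def E_def)
    have Ec: "(\<lambda>i. d i - e i - c i) = E" by (simp add: E_def D_def algebra_simps)
    have EL: "L E \<longleftrightarrow> xl (\<lambda>i. d i - e i)" by (simp add: L_def E_def D_def algebra_simps)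
    have l: "acf (hom_of u (mterm n e z * p)) d = u D * (z * cf n p E)"
      using acf_hom_of[OF mp] d p by (simp add: D_def[symmetric] cf_mterm_mult[OF _ e] I_polys E_def)
    have r: "acf (cls (mterm n e z) \<otimes>\<^bsub>A\<^esub> hom_of u p) d = z * (if L E then u E * cf n p E else 0)"
      using acf_mterm_mult[OF hom_of_carrier[OF p] e] d acf_hom_of[OF p] by (simp add: Ec EL)
    show "acf (hom_of u (mterm n e z * p)) d = acf (cls (mterm n e z) \<otimes>\<^bsub>A\<^esub> hom_of u p) d"
    proof (cases "cf n p E = 0")
      case False
      then have E: "ID E" using cf_in_I[OF p] by simp
      have "vdeg n D" using vdeg_add[OF _ e, of E] E by (simp add: ID_def E_def)
      then have MD: "M D" using ID_up[OF E _ ED] LD by (simp add: M_def)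
      show ?thesis
      proof (cases "L E")
        case True
        then have "u E = u D" using compat_eq[OF u _ MD ED] E by (simp add: M_def)
        then show ?thesis using True by (simp add: l r)
      next
        case False
        then show ?thesis using compat_zero[OF u E False MD ED] by (simp add: l r)
      qed
    qed (simp add: l r)
  qed
  have "hom_of u (r \<odot>\<^bsub>ideal_module n I\<^esub> p) = cls r \<otimes>\<^bsub>A\<^esub> hom_of u p" if "r \<in> polys n" "p \<in> I" for r p
  proof (rule linear_from_monomials[where D=I])
    show "hom_of u (0 \<odot>\<^bsub>ideal_module n I\<^esub> x) = \<zero>\<^bsub>A\<^esub>" if "x \<in> I" for x
      by (rule acf_ext) (use that in \<open>auto simp: hom_of_carrier acf_hom_of I_iff\<close>)
  qed (use that add mon in \<open>auto simp: hom_of_carrier I_mult algebra_simps\<close>)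
  then show ?thesis using add
    by (auto simp: mod_hom_def hom_of_carrier) (auto simp: hom_of_def)
qed

lemma hom_of_part:
  assumes u: "compat u" shows "hom_of u \<in> carrier (hom_I_A_part n I c)"
  unfolding hom_I_A_part_carrier hom_part_def
proof (intro CollectI conjI allI subsetI)
  show "hom_of u \<in> mod_hom P (ideal_module n I) AP" by (rule hom_of_mod_hom[OF u])
  fix d x assume "x \<in> hom_of u ` (I \<inter> poly_part n d)"
  then obtain z where z: "mterm n d z \<in> I" "x = hom_of u (mterm n d z)" by (auto simp: poly_part_eq)
  show "x \<in> quot_part n I (\<lambda>i. d i + c i)"
    unfolding z(2) quot_part_iff_acf[OF hom_of_carrier[OF z(1)]]
  proof (intro allI impI)
    fix e assume "e \<noteq> (\<lambda>i. d i + c i)"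
    then have "(\<lambda>i. e i - c i) \<noteq> d" by (auto simp: fun_eq_iff algebra_simps)
    then show "acf (hom_of u (mterm n d z)) e = 0"
      using acf_hom_of[OF z(1)] by (simp add: cf_mterm)
  qed
qed

definition weight :: "(cpoly \<Rightarrow> cpoly set) \<Rightarrow> (nat \<Rightarrow> int) \<Rightarrow> complex" where
  "weight h d = acf (h (mterm n d 1)) (\<lambda>i. d i + c i)"

context
  fixes h assumes h: "h \<in> carrier (hom_I_A_part n I c)"
begin

lemma h_mod_hom: "h \<in> mod_hom P (ideal_module n I) AP"
  using h by (simp add: hom_I_A_part_carrier hom_part_def)

lemma h_carrier: "p \<in> I \<Longrightarrow> h p \<in> carrier A"
  using HI.mod_homD(1)[OF h_mod_hom] by simp

lemma h_add: "p \<in> I \<Longrightarrow> q \<in> I \<Longrightarrow> h (p + q) = h p \<oplus>\<^bsub>A\<^esub> h q"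
  using HI.mod_homD(3)[OF h_mod_hom] by simp

lemma h_mult: "r \<in> polys n \<Longrightarrow> p \<in> I \<Longrightarrow> h (r * p) = cls r \<otimes>\<^bsub>A\<^esub> h p"
  using HI.mod_homD(4)[OF h_mod_hom] by simp

lemma ID_mterm_I: "ID d \<Longrightarrow> mterm n d z \<in> I"
  by (auto simp: I_iff ID_iff cf_mterm)

lemma h_mterm:
  assumes d: "ID d"
  shows "acf (h (mterm n d z)) e = (if e = (\<lambda>i. d i + c i) then z * weight h d else 0)"
proof -
  have v0: "vdeg n (\<lambda>_. 0)" by (simp add: vdeg_def)
  have vd: "vdeg n d" using d by (simp add: ID_def)
  have "mterm n d z = mterm n (\<lambda>_. 0) z * mterm n d 1" using mterm_mult[OF v0 vd, of z 1] by simp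
  then have eq: "h (mterm n d z) = cls (mterm n (\<lambda>_. 0) z) \<otimes>\<^bsub>A\<^esub> h (mterm n d 1)"
    using h_mult[of "mterm n (\<lambda>_. 0) z" "mterm n d 1"] ID_mterm_I[OF d] by simp
  have "h (mterm n d 1) \<in> quot_part n I (\<lambda>i. d i + c i)"
    using h ID_mterm_I[OF d, of 1] unfolding hom_I_A_part_carrier hom_part_def poly_part_eq by blast
  then have "acf (h (mterm n d 1)) e = 0" if "e \<noteq> (\<lambda>i. d i + c i)"
    using that quot_part_iff_acf[OF h_carrier[OF ID_mterm_I[OF d, of 1]]] by blast
  then show ?thesis
    unfolding eq acf_mterm_mult[OF h_carrier[OF ID_mterm_I[OF d]] v0]
    using acf_not_xl by (auto simp: weight_def)
qed

lemma weight_compat: "compat (weight h)"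
  unfolding compat_def
proof (intro allI impI)
  fix d e assume d: "ID d" and e: "M e" and le: "d \<le> e"
  define r where "r = (\<lambda>i. e i - d i)"
  have vr: "vdeg n r" using d M_vdeg[OF e] le by (auto simp: ID_def vdeg_def r_def le_fun_def)
  have vd: "vdeg n d" using d by (simp add: ID_def)
  have "mterm n e 1 = mterm n r 1 * mterm n d 1" using mterm_mult[OF vr vd, of 1 1] by (simp add: r_def)
  then have "h (mterm n e 1) = cls (mterm n r 1) \<otimes>\<^bsub>A\<^esub> h (mterm n d 1)"
    using h_mult[of "mterm n r 1" "mterm n d 1"] ID_mterm_I[OF d] by simp
  then have "weight h e = acf (h (mterm n d 1)) (\<lambda>i. e i + c i - r i)"
    using acf_mterm_mult[OF h_carrier[OF ID_mterm_I[OF d]] vr, of 1 1] e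
    by (simp add: weight_def M_def L_def)
  also have "(\<lambda>i. e i + c i - r i) = (\<lambda>i. d i + c i)" by (auto simp: r_def fun_eq_iff)
  finally have "weight h e = weight h d" by (simp add: weight_def)
  moreover have "weight h d = 0" if "\<not> M d"
    using that d acf_not_xl by (simp add: weight_def M_def L_def)
  ultimately show "if M d then weight h d = weight h e else weight h e = 0" by simp
qed

text \<open>Both sides agree on the monomials, which span the ideal.\<close>

lemma hom_of_weight: "h = hom_of (weight h)"
proof
  fix p
  show "h p = hom_of (weight h) p"
  proof (cases "p \<in> I")
    case True
    note hc = hom_of_mod_hom[OF weight_compat]
    show ?thesis using True
    proof (induction p rule: I_induct)
      case zero
      have "h (0 * 0) = hom_of (weight h) (0 * 0)"
        using h_mult[of 0 0] HI.mod_homD(4)[OF hc, of 0 0] h_carrier[of 0] hom_of_carrier[of 0]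
        by (simp add: I_iff A_zero[symmetric])
      then show ?case by simp
    next
      case (mterm d z)
      then have d: "ID d" by (simp add: ID_iff)
      show ?case
      proof (rule acf_ext[OF h_carrier[OF ID_mterm_I[OF d]] hom_of_carrier[OF ID_mterm_I[OF d]]])
        fix e assume e: "xl e"
        have "(e = (\<lambda>i. d i + c i)) \<longleftrightarrow> ((\<lambda>i. e i - c i) = d)" by (auto simp: fun_eq_iff algebra_simps)
        then show "acf (h (mterm n d z)) e = acf (hom_of (weight h) (mterm n d z)) e"
          unfolding h_mterm[OF d] acf_hom_of[OF ID_mterm_I[OF d]] using e d by (auto simp: cf_mterm ID_def)
      qed
    next
      case (add p q)
      then show ?case using h_add HI.mod_homD(3)[OF hc, of p q] by simp
    qed
  next
    case False
    then show ?thesis using HI.mod_homD(2)[OF h_mod_hom] by (simp add: hom_of_def extensional_def)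
  qed
qed

end

lemma hom_of_cong: "(\<And>d. M d \<Longrightarrow> u d = v d) \<Longrightarrow> hom_of u = hom_of v"
proof
  fix p assume uv: "\<And>d. M d \<Longrightarrow> u d = v d"
  show "hom_of u p = hom_of v p"
  proof (cases "p \<in> I")
    case True
    show ?thesis
    proof (rule acf_ext[OF hom_of_carrier[OF True] hom_of_carrier[OF True]])
      fix e assume e: "xl e"
      define d where "d = (\<lambda>i. e i - c i)"
      have "L d" using e by (simp add: L_def d_def)
      then have "cf n p d \<noteq> 0 \<Longrightarrow> M d" using cf_in_I[OF True] by (auto simp: M_def)
      then have "u d * cf n p d = v d * cf n p d" using uv[of d] by (cases "cf n p d = 0") simp_all
      then show "acf (hom_of u p) e = acf (hom_of v p) e"
        unfolding acf_hom_of[OF True] d_def[symmetric] by simp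
    qed
  qed (simp add: hom_of_def)
qed

lemma hom_of_inj: "hom_of u = hom_of v \<Longrightarrow> M d \<Longrightarrow> u d = v d"
proof -
  assume eq: "hom_of u = hom_of v" and d: "M d"
  have I: "mterm n d 1 \<in> I" using d ID_mterm_I by (simp add: M_def I_iff ID_iff cf_mterm)
  have "acf (hom_of w (mterm n d 1)) (\<lambda>i. d i + c i) = w d" for w
    using acf_hom_of[OF I] d by (simp add: M_def L_def ID_def cf_mterm)
  then show ?thesis using eq by metis
qed

lemma hom_of_add: "hom_of (\<lambda>d. u d + v d) = (\<lambda>p\<in>I. hom_of u p \<oplus>\<^bsub>A\<^esub> hom_of v p)"
proof
  fix p show "hom_of (\<lambda>d. u d + v d) p = (\<lambda>p\<in>I. hom_of u p \<oplus>\<^bsub>A\<^esub> hom_of v p) p"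
  proof (cases "p \<in> I")
    case True
    have "hom_of (\<lambda>d. u d + v d) p = hom_of u p \<oplus>\<^bsub>A\<^esub> hom_of v p"
      by (rule acf_ext) (use True in \<open>auto simp: hom_of_carrier acf_add acf_hom_of algebra_simps\<close>)
    then show ?thesis using True by simp
  qed (simp add: hom_of_def)
qed

lemma hom_of_scale: "hom_of (\<lambda>d. z * u d) = (\<lambda>p\<in>I. cls (const_poly z) \<otimes>\<^bsub>A\<^esub> hom_of u p)"
proof
  fix p show "hom_of (\<lambda>d. z * u d) p = (\<lambda>p\<in>I. cls (const_poly z) \<otimes>\<^bsub>A\<^esub> hom_of u p) p"
  proof (cases "p \<in> I")
    case True
    have v0: "vdeg n (\<lambda>_. 0)" by (simp add: vdeg_def)
    have "hom_of (\<lambda>d. z * u d) p = cls (mterm n (\<lambda>_. 0) z) \<otimes>\<^bsub>A\<^esub> hom_of u p"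
    proof (rule acf_ext)
      show "cls (mterm n (\<lambda>_. 0) z) \<otimes>\<^bsub>A\<^esub> hom_of u p \<in> carrier A"
        using hom_of_carrier[OF True] by (intro A.m_closed) auto
      show "acf (hom_of (\<lambda>d. z * u d) p) d = acf (cls (mterm n (\<lambda>_. 0) z) \<otimes>\<^bsub>A\<^esub> hom_of u p) d" if "xl d" for d
        unfolding acf_mterm_mult[OF hom_of_carrier[OF True] v0] acf_hom_of[OF True] by simp
    qed (use hom_of_carrier[OF True] in simp)
    then show ?thesis using True by (simp add: const_poly_mterm[of z n])
  qed (simp add: hom_of_def)
qed

lemma hom_of_zero: "hom_of (\<lambda>_. 0) = (\<lambda>p\<in>I. \<zero>\<^bsub>A\<^esub>)"
proof
  fix p show "hom_of (\<lambda>_. 0) p = (\<lambda>p\<in>I. \<zero>\<^bsub>A\<^esub>) p"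
  proof (cases "p \<in> I")
    case True
    have "hom_of (\<lambda>_. 0) p = \<zero>\<^bsub>A\<^esub>"
      by (rule acf_ext) (use True in \<open>auto simp: hom_of_carrier acf_hom_of\<close>)
    then show ?thesis using True by simp
  qed (simp add: hom_of_def)
qed

text \<open>If \<open>bv i > 1\<close>, the radical of a monomial of the ideal is a monomial of the ideal with exponent
  at most 1 at \<open>i\<close>, hence outside \<open>L\<close>.\<close>

lemma compat_not_sqfree:
  assumes "\<not> (\<forall>i. bv i \<in> {0, 1})" "compat u" "M d"
  shows "u d = 0"
proof -
  obtain i where i': "bv i \<notin> {0, 1}" using assms(1) by blast
  then have i: "1 < bv i" by simp
  then have ib: "i \<in> b" by (simp add: b_def supp_def)
  define r where "r = (\<lambda>i. if d i = 0 then 0 else 1 :: int)"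
  have vd: "vdeg n d" using M_vdeg[OF assms(3)] .
  have "{i. r i \<noteq> 0} = {i. d i \<noteq> 0}" by (auto simp: r_def)
  moreover have "vdeg n r" using vd by (auto simp: vdeg_def r_def)
  ultimately have "ID r" using assms(3) by (simp add: M_def ID_def)
  moreover have "r i \<le> d i" for i
  proof -
    have "0 \<le> d i" using vd by (simp add: vdeg_def)
    then show ?thesis by (simp add: r_def)
  qed
  then have "r \<le> d" by (simp add: le_fun_def)
  moreover have "\<not> L r" using not_L_I[OF ib, of r] i by (simp add: r_def)
  ultimately show ?thesis using compat_zero[OF assms(2) _ _ assms(3)] by blast
qed

lemma hom_I_A_part_not_sqfree:
  assumes "\<not> (\<forall>i. bv i \<in> {0, 1})"
  shows "carrier (hom_I_A_part n I c) = {\<lambda>p\<in>I. \<zero>\<^bsub>A\<^esub>}"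
proof -
  have "hom_of (\<lambda>_. 0) \<in> carrier (hom_I_A_part n I c)" by (rule hom_of_part[OF compat_const_zero])
  moreover have "h = hom_of (\<lambda>_. 0)" if h: "h \<in> carrier (hom_I_A_part n I c)" for h
  proof -
    have "h = hom_of (weight h)" by (rule hom_of_weight[OF h])
    also have "\<dots> = hom_of (\<lambda>_. 0)"
      by (rule hom_of_cong) (rule compat_not_sqfree[OF assms weight_compat[OF h]])
    finally show ?thesis .
  qed
  ultimately show ?thesis unfolding hom_of_zero by blast
qed

definition face_weight :: "(nat set \<Rightarrow> complex) \<Rightarrow> (nat \<Rightarrow> int) \<Rightarrow> complex" where
  "face_weight \<mu> d = (if M d then \<mu> (cell_of d) else 0)"

end

context sr_sqfree_degree begin

lemma face_weight_compat: "\<mu> \<in> face_constants N Nt \<Longrightarrow> compat (face_weight \<mu>)"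
  unfolding compat_def face_weight_def
proof (intro allI impI)
  fix d e assume \<mu>: "\<mu> \<in> face_constants N Nt" and d: "ID d" and e: "M e" and le: "d \<le> e"
  show "if M d then (if M d then \<mu> (cell_of d) else 0) = (if M e then \<mu> (cell_of e) else 0)
        else (if M e then \<mu> (cell_of e) else 0) = 0"
  proof (cases "M d")
    case True
    then show ?thesis
      using e face_constants_eq[OF \<mu> cell_of_N[OF True] cell_of_N[OF e] cell_of_mono[OF True e le]] by simp
  next
    case False
    then have "cell_of e \<in> Nt" using not_L_imp_Nt[OF d _ le e] d by (simp add: M_def)
    then show ?thesis using False face_constants_zero[OF \<mu>] by simp
  qed
qed

text \<open>Weights are determined by their values at the exponents of \<open>f \<union> b\<close>. If \<open>f\<close> lies in \<open>Nt\<close>, then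
  dropping a suitable vertex of \<open>b\<close> leaves a nonface outside \<open>L\<close> below this exponent.\<close>

lemma compat_face_weight:
  assumes "compat u"
  shows "(\<lambda>f. u (deg_of f)) \<in> face_constants N Nt" "\<And>d. M d \<Longrightarrow> u d = face_weight (\<lambda>f. u (deg_of f)) d"
proof -
  show "(\<lambda>f. u (deg_of f)) \<in> face_constants N Nt"
    unfolding face_constants_def
  proof (intro CollectI conjI ballI impI)
    fix f g assume f: "f \<in> N" and g: "g \<in> N" and fg: "f \<subseteq> g"
    show "u (deg_of f) = u (deg_of g)"
      by (rule compat_eq[OF assms deg_of_M[OF f] deg_of_M[OF g] deg_of_mono[OF fg]])
  next
    fix f assume f: "f \<in> Nt"
    then obtain i where fN: "f \<in> N" and i: "i \<in> b" "f \<union> (b - {i}) \<notin> X" using Nt_iff by blast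
    define d where "d = (\<lambda>j. if j \<in> f \<union> (b - {i}) then 1 else 0 :: int)"
    have sd: "{j. d j \<noteq> 0} = f \<union> (b - {i})" by (auto simp: d_def)
    have "f \<subseteq> {0..n}" using N_D[OF fN] X_sub by blast
    then have "vdeg n d" using b_sub by (auto simp: vdeg_def d_def)
    then have "ID d" using i sd by (simp add: ID_def)
    moreover have "d i = 0" using i N_D[OF fN] by (auto simp: d_def)
    then have "\<not> L d" using not_L_I[OF i(1), of d] bv_1[OF i(1)] by simp
    moreover have "d \<le> deg_of f" by (auto simp: d_def deg_of_def le_fun_def)
    ultimately show "u (deg_of f) = 0"
      using compat_zero[OF assms _ _ deg_of_M[OF fN]] by blast
  qed
  show "u d = face_weight (\<lambda>f. u (deg_of f)) d" if "M d" for d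
  proof -
    \<comment> \<open>both \<open>d\<close> and the exponent of its face lie below their maximum in \<open>M\<close>\<close>
    define e where "e = (\<lambda>i. max (d i) (deg_of (cell_of d) i))"
    note e = sup_deg_of[OF that, folded e_def]
    have "u d = u e" by (rule compat_eq[OF assms that e(1,2)])
    moreover have "u (deg_of (cell_of d)) = u e"
      by (rule compat_eq[OF assms deg_of_M[OF cell_of_N[OF that]] e(1,3)])
    ultimately show ?thesis using that by (simp add: face_weight_def)
  qed
qed

lemma face_weight_deg_of: "f \<in> N \<Longrightarrow> face_weight \<mu> (deg_of f) = \<mu> f"
  by (simp add: face_weight_def deg_of_M cell_of_deg_of)

lemma hom_of_face_weight_eq_iff:
  "hom_of (face_weight \<mu>) = hom_of (face_weight \<nu>) \<longleftrightarrow> (\<lambda>f. \<mu> f - \<nu> f) \<in> vanishing N"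
proof
  assume eq: "hom_of (face_weight \<mu>) = hom_of (face_weight \<nu>)"
  have "\<mu> f = \<nu> f" if "f \<in> N" for f
    using hom_of_inj[OF eq deg_of_M[OF that]] face_weight_deg_of[OF that] by simp
  then show "(\<lambda>f. \<mu> f - \<nu> f) \<in> vanishing N" by (simp add: vanishing_def)
next
  assume "(\<lambda>f. \<mu> f - \<nu> f) \<in> vanishing N"
  then show "hom_of (face_weight \<mu>) = hom_of (face_weight \<nu>)"
    using cell_of_N by (intro hom_of_cong) (auto simp: vanishing_def face_weight_def)
qed

lemma hom_of_face_weight_add:
  "hom_of (face_weight (\<lambda>f. \<mu> f + \<nu> f)) = (\<lambda>p\<in>I. hom_of (face_weight \<mu>) p \<oplus>\<^bsub>A\<^esub> hom_of (face_weight \<nu>) p)"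
  unfolding hom_of_add[symmetric] by (rule hom_of_cong) (simp add: face_weight_def)

lemma hom_of_face_weight_scale:
  "hom_of (face_weight (\<lambda>f. z * \<mu> f)) = (\<lambda>p\<in>I. cls (const_poly z) \<otimes>\<^bsub>A\<^esub> hom_of (face_weight \<mu>) p)"
  unfolding hom_of_scale[symmetric] by (rule hom_of_cong) (simp add: face_weight_def)

lemma hom_of_face_weight_surj:
  assumes "h \<in> carrier (hom_I_A_part n I c)"
  shows "\<exists>\<mu>\<in>face_constants N Nt. h = hom_of (face_weight \<mu>)"
proof -
  note w = compat_face_weight[OF weight_compat[OF assms]]
  have "h = hom_of (face_weight (\<lambda>f. weight h (deg_of f)))"
    using hom_of_weight[OF assms] hom_of_cong[of "weight h", OF w(2)] by simp
  then show ?thesis using w(1) by blast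
qed

lemma presents_hom_I_A_part: "presents (face_constants N Nt) (vanishing N) (hom_I_A_part n I c)"
  unfolding presents_def presentation_map_def
proof (intro exI[where x="\<lambda>\<mu>. hom_of (face_weight \<mu>)"] conjI ballI allI)
  show "(\<lambda>\<mu>. hom_of (face_weight \<mu>)) ` face_constants N Nt = carrier (hom_I_A_part n I c)"
    using hom_of_face_weight_surj hom_of_part[OF face_weight_compat] by blast
qed (simp_all add: hom_of_face_weight_eq_iff hom_of_face_weight_add hom_of_face_weight_scale
    hom_I_A_part_def restrict_scalars_def hom_I_A_def hom_module_def)

end

section \<open>Derivations\<close>

context sr_ring begin

lemma derivationsD:
  assumes "D \<in> derivations n"
  shows "p \<in> polys n \<Longrightarrow> D p \<in> polys n"
    "p \<in> polys n \<Longrightarrow> q \<in> polys n \<Longrightarrow> D (p + q) = D p + D q"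
    "p \<in> polys n \<Longrightarrow> q \<in> polys n \<Longrightarrow> D (p * q) = p * D q + q * D p"
    "p \<in> polys n \<Longrightarrow> D (const_poly z * p) = const_poly z * D p"
  using assms by (auto simp: derivations_def)

lemma const_poly_polys [simp]: "const_poly z \<in> polys n"
  unfolding const_poly_mterm[of z n] by simp

lemma derivation_one: "D \<in> derivations n \<Longrightarrow> D 1 = 0"
  using derivationsD(3)[of D 1 1] by simp

lemma derivation_const: "D \<in> derivations n \<Longrightarrow> D (const_poly z) = 0"
  using derivationsD(4)[of D 1 z] derivation_one[of D] by simp

lemma derivationsI:
  assumes "\<And>p. p \<in> polys n \<Longrightarrow> D p \<in> polys n"
    "\<And>p q. p \<in> polys n \<Longrightarrow> q \<in> polys n \<Longrightarrow> D (p + q) = D p + D q"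
    "\<And>p q. p \<in> polys n \<Longrightarrow> q \<in> polys n \<Longrightarrow> D (p * q) = p * D q + q * D p"
    "\<And>p z. p \<in> polys n \<Longrightarrow> D (const_poly z * p) = const_poly z * D p"
  shows "(\<lambda>p\<in>polys n. D p) \<in> derivations n"
  using assms by (auto simp: derivations_def const_poly_mterm[of _ n] polys_add polys_mult)

lemma der_image_sub: "der_image n I \<subseteq> mod_hom P (ideal_module n I) AP"
proof
  fix h assume "h \<in> der_image n I"
  then obtain D where D: "D \<in> derivations n" and h: "h = (\<lambda>p\<in>I. cls (D p))"
    by (auto simp: der_image_def cls_def)
  show "h \<in> mod_hom P (ideal_module n I) AP"
    unfolding h
  proof (rule HI.mod_homI[simplified])
    fix r p assume r: "r \<in> polys n" and p: "p \<in> I"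
    have pp: "p \<in> polys n" using p I_polys by blast
    have "D (r * p) - r * D p \<in> I"
      using derivationsD(3)[OF D r pp] I_mult[of "D r" p] derivationsD(1)[OF D r] p by (simp add: mult.commute)
    then have "cls (D (r * p)) = cls (r * D p)"
      using cls_eq_iff derivationsD(1)[OF D] r pp polys_mult by simp
    then show "cls (D (r * p)) = cls r \<otimes>\<^bsub>A\<^esub> cls (D p)"
      using A_mult derivationsD(1)[OF D pp] r by simp
  qed (use derivationsD[OF D] I_polys in \<open>auto simp: A_add\<close>)
qed

lemma der_image_iff: "h \<in> der_image n I \<longleftrightarrow> (\<exists>D\<in>derivations n. h = (\<lambda>p\<in>I. cls (D p)))"
  by (auto simp: der_image_def cls_def)

lemma der_imageI: "D \<in> derivations n \<Longrightarrow> h = (\<lambda>p\<in>I. cls (D p)) \<Longrightarrow> h \<in> der_image n I"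
  unfolding der_image_iff by blast

lemma A_uminus: "p \<in> polys n \<Longrightarrow> \<ominus>\<^bsub>A\<^esub> cls p = cls (- p)"
  by (rule A.minus_equality) (auto simp: A_add A_zero polys_uminus)

lemma AP_a_inv: "x \<in> carrier A \<Longrightarrow> \<ominus>\<^bsub>AP\<^esub> x = \<ominus>\<^bsub>A\<^esub> x"
proof -
  interpret AP: abelian_group AP by (rule AP_abelian_group)
  show "x \<in> carrier A \<Longrightarrow> \<ominus>\<^bsub>AP\<^esub> x = \<ominus>\<^bsub>A\<^esub> x"
    by (rule AP.minus_equality) (auto simp: A.l_neg)
qed

lemma der_image_subgroup: "subgroup (der_image n I) (add_monoid (hom_I_A n I))"
  unfolding hom_I_A_simps
proof (rule HI.hom_subgroupI[OF der_image_sub])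
  have "(\<lambda>p\<in>polys n. 0) \<in> derivations n" by (rule derivationsI) auto
  moreover have "(\<lambda>p\<in>I. \<zero>\<^bsub>A\<^esub>) = (\<lambda>p\<in>I. cls ((\<lambda>p\<in>polys n. 0) p))"
    using I_polys by (intro restrict_ext) (simp add: A_zero)
  ultimately show "(\<lambda>x\<in>carrier (ideal_module n I). \<zero>\<^bsub>AP\<^esub>) \<in> der_image n I"
    unfolding AP_simps ideal_module_simps by (rule der_imageI)
next
  fix g h assume "g \<in> der_image n I" "h \<in> der_image n I"
  then obtain D E where D: "D \<in> derivations n" and g: "g = (\<lambda>p\<in>I. cls (D p))"
    and E: "E \<in> derivations n" and h: "h = (\<lambda>p\<in>I. cls (E p))" unfolding der_image_iff by blast
  have "(\<lambda>p\<in>polys n. D p + E p) \<in> derivations n"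
    by (rule derivationsI)
       (simp_all add: derivationsD(1-3)[OF D] derivationsD(1-3)[OF E] derivation_const[OF D] derivation_const[OF E]
         polys_add algebra_simps)
  moreover have "(\<lambda>p\<in>I. g p \<oplus>\<^bsub>A\<^esub> h p) = (\<lambda>p\<in>I. cls ((\<lambda>p\<in>polys n. D p + E p) p))"
    using I_polys derivationsD(1)[OF D] derivationsD(1)[OF E] by (intro restrict_ext) (simp add: g h A_add)
  ultimately show "(\<lambda>x\<in>carrier (ideal_module n I). g x \<oplus>\<^bsub>AP\<^esub> h x) \<in> der_image n I"
    unfolding AP_simps ideal_module_simps by (rule der_imageI)
next
  fix h assume "h \<in> der_image n I"
  then obtain E where E: "E \<in> derivations n" and h: "h = (\<lambda>p\<in>I. cls (E p))" unfolding der_image_iff by blast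
  have "(\<lambda>p\<in>polys n. - E p) \<in> derivations n"
    by (rule derivationsI)
       (simp_all add: derivationsD(1-3)[OF E] derivation_const[OF E] polys_uminus algebra_simps)
  moreover have "(\<lambda>p\<in>I. \<ominus>\<^bsub>AP\<^esub> h p) = (\<lambda>p\<in>I. cls ((\<lambda>p\<in>polys n. - E p) p))"
    using I_polys derivationsD(1)[OF E] by (intro restrict_ext) (simp add: h A_uminus AP_a_inv)
  ultimately show "(\<lambda>x\<in>carrier (ideal_module n I). \<ominus>\<^bsub>AP\<^esub> h x) \<in> der_image n I"
    unfolding ideal_module_simps by (rule der_imageI)
qed

lemma der_image_scale:
  assumes "h \<in> der_image n I"
  shows "(\<lambda>p\<in>I. cls (const_poly z) \<otimes>\<^bsub>A\<^esub> h p) \<in> der_image n I"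
proof -
  obtain E where E: "E \<in> derivations n" and h: "h = (\<lambda>p\<in>I. cls (E p))" using assms unfolding der_image_iff by blast
  have "(\<lambda>p\<in>polys n. const_poly z * E p) \<in> derivations n"
    by (rule derivationsI)
       (simp_all add: derivationsD(1-3)[OF E] derivation_const[OF E] polys_mult algebra_simps)
  moreover have "(\<lambda>p\<in>I. cls (const_poly z) \<otimes>\<^bsub>A\<^esub> h p) = (\<lambda>p\<in>I. cls ((\<lambda>p\<in>polys n. const_poly z * E p) p))"
    using I_polys derivationsD(1)[OF E] by (intro restrict_ext) (simp add: h A_mult)
  ultimately show ?thesis by (rule der_imageI)
qed

text \<open>By the Leibniz rule, a derivation is known on squarefree monomials from its values on the
  variables.\<close>

lemma derivation_sqfree:
  assumes D: "D \<in> derivations n" and s: "s \<subseteq> {0..n}"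
  shows "cf n (D (mterm n (\<lambda>i. if i \<in> s then 1 else 0) 1)) e =
    (\<Sum>k\<in>s. cf n (D (mterm n (\<lambda>i. if i = k then 1 else 0) 1))
       (\<lambda>i. e i - (if i \<in> s then 1 else 0) + (if i = k then 1 else 0)))"
proof -
  have "finite s" using s finite_subset by blast
  then show ?thesis using s
  proof (induction s arbitrary: e)
    case empty
    have "D (1 * 1) = 1 * D 1 + 1 * D 1" by (rule derivationsD(3)[OF D]) auto
    then have "D 1 = 0" by simp
    moreover have "mterm n (\<lambda>i. 0) 1 = 1" using const_poly_mterm[of 1 n] by (simp add: const_poly_def)
    ultimately show ?case by simp
  next
    case (insert k s)
    let ?x = "\<lambda>k. mterm n (\<lambda>i. if i = k then 1 else 0) 1"
    let ?m = "mterm n (\<lambda>i. if i \<in> s then 1 else 0) 1"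
    have vk: "vdeg n (\<lambda>i. if i = k then 1 else 0)" using insert by (auto simp: vdeg_def)
    have vs: "vdeg n (\<lambda>i. if i \<in> s then 1 else 0)" using insert by (auto simp: vdeg_def)
    have "(\<lambda>i. (if i = k then 1 else 0) + (if i \<in> s then 1 else 0 :: int)) = (\<lambda>i. if i \<in> insert k s then 1 else 0)"
      using insert by (auto simp: fun_eq_iff)
    then have "mterm n (\<lambda>i. if i \<in> insert k s then 1 else 0) 1 = ?x k * ?m"
      using mterm_mult[OF vk vs, of 1 1] by simp
    then have "D (mterm n (\<lambda>i. if i \<in> insert k s then 1 else 0) 1) = ?x k * D ?m + ?m * D (?x k)"
      using derivationsD(3)[OF D] by simp
    moreover have "(\<lambda>i. e i - (if i = k then 1 else 0) - (if i \<in> s then 1 else 0) + (if i = l then 1 else 0))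
       = (\<lambda>i. e i - (if i \<in> insert k s then 1 else 0) + (if i = l then 1 else 0))" for l
      using insert by (auto simp: fun_eq_iff)
    moreover have "(\<lambda>i. e i - (if i \<in> s then 1 else 0))
      = (\<lambda>i. e i - (if i \<in> insert k s then 1 else 0) + (if i = k then 1 else 0))"
      using insert by (auto simp: fun_eq_iff)
    ultimately show ?case
      using insert by (simp add: cf_add cf_mterm_mult[OF _ vk] cf_mterm_mult[OF _ vs] derivationsD(1)[OF D])
  qed
qed

lemma mterm_shift: "vdeg n d \<Longrightarrow> shift n u e (mterm n d z) = mterm n (\<lambda>i. d i + e i) (z * u d)"
proof (rule cf_ext)
  fix g assume d: "vdeg n d" and g: "vdeg n g"
  have "(\<lambda>i. g i - e i) = d \<longleftrightarrow> g = (\<lambda>i. d i + e i)" by (auto simp: fun_eq_iff algebra_simps)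
  then show "cf n (shift n u e (mterm n d z)) g = cf n (mterm n (\<lambda>i. d i + e i) (z * u d)) g"
    using d g by (auto simp: cf_shift cf_mterm)
qed auto

lemma shift_add: "p \<in> polys n \<Longrightarrow> q \<in> polys n \<Longrightarrow> shift n u e (p + q) = shift n u e p + shift n u e q"
  by (rule cf_ext[where n=n]) (auto simp: cf_shift cf_add polys_add algebra_simps)

lemma shift_zero [simp]: "shift n u e 0 = 0" by (simp add: shift_def)

text \<open>This is the derivation \<open>z x_k x^e d/dx_k\<close>, whose coefficient \<open>x_k x^e\<close> is a monomial because
  \<open>e k = - 1\<close>.\<close>

lemma monomial_derivation:
  assumes e: "\<And>i. i \<noteq> k \<Longrightarrow> 0 \<le> e i" "e k = - 1" "\<And>i. n < i \<Longrightarrow> e i = 0"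
  shows "(\<lambda>p\<in>polys n. shift n (\<lambda>d. z * of_int (d k)) e p) \<in> derivations n" (is "(\<lambda>p\<in>polys n. ?D p) \<in> _")
proof -
  have bil: "?D (p * q) = p * ?D q + q * ?D p" if p: "p \<in> polys n" and q: "q \<in> polys n" for p q
    using p
  proof (induction p rule: polys_induct)
    case (mterm d w)
    show ?case using q
    proof (induction q rule: polys_induct)
      case (mterm d' w')
      note d = \<open>vdeg n d\<close> and d' = \<open>vdeg n d'\<close>
      have half: "mterm n f y * ?D (mterm n f' y') = mterm n (\<lambda>i. f i + f' i + e i) (y * y' * z * of_int (f' k))"
        if f: "vdeg n f" "vdeg n f'" for f f' y y'
      proof (cases "f' k = 0")
        case False
        then have "vdeg n (\<lambda>i. f' i + e i)" using f(2) e by (auto simp: vdeg_def) (smt (verit))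
        from mterm_mult[OF f(1) this] show ?thesis unfolding mterm_shift[OF f(2)] by (simp add: algebra_simps)
      qed (simp add: mterm_shift[OF f(2)])
      have "?D (mterm n d w * mterm n d' w') = mterm n (\<lambda>i. d i + d' i + e i) (w * w' * (z * of_int (d k + d' k)))"
        unfolding mterm_mult[OF d d'] mterm_shift[OF vdeg_add[OF d d']] by simp
      moreover have "(\<lambda>i. d' i + d i + e i) = (\<lambda>i. d i + d' i + e i)" by (simp add: add.commute)
      ultimately show ?case unfolding half[OF d d'] half[OF d' d]
        by (simp add: mterm_add[symmetric] algebra_simps)
    next
      case (add p q)
      then show ?case by (simp add: shift_add polys_mult distrib_left algebra_simps)
    qed simp
  next
    case (add p p')
    then show ?case using q by (simp add: shift_add polys_mult distrib_right algebra_simps)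
  qed simp
  show ?thesis
  proof (rule derivationsI)
    fix p w assume p: "p \<in> polys n"
    have v0: "vdeg n (\<lambda>_. 0)" by (simp add: vdeg_def)
    show "?D (const_poly w * p) = const_poly w * ?D p"
      unfolding const_poly_mterm[of w n]
      by (rule cf_ext[where n=n]) (use p in \<open>auto simp: cf_shift polys_mult cf_mterm_mult[OF _ v0]\<close>)
  qed (auto simp: shift_add bil)
qed

end

section \<open>The first cotangent cohomology\<close>

context sr_degree begin

lemma T1_part_simps:
  "carrier (T1_part n I c) = (\<lambda>h. der_image n I +>\<^bsub>hom_I_A n I\<^esub> h) ` carrier (hom_I_A_part n I c)"
  "add (T1_part n I c) = set_add (hom_I_A n I)"
  "z \<odot>\<^bsub>T1_part n I c\<^esub> x = (\<Union>h\<in>x. der_image n I +>\<^bsub>hom_I_A n I\<^esub> (const_poly z \<odot>\<^bsub>hom_I_A n I\<^esub> h))"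
  "\<zero>\<^bsub>T1_part n I c\<^esub> = der_image n I"
  by (simp_all add: T1_part_def restrict_scalars_def T1_def quot_module_def)

lemma T1_part_not_sqfree:
  assumes "\<not> (\<forall>i. bv i \<in> {0, 1})"
  shows "carrier (T1_part n I c) = {\<zero>\<^bsub>T1_part n I c\<^esub>}"
proof -
  interpret H: abelian_group "hom_I_A n I" unfolding hom_I_A_simps by (rule HI.hom_module_abelian_group)
  have sub: "der_image n I \<subseteq> carrier (hom_I_A n I)"
    using der_image_sub by (simp add: hom_I_A_simps HI.hom_module_simps)
  have "(\<lambda>p\<in>I. \<zero>\<^bsub>A\<^esub>) = \<zero>\<^bsub>hom_I_A n I\<^esub>" by (simp add: hom_I_A_simps HI.hom_module_simps)
  then show ?thesis
    using H.a_coset_add_zero[OF sub] hom_I_A_part_not_sqfree[OF assms] by (simp add: T1_part_simps)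
qed

end

context sr_sqfree_degree begin

lemma N_empty_b: "b = {} \<Longrightarrow> N = {}"
  by (auto simp: N_set_def b_def[symmetric])

lemma Nt_single: "card b = 1 \<Longrightarrow> Nt = {}"
proof -
  assume "card b = 1"
  then obtain k where "b = {k}" by (rule card_1_singletonE)
  then have "b' = {}" if "b' \<subset> b" for b' using that by (auto simp: psubset_eq subset_singleton_iff)
  then have "f \<union> b' \<in> X" if fb: "f \<in> N" "b' \<subset> b" for f b'
    using N_D[OF fb(1)] fb(2) by (metis sup_bot.right_neutral)
  then show "Nt = {}" unfolding N_tilde_def b_def[symmetric] by blast
qed

text \<open>The image of \<open>x_k\<close> under a derivation contributes to degree \<open>c\<close> only through the exponent
  obtained from \<open>c\<close> by adding 1 at \<open>k\<close>, which is not negative only if \<open>b\<close> is contained in \<open>{k}\<close>.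
  So derivations of degree \<open>c\<close> matter only if \<open>b = {k}\<close>, and then they act on all degrees of \<open>M\<close>
  by the same scalar. If \<open>b\<close> is empty, so is \<open>N\<close>.\<close>

lemma face_weight_der_image:
  assumes \<mu>: "\<mu> \<in> face_constants N Nt"
  shows "hom_of (face_weight \<mu>) \<in> der_image n I \<longleftrightarrow>
    \<mu> \<in> (if card b = 1 then constants N else vanishing N)"
proof
  assume "hom_of (face_weight \<mu>) \<in> der_image n I"
  then obtain D where D: "D \<in> derivations n" and eq: "hom_of (face_weight \<mu>) = (\<lambda>p\<in>I. cls (D p))"
    unfolding der_image_iff by blast
  \<comment> \<open>the coefficient that contributes to degree \<open>c\<close> in the image of the variable \<open>x_k\<close>\<close>
  let ?co = "\<lambda>k. cf n (D (mterm n (\<lambda>i. if i = k then 1 else 0) 1)) (\<lambda>i. c i + (if i = k then 1 else 0))"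
  have val: "\<mu> f = (\<Sum>k\<in>f \<union> b. ?co k)" if f: "f \<in> N" for f
  proof -
    let ?p = "mterm n (deg_of f) 1"
    let ?e = "\<lambda>i. deg_of f i + c i"
    have fb: "f \<union> b \<subseteq> {0..n}" using N_D[OF f] X_sub b_sub by blast
    have dfM: "M (deg_of f)" using deg_of_M[OF f] .
    have p: "?p \<in> I" using dfM by (simp add: M_def I_iff ID_iff cf_mterm)
    have xle: "xl ?e" using dfM by (simp add: M_def L_def)
    have vdf: "vdeg n (deg_of f)" using M_vdeg[OF dfM] .
    have "\<mu> f = acf (hom_of (face_weight \<mu>) ?p) ?e"
      using acf_hom_of[OF p] xle vdf face_weight_deg_of[OF f] by (simp add: cf_mterm)
    also have "\<dots> = cf n (D ?p) ?e"
      using eq p derivationsD(1)[OF D] xle by (simp add: acf_cls)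
    also have "\<dots> = (\<Sum>k\<in>f \<union> b. ?co k)"
      using derivation_sqfree[OF D fb, of ?e] by (simp add: deg_of_def)
    finally show ?thesis .
  qed
  have co0: "?co k = 0" if "j \<in> b" "j \<noteq> k" for j k
    by (rule cf_invalid) (use c_b1[OF that(1)] that in \<open>auto simp: vdeg_def intro!: exI[where x=j]\<close>)
  show "\<mu> \<in> (if card b = 1 then constants N else vanishing N)"
  proof (cases "card b = 1")
    case True
    then obtain k where k: "b = {k}" by (rule card_1_singletonE)
    have "\<mu> f = ?co k" if f: "f \<in> N" for f
    proof -
      have "finite f" using finite_subset[OF X_sub[of f]] N_D[OF f] by simp
      then have "(\<Sum>l\<in>f \<union> b. ?co l) = (\<Sum>l\<in>{k}. ?co l)"
        using k co0 by (intro sum.mono_neutral_right) auto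
      then show ?thesis using val[OF f] by simp
    qed
    then show ?thesis using True by (auto simp: constants_def)
  next
    case False
    have "\<mu> f = 0" if f: "f \<in> N" for f
    proof -
      have "b \<noteq> {}" using N_empty_b f by blast
      then have "\<exists>j\<in>b. j \<noteq> k" for k using False by (metis is_singletonI' is_singleton_altdef)
      then have "?co k = 0" for k using co0 by blast
      then show ?thesis using val[OF f] by simp
    qed
    then show ?thesis using False by (auto simp: vanishing_def)
  qed
next
  assume B: "\<mu> \<in> (if card b = 1 then constants N else vanishing N)"
  show "hom_of (face_weight \<mu>) \<in> der_image n I"
  proof (cases "card b = 1")
    case True
    then obtain k where k: "b = {k}" by (rule card_1_singletonE)
    obtain z where z: "\<And>f. f \<in> N \<Longrightarrow> \<mu> f = z" using B True by (auto simp: constants_def)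
    let ?D = "\<lambda>p\<in>polys n. shift n (\<lambda>d. z * of_int (d k)) c p"
    have D: "?D \<in> derivations n"
      by (rule monomial_derivation) (use k c_out c_b1 c_above in auto)
    have "face_weight \<mu> d = z * of_int (d k)" if d: "M d" for d
    proof -
      have dk: "1 \<le> d k" using L_ge_b[of d k] d k bv_1[of k] by (simp add: M_def)
      \<comment> \<open>otherwise the vertex \<open>k\<close> would stay in the shifted support, which would contain the
        nonface \<open>supp d\<close>\<close>
      have "d k = 1"
      proof (rule ccontr)
        assume "d k \<noteq> 1"
        then have "d k + c k \<noteq> 0" using c_b1[of k] k by simp
        then have "cell_of d \<union> b \<subseteq> {i. d i + c i \<noteq> 0}" using k by (auto simp: cell_of_def)
        then have "{i. d i \<noteq> 0} \<in> X"
          using M_support[OF d] L_in_X[of d] d X_down[of "{i. d i + c i \<noteq> 0}" "{i. d i \<noteq> 0}"]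
          by (auto simp: M_def)
        then show False using d by (simp add: M_def ID_def)
      qed
      then show ?thesis using z[OF cell_of_N[OF d]] d by (simp add: face_weight_def)
    qed
    then have "hom_of (face_weight \<mu>) = hom_of (\<lambda>d. z * of_int (d k))" by (rule hom_of_cong)
    also have "\<dots> = (\<lambda>p\<in>I. cls (?D p))" unfolding hom_of_def using I_polys by (intro restrict_ext) simp
    finally show ?thesis using D unfolding der_image_iff by blast
  next
    case False
    then have "hom_of (face_weight \<mu>) = hom_of (\<lambda>_. 0)"
      using B cell_of_N by (intro hom_of_cong) (auto simp: vanishing_def face_weight_def)
    then show ?thesis
      using subgroup.one_closed[OF der_image_subgroup] hom_of_zero
      by (simp add: hom_I_A_simps HI.hom_module_simps)
  qed
qed

lemma presents_T1_part:
  "presents (face_constants N Nt) (if card b = 1 then constants N else vanishing N) (T1_part n I c)"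
proof (rule presents_quotient[where M="hom_I_A n I" and N="der_image n I" and f=const_poly
      and S="carrier (hom_I_A_part n I c)" and t="\<lambda>\<mu>. hom_of (face_weight \<mu>)"])
  show "abelian_group (hom_I_A n I)" unfolding hom_I_A_simps by (rule HI.hom_module_abelian_group)
  show "subgroup (der_image n I) (add_monoid (hom_I_A n I))" by (rule der_image_subgroup)
  show "carrier (hom_I_A_part n I c) \<subseteq> carrier (hom_I_A n I)"
    by (auto simp: hom_I_A_part_carrier hom_part_def hom_I_A_simps HI.hom_module_simps)
  show "const_poly z \<odot>\<^bsub>hom_I_A n I\<^esub> h \<in> carrier (hom_I_A n I)" if "h \<in> carrier (hom_I_A n I)" for z h
    using that HI.hom_smult_closed[of h "const_poly z"] by (simp add: hom_I_A_simps HI.hom_module_simps)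
  show "const_poly z \<odot>\<^bsub>hom_I_A n I\<^esub> (g \<oplus>\<^bsub>hom_I_A n I\<^esub> h) = const_poly z \<odot>\<^bsub>hom_I_A n I\<^esub> g \<oplus>\<^bsub>hom_I_A n I\<^esub> const_poly z \<odot>\<^bsub>hom_I_A n I\<^esub> h"
    if "g \<in> carrier (hom_I_A n I)" "h \<in> carrier (hom_I_A n I)" for z g h
    using that HI.hom_smult_add[of g h "const_poly z"] by (simp add: hom_I_A_simps HI.hom_module_simps(1))
  show "const_poly z \<odot>\<^bsub>hom_I_A n I\<^esub> h \<in> der_image n I" if "h \<in> der_image n I" for z h
    using der_image_scale[OF that] by (simp add: hom_I_A_simps HI.hom_module_simps)
  show "\<exists>u\<in>face_constants N Nt. \<exists>k\<in>der_image n I. h = k \<oplus>\<^bsub>hom_I_A n I\<^esub> hom_of (face_weight u)"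
    if h: "h \<in> carrier (hom_I_A_part n I c)" for h
  proof -
    interpret H: abelian_group "hom_I_A n I" unfolding hom_I_A_simps by (rule HI.hom_module_abelian_group)
    obtain \<mu> where \<mu>: "\<mu> \<in> face_constants N Nt" "h = hom_of (face_weight \<mu>)"
      using hom_of_face_weight_surj[OF h] by blast
    have "h \<in> carrier (hom_I_A n I)"
      using h by (auto simp: hom_I_A_part_carrier hom_part_def hom_I_A_simps HI.hom_module_simps)
    then have "h = \<zero>\<^bsub>hom_I_A n I\<^esub> \<oplus>\<^bsub>hom_I_A n I\<^esub> hom_of (face_weight \<mu>)" using \<mu> by simp
    then show ?thesis using \<mu> subgroup.one_closed[OF der_image_subgroup] by auto
  qed
qed (simp_all add: T1_part_simps face_constants_subspace hom_of_part[OF face_weight_compat]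
    face_weight_der_image hom_of_face_weight_add hom_of_face_weight_scale hom_I_A_def hom_module_def)

end

section \<open>Relations of a graded presentation\<close>

locale sr_presentation = sr_ring +
  fixes m :: nat and \<delta> :: "nat \<Rightarrow> nat \<Rightarrow> int" and j :: "(nat \<Rightarrow> cpoly) \<Rightarrow> cpoly"
  assumes pres: "graded_presentation n I m \<delta> j"
begin

abbreviation F where "F \<equiv> free_module P m"
abbreviation R where "R \<equiv> relations n m j"
abbreviation K where "K \<equiv> koszul_relations n m j"
abbreviation RM where "RM \<equiv> rel_module n m j"
abbreviation RQ where "RQ \<equiv> rel_quot n m j"

text \<open>The scalar for which the generator \<open>k\<close> is mapped to \<open>lam k x^(\<delta> k)\<close>.\<close>

definition lam :: "nat \<Rightarrow> complex" where "lam k = cf n (j (unit_vec P m k)) (\<delta> k)"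

lemma F_simps [simp]:
  "carrier F = {..<m} \<rightarrow>\<^sub>E polys n" "v \<oplus>\<^bsub>F\<^esub> w = (\<lambda>k\<in>{..<m}. v k + w k)"
  "r \<odot>\<^bsub>F\<^esub> v = (\<lambda>k\<in>{..<m}. r * v k)" "\<zero>\<^bsub>F\<^esub> = (\<lambda>k\<in>{..<m}. 0)"
  by (simp_all add: free_module_def)

lemma F_component: "v \<in> {..<m} \<rightarrow>\<^sub>E polys n \<Longrightarrow> k < m \<Longrightarrow> v k \<in> polys n" by (erule PiE_mem) simp

lemma F_ext0:
  assumes "v \<in> {..<m} \<rightarrow>\<^sub>E polys n" "w \<in> {..<m} \<rightarrow>\<^sub>E polys n" "\<And>k. k < m \<Longrightarrow> v k = w k"
  shows "v = w"
  by (rule PiE_ext[OF assms(1,2)]) (rule assms(3), simp)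

lemma F_restrict: "(\<And>k. k < m \<Longrightarrow> f k \<in> polys n) \<Longrightarrow> (\<lambda>k\<in>{..<m}. f k) \<in> {..<m} \<rightarrow>\<^sub>E polys n"
  unfolding restrict_PiE_iff by simp

lemma F_module: "module P F"
proof (rule moduleI)
  show "cring P" by (rule poly_ring_cring)
  show "abelian_group F"
  proof (rule abelian_groupI)
    fix u v w assume "u \<in> carrier F" "v \<in> carrier F" "w \<in> carrier F"
    then have u: "u \<in> {..<m} \<rightarrow>\<^sub>E polys n" and v: "v \<in> {..<m} \<rightarrow>\<^sub>E polys n" and w: "w \<in> {..<m} \<rightarrow>\<^sub>E polys n" by simp_all
    note uk = F_component[OF u] and vk = F_component[OF v] and wk = F_component[OF w]
    show "u \<oplus>\<^bsub>F\<^esub> v \<in> carrier F" unfolding F_simps by (rule F_restrict) (rule polys_add[OF uk vk])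
    show "u \<oplus>\<^bsub>F\<^esub> v \<oplus>\<^bsub>F\<^esub> w = u \<oplus>\<^bsub>F\<^esub> (v \<oplus>\<^bsub>F\<^esub> w)" unfolding F_simps by (rule restrict_ext) (simp add: add.assoc)
    show "u \<oplus>\<^bsub>F\<^esub> v = v \<oplus>\<^bsub>F\<^esub> u" unfolding F_simps by (rule restrict_ext) (simp add: add.commute)
    show "\<zero>\<^bsub>F\<^esub> \<oplus>\<^bsub>F\<^esub> u = u" unfolding F_simps
    proof (rule F_ext0[OF _ u])
      show "(\<lambda>k\<in>{..<m}. (\<lambda>k\<in>{..<m}. 0) k + u k) \<in> {..<m} \<rightarrow>\<^sub>E polys n"
        by (rule F_restrict) (use uk in simp)
    qed simp
    have "(\<lambda>k\<in>{..<m}. - u k) \<in> carrier F" unfolding F_simps by (rule F_restrict) (rule polys_uminus[OF uk])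
    moreover have "(\<lambda>k\<in>{..<m}. - u k) \<oplus>\<^bsub>F\<^esub> u = \<zero>\<^bsub>F\<^esub>" unfolding F_simps by (rule restrict_ext) simp
    ultimately show "\<exists>w\<in>carrier F. w \<oplus>\<^bsub>F\<^esub> u = \<zero>\<^bsub>F\<^esub>" by blast
  next
    show "\<zero>\<^bsub>F\<^esub> \<in> carrier F" unfolding F_simps by (rule F_restrict) simp
  qed
  have c: "v \<in> carrier F \<Longrightarrow> k < m \<Longrightarrow> v k \<in> polys n" for v k unfolding F_simps by (rule F_component)
  show "r \<odot>\<^bsub>F\<^esub> v \<in> carrier F" if "r \<in> carrier P" "v \<in> carrier F" for r v
    unfolding F_simps by (rule F_restrict) (rule polys_mult[OF that(1) c[OF that(2)]])
  show "(r \<oplus>\<^bsub>P\<^esub> s) \<odot>\<^bsub>F\<^esub> v = r \<odot>\<^bsub>F\<^esub> v \<oplus>\<^bsub>F\<^esub> s \<odot>\<^bsub>F\<^esub> v" for r s v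
    unfolding F_simps by (rule restrict_ext) (simp add: distrib_right)
  show "r \<odot>\<^bsub>F\<^esub> (v \<oplus>\<^bsub>F\<^esub> w) = r \<odot>\<^bsub>F\<^esub> v \<oplus>\<^bsub>F\<^esub> r \<odot>\<^bsub>F\<^esub> w" for r v w
    unfolding F_simps by (rule restrict_ext) (simp add: distrib_left)
  show "(r \<otimes>\<^bsub>P\<^esub> s) \<odot>\<^bsub>F\<^esub> v = r \<odot>\<^bsub>F\<^esub> (s \<odot>\<^bsub>F\<^esub> v)" for r s v
    unfolding F_simps by (rule restrict_ext) (simp add: mult.assoc)
  show "\<one>\<^bsub>P\<^esub> \<odot>\<^bsub>F\<^esub> v = v" if v: "v \<in> carrier F" for v unfolding F_simps
    by (rule F_ext0[OF F_restrict v[unfolded F_simps]]) (use c[OF v] in simp_all)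
qed

lemma F_ext: "v \<in> carrier F \<Longrightarrow> w \<in> carrier F \<Longrightarrow> (\<And>k. k < m \<Longrightarrow> v k = w k) \<Longrightarrow> v = w"
  unfolding F_simps by (rule F_ext0)

end

sublocale sr_presentation \<subseteq> F: module P F by (rule F_module)

context sr_presentation begin

lemma F_a_inv: "v \<in> carrier F \<Longrightarrow> \<ominus>\<^bsub>F\<^esub> v = (\<lambda>k\<in>{..<m}. - v k)"
proof (rule F.minus_equality)
  show "(\<lambda>k\<in>{..<m}. - v k) \<oplus>\<^bsub>F\<^esub> v = \<zero>\<^bsub>F\<^esub>" unfolding F_simps by (rule restrict_ext) simp
  show "v \<in> carrier F \<Longrightarrow> (\<lambda>k\<in>{..<m}. - v k) \<in> carrier F"
    unfolding F_simps by (rule F_restrict) (rule polys_uminus[OF F_component])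
qed

lemma j_mod_hom: "j \<in> mod_hom P F (self_module P)"
  using pres by (simp add: graded_presentation_def)

lemma j_polys: "v \<in> carrier F \<Longrightarrow> j v \<in> polys n"
  using j_mod_hom by (auto simp: mod_hom_def self_module_def simp del: F_simps)

lemma j_add: "v \<in> carrier F \<Longrightarrow> w \<in> carrier F \<Longrightarrow> j (v \<oplus>\<^bsub>F\<^esub> w) = j v + j w"
  using j_mod_hom by (simp add: mod_hom_def self_module_def del: F_simps)

lemma j_smult: "r \<in> polys n \<Longrightarrow> v \<in> carrier F \<Longrightarrow> j (r \<odot>\<^bsub>F\<^esub> v) = r * j v"
  using j_mod_hom by (simp add: mod_hom_def self_module_def del: F_simps)

lemma j_image: "j ` carrier F = I"
  using pres by (simp add: graded_presentation_def del: F_simps)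

lemma j_in_I: "v \<in> carrier F \<Longrightarrow> j v \<in> I" using j_image by blast

lemma unit_vec_F: "unit_vec P m k \<in> carrier F"
  unfolding unit_vec_def F_simps by (rule F_restrict) simp

lemma j_unit: "k < m \<Longrightarrow> j (unit_vec P m k) = mterm n (\<delta> k) (lam k)"
proof -
  assume "k < m"
  then have "j (unit_vec P m k) \<in> poly_part n (\<delta> k)" using pres by (simp add: graded_presentation_def)
  then obtain z where z: "j (unit_vec P m k) = mterm n (\<delta> k) z" by (auto simp: poly_part_eq)
  show ?thesis by (cases "vdeg n (\<delta> k)") (auto simp: lam_def z cf_mterm, simp add: mterm_def)
qed

lemma lam_ID:
  assumes "k < m" "lam k \<noteq> 0" shows "vdeg n (\<delta> k)" "\<not> xl (\<delta> k)"
proof -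
  show "vdeg n (\<delta> k)" using assms cf_invalid by (auto simp: lam_def)
  show "\<not> xl (\<delta> k)" using assms j_in_I[OF unit_vec_F, of k] by (auto simp: lam_def I_iff)
qed

lemma j_expand:
  assumes v: "v \<in> carrier F"
  shows "j v = (\<Sum>k<m. v k * mterm n (\<delta> k) (lam k))"
proof -
  define cut where "cut l = (\<lambda>k\<in>{..<m}. if k < l then v k else 0)" for l
  have cutF: "cut l \<in> carrier F" for l unfolding cut_def F_simps by (rule F_restrict) (use v F_component[of v] in simp)
  have "l \<le> m \<Longrightarrow> j (cut l) = (\<Sum>k<l. v k * mterm n (\<delta> k) (lam k))" for l
  proof (induction l)
    case 0
    have "cut 0 = 0 \<odot>\<^bsub>F\<^esub> v" unfolding cut_def F_simps by (rule restrict_ext) simp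
    then show ?case using j_smult[OF polys_0 v] by (simp del: F_simps)
  next
    case (Suc l)
    have "cut (Suc l) = cut l \<oplus>\<^bsub>F\<^esub> (v l \<odot>\<^bsub>F\<^esub> unit_vec P m l)"
      unfolding cut_def unit_vec_def F_simps by (rule restrict_ext) (simp add: less_Suc_eq)
    moreover have "v l \<odot>\<^bsub>F\<^esub> unit_vec P m l \<in> carrier F"
      using F.smult_closed[OF F_component[OF v[unfolded F_simps], of l] unit_vec_F] Suc by simp
    ultimately have "j (cut (Suc l)) = j (cut l) + j (v l \<odot>\<^bsub>F\<^esub> unit_vec P m l)"
      using j_add[OF cutF] by metis
    also have "j (v l \<odot>\<^bsub>F\<^esub> unit_vec P m l) = v l * mterm n (\<delta> l) (lam l)"
      using j_smult[OF F_component[OF v[unfolded F_simps], of l] unit_vec_F] j_unit Suc by simp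
    finally show ?case using Suc by simp
  qed
  moreover have "cut m = v" by (rule F_ext[OF cutF v]) (simp add: cut_def)
  ultimately show ?thesis by (metis order_refl)
qed

lemma cf_j:
  assumes v: "v \<in> carrier F"
  shows "cf n (j v) d = (\<Sum>k<m. lam k * cf n (v k) (\<lambda>i. d i - \<delta> k i))"
  unfolding j_expand[OF v] cf_sum
proof (rule sum.cong[OF refl])
  fix k assume "k \<in> {..<m}"
  then have k: "k < m" by simp
  show "cf n (v k * mterm n (\<delta> k) (lam k)) d = lam k * cf n (v k) (\<lambda>i. d i - \<delta> k i)"
  proof (cases "lam k = 0")
    case False
    then show ?thesis using cf_mterm_mult[OF F_component[OF v[unfolded F_simps] k] lam_ID(1)[OF k False], of "lam k" d]
      by (simp add: mult.commute)
  qed simp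
qed

text \<open>The generators of the ideal of a presentation generate its monomials, so every nonface is
  divisible by one of them.\<close>

lemma generator_below:
  assumes s: "vdeg n s" "\<not> xl s"
  shows "\<exists>k<m. lam k \<noteq> 0 \<and> \<delta> k \<le> s"
proof -
  have "mterm n s 1 \<in> I" using s by (auto simp: I_iff cf_mterm)
  then obtain v where v: "v \<in> carrier F" "j v = mterm n s 1" using j_image by (metis imageE)
  have "(\<Sum>k<m. lam k * cf n (v k) (\<lambda>i. s i - \<delta> k i)) \<noteq> 0"
    using cf_j[OF v(1), of s] v(2) s by (simp add: cf_mterm)
  then obtain k where k: "k < m" "lam k * cf n (v k) (\<lambda>i. s i - \<delta> k i) \<noteq> 0"
    by (metis (no_types, lifting) lessThan_iff sum.neutral)
  then have "vdeg n (\<lambda>i. s i - \<delta> k i)" using cf_invalid by fastforce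
  then have "\<delta> k \<le> s" by (auto simp: vdeg_def le_fun_def)
  then show ?thesis using k by auto
qed

lemma R_iff: "v \<in> R \<longleftrightarrow> v \<in> carrier F \<and> j v = 0" by (simp add: relations_def del: F_simps)
lemma R_F: "v \<in> R \<Longrightarrow> v \<in> carrier F" by (simp add: R_iff del: F_simps)

lemma R_submodule: "submodule R P F"
proof (rule F.submoduleI)
  show "R \<subseteq> carrier F" using R_F by blast
  show "\<zero>\<^bsub>F\<^esub> \<in> R" using j_smult[OF polys_0 F.zero_closed] by (simp add: R_iff)
  show "\<ominus>\<^bsub>F\<^esub> v \<in> R" if v: "v \<in> R" for v
  proof -
    have "\<ominus>\<^bsub>F\<^esub> v = (- 1) \<odot>\<^bsub>F\<^esub> v" using F_a_inv[OF R_F[OF v]] by simp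
    then show ?thesis using j_smult[OF polys_uminus[OF polys_1] R_F[OF v]] v F.a_inv_closed[OF R_F[OF v]]
      by (simp add: R_iff del: F_simps)
  qed
  show "v \<oplus>\<^bsub>F\<^esub> w \<in> R" if "v \<in> R" "w \<in> R" for v w
    using that j_add[of v w] F.a_closed[of v w] by (simp add: R_iff del: F_simps)
  show "r \<odot>\<^bsub>F\<^esub> v \<in> R" if "r \<in> carrier P" "v \<in> R" for r v
    using that j_smult[of r v] F.smult_closed[of r v] by (simp add: R_iff del: F_simps)
qed

definition gens :: "(nat \<Rightarrow> cpoly) set" where
  "gens = {(j f \<odot>\<^bsub>F\<^esub> e) \<ominus>\<^bsub>F\<^esub> (j e \<odot>\<^bsub>F\<^esub> f) |e f. e \<in> carrier F \<and> f \<in> carrier F}"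

lemma K_eq: "K = \<Inter> {N. submodule N P F \<and> gens \<subseteq> N}"
  by (simp add: koszul_relations_def hull_def gens_def Let_def)

lemma gen_minus:
  assumes "e \<in> carrier F" "f \<in> carrier F"
  shows "(j f \<odot>\<^bsub>F\<^esub> e) \<ominus>\<^bsub>F\<^esub> (j e \<odot>\<^bsub>F\<^esub> f) = (j f \<odot>\<^bsub>F\<^esub> e) \<oplus>\<^bsub>F\<^esub> ((- j e) \<odot>\<^bsub>F\<^esub> f)"
proof -
  have "\<ominus>\<^bsub>F\<^esub> (j e \<odot>\<^bsub>F\<^esub> f) = (- j e) \<odot>\<^bsub>F\<^esub> f"
    unfolding F_a_inv[OF F.smult_closed[OF j_polys[OF assms(1)] assms(2)]]
    unfolding F_simps by (rule restrict_ext) simp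
  then show ?thesis by (simp add: a_minus_def del: F_simps)
qed

lemma gensI:
  assumes "e \<in> carrier F" "f \<in> carrier F"
  shows "(j f \<odot>\<^bsub>F\<^esub> e) \<oplus>\<^bsub>F\<^esub> ((- j e) \<odot>\<^bsub>F\<^esub> f) \<in> gens"
  unfolding gens_def gen_minus[OF assms, symmetric]
  by (intro CollectI exI[where x=e] exI[where x=f] conjI refl assms)

lemma gensE:
  assumes "v \<in> gens"
  obtains e f where "e \<in> carrier F" "f \<in> carrier F" "v = (j f \<odot>\<^bsub>F\<^esub> e) \<oplus>\<^bsub>F\<^esub> ((- j e) \<odot>\<^bsub>F\<^esub> f)"
proof -
  obtain e f where ef: "v = (j f \<odot>\<^bsub>F\<^esub> e) \<ominus>\<^bsub>F\<^esub> (j e \<odot>\<^bsub>F\<^esub> f)" "e \<in> carrier F" "f \<in> carrier F"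
    using assms unfolding gens_def mem_Collect_eq by (elim exE conjE)
  show ?thesis by (rule that[OF ef(2,3)]) (unfold ef(1) gen_minus[OF ef(2,3)], rule refl)
qed

lemma K_least: "submodule N P F \<Longrightarrow> gens \<subseteq> N \<Longrightarrow> K \<subseteq> N" unfolding K_eq by blast

lemma gens_R: "gens \<subseteq> R"
proof
  fix v assume "v \<in> gens"
  then obtain e f where e: "e \<in> carrier F" and f: "f \<in> carrier F" and v: "v = (j f \<odot>\<^bsub>F\<^esub> e) \<oplus>\<^bsub>F\<^esub> ((- j e) \<odot>\<^bsub>F\<^esub> f)"
    by (rule gensE)
  have c1: "j f \<odot>\<^bsub>F\<^esub> e \<in> carrier F" using F.smult_closed[OF j_polys[OF f] e] .
  have ne: "- j e \<in> polys n" using j_polys[OF e] by (rule polys_uminus)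
  have c2: "(- j e) \<odot>\<^bsub>F\<^esub> f \<in> carrier F" using F.smult_closed[OF ne f] .
  have "j v = 0" unfolding v j_add[OF c1 c2] j_smult[OF j_polys[OF f] e] j_smult[OF ne f] by simp
  then show "v \<in> R" using F.a_closed[OF c1 c2] v by (simp add: R_iff del: F_simps)
qed

lemma K_submodule: "submodule K P F"
proof (rule F.submoduleI)
  show "K \<subseteq> carrier F" unfolding K_eq using gens_R R_F R_submodule by blast
  show "\<zero>\<^bsub>F\<^esub> \<in> K" unfolding K_eq
  proof (intro InterI)
    fix N assume "N \<in> {N. submodule N P F \<and> gens \<subseteq> N}"
    then have N: "submodule N P F" by blast
    show "\<zero>\<^bsub>F\<^esub> \<in> N" using subgroup.one_closed[OF submodule.axioms(1)[OF N]] by (simp del: F_simps)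
  qed
  show "\<ominus>\<^bsub>F\<^esub> v \<in> K" if "v \<in> K" for v
    using that F.submoduleE(3) unfolding K_eq by blast
  show "v \<oplus>\<^bsub>F\<^esub> w \<in> K" if "v \<in> K" "w \<in> K" for v w
    using that F.submoduleE(5) unfolding K_eq by blast
  show "r \<odot>\<^bsub>F\<^esub> v \<in> K" if "r \<in> carrier P" "v \<in> K" for r v
    using that F.submoduleE(4) unfolding K_eq by blast
qed

lemma K_R: "K \<subseteq> R" by (rule K_least[OF R_submodule gens_R])

lemma gens_K: "gens \<subseteq> K" unfolding K_eq by blast

text \<open>If \<open>i = j e\<close> and \<open>j v = 0\<close>, then \<open>i v\<close> is the Koszul relation of \<open>e\<close> and \<open>v\<close>. This makes \<open>R /
  K\<close> a module over the Stanley-Reisner ring.\<close>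

lemma I_R_K:
  assumes i: "i \<in> I" and v: "v \<in> R" shows "i \<odot>\<^bsub>F\<^esub> v \<in> K"
proof -
  obtain e where e: "e \<in> carrier F" "i = j e" using i j_image by (metis imageE)
  have vF: "v \<in> carrier F" and jv: "j v = 0" using v by (simp_all add: R_iff del: F_simps)
  have "(j e \<odot>\<^bsub>F\<^esub> v) \<oplus>\<^bsub>F\<^esub> ((- j v) \<odot>\<^bsub>F\<^esub> e) \<in> gens" using gensI[OF vF e(1)] .
  moreover have "(j e \<odot>\<^bsub>F\<^esub> v) \<oplus>\<^bsub>F\<^esub> ((- j v) \<odot>\<^bsub>F\<^esub> e) = i \<odot>\<^bsub>F\<^esub> v"
    unfolding F_simps by (rule restrict_ext) (simp add: jv e)
  ultimately show ?thesis using gens_K by auto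
qed

lemma RM_simps [simp]: "carrier RM = R" "add RM = add F" "zero RM = zero F" "smult RM = smult F"
  by (simp_all add: rel_module_def del: F_simps)

lemma RM_module: "module P RM"
  unfolding rel_module_def by (rule submodule.submodule_is_module[OF R_submodule F_module])

end

sublocale sr_presentation \<subseteq> RM: module P RM by (rule RM_module)

context sr_presentation begin

lemma K_RM: "subgroup K (add_monoid RM)"
proof -
  have "submodule K P RM"
  proof (rule RM.submoduleI)
    show "\<ominus>\<^bsub>RM\<^esub> v \<in> K" if "v \<in> K" for v
    proof -
      have vR: "v \<in> R" using that K_R by blast
      have nR: "\<ominus>\<^bsub>F\<^esub> v \<in> R" using F.submoduleE(3)[OF R_submodule vR] .
      have "\<ominus>\<^bsub>RM\<^esub> v = \<ominus>\<^bsub>F\<^esub> v"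
        by (rule RM.minus_equality) (use vR nR F.l_neg[OF R_F[OF vR]] in \<open>simp_all del: F_simps\<close>)
      then show ?thesis using F.submoduleE(3)[OF K_submodule that] by simp
    qed
  qed (use K_R F.submoduleE(4,5)[OF K_submodule] subgroup.one_closed[OF submodule.axioms(1)[OF K_submodule]]
      in \<open>auto simp del: F_simps\<close>)
  then show ?thesis by (rule submodule.axioms(1))
qed

definition rcl :: "(nat \<Rightarrow> cpoly) \<Rightarrow> (nat \<Rightarrow> cpoly) set" where "rcl v = K +>\<^bsub>RM\<^esub> v"

lemma rcl_mem: "w \<in> rcl v \<longleftrightarrow> (\<exists>\<kappa>\<in>K. w = \<kappa> \<oplus>\<^bsub>F\<^esub> v)"
  by (auto simp: rcl_def a_r_coset_def' simp del: F_simps)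

lemma rcl_self: "v \<in> R \<Longrightarrow> v \<in> rcl v"
  using subgroup.one_closed[OF K_RM] RM.l_zero[of v] by (force simp: rcl_mem simp del: F_simps)

lemma R_minus: "v \<in> R \<Longrightarrow> w \<in> R \<Longrightarrow> v \<ominus>\<^bsub>RM\<^esub> w = (\<lambda>k\<in>{..<m}. v k - w k)"
proof -
  assume v: "v \<in> R" and w: "w \<in> R"
  have nR: "\<ominus>\<^bsub>F\<^esub> w \<in> R" using F.submoduleE(3)[OF R_submodule w] .
  have "\<ominus>\<^bsub>RM\<^esub> w = \<ominus>\<^bsub>F\<^esub> w"
    by (rule RM.minus_equality) (use w nR F.l_neg[OF R_F[OF w]] in \<open>simp_all del: F_simps\<close>)
  then show ?thesis unfolding a_minus_def F_a_inv[OF R_F[OF w]] RM_simps F_simps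
    by (intro restrict_ext) simp
qed

lemma rcl_eq: "v \<in> R \<Longrightarrow> w \<in> R \<Longrightarrow> rcl v = rcl w \<longleftrightarrow> (\<lambda>k\<in>{..<m}. v k - w k) \<in> K"
  unfolding rcl_def using RM.a_rcos_eq_iff[OF K_RM, of v w] R_minus by simp

lemma RQ_carrier: "carrier RQ = rcl ` R"
  by (auto simp: rel_quot_def descend_scalars_def quot_module_def A_RCOSETS_def' rcl_def)

lemma RQ_add: "v \<in> R \<Longrightarrow> w \<in> R \<Longrightarrow> rcl v \<oplus>\<^bsub>RQ\<^esub> rcl w = rcl (v \<oplus>\<^bsub>F\<^esub> w)"
  using RM.a_rcos_add[OF K_RM, of v w]
  by (simp add: rel_quot_def descend_scalars_def quot_module_def rcl_def del: F_simps)

lemma R_add: "v \<in> R \<Longrightarrow> w \<in> R \<Longrightarrow> v \<oplus>\<^bsub>F\<^esub> w \<in> R" by (rule F.submoduleE(5)[OF R_submodule])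
lemma R_smult: "r \<in> polys n \<Longrightarrow> v \<in> R \<Longrightarrow> r \<odot>\<^bsub>F\<^esub> v \<in> R" by (rule F.submoduleE(4)[OF R_submodule])
lemma K_add: "v \<in> K \<Longrightarrow> w \<in> K \<Longrightarrow> v \<oplus>\<^bsub>F\<^esub> w \<in> K" by (rule F.submoduleE(5)[OF K_submodule])
lemma K_smult: "r \<in> polys n \<Longrightarrow> v \<in> K \<Longrightarrow> r \<odot>\<^bsub>F\<^esub> v \<in> K" by (rule F.submoduleE(4)[OF K_submodule])

lemma RQ_smult:
  assumes r: "r \<in> polys n" and v: "v \<in> R"
  shows "cls r \<odot>\<^bsub>RQ\<^esub> rcl v = rcl (r \<odot>\<^bsub>F\<^esub> v)"
proof -
  have "rcl (r' \<odot>\<^bsub>F\<^esub> y) = rcl (r \<odot>\<^bsub>F\<^esub> v)" if r': "r' \<in> cls r" and y: "y \<in> rcl v" for r' y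
  proof -
    obtain i where i: "i \<in> I" "r' = i + r" using r' by (auto simp: cls_def a_r_coset_def')
    obtain \<kappa> where \<kappa>: "\<kappa> \<in> K" "y = \<kappa> \<oplus>\<^bsub>F\<^esub> v" using y rcl_mem by blast
    have yR: "y \<in> R" using \<kappa> R_add K_R v by blast
    have ip: "i \<in> polys n" using i I_polys by blast
    have rp: "r' \<in> polys n" using ip r i by auto
    have "(i \<odot>\<^bsub>F\<^esub> y) \<oplus>\<^bsub>F\<^esub> (r \<odot>\<^bsub>F\<^esub> \<kappa>) \<in> K"
      by (rule K_add[OF I_R_K[OF i(1) yR] K_smult[OF r \<kappa>(1)]])
    moreover have "(i \<odot>\<^bsub>F\<^esub> y) \<oplus>\<^bsub>F\<^esub> (r \<odot>\<^bsub>F\<^esub> \<kappa>) = (\<lambda>k\<in>{..<m}. (r' \<odot>\<^bsub>F\<^esub> y) k - (r \<odot>\<^bsub>F\<^esub> v) k)"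
      unfolding F_simps by (rule restrict_ext) (simp add: i(2) \<kappa>(2) algebra_simps)
    ultimately show ?thesis using rcl_eq[OF R_smult[OF rp yR] R_smult[OF r v]] by simp
  qed
  then have 1: "(\<Union>y\<in>rcl v. rcl (r' \<odot>\<^bsub>F\<^esub> y)) = rcl (r \<odot>\<^bsub>F\<^esub> v)" if "r' \<in> cls r" for r'
    using that rcl_self[OF v] by blast
  have "r \<in> cls r" using I.zero_closed by (force simp: cls_def a_r_coset_def')
  moreover have "(\<lambda>r'. \<Union>y\<in>rcl v. rcl (r' \<odot>\<^bsub>F\<^esub> y)) ` cls r = (\<lambda>_. rcl (r \<odot>\<^bsub>F\<^esub> v)) ` cls r"
    by (intro image_cong refl 1)
  ultimately have "(\<lambda>r'. \<Union>y\<in>rcl v. rcl (r' \<odot>\<^bsub>F\<^esub> y)) ` cls r = {rcl (r \<odot>\<^bsub>F\<^esub> v)}"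
    using image_constant[of r "cls r" "rcl (r \<odot>\<^bsub>F\<^esub> v)"] by simp
  then show ?thesis
    by (simp add: rel_quot_def descend_scalars_def quot_module_def rcl_def[symmetric] del: F_simps)
qed

abbreviation SA where "SA \<equiv> self_module A"

lemma SA_simps [simp]: "carrier SA = carrier A" "add SA = add A" "zero SA = zero A" "smult SA = monoid.mult A"
  by (simp_all add: self_module_def)

lemma SA_abelian_group: "abelian_group SA"
proof (rule abelian_groupI)
  fix x assume "x \<in> carrier SA"
  then show "\<exists>y\<in>carrier SA. y \<oplus>\<^bsub>SA\<^esub> x = \<zero>\<^bsub>SA\<^esub>"
    using A.l_neg A.a_inv_closed by auto
next
  fix x y assume "x \<in> carrier SA" "y \<in> carrier SA"
  then show "x \<oplus>\<^bsub>SA\<^esub> y = y \<oplus>\<^bsub>SA\<^esub> x" using A.a_comm by simp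
next
  fix x y z assume "x \<in> carrier SA" "y \<in> carrier SA" "z \<in> carrier SA"
  then show "x \<oplus>\<^bsub>SA\<^esub> y \<oplus>\<^bsub>SA\<^esub> z = x \<oplus>\<^bsub>SA\<^esub> (y \<oplus>\<^bsub>SA\<^esub> z)" using A.a_assoc by simp
qed simp_all

lemma hom_R_target: "hom_target A RQ SA"
proof (rule hom_target.intro[OF SA_abelian_group])
  show "x \<oplus>\<^bsub>RQ\<^esub> y \<in> carrier RQ" if xy: "x \<in> carrier RQ" "y \<in> carrier RQ" for x y
  proof -
    obtain v w where "v \<in> R" "x = rcl v" "w \<in> R" "y = rcl w" using xy unfolding RQ_carrier by blast
    then show ?thesis using RQ_add R_add by (simp add: RQ_carrier del: F_simps)
  qed
  show "r \<odot>\<^bsub>RQ\<^esub> x \<in> carrier RQ" if rx: "r \<in> carrier A" "x \<in> carrier RQ" for r x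
  proof -
    obtain v p where "v \<in> R" "x = rcl v" "p \<in> polys n" "r = cls p" using rx unfolding RQ_carrier A_carrier by blast
    then show ?thesis using RQ_smult R_smult by (simp add: RQ_carrier del: F_simps)
  qed
qed (simp_all add: A.r_distr A.m_lcomm)

end

sublocale sr_presentation \<subseteq> HR: hom_target A RQ SA by (rule hom_R_target)

context sr_presentation begin

lemma hom_R_A_simps: "hom_R_A n I m j = hom_module A RQ SA" by (simp add: hom_R_A_def)

text \<open>A homomorphism on \<open>R / K\<close> is handled as a map on \<open>R\<close> that vanishes on the Koszul relations
  \<open>K\<close>; \<open>desc\<close> is the induced map on cosets.\<close>

definition lin :: "((nat \<Rightarrow> cpoly) \<Rightarrow> cpoly set) \<Rightarrow> bool" where
  "lin g \<longleftrightarrow> (\<forall>v\<in>R. g v \<in> carrier A) \<and> (\<forall>v\<in>R. \<forall>w\<in>R. g (v \<oplus>\<^bsub>F\<^esub> w) = g v \<oplus>\<^bsub>A\<^esub> g w) \<and>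
     (\<forall>r\<in>polys n. \<forall>v\<in>R. g (r \<odot>\<^bsub>F\<^esub> v) = cls r \<otimes>\<^bsub>A\<^esub> g v) \<and> (\<forall>v\<in>K. g v = \<zero>\<^bsub>A\<^esub>)"

lemma linD:
  assumes "lin g"
  shows "v \<in> R \<Longrightarrow> g v \<in> carrier A" "v \<in> R \<Longrightarrow> w \<in> R \<Longrightarrow> g (v \<oplus>\<^bsub>F\<^esub> w) = g v \<oplus>\<^bsub>A\<^esub> g w"
    "r \<in> polys n \<Longrightarrow> v \<in> R \<Longrightarrow> g (r \<odot>\<^bsub>F\<^esub> v) = cls r \<otimes>\<^bsub>A\<^esub> g v" "v \<in> K \<Longrightarrow> g v = \<zero>\<^bsub>A\<^esub>"
  using assms unfolding lin_def by blast+

definition desc :: "((nat \<Rightarrow> cpoly) \<Rightarrow> cpoly set) \<Rightarrow> (nat \<Rightarrow> cpoly) set \<Rightarrow> cpoly set" where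
  "desc g = (\<lambda>\<xi>\<in>carrier RQ. the_elem (g ` \<xi>))"

lemma desc_rcl:
  assumes g: "lin g" and v: "v \<in> R" shows "desc g (rcl v) = g v"
proof -
  have "g w = g v" if w: "w \<in> rcl v" for w
  proof -
    obtain \<kappa> where \<kappa>: "\<kappa> \<in> K" "w = \<kappa> \<oplus>\<^bsub>F\<^esub> v" using w rcl_mem by blast
    have "\<kappa> \<in> R" using \<kappa> K_R by blast
    then have "g w = g \<kappa> \<oplus>\<^bsub>A\<^esub> g v" unfolding \<kappa>(2) by (rule linD(2)[OF g _ v])
    then show ?thesis using linD(4)[OF g \<kappa>(1)] linD(1)[OF g v] by simp
  qed
  then have "g ` rcl v = (\<lambda>_. g v) ` rcl v" by (intro image_cong refl)
  then have "g ` rcl v = {g v}" using image_constant[OF rcl_self[OF v], of "g v"] by simp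
  then show ?thesis using v by (simp add: desc_def RQ_carrier)
qed

lemma desc_ext: "desc g \<in> extensional (carrier RQ)" by (simp add: desc_def)

lemma desc_mod_hom:
  assumes g: "lin g" shows "desc g \<in> mod_hom A RQ SA"
proof -
  have 1: "desc g x \<in> carrier A" if x: "x \<in> carrier RQ" for x
  proof -
    obtain v where "v \<in> R" "x = rcl v" using x unfolding RQ_carrier by blast
    then show ?thesis using desc_rcl[OF g] linD(1)[OF g] by simp
  qed
  have 2: "desc g (x \<oplus>\<^bsub>RQ\<^esub> y) = desc g x \<oplus>\<^bsub>A\<^esub> desc g y" if xy: "x \<in> carrier RQ" "y \<in> carrier RQ" for x y
  proof -
    obtain v w where vw: "v \<in> R" "x = rcl v" "w \<in> R" "y = rcl w" using xy unfolding RQ_carrier by blast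
    have "desc g (x \<oplus>\<^bsub>RQ\<^esub> y) = g (v \<oplus>\<^bsub>F\<^esub> w)"
      unfolding vw(2,4) RQ_add[OF vw(1,3)] by (rule desc_rcl[OF g R_add[OF vw(1,3)]])
    also have "\<dots> = g v \<oplus>\<^bsub>A\<^esub> g w" by (rule linD(2)[OF g vw(1,3)])
    finally show ?thesis unfolding vw(2,4) desc_rcl[OF g vw(1)] desc_rcl[OF g vw(3)] .
  qed
  have 3: "desc g (r \<odot>\<^bsub>RQ\<^esub> x) = r \<otimes>\<^bsub>A\<^esub> desc g x" if rx: "r \<in> carrier A" "x \<in> carrier RQ" for r x
  proof -
    obtain v p where vp: "v \<in> R" "x = rcl v" "p \<in> polys n" "r = cls p" using rx unfolding RQ_carrier A_carrier by blast
    have "desc g (r \<odot>\<^bsub>RQ\<^esub> x) = g (p \<odot>\<^bsub>F\<^esub> v)"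
      unfolding vp(2,4) RQ_smult[OF vp(3,1)] by (rule desc_rcl[OF g R_smult[OF vp(3,1)]])
    also have "\<dots> = cls p \<otimes>\<^bsub>A\<^esub> g v" by (rule linD(3)[OF g vp(3,1)])
    finally show ?thesis unfolding vp(2,4) desc_rcl[OF g vp(1)] .
  qed
  show ?thesis using 1 2 3 desc_ext[of g] by (simp add: mod_hom_def PiE_def)
qed

lemma desc_cong:
  assumes g: "lin g" "lin g'" shows "desc g = desc g' \<longleftrightarrow> (\<forall>v\<in>R. g v = g' v)"
proof
  assume "desc g = desc g'"
  then have "desc g (rcl v) = desc g' (rcl v)" for v by simp
  then show "\<forall>v\<in>R. g v = g' v" using desc_rcl[OF g(1)] desc_rcl[OF g(2)] by (metis (no_types))
next
  assume eq: "\<forall>v\<in>R. g v = g' v"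
  show "desc g = desc g'"
  proof (rule extensionalityI[OF desc_ext desc_ext])
    fix x assume "x \<in> carrier RQ"
    then obtain v where "v \<in> R" "x = rcl v" unfolding RQ_carrier by blast
    then show "desc g x = desc g' x" using eq desc_rcl[OF g(1)] desc_rcl[OF g(2)] by simp
  qed
qed

lemma mod_hom_desc:
  assumes h: "h \<in> mod_hom A RQ SA"
  shows "lin (\<lambda>v. h (rcl v))" "h = desc (\<lambda>v. h (rcl v))"
proof -
  have rc: "v \<in> R \<Longrightarrow> rcl v \<in> carrier RQ" for v by (simp add: RQ_carrier)
  have K0: "h (rcl v) = \<zero>\<^bsub>A\<^esub>" if v: "v \<in> K" for v
  proof -
    have vR: "v \<in> R" using v K_R by blast
    have zR: "\<zero>\<^bsub>F\<^esub> \<in> R" using RM.zero_closed by simp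
    have "rcl v = rcl (0 \<odot>\<^bsub>F\<^esub> v)"
      unfolding rcl_eq[OF vR R_smult[OF polys_0 vR]]
    proof -
      have "(\<lambda>k\<in>{..<m}. v k - (0 \<odot>\<^bsub>F\<^esub> v) k) = v"
        unfolding F_simps
        by (rule F_ext0[OF F_restrict R_F[OF vR, unfolded F_simps]])
           (use F_component[OF R_F[OF vR, unfolded F_simps]] in simp_all)
      then show "(\<lambda>k\<in>{..<m}. v k - (0 \<odot>\<^bsub>F\<^esub> v) k) \<in> K" using v by simp
    qed
    then have "h (rcl v) = cls 0 \<otimes>\<^bsub>A\<^esub> h (rcl v)"
      using HR.mod_homD(4)[OF h cls_carrier[OF polys_0] rc[OF vR]] RQ_smult[OF polys_0 vR] by simp
    then show ?thesis using HR.mod_homD(1)[OF h rc[OF vR]] A.l_null[of "h (rcl v)"] by (simp add: A_zero)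
  qed
  show lin: "lin (\<lambda>v. h (rcl v))"
    unfolding lin_def
  proof (intro conjI ballI)
    show "h (rcl v) \<in> carrier A" if "v \<in> R" for v using HR.mod_homD(1)[OF h rc[OF that]] by simp
    show "h (rcl (v \<oplus>\<^bsub>F\<^esub> w)) = h (rcl v) \<oplus>\<^bsub>A\<^esub> h (rcl w)" if "v \<in> R" "w \<in> R" for v w
      using HR.mod_homD(3)[OF h rc[OF that(1)] rc[OF that(2)]] RQ_add[OF that] by (simp del: F_simps)
    show "h (rcl (r \<odot>\<^bsub>F\<^esub> v)) = cls r \<otimes>\<^bsub>A\<^esub> h (rcl v)" if "r \<in> polys n" "v \<in> R" for r v
      using HR.mod_homD(4)[OF h cls_carrier[OF that(1)] rc[OF that(2)]] RQ_smult[OF that] by (simp del: F_simps)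
  qed (use K0 in simp)
  show "h = desc (\<lambda>v. h (rcl v))"
  proof (rule extensionalityI[OF HR.mod_homD(2)[OF h] desc_ext])
    fix x assume "x \<in> carrier RQ"
    then obtain v where "v \<in> R" "x = rcl v" unfolding RQ_carrier by blast
    then show "h x = desc (\<lambda>v. h (rcl v)) x" using desc_rcl[OF lin] by simp
  qed
qed

text \<open>A Koszul relation is a combination of vectors with coefficients in \<open>I\<close>. A map defined on the
  whole free module that kills such multiples kills all Koszul relations.\<close>

lemma lin_from_F:
  assumes car: "\<And>v. v \<in> carrier F \<Longrightarrow> g v \<in> carrier A"
    and add: "\<And>v w. v \<in> carrier F \<Longrightarrow> w \<in> carrier F \<Longrightarrow> g (v \<oplus>\<^bsub>F\<^esub> w) = g v \<oplus>\<^bsub>A\<^esub> g w"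
    and sm: "\<And>r v. r \<in> polys n \<Longrightarrow> v \<in> R \<Longrightarrow> g (r \<odot>\<^bsub>F\<^esub> v) = cls r \<otimes>\<^bsub>A\<^esub> g v"
    and I0: "\<And>i v. i \<in> I \<Longrightarrow> v \<in> carrier F \<Longrightarrow> g (i \<odot>\<^bsub>F\<^esub> v) = \<zero>\<^bsub>A\<^esub>"
  shows "lin g"
proof -
  have zR: "\<zero>\<^bsub>F\<^esub> \<in> R" using RM.zero_closed by simp
  have "submodule {v \<in> R. g v = \<zero>\<^bsub>A\<^esub>} P F"
  proof (rule F.submoduleI)
    show "{v \<in> R. g v = \<zero>\<^bsub>A\<^esub>} \<subseteq> carrier F" using R_F by blast
    have "0 \<odot>\<^bsub>F\<^esub> \<zero>\<^bsub>F\<^esub> = \<zero>\<^bsub>F\<^esub>" unfolding F_simps by (rule restrict_ext) simp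
    moreover have "0 \<in> I" using I.zero_closed by simp
    ultimately have "g \<zero>\<^bsub>F\<^esub> = \<zero>\<^bsub>A\<^esub>" using I0[of 0 "\<zero>\<^bsub>F\<^esub>"] R_F[OF zR] by (simp only:)
    then show "\<zero>\<^bsub>F\<^esub> \<in> {v \<in> R. g v = \<zero>\<^bsub>A\<^esub>}" using zR by (simp only: mem_Collect_eq)
    have smz: "r \<odot>\<^bsub>F\<^esub> v \<in> {v \<in> R. g v = \<zero>\<^bsub>A\<^esub>}" if "r \<in> polys n" "v \<in> {v \<in> R. g v = \<zero>\<^bsub>A\<^esub>}" for r v
      using that sm R_smult A.r_null by (simp del: F_simps)
    then show "r \<odot>\<^bsub>F\<^esub> v \<in> {v \<in> R. g v = \<zero>\<^bsub>A\<^esub>}" if "r \<in> carrier P" "v \<in> {v \<in> R. g v = \<zero>\<^bsub>A\<^esub>}" for r v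
      using that by blast
    show "\<ominus>\<^bsub>F\<^esub> v \<in> {v \<in> R. g v = \<zero>\<^bsub>A\<^esub>}" if v: "v \<in> {v \<in> R. g v = \<zero>\<^bsub>A\<^esub>}" for v
    proof -
      have "\<ominus>\<^bsub>F\<^esub> v = (- 1) \<odot>\<^bsub>F\<^esub> v" using F_a_inv[of v] v R_F by simp
      then show ?thesis using smz[OF polys_uminus[OF polys_1] v] by (simp del: F_simps)
    qed
    show "v \<oplus>\<^bsub>F\<^esub> w \<in> {v \<in> R. g v = \<zero>\<^bsub>A\<^esub>}" if "v \<in> {v \<in> R. g v = \<zero>\<^bsub>A\<^esub>}" "w \<in> {v \<in> R. g v = \<zero>\<^bsub>A\<^esub>}" for v w
      using that add[of v w] R_F R_add by (simp del: F_simps)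
  qed
  moreover have "gens \<subseteq> {v \<in> R. g v = \<zero>\<^bsub>A\<^esub>}"
  proof
    fix v assume v: "v \<in> gens"
    then obtain e f where e: "e \<in> carrier F" and f: "f \<in> carrier F" and ef: "v = (j f \<odot>\<^bsub>F\<^esub> e) \<oplus>\<^bsub>F\<^esub> ((- j e) \<odot>\<^bsub>F\<^esub> f)"
      by (rule gensE)
    have ne: "- j e \<in> I" using j_in_I[OF e] I.a_inv_closed[of "j e"] poly_ring_a_inv j_polys[OF e] by simp
    have c: "j f \<odot>\<^bsub>F\<^esub> e \<in> carrier F" "(- j e) \<odot>\<^bsub>F\<^esub> f \<in> carrier F"
      using F.smult_closed[OF j_polys[OF f] e] F.smult_closed[OF polys_uminus[OF j_polys[OF e]] f] .
    have "g v = \<zero>\<^bsub>A\<^esub>" unfolding ef add[OF c] I0[OF j_in_I[OF f] e] I0[OF ne f] by simp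
    then show "v \<in> {v \<in> R. g v = \<zero>\<^bsub>A\<^esub>}" using v gens_R by blast
  qed
  ultimately have K0: "K \<subseteq> {v \<in> R. g v = \<zero>\<^bsub>A\<^esub>}" by (rule K_least)
  show ?thesis unfolding lin_def
  proof (intro conjI ballI)
    show "g v \<in> carrier A" if "v \<in> R" for v by (rule car[OF R_F[OF that]])
    show "g (v \<oplus>\<^bsub>F\<^esub> w) = g v \<oplus>\<^bsub>A\<^esub> g w" if "v \<in> R" "w \<in> R" for v w
      by (rule add[OF R_F[OF that(1)] R_F[OF that(2)]])
    show "g (r \<odot>\<^bsub>F\<^esub> v) = cls r \<otimes>\<^bsub>A\<^esub> g v" if "r \<in> polys n" "v \<in> R" for r v by (rule sm[OF that])
    show "g v = \<zero>\<^bsub>A\<^esub>" if "v \<in> K" for v using K0 that by blast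
  qed
qed

lemma mod_hom_lin:
  assumes h: "h \<in> mod_hom P F AP" shows "lin h"
proof (rule lin_from_F)
  show 1: "h v \<in> carrier A" if "v \<in> carrier F" for v
    using h that by (auto simp: mod_hom_def simp del: F_simps)
  show "h (v \<oplus>\<^bsub>F\<^esub> w) = h v \<oplus>\<^bsub>A\<^esub> h w" if "v \<in> carrier F" "w \<in> carrier F" for v w
    using h that by (simp add: mod_hom_def del: F_simps)
  show 2: "h (r \<odot>\<^bsub>F\<^esub> v) = cls r \<otimes>\<^bsub>A\<^esub> h v" if "r \<in> polys n" "v \<in> R" for r v
    using h that R_F by (simp add: mod_hom_def del: F_simps)
  show "h (i \<odot>\<^bsub>F\<^esub> v) = \<zero>\<^bsub>A\<^esub>" if i: "i \<in> I" "v \<in> carrier F" for i v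
  proof -
    have ip: "i \<in> polys n" using i I_polys by blast
    have "h (i \<odot>\<^bsub>F\<^esub> v) = cls i \<otimes>\<^bsub>A\<^esub> h v" using h i ip by (simp add: mod_hom_def del: F_simps)
    moreover have "cls i = \<zero>\<^bsub>A\<^esub>" unfolding A_zero using cls_eq_iff[OF ip polys_0] i by simp
    ultimately show ?thesis using A.l_null[OF 1[OF i(2)]] by simp
  qed
qed

text \<open>Homomorphisms from the free module vanish on the Koszul relations automatically, so that their
  restriction to \<open>R\<close> descends.\<close>

lemma free_image_eq: "free_image n I m j = desc ` mod_hom P F AP"
  unfolding free_image_def desc_def ..

text \<open>The multiple of the generator \<open>k\<close> of total degree \<open>d\<close>.\<close>

definition mvec :: "nat \<Rightarrow> (nat \<Rightarrow> int) \<Rightarrow> complex \<Rightarrow> nat \<Rightarrow> cpoly" where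
  "mvec k d z = (\<lambda>t\<in>{..<m}. if t = k then mterm n (\<lambda>i. d i - \<delta> k i) z else 0)"

text \<open>Both parts are mapped to \<open>z x^d\<close> up to sign, so this is a relation of total degree \<open>d\<close>.\<close>

definition rel :: "nat \<Rightarrow> nat \<Rightarrow> (nat \<Rightarrow> int) \<Rightarrow> complex \<Rightarrow> nat \<Rightarrow> cpoly" where
  "rel k l d z = mvec k d (z / lam k) \<oplus>\<^bsub>F\<^esub> mvec l d (- z / lam l)"

lemma mvec_F: "mvec k d z \<in> carrier F" unfolding mvec_def F_simps by (rule F_restrict) simp

lemma cf_mvec: "t < m \<Longrightarrow> cf n (mvec k d z t) e =
    (if t = k \<and> e = (\<lambda>i. d i - \<delta> k i) \<and> vdeg n (\<lambda>i. d i - \<delta> k i) then z else 0)"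
  by (auto simp: mvec_def cf_mterm)

lemma mvec_smult: "mvec k d z = mterm n (\<lambda>i. d i - \<delta> k i) z \<odot>\<^bsub>F\<^esub> unit_vec P m k"
  unfolding mvec_def unit_vec_def F_simps by (rule restrict_ext) simp

lemma vdeg_diff: "vdeg n d \<Longrightarrow> vdeg n e \<Longrightarrow> e \<le> d \<Longrightarrow> vdeg n (\<lambda>i. d i - e i)"
  by (auto simp: vdeg_def le_fun_def)

text \<open>The generators that are mapped to 0 are excluded: they are relations themselves, and their
  degrees are arbitrary.\<close>

definition gen :: "nat \<Rightarrow> bool" where "gen k \<longleftrightarrow> k < m \<and> lam k \<noteq> 0"

lemma gen_vdeg: "gen k \<Longrightarrow> vdeg n (\<delta> k)" using lam_ID by (simp add: gen_def)
lemma gen_not_xl: "gen k \<Longrightarrow> \<not> xl (\<delta> k)" using lam_ID by (simp add: gen_def)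

lemma j_mvec:
  assumes k: "k < m"
  shows "j (mvec k d z) = mterm n (\<lambda>i. d i - \<delta> k i) z * mterm n (\<delta> k) (lam k)"
  unfolding mvec_smult j_smult[OF mterm_polys unit_vec_F] j_unit[OF k] ..

lemma j_mvec_gen:
  assumes k: "gen k" and d: "vdeg n d" "\<delta> k \<le> d"
  shows "j (mvec k d z) = mterm n d (z * lam k)"
  using j_mvec[of k d z] k mterm_mult[OF vdeg_diff[OF d(1) gen_vdeg[OF k] d(2)] gen_vdeg[OF k], of z "lam k"]
  by (simp add: gen_def)

lemma rel_R:
  assumes "gen k" "gen l" "vdeg n d" "\<delta> k \<le> d" "\<delta> l \<le> d"
  shows "rel k l d z \<in> R"
proof -
  have "j (rel k l d z) = mterm n d z + mterm n d (- z)"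
    unfolding rel_def j_add[OF mvec_F mvec_F] j_mvec_gen[OF assms(1,3,4)] j_mvec_gen[OF assms(2,3,5)]
    using assms(1,2) by (simp add: gen_def)
  also have "\<dots> = 0" by (simp add: mterm_add[symmetric])
  finally show ?thesis using F.a_closed[OF mvec_F mvec_F] by (simp add: R_iff rel_def del: F_simps)
qed

lemma mvec_R: "k < m \<Longrightarrow> lam k = 0 \<Longrightarrow> mvec k d z \<in> R"
  using mvec_F j_mvec by (simp add: R_iff del: F_simps)

definition terms :: "(nat \<Rightarrow> cpoly) \<Rightarrow> (nat \<times> (nat \<Rightarrow> int)) set" where
  "terms v = {(k, e). k < m \<and> cf n (v k) e \<noteq> 0}"

lemma finite_terms: "finite (terms v)"
proof (rule finite_subset)
  show "terms v \<subseteq> (\<Union>k<m. (\<lambda>\<mu>. (k, mdeg \<mu>)) ` Poly_Mapping.keys (v k))"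
  proof clarify
    fix k e assume "(k, e) \<in> terms v"
    then have k: "k < m" and e: "cf n (v k) e \<noteq> 0" by (auto simp: terms_def)
    then have "vdeg n e" using cf_invalid by blast
    then have "expo e \<in> Poly_Mapping.keys (v k)" "mdeg (expo e) = e"
      using e mdeg_expo by (auto simp: cf_def in_keys_iff)
    then show "(k, e) \<in> (\<Union>k<m. (\<lambda>\<mu>. (k, mdeg \<mu>)) ` Poly_Mapping.keys (v k))" using k by force
  qed
qed simp

text \<open>These relations span \<open>R\<close>. In each degree, a nonzero coefficient of a relation must cancel
  against another one, and subtracting a multiple of \<open>rel\<close> removes the first without creating a
  new one; the number of coefficients decreases.\<close>

lemma R_induct [consumes 1, case_names zero mvec rel add]:
  assumes v: "v \<in> R" and zero: "Q \<zero>\<^bsub>F\<^esub>"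
    and mvec: "\<And>k d z. k < m \<Longrightarrow> lam k = 0 \<Longrightarrow> vdeg n (\<lambda>i. d i - \<delta> k i) \<Longrightarrow> Q (mvec k d z)"
    and rel: "\<And>k l d z. gen k \<Longrightarrow> gen l \<Longrightarrow> vdeg n d \<Longrightarrow> \<delta> k \<le> d \<Longrightarrow> \<delta> l \<le> d \<Longrightarrow> Q (rel k l d z)"
    and add: "\<And>v w. v \<in> R \<Longrightarrow> w \<in> R \<Longrightarrow> Q v \<Longrightarrow> Q w \<Longrightarrow> Q (v \<oplus>\<^bsub>F\<^esub> w)"
  shows "Q v"
  using v
proof (induction "card (terms v)" arbitrary: v rule: less_induct)
  case less
  have vF: "v \<in> carrier F" using R_F[OF less.prems] .
  have step: "Q v" if t: "t \<in> R" "Q t" and sub: "terms (\<lambda>k\<in>{..<m}. v k + (- 1) * t k) \<subset> terms v" for t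
  proof -
    let ?w = "v \<oplus>\<^bsub>F\<^esub> ((- 1) \<odot>\<^bsub>F\<^esub> t)"
    have tF: "t \<in> carrier F" using R_F[OF t(1)] .
    have w: "?w \<in> R" by (rule R_add[OF less.prems R_smult[OF polys_uminus[OF polys_1] t(1)]])
    have weq: "?w = (\<lambda>k\<in>{..<m}. v k + (- 1) * t k)" unfolding F_simps by (rule restrict_ext) simp
    have "card (terms ?w) < card (terms v)" unfolding weq by (rule psubset_card_mono[OF finite_terms sub])
    then have "Q ?w" by (rule less.hyps[OF _ w])
    then have "Q (?w \<oplus>\<^bsub>F\<^esub> t)" by (rule add[OF w t(1) _ t(2)])
    moreover have "?w \<oplus>\<^bsub>F\<^esub> t = v"
      by (rule F_ext[OF F.a_closed[OF R_F[OF w] tF] vF]) simp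
    ultimately show ?thesis by (simp del: F_simps)
  qed
  show ?case
  proof (cases "terms v = {}")
    case True
    have "v = \<zero>\<^bsub>F\<^esub>"
    proof (rule F_ext[OF vF F.zero_closed])
      fix k assume k: "k < m"
      have "v k = 0" by (rule cf_ext[OF F_component[OF vF[unfolded F_simps] k] polys_0]) (use True k in \<open>auto simp: terms_def\<close>)
      then show "v k = \<zero>\<^bsub>F\<^esub> k" using k by simp
    qed
    then show ?thesis using zero by (simp del: F_simps)
  next
    case False
    \<comment> \<open>the term \<open>x^e\<close> of the component \<open>k\<close> has total degree \<open>d = e + \<delta> k\<close>\<close>
    then obtain k e where ke: "k < m" "cf n (v k) e \<noteq> 0" by (auto simp: terms_def)
    define d where "d = (\<lambda>i. e i + \<delta> k i)"
    have ed: "(\<lambda>i. d i - \<delta> k i) = e" by (simp add: d_def)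
    have ve: "vdeg n e" using ke cf_invalid by blast
    show ?thesis
    proof (cases "lam k = 0")
      case True
      let ?t = "mvec k d (cf n (v k) e)"
      have cft: "cf n ((\<lambda>t\<in>{..<m}. v t + (- 1) * ?t t) l) f = (if l = k \<and> f = e then 0 else cf n (v l) f)" if "l < m" for l f
        using that ve by (auto simp: cf_diff cf_mvec ed)
      have "terms (\<lambda>t\<in>{..<m}. v t + (- 1) * ?t t) \<subseteq> terms v - {(k, e)}"
        using cft by (auto simp: terms_def split: if_splits)
      then have "terms (\<lambda>t\<in>{..<m}. v t + (- 1) * ?t t) \<subset> terms v" using ke by (auto simp: terms_def)
      moreover have vde: "vdeg n (\<lambda>i. d i - \<delta> k i)" using ve ed by simp
      ultimately show ?thesis by (intro step[OF mvec_R[OF ke(1) True] mvec[OF ke(1) True vde]])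
    next
      case lam: False
      have gk: "gen k" using lam ke by (simp add: gen_def)
      have vd: "vdeg n d" unfolding d_def by (rule vdeg_add[OF ve gen_vdeg[OF gk]])
      have kd: "\<delta> k \<le> d" using ve by (auto simp: d_def le_fun_def vdeg_def)
      have "(\<Sum>l<m. lam l * cf n (v l) (\<lambda>i. d i - \<delta> l i)) = 0"
        using cf_j[OF vF, of d] less.prems by (simp add: R_iff del: F_simps)
      \<comment> \<open>the coefficients of \<open>j v = 0\<close> in degree \<open>d\<close> cancel, so a second generator \<open>l\<close> occurs
        there\<close>
      moreover have "lam k * cf n (v k) (\<lambda>i. d i - \<delta> k i) \<noteq> 0" using lam ke ed by simp
      ultimately have "(\<Sum>l\<in>{..<m} - {k}. lam l * cf n (v l) (\<lambda>i. d i - \<delta> l i)) \<noteq> 0"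
        using ke(1) by (metis (no_types, lifting) add.right_neutral finite_lessThan lessThan_iff sum.remove)
      then obtain l where l: "l \<in> {..<m} - {k}" "lam l * cf n (v l) (\<lambda>i. d i - \<delta> l i) \<noteq> 0"
        using sum.neutral[of "{..<m} - {k}" "\<lambda>l. lam l * cf n (v l) (\<lambda>i. d i - \<delta> l i)"] by blast
      have gl: "gen l" and lk: "l \<noteq> k" using l by (auto simp: gen_def)
      have vl: "vdeg n (\<lambda>i. d i - \<delta> l i)" using l cf_invalid by fastforce
      have ld: "\<delta> l \<le> d" using vl by (auto simp: vdeg_def le_fun_def)
      let ?z = "lam k * cf n (v k) e"
      let ?t = "rel k l d ?z"
      have kz: "?z / lam k = cf n (v k) e" using lam by simp
      have cft: "cf n ((\<lambda>t\<in>{..<m}. v t + (- 1) * ?t t) s) f =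
         (if s = k \<and> f = e then 0 else if s = l \<and> f = (\<lambda>i. d i - \<delta> l i) then cf n (v l) f + ?z / lam l else cf n (v s) f)"
        if "s < m" for s f
        using that ve vl lk lam by (auto simp: rel_def cf_diff cf_add cf_mvec ed)
      have "terms (\<lambda>t\<in>{..<m}. v t + (- 1) * ?t t) \<subseteq> terms v - {(k, e)}"
        using cft l by (auto simp: terms_def split: if_splits)
      then have "terms (\<lambda>t\<in>{..<m}. v t + (- 1) * ?t t) \<subset> terms v" using ke by (auto simp: terms_def)
      then show ?thesis by (intro step[OF rel_R[OF gk gl vd kd ld] rel[OF gk gl vd kd ld]])
    qed
  qed
qed

end

section \<open>Homomorphisms on the relations\<close>

text \<open>The 1-cocycles and the 1-coboundaries of the order complex of \<open>F\<close> relative to \<open>G\<close>, as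
  functions of pairs \<open>f \<subseteq> g\<close>. If \<open>f\<close> lies in the upward closed set \<open>G\<close>, then so does \<open>g\<close>.\<close>

definition face_cocycles :: "'a set set \<Rightarrow> 'a set set \<Rightarrow> ('a set \<times> 'a set \<Rightarrow> complex) set" where
  "face_cocycles F G = {l. (\<forall>f\<in>F. \<forall>g\<in>F. \<forall>h\<in>F. f \<subseteq> g \<longrightarrow> g \<subseteq> h \<longrightarrow> l (f, g) + l (g, h) = l (f, h)) \<and>
     (\<forall>f\<in>G. \<forall>g\<in>F. f \<subseteq> g \<longrightarrow> l (f, g) = 0)}"

definition face_coboundaries :: "'a set set \<Rightarrow> 'a set set \<Rightarrow> ('a set \<times> 'a set \<Rightarrow> complex) set" where
  "face_coboundaries F G = {l. \<exists>\<mu>. (\<forall>f\<in>G. \<mu> f = 0) \<and> (\<forall>f\<in>F. \<forall>g\<in>F. f \<subseteq> g \<longrightarrow> l (f, g) = \<mu> g - \<mu> f)}"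

lemma face_cocycles_add:
  "l \<in> face_cocycles F G \<Longrightarrow> f \<in> F \<Longrightarrow> g \<in> F \<Longrightarrow> h \<in> F \<Longrightarrow> f \<subseteq> g \<Longrightarrow> g \<subseteq> h \<Longrightarrow> l (f, g) + l (g, h) = l (f, h)"
  unfolding face_cocycles_def by blast

lemma face_cocycles_zero:
  "l \<in> face_cocycles F G \<Longrightarrow> f \<in> G \<Longrightarrow> g \<in> F \<Longrightarrow> f \<subseteq> g \<Longrightarrow> l (f, g) = 0"
  unfolding face_cocycles_def by blast

lemma face_cocycles_subspace: "fun_subspace (face_cocycles F G)"
proof -
  have add: "(\<lambda>x. u x + v x) \<in> face_cocycles F G" if u: "u \<in> face_cocycles F G" and v: "v \<in> face_cocycles F G" for u v
    unfolding face_cocycles_def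
  proof (intro CollectI conjI ballI impI)
    fix f g h assume fgh: "f \<in> F" "g \<in> F" "h \<in> F" "f \<subseteq> g" "g \<subseteq> h"
    have "(u (f, g) + v (f, g)) + (u (g, h) + v (g, h)) = (u (f, g) + u (g, h)) + (v (f, g) + v (g, h))"
      by (simp only: add_ac)
    also have "\<dots> = u (f, h) + v (f, h)"
      unfolding face_cocycles_add[OF u fgh] face_cocycles_add[OF v fgh] ..
    finally show "u (f, g) + v (f, g) + (u (g, h) + v (g, h)) = u (f, h) + v (f, h)" .
  next
    fix f g assume fg: "f \<in> G" "g \<in> F" "f \<subseteq> g"
    show "u (f, g) + v (f, g) = 0" using face_cocycles_zero[OF u fg] face_cocycles_zero[OF v fg] by simp
  qed
  have scale: "(\<lambda>x. z * u x) \<in> face_cocycles F G" if u: "u \<in> face_cocycles F G" for u z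
    unfolding face_cocycles_def
  proof (intro CollectI conjI ballI impI)
    fix f g h assume fgh: "f \<in> F" "g \<in> F" "h \<in> F" "f \<subseteq> g" "g \<subseteq> h"
    show "z * u (f, g) + z * u (g, h) = z * u (f, h)"
      unfolding distrib_left[symmetric] face_cocycles_add[OF u fgh] ..
  next
    fix f g assume fg: "f \<in> G" "g \<in> F" "f \<subseteq> g"
    show "z * u (f, g) = 0" using face_cocycles_zero[OF u fg] by simp
  qed
  have zero: "(\<lambda>x. 0) \<in> face_cocycles F G" by (simp add: face_cocycles_def)
  show ?thesis unfolding fun_subspace_def by (intro conjI ballI allI zero add scale)
qed

context sr_presentation begin

declare F_simps [simp del]

lemma F_apply [simp]:
  "t < m \<Longrightarrow> (v \<oplus>\<^bsub>F\<^esub> w) t = v t + w t" "t < m \<Longrightarrow> (r \<odot>\<^bsub>F\<^esub> v) t = r * v t" "t < m \<Longrightarrow> \<zero>\<^bsub>F\<^esub> t = 0"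
  by (simp_all add: F_simps)

end

locale sr_t2 = sr_degree + sr_presentation
begin

text \<open>Degrees of images are indexed by the degree before the shift by \<open>c\<close>, which lets relations and
  images be compared without shifts.\<close>

definition al :: "cpoly set \<Rightarrow> (nat \<Rightarrow> int) \<Rightarrow> complex" where "al x D = acf x (\<lambda>i. D i + c i)"

lemma al_ext: "x \<in> carrier A \<Longrightarrow> y \<in> carrier A \<Longrightarrow> (\<And>D. L D \<Longrightarrow> al x D = al y D) \<Longrightarrow> x = y"
proof (rule acf_ext)
  fix d assume eq: "\<And>D. L D \<Longrightarrow> al x D = al y D" and d: "xl d"
  have dd: "(\<lambda>i. (d i - c i) + c i) = d" by simp
  have "L (\<lambda>i. d i - c i)" using d by (simp add: L_def)
  from eq[OF this] show "acf x d = acf y d" by (simp add: al_def)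
qed

lemma al_not_L: "\<not> L D \<Longrightarrow> al x D = 0" by (simp add: al_def L_def acf_not_xl)
lemma al_add: "x \<in> carrier A \<Longrightarrow> y \<in> carrier A \<Longrightarrow> al (x \<oplus>\<^bsub>A\<^esub> y) D = al x D + al y D"
  by (simp add: al_def acf_add)
lemma al_zero [simp]: "al \<zero>\<^bsub>A\<^esub> D = 0" by (simp add: al_def)

lemma al_mult:
  assumes "x \<in> carrier A" "vdeg n e"
  shows "al (cls (mterm n e z) \<otimes>\<^bsub>A\<^esub> x) D = (if L D then z * al x (\<lambda>i. D i - e i) else 0)"
proof -
  have "(\<lambda>i. D i + c i - e i) = (\<lambda>i. (D i - e i) + c i)" by (auto simp: fun_eq_iff)
  then show ?thesis using acf_mterm_mult[OF assms, of z "\<lambda>i. D i + c i"] by (simp add: al_def L_def)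
qed

lemma al_cls: "p \<in> polys n \<Longrightarrow> L D \<Longrightarrow> al (cls p) D = cf n p (\<lambda>i. D i + c i)"
  by (simp add: al_def acf_cls L_def)

lemma quot_part_iff_al:
  assumes "x \<in> carrier A"
  shows "x \<in> quot_part n I (\<lambda>i. d i + c i) \<longleftrightarrow> (\<forall>D. D \<noteq> d \<longrightarrow> al x D = 0)"
  unfolding quot_part_iff_acf[OF assms]
proof
  assume h: "\<forall>e. e \<noteq> (\<lambda>i. d i + c i) \<longrightarrow> acf x e = 0"
  show "\<forall>D. D \<noteq> d \<longrightarrow> al x D = 0"
  proof (intro allI impI)
    fix D assume "D \<noteq> d"
    then have "(\<lambda>i. D i + c i) \<noteq> (\<lambda>i. d i + c i)" by (auto simp: fun_eq_iff)
    then show "al x D = 0" unfolding al_def using h by blast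
  qed
next
  assume h: "\<forall>D. D \<noteq> d \<longrightarrow> al x D = 0"
  show "\<forall>e. e \<noteq> (\<lambda>i. d i + c i) \<longrightarrow> acf x e = 0"
  proof (intro allI impI)
    fix e assume "e \<noteq> (\<lambda>i. d i + c i)"
    moreover have "e = (\<lambda>i. (e i - c i) + c i)" by simp
    ultimately have "(\<lambda>i. e i - c i) \<noteq> d" by (metis (no_types))
    then have "al x (\<lambda>i. e i - c i) = 0" using h by blast
    then show "acf x e = 0" by (simp add: al_def)
  qed
qed

lemma gen_ID: "gen k \<Longrightarrow> ID (\<delta> k)" using gen_vdeg gen_not_xl by (simp add: ID_iff)

lemma gen_below: "ID s \<Longrightarrow> \<exists>k. gen k \<and> \<delta> k \<le> s"
  using generator_below[of s] by (auto simp: gen_def ID_iff)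

text \<open>On linear maps this says that the induced homomorphism has degree \<open>c\<close>.\<close>

definition homog :: "((nat \<Rightarrow> cpoly) \<Rightarrow> cpoly set) \<Rightarrow> bool" where
  "homog g \<longleftrightarrow> (\<forall>d. \<forall>v\<in>R \<inter> free_part n m \<delta> d. \<forall>D. D \<noteq> d \<longrightarrow> al (g v) D = 0)"

lemma homogD: "homog g \<Longrightarrow> v \<in> R \<Longrightarrow> v \<in> free_part n m \<delta> d \<Longrightarrow> D \<noteq> d \<Longrightarrow> al (g v) D = 0"
  unfolding homog_def by blast

lemma free_part_iff: "v \<in> free_part n m \<delta> d \<longleftrightarrow>
    v \<in> carrier F \<and> (\<forall>k<m. v k \<in> poly_part n (\<lambda>i. d i - \<delta> k i))"
  by (simp add: free_part_def)

lemma mvec_part: "mvec k d z \<in> free_part n m \<delta> d"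
  unfolding free_part_iff
proof (intro conjI mvec_F allI impI)
  fix t assume t: "t < m"
  have "0 = mterm n (\<lambda>i. d i - \<delta> t i) 0" by simp
  then have "0 \<in> poly_part n (\<lambda>i. d i - \<delta> t i)" unfolding poly_part_eq by (rule range_eqI)
  then show "mvec k d z t \<in> poly_part n (\<lambda>i. d i - \<delta> t i)"
    using t by (simp add: mvec_def poly_part_eq)
qed

lemma poly_part_add: "p \<in> poly_part n d \<Longrightarrow> q \<in> poly_part n d \<Longrightarrow> p + q \<in> poly_part n d"
  unfolding poly_part_eq by (auto simp: mterm_add[symmetric])

lemma rel_part: "rel k l d z \<in> free_part n m \<delta> d"
proof -
  have "rel k l d z \<in> carrier F" unfolding rel_def by (rule F.a_closed[OF mvec_F mvec_F])
  moreover have "rel k l d z t \<in> poly_part n (\<lambda>i. d i - \<delta> t i)" if t: "t < m" for t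
  proof -
    have "mvec k d (z / lam k) t \<in> poly_part n (\<lambda>i. d i - \<delta> t i)"
      "mvec l d (- z / lam l) t \<in> poly_part n (\<lambda>i. d i - \<delta> t i)"
      using mvec_part t unfolding free_part_iff by blast+
    from poly_part_add[OF this] show ?thesis using t by (simp add: rel_def)
  qed
  ultimately show ?thesis unfolding free_part_iff by blast
qed

text \<open>A homogeneous linear map is known from the single coefficients that it may have on the
  relations that span \<open>R\<close>.\<close>

lemma lin_agree:
  assumes g: "lin g" "homog g" and g': "lin g'" "homog g'"
    and un: "\<And>k. k < m \<Longrightarrow> lam k = 0 \<Longrightarrow> L (\<delta> k) \<Longrightarrow> al (g (unit_vec P m k)) (\<delta> k) = al (g' (unit_vec P m k)) (\<delta> k)"
    and re: "\<And>k l d z. gen k \<Longrightarrow> gen l \<Longrightarrow> vdeg n d \<Longrightarrow> \<delta> k \<le> d \<Longrightarrow> \<delta> l \<le> d \<Longrightarrow> L d \<Longrightarrow>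
       al (g (rel k l d z)) d = al (g' (rel k l d z)) d"
    and v: "v \<in> R"
  shows "g v = g' v"
  using v
proof (induction v rule: R_induct)
  case zero
  have "\<zero>\<^bsub>F\<^esub> \<in> K" using subgroup.one_closed[OF submodule.axioms(1)[OF K_submodule]] by simp
  then show ?case using linD(4)[OF g(1)] linD(4)[OF g'(1)] by simp
next
  case (mvec k d z)
  have uR: "unit_vec P m k \<in> R" using unit_vec_F j_unit[OF mvec(1)] mvec(2) by (simp add: R_iff)
  have "unit_vec P m k = mvec k (\<delta> k) 1"
  proof (rule F_ext[OF unit_vec_F mvec_F])
    fix t assume "t < m"
    have "mterm n (\<lambda>i. 0) 1 = 1" using const_poly_mterm[of 1 n] by (simp add: const_poly_def)
    then show "unit_vec P m k t = mvec k (\<delta> k) 1 t" using \<open>t < m\<close> by (simp add: unit_vec_def mvec_def)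
  qed
  then have up: "unit_vec P m k \<in> free_part n m \<delta> (\<delta> k)" using mvec_part by simp
  have eq: "al (g (unit_vec P m k)) D = al (g' (unit_vec P m k)) D" for D
  proof (cases "D = \<delta> k")
    case True
    then show ?thesis using un[OF mvec(1,2)] al_not_L by (cases "L (\<delta> k)") auto
  next
    case False
    then show ?thesis using homogD[OF g(2) uR up] homogD[OF g'(2) uR up] by simp
  qed
  have "g (unit_vec P m k) = g' (unit_vec P m k)"
    by (rule al_ext[OF linD(1)[OF g(1) uR] linD(1)[OF g'(1) uR] eq])
  then show ?case unfolding mvec_smult using linD(3)[OF g(1) mterm_polys uR] linD(3)[OF g'(1) mterm_polys uR] by simp
next
  case (rel k l d z)
  have rR: "rel k l d z \<in> R" by (rule rel_R[OF rel])
  show ?case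
  proof (rule al_ext[OF linD(1)[OF g(1) rR] linD(1)[OF g'(1) rR]])
    fix D assume "L D"
    show "al (g (rel k l d z)) D = al (g' (rel k l d z)) D"
    proof (cases "D = d")
      case True
      then show ?thesis using re[OF rel] \<open>L D\<close> by blast
    next
      case False
      then show ?thesis using homogD[OF g(2) rR rel_part] homogD[OF g'(2) rR rel_part] by simp
    qed
  qed
next
  case (add v w)
  then show ?case using linD(2)[OF g(1) add(1,2)] linD(2)[OF g'(1) add(1,2)] by simp
qed

lemma lin_homog_add:
  assumes "lin g" "homog g" "lin g'" "homog g'"
  shows "lin (\<lambda>v. g v \<oplus>\<^bsub>A\<^esub> g' v)" "homog (\<lambda>v. g v \<oplus>\<^bsub>A\<^esub> g' v)"
proof -
  note g = linD[OF assms(1)] and g' = linD[OF assms(3)]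
  show "lin (\<lambda>v. g v \<oplus>\<^bsub>A\<^esub> g' v)"
    unfolding lin_def
  proof (intro conjI ballI)
    fix v assume v: "v \<in> R"
    show "g v \<oplus>\<^bsub>A\<^esub> g' v \<in> carrier A" using g(1)[OF v] g'(1)[OF v] by simp
    show "g (v \<oplus>\<^bsub>F\<^esub> w) \<oplus>\<^bsub>A\<^esub> g' (v \<oplus>\<^bsub>F\<^esub> w) = g v \<oplus>\<^bsub>A\<^esub> g' v \<oplus>\<^bsub>A\<^esub> (g w \<oplus>\<^bsub>A\<^esub> g' w)" if w: "w \<in> R" for w
      unfolding g(2)[OF v w] g'(2)[OF v w]
      using A.add.m_assoc A.add.m_lcomm g(1)[OF v] g'(1)[OF v] g(1)[OF w] g'(1)[OF w] by simp
    show "g (r \<odot>\<^bsub>F\<^esub> v) \<oplus>\<^bsub>A\<^esub> g' (r \<odot>\<^bsub>F\<^esub> v) = cls r \<otimes>\<^bsub>A\<^esub> (g v \<oplus>\<^bsub>A\<^esub> g' v)" if r: "r \<in> polys n" for r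
      unfolding g(3)[OF r v] g'(3)[OF r v]
      by (rule A.r_distr[OF g(1)[OF v] g'(1)[OF v] cls_carrier[OF r], symmetric])
  next
    show "g v \<oplus>\<^bsub>A\<^esub> g' v = \<zero>\<^bsub>A\<^esub>" if "v \<in> K" for v
      unfolding g(4)[OF that] g'(4)[OF that] by simp
  qed
  show "homog (\<lambda>v. g v \<oplus>\<^bsub>A\<^esub> g' v)"
    unfolding homog_def
  proof (intro allI ballI impI)
    fix d v D assume v: "v \<in> R \<inter> free_part n m \<delta> d" and D: "D \<noteq> d"
    then show "al (g v \<oplus>\<^bsub>A\<^esub> g' v) D = 0"
      using homogD[OF assms(2), of v d D] homogD[OF assms(4), of v d D] al_add[of "g v" "g' v" D] g(1)[of v] g'(1)[of v]
      by simp
  qed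
qed

text \<open>The homomorphism from the free module that sends the generator \<open>k\<close> to \<open>r k x^(\<delta> k + c)\<close>.\<close>

definition free_hom :: "(nat \<Rightarrow> complex) \<Rightarrow> (nat \<Rightarrow> cpoly) \<Rightarrow> cpoly set" where
  "free_hom r = (\<lambda>v\<in>carrier F. cls (\<Sum>k<m. v k * mterm n (\<lambda>i. \<delta> k i + c i) (r k)))"

lemma free_hom_mod_hom: "free_hom r \<in> mod_hom P F AP"
proof -
  have p: "(\<Sum>k<m. v k * mterm n (\<lambda>i. \<delta> k i + c i) (r k)) \<in> polys n" if v: "v \<in> carrier F" for v
    by (rule polys_sum, rule polys_mult) (use F_component[OF v[unfolded F_simps]] in auto)
  have "free_hom r (v \<oplus>\<^bsub>F\<^esub> w) = free_hom r v \<oplus>\<^bsub>A\<^esub> free_hom r w" if v: "v \<in> carrier F" and w: "w \<in> carrier F" for v w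
  proof -
    have "(\<Sum>k<m. (v \<oplus>\<^bsub>F\<^esub> w) k * mterm n (\<lambda>i. \<delta> k i + c i) (r k))
      = (\<Sum>k<m. v k * mterm n (\<lambda>i. \<delta> k i + c i) (r k)) + (\<Sum>k<m. w k * mterm n (\<lambda>i. \<delta> k i + c i) (r k))"
      by (simp add: sum.distrib[symmetric] distrib_right)
    then show ?thesis using v w F.a_closed[OF v w] A_add[OF p[OF v] p[OF w]] by (simp add: free_hom_def)
  qed
  moreover have "free_hom r (s \<odot>\<^bsub>F\<^esub> v) = cls s \<otimes>\<^bsub>A\<^esub> free_hom r v" if s: "s \<in> polys n" and v: "v \<in> carrier F" for s v
  proof -
    have "(\<Sum>k<m. (s \<odot>\<^bsub>F\<^esub> v) k * mterm n (\<lambda>i. \<delta> k i + c i) (r k)) = s * (\<Sum>k<m. v k * mterm n (\<lambda>i. \<delta> k i + c i) (r k))"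
      by (simp add: sum_distrib_left mult.assoc)
    then show ?thesis using v F.smult_closed[OF s v] A_mult[OF s p[OF v]] by (simp add: free_hom_def)
  qed
  moreover have "free_hom r v \<in> carrier A" if v: "v \<in> carrier F" for v
    using cls_carrier[OF p[OF v]] v by (simp add: free_hom_def)
  ultimately show ?thesis by (simp add: mod_hom_def free_hom_def PiE_def Pi_def)
qed

lemma free_hom_lin: "lin (free_hom r)" by (rule mod_hom_lin[OF free_hom_mod_hom])

lemma al_free_hom:
  assumes r: "\<forall>k<m. r k \<noteq> 0 \<longrightarrow> L (\<delta> k)" and v: "v \<in> carrier F" and D: "L D"
  shows "al (free_hom r v) D = (\<Sum>k<m. r k * cf n (v k) (\<lambda>i. D i - \<delta> k i))"
proof -
  have p: "(\<Sum>k<m. v k * mterm n (\<lambda>i. \<delta> k i + c i) (r k)) \<in> polys n"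
    by (rule polys_sum, rule polys_mult) (use F_component[OF v[unfolded F_simps]] in auto)
  have "cf n (v k * mterm n (\<lambda>i. \<delta> k i + c i) (r k)) (\<lambda>i. D i + c i) = r k * cf n (v k) (\<lambda>i. D i - \<delta> k i)"
    if k: "k < m" for k
  proof (cases "r k = 0")
    case False
    have vc: "vdeg n (\<lambda>i. \<delta> k i + c i)" using r k False by (simp add: L_def xl_def)
    have "(\<lambda>i. D i + c i - (\<delta> k i + c i)) = (\<lambda>i. D i - \<delta> k i)" by simp
    then show ?thesis
      using cf_mterm_mult[OF F_component[OF v[unfolded F_simps] k] vc, of "r k" "\<lambda>i. D i + c i"]
      by (simp add: mult.commute)
  qed simp
  then show ?thesis
    using v al_cls[OF p D] by (simp add: free_hom_def cf_sum)
qed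

lemma poly_part_cf: "p \<in> poly_part n d \<Longrightarrow> e \<noteq> d \<Longrightarrow> cf n p e = 0"
  by (auto simp: poly_part_eq cf_mterm)

lemma homog_weights:
  assumes "\<And>v D. v \<in> carrier F \<Longrightarrow> L D \<Longrightarrow> al (g v) D = (\<Sum>k<m. w k D * cf n (v k) (\<lambda>i. D i - \<delta> k i))"
  shows "homog g"
  unfolding homog_def
proof (intro allI ballI impI)
  fix d v D assume v: "v \<in> R \<inter> free_part n m \<delta> d" and D: "D \<noteq> d"
  have vF: "v \<in> carrier F" using v R_F by blast
  show "al (g v) D = 0"
  proof (cases "L D")
    case True
    have "cf n (v k) (\<lambda>i. D i - \<delta> k i) = 0" if k: "k < m" for k
    proof (rule poly_part_cf)
      have "v \<in> free_part n m \<delta> d" using v by blast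
      then show "v k \<in> poly_part n (\<lambda>i. d i - \<delta> k i)" using k unfolding free_part_iff by blast
      show "(\<lambda>i. D i - \<delta> k i) \<noteq> (\<lambda>i. d i - \<delta> k i)" using D by (auto simp: fun_eq_iff)
    qed
    then show ?thesis unfolding assms[OF vF True] by simp
  qed (rule al_not_L)
qed

lemma free_hom_homog:
  assumes r: "\<forall>k<m. r k \<noteq> 0 \<longrightarrow> L (\<delta> k)"
  shows "homog (free_hom r)"
  by (rule homog_weights[where w="\<lambda>k D. r k"]) (rule al_free_hom[OF r])

lemma weights_rel:
  assumes gw: "\<And>v D. v \<in> carrier F \<Longrightarrow> L D \<Longrightarrow> al (g v) D = (\<Sum>k<m. w k D * cf n (v k) (\<lambda>i. D i - \<delta> k i))"
    and k: "gen k" and l: "gen l" and d: "vdeg n d" "\<delta> k \<le> d" "\<delta> l \<le> d" "L d"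
  shows "al (g (rel k l d z)) d = z * (w k d / lam k - w l d / lam l)"
proof -
  have km: "k < m" "l < m" using k l by (auto simp: gen_def)
  have vk: "vdeg n (\<lambda>i. d i - \<delta> k i)" by (rule vdeg_diff[OF d(1) gen_vdeg[OF k] d(2)])
  have vl: "vdeg n (\<lambda>i. d i - \<delta> l i)" by (rule vdeg_diff[OF d(1) gen_vdeg[OF l] d(3)])
  have "rel k l d z \<in> carrier F" unfolding rel_def by (rule F.a_closed[OF mvec_F mvec_F])
  from gw[OF this d(4)]
  have "al (g (rel k l d z)) d = (\<Sum>t<m. w t d * cf n (rel k l d z t) (\<lambda>i. d i - \<delta> t i))" .
  also have "\<dots> = (\<Sum>t<m. (if t = k then w t d * (z / lam k) else 0) + (if t = l then w t d * (- z / lam l) else 0))"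
  proof (rule sum.cong[OF refl])
    fix t assume "t \<in> {..<m}"
    then have t: "t < m" by simp
    have "cf n (rel k l d z t) (\<lambda>i. d i - \<delta> t i) = (if t = k then z / lam k else 0) + (if t = l then - z / lam l else 0)"
      using t vk vl by (simp add: rel_def cf_add cf_mvec)
    then show "w t d * cf n (rel k l d z t) (\<lambda>i. d i - \<delta> t i) =
       (if t = k then w t d * (z / lam k) else 0) + (if t = l then w t d * (- z / lam l) else 0)"
      by (simp add: distrib_left)
  qed
  also have "\<dots> = w k d * (z / lam k) + w l d * (- z / lam l)"
    using km by (simp add: sum.distrib sum.delta)
  also have "\<dots> = z * (w k d / lam k - w l d / lam l)" by (simp add: algebra_simps)
  finally show ?thesis .
qed

text \<open>A cochain of the poset of degrees acts on the generator \<open>k\<close> through its values on \<open>\<delta> k \<le> D\<close>.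
  On the whole free module this map need not be linear; on relations the correction terms
  cancel.\<close>

definition cochain_hom :: "((nat \<Rightarrow> int) \<Rightarrow> (nat \<Rightarrow> int) \<Rightarrow> complex) \<Rightarrow> (nat \<Rightarrow> cpoly) \<Rightarrow> cpoly set" where
  "cochain_hom l v = cls (\<Sum>k<m. shift n (\<lambda>e. lam k * l (\<delta> k) (\<lambda>i. e i + \<delta> k i)) (\<lambda>i. \<delta> k i + c i) (v k))"

text \<open>For \<open>p\<close> outside \<open>L\<close> the two conditions together say that \<open>l d e\<close> is 0 whenever a nonface
  without room lies below \<open>d\<close>.\<close>

definition degree_cocycle :: "((nat \<Rightarrow> int) \<Rightarrow> (nat \<Rightarrow> int) \<Rightarrow> complex) \<Rightarrow> bool" where
  "degree_cocycle l \<longleftrightarrow> (\<forall>p d e. ID p \<longrightarrow> p \<le> d \<longrightarrow> d \<le> e \<longrightarrow> M d \<longrightarrow> M e \<longrightarrow> l p e = l p d + l d e) \<and>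
     (\<forall>p d. ID p \<longrightarrow> \<not> L p \<longrightarrow> l p d = 0)"

lemma cochain_hom_carrier: "cochain_hom l v \<in> carrier A"
  unfolding cochain_hom_def by (rule cls_carrier[OF polys_sum]) simp

lemma al_cochain_hom:
  assumes v: "v \<in> carrier F" and D: "L D"
  shows "al (cochain_hom l v) D = (\<Sum>k<m. (lam k * l (\<delta> k) D) * cf n (v k) (\<lambda>i. D i - \<delta> k i))"
proof -
  have vD: "vdeg n (\<lambda>i. D i + c i)" using D by (simp add: L_def xl_def)
  have "cf n (shift n (\<lambda>e. lam k * l (\<delta> k) (\<lambda>i. e i + \<delta> k i)) (\<lambda>i. \<delta> k i + c i) (v k)) (\<lambda>i. D i + c i)
     = (lam k * l (\<delta> k) D) * cf n (v k) (\<lambda>i. D i - \<delta> k i)" if k: "k < m" for k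
  proof -
    have 1: "(\<lambda>i. D i + c i - (\<delta> k i + c i)) = (\<lambda>i. D i - \<delta> k i)" by simp
    show ?thesis unfolding cf_shift[OF F_component[OF v[unfolded F_simps] k]] 1 using vD by simp
  qed
  moreover have p: "(\<Sum>k<m. shift n (\<lambda>e. lam k * l (\<delta> k) (\<lambda>i. e i + \<delta> k i)) (\<lambda>i. \<delta> k i + c i) (v k)) \<in> polys n"
    by (rule polys_sum) simp
  ultimately show ?thesis unfolding cochain_hom_def al_cls[OF p D] cf_sum by (intro sum.cong refl) simp
qed

lemma cochain_hom_add:
  assumes v: "v \<in> carrier F" and w: "w \<in> carrier F"
  shows "cochain_hom l (v \<oplus>\<^bsub>F\<^esub> w) = cochain_hom l v \<oplus>\<^bsub>A\<^esub> cochain_hom l w"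
proof (rule al_ext[OF cochain_hom_carrier A.a_closed[OF cochain_hom_carrier cochain_hom_carrier]])
  fix D assume D: "L D"
  show "al (cochain_hom l (v \<oplus>\<^bsub>F\<^esub> w)) D = al (cochain_hom l v \<oplus>\<^bsub>A\<^esub> cochain_hom l w) D"
    unfolding al_add[OF cochain_hom_carrier cochain_hom_carrier] al_cochain_hom[OF v D] al_cochain_hom[OF w D]
      al_cochain_hom[OF F.a_closed[OF v w] D]
    by (simp add: cf_add sum.distrib[symmetric] distrib_left)
qed

text \<open>By the cocycle condition, raising the degree from \<open>E\<close> to \<open>D\<close> changes the coefficient by \<open>l E
  D\<close> times the coefficient of \<open>j v\<close>, which is 0 for a relation.\<close>

lemma cochain_hom_monomial:
  assumes l: "degree_cocycle l" and e: "vdeg n e" and v: "v \<in> R"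
  shows "cochain_hom l (mterm n e z \<odot>\<^bsub>F\<^esub> v) = cls (mterm n e z) \<otimes>\<^bsub>A\<^esub> cochain_hom l v"
proof (rule al_ext[OF cochain_hom_carrier A.m_closed[OF cls_carrier[OF mterm_polys] cochain_hom_carrier]])
  fix D assume D: "L D"
  have vF: "v \<in> carrier F" using R_F[OF v] .
  \<comment> \<open>the degree from which multiplication by \<open>x^e\<close> leads to \<open>D\<close>\<close>
  define E where "E = (\<lambda>i. D i - e i)"
  have e0: "0 \<le> e i" for i using e by (simp add: vdeg_def)
  have ED: "E \<le> D" using e0 by (auto simp: E_def le_fun_def)
  have lhs: "al (cochain_hom l (mterm n e z \<odot>\<^bsub>F\<^esub> v)) D = (\<Sum>k<m. z * (lam k * l (\<delta> k) D * cf n (v k) (\<lambda>i. E i - \<delta> k i)))"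
    unfolding al_cochain_hom[OF F.smult_closed[OF mterm_polys vF] D]
  proof (rule sum.cong[OF refl])
    fix k assume "k \<in> {..<m}"
    then have k: "k < m" by simp
    have "(\<lambda>i. D i - \<delta> k i - e i) = (\<lambda>i. E i - \<delta> k i)" by (auto simp: E_def fun_eq_iff)
    then show "lam k * l (\<delta> k) D * cf n ((mterm n e z \<odot>\<^bsub>F\<^esub> v) k) (\<lambda>i. D i - \<delta> k i) =
        z * (lam k * l (\<delta> k) D * cf n (v k) (\<lambda>i. E i - \<delta> k i))"
      using k cf_mterm_mult[OF F_component[OF vF[unfolded F_simps] k] e, of z "\<lambda>i. D i - \<delta> k i"] by simp
  qed
  have rhs: "al (cls (mterm n e z) \<otimes>\<^bsub>A\<^esub> cochain_hom l v) D = z * al (cochain_hom l v) E"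
    using al_mult[OF cochain_hom_carrier e] D by (simp add: E_def)
  show "al (cochain_hom l (mterm n e z \<odot>\<^bsub>F\<^esub> v)) D = al (cls (mterm n e z) \<otimes>\<^bsub>A\<^esub> cochain_hom l v) D"
  proof (cases "\<exists>k<m. lam k * cf n (v k) (\<lambda>i. E i - \<delta> k i) \<noteq> 0")
    case False
    then have z: "lam k * cf n (v k) (\<lambda>i. E i - \<delta> k i) = 0" if "k < m" for k using that by blast
    then have zz: "lam k * y * cf n (v k) (\<lambda>i. E i - \<delta> k i) = 0" if "k < m" for k y using that by fastforce
    have "al (cochain_hom l v) E = 0"
      using al_cochain_hom[OF vF, of E l] zz al_not_L by (cases "L E") auto
    moreover have "(\<Sum>k<m. z * (lam k * l (\<delta> k) D * cf n (v k) (\<lambda>i. E i - \<delta> k i))) = 0"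
    proof (rule sum.neutral, rule ballI)
      fix k assume "k \<in> {..<m}"
      then show "z * (lam k * l (\<delta> k) D * cf n (v k) (\<lambda>i. E i - \<delta> k i)) = 0" using zz[of k "l (\<delta> k) D"] by simp
    qed
    ultimately show ?thesis unfolding lhs rhs by simp
  next
    case True
    have below: "\<delta> k \<le> E \<and> gen k" if "k < m" "lam k * cf n (v k) (\<lambda>i. E i - \<delta> k i) \<noteq> 0" for k
    proof -
      have "vdeg n (\<lambda>i. E i - \<delta> k i)" using that(2) cf_invalid by fastforce
      then show ?thesis using that by (auto simp: vdeg_def le_fun_def gen_def)
    qed
    obtain k where k: "k < m" "lam k * cf n (v k) (\<lambda>i. E i - \<delta> k i) \<noteq> 0" using True by blast
    have gk: "gen k" "\<delta> k \<le> E" using below[OF k] by auto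
    have vE: "vdeg n E"
    proof -
      have "vdeg n (\<lambda>i. E i - \<delta> k i)" using k(2) cf_invalid by fastforce
      from vdeg_add[OF this gen_vdeg[OF gk(1)]] show ?thesis by simp
    qed
    have IDE: "ID E" by (rule ID_up[OF gen_ID[OF gk(1)] vE gk(2)])
    have vD: "vdeg n D" using vdeg_add[OF vE e] by (simp add: E_def)
    have MD: "M D" using ID_up[OF IDE vD ED] D by (simp add: M_def)
    show ?thesis
    proof (cases "L E")
      case LE: True
      then have ME: "M E" using IDE by (simp add: M_def)
      have "lam k * l (\<delta> k) D * cf n (v k) (\<lambda>i. E i - \<delta> k i) =
        lam k * l (\<delta> k) E * cf n (v k) (\<lambda>i. E i - \<delta> k i) + l E D * (lam k * cf n (v k) (\<lambda>i. E i - \<delta> k i))"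
        if k: "k < m" for k
      proof (cases "lam k * cf n (v k) (\<lambda>i. E i - \<delta> k i) = 0")
        case True
        then show ?thesis by auto
      next
        case False
        then have "l (\<delta> k) D = l (\<delta> k) E + l E D"
          using l below[OF k False] gen_ID ED ME MD unfolding degree_cocycle_def by blast
        then show ?thesis by (simp add: algebra_simps)
      qed
      then have "(\<Sum>k<m. z * (lam k * l (\<delta> k) D * cf n (v k) (\<lambda>i. E i - \<delta> k i)))
        = (\<Sum>k<m. z * (lam k * l (\<delta> k) E * cf n (v k) (\<lambda>i. E i - \<delta> k i)) + z * l E D * (lam k * cf n (v k) (\<lambda>i. E i - \<delta> k i)))"
        by (intro sum.cong refl) (simp add: distrib_left mult.assoc)
      also have "\<dots> = z * (\<Sum>k<m. lam k * l (\<delta> k) E * cf n (v k) (\<lambda>i. E i - \<delta> k i))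
         + z * l E D * (\<Sum>k<m. lam k * cf n (v k) (\<lambda>i. E i - \<delta> k i))"
        by (simp add: sum.distrib sum_distrib_left)
      also have "(\<Sum>k<m. lam k * cf n (v k) (\<lambda>i. E i - \<delta> k i)) = 0"
        using cf_j[OF vF, of E] v by (simp add: R_iff)
      finally show ?thesis unfolding lhs rhs al_cochain_hom[OF vF LE] by simp
    next
      case nL: False
      have "lam k * l (\<delta> k) D * cf n (v k) (\<lambda>i. E i - \<delta> k i) = 0" if k: "k < m" for k
      proof (cases "lam k * cf n (v k) (\<lambda>i. E i - \<delta> k i) = 0")
        case False
        note b = below[OF k False]
        have "\<not> L (\<delta> k)"
        proof
          assume Lk: "L (\<delta> k)"
          have "0 \<le> E i + c i" for i
            using L_nonneg[OF Lk, of i] b by (auto simp: le_fun_def) (smt (verit))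
          then have "L E" using L_down[OF D ED] vE by (simp add: vdeg_def)
          then show False using nL by simp
        qed
        then have "l (\<delta> k) D = 0" using l gen_ID b unfolding degree_cocycle_def by blast
        then show ?thesis by simp
      qed auto
      then have "(\<Sum>k<m. z * (lam k * l (\<delta> k) D * cf n (v k) (\<lambda>i. E i - \<delta> k i))) = 0"
        by (intro sum.neutral ballI) simp
      then show ?thesis unfolding lhs rhs using al_not_L[OF nL] by simp
    qed
  qed
qed

text \<open>If \<open>p\<close> has room for its image, then \<open>p + c\<close> is nonnegative and the shift of \<open>D = p + q\<close> has
  the nonface \<open>q\<close> in its support.\<close>

lemma no_two_nonfaces:
  assumes p: "ID p" "L p" and q: "ID q" and D: "L D" "\<And>i. D i = p i + q i"
  shows False
proof -
  have "{i. q i \<noteq> 0} \<subseteq> {i. D i + c i \<noteq> 0}"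
  proof
    fix i assume "i \<in> {i. q i \<noteq> 0}"
    moreover have "0 \<le> q i" using q by (simp add: ID_def vdeg_def)
    ultimately show "i \<in> {i. D i + c i \<noteq> 0}" using L_nonneg[OF p(2), of i] D(2)[of i] by auto
  qed
  then show False using X_down[OF L_in_X[OF D(1)]] q by (auto simp: ID_def)
qed

lemma cochain_hom_I:
  assumes l: "degree_cocycle l" and i: "i \<in> I" and v: "v \<in> carrier F"
  shows "cochain_hom l (i \<odot>\<^bsub>F\<^esub> v) = \<zero>\<^bsub>A\<^esub>"
proof (rule al_ext[OF cochain_hom_carrier A.zero_closed])
  fix D assume D: "L D"
  have ip: "i \<in> polys n" using i I_polys by blast
  have "lam k * l (\<delta> k) D * cf n (i * v k) (\<lambda>i. D i - \<delta> k i) = 0" if k: "k < m" for k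
  proof (rule ccontr)
    assume nz: "lam k * l (\<delta> k) D * cf n (i * v k) (\<lambda>i. D i - \<delta> k i) \<noteq> 0"
    then have gk: "gen k" using k by (auto simp: gen_def)
    have iv: "i * v k \<in> I" using I_mult[OF F_component[OF v[unfolded F_simps] k] i] by (simp add: mult.commute)
    have q: "ID (\<lambda>i. D i - \<delta> k i)" using cf_in_I[OF iv] nz by auto
    have "L (\<delta> k)"
    proof (rule ccontr)
      assume "\<not> L (\<delta> k)"
      then have "l (\<delta> k) D = 0" using l gen_ID[OF gk] unfolding degree_cocycle_def by blast
      then show False using nz by simp
    qed
    then show False using no_two_nonfaces[OF gen_ID[OF gk] _ q D] by simp
  qed
  then show "al (cochain_hom l (i \<odot>\<^bsub>F\<^esub> v)) D = al \<zero>\<^bsub>A\<^esub> D"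
    unfolding al_cochain_hom[OF F.smult_closed[OF ip v] D] al_zero by (intro sum.neutral ballI) simp
qed

lemma cochain_hom_lin:
  assumes l: "degree_cocycle l" shows "lin (cochain_hom l)"
proof (rule lin_from_F)
  fix r v assume r: "r \<in> polys n" and v: "v \<in> R"
  show "cochain_hom l (r \<odot>\<^bsub>F\<^esub> v) = cls r \<otimes>\<^bsub>A\<^esub> cochain_hom l v"
  proof (rule linear_from_monomials[where D=R, OF _ cochain_hom_carrier _ _ _ _ r v])
    show "cochain_hom l (x \<oplus>\<^bsub>F\<^esub> y) = cochain_hom l x \<oplus>\<^bsub>A\<^esub> cochain_hom l y" if "x \<in> R" "y \<in> R" for x y
      by (rule cochain_hom_add[OF R_F[OF that(1)] R_F[OF that(2)]])
    show "r \<odot>\<^bsub>F\<^esub> x \<in> R" if "r \<in> polys n" "x \<in> R" for r x by (rule R_smult[OF that])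
    show "cochain_hom l (0 \<odot>\<^bsub>F\<^esub> x) = \<zero>\<^bsub>A\<^esub>" if "x \<in> R" for x
      by (rule cochain_hom_I[OF l _ R_F[OF that]]) (use I.zero_closed in simp)
    show "(r + s) \<odot>\<^bsub>F\<^esub> x = r \<odot>\<^bsub>F\<^esub> x \<oplus>\<^bsub>F\<^esub> s \<odot>\<^bsub>F\<^esub> x" for r s x
      unfolding F_simps by (rule restrict_ext) (simp add: distrib_right)
    show "cochain_hom l (mterm n e z \<odot>\<^bsub>F\<^esub> x) = cls (mterm n e z) \<otimes>\<^bsub>A\<^esub> cochain_hom l x" if "vdeg n e" "x \<in> R" for e z x
      by (rule cochain_hom_monomial[OF l that])
  qed
qed (rule cochain_hom_carrier cochain_hom_add cochain_hom_I[OF l]; assumption)+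

lemma cochain_hom_homog: "homog (cochain_hom l)"
  by (rule homog_weights[where w="\<lambda>k D. lam k * l (\<delta> k) D"]) (rule al_cochain_hom)

lemma cochain_hom_rel:
  assumes "gen k" "gen h" "vdeg n d" "\<delta> k \<le> d" "\<delta> h \<le> d" "L d"
  shows "al (cochain_hom l (rel k h d z)) d = z * (l (\<delta> k) d - l (\<delta> h) d)"
  using weights_rel[where g="cochain_hom l" and w="\<lambda>k D. lam k * l (\<delta> k) D", OF al_cochain_hom assms] assms(1,2)
  by (simp add: gen_def)

lemma free_hom_rel:
  assumes r: "\<forall>k<m. r k \<noteq> 0 \<longrightarrow> L (\<delta> k)" and "gen k" "gen h" "vdeg n d" "\<delta> k \<le> d" "\<delta> h \<le> d" "L d"
  shows "al (free_hom r (rel k h d z)) d = z * (r k / lam k - r h / lam h)"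
  by (rule weights_rel[where g="free_hom r" and w="\<lambda>k D. r k", OF al_free_hom[OF r] assms(2-)])

lemma hom_R_part_iff:
  assumes g: "lin g"
  shows "desc g \<in> hom_part (rel_quot_part n m \<delta> j) (quot_part n I) (mod_hom A RQ SA) c \<longleftrightarrow> homog g"
proof -
  have rq: "rel_quot_part n m \<delta> j d = rcl ` (R \<inter> free_part n m \<delta> d)" for d
    by (simp add: rel_quot_part_def rcl_def)
  have "desc g ` rel_quot_part n m \<delta> j d \<subseteq> quot_part n I (\<lambda>i. d i + c i) \<longleftrightarrow>
     (\<forall>v\<in>R \<inter> free_part n m \<delta> d. \<forall>D. D \<noteq> d \<longrightarrow> al (g v) D = 0)" for d
  proof -
    have "desc g ` rel_quot_part n m \<delta> j d = g ` (R \<inter> free_part n m \<delta> d)"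
      unfolding rq image_image by (rule image_cong[OF refl]) (rule desc_rcl[OF g], blast)
    moreover have "g v \<in> quot_part n I (\<lambda>i. d i + c i) \<longleftrightarrow> (\<forall>D. D \<noteq> d \<longrightarrow> al (g v) D = 0)" if "v \<in> R" for v
      by (rule quot_part_iff_al[OF linD(1)[OF g that]])
    ultimately show ?thesis by auto
  qed
  then show ?thesis using desc_mod_hom[OF g] unfolding hom_part_def homog_def by simp
qed

text \<open>The coefficient does not depend on the common multiple \<open>d\<close>: any two of them in \<open>L\<close> lie above
  their minimum, which is a common multiple as well, and multiplication by a monomial carries
  the coefficient along (\<open>val_eq\<close>).\<close>

definition val :: "((nat \<Rightarrow> cpoly) \<Rightarrow> cpoly set) \<Rightarrow> nat \<Rightarrow> nat \<Rightarrow> complex" where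
  "val g k l = (let d = (SOME d. L d \<and> \<delta> k \<le> d \<and> \<delta> l \<le> d) in al (g (rel k l d 1)) d)"

lemma L_gen_vdeg: "gen k \<Longrightarrow> \<delta> k \<le> d \<Longrightarrow> L d \<Longrightarrow> vdeg n d"
  using gen_vdeg[of k] L_above[of d] by (auto simp: vdeg_def le_fun_def) (meson order_trans)

lemma L_gen_M: "gen k \<Longrightarrow> \<delta> k \<le> d \<Longrightarrow> L d \<Longrightarrow> M d"
  using L_gen_vdeg ID_up[OF gen_ID] by (simp add: M_def)

lemma rel_smult:
  assumes k: "gen k" "gen l" and d: "\<delta> k \<le> d" "\<delta> l \<le> d" "vdeg n d" and e: "d \<le> e" "vdeg n e"
  shows "rel k l e z = mterm n (\<lambda>i. e i - d i) 1 \<odot>\<^bsub>F\<^esub> rel k l d z"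
proof -
  have ve: "vdeg n (\<lambda>i. e i - d i)" by (rule vdeg_diff[OF e(2) d(3) e(1)])
  have "mvec k e z = mterm n (\<lambda>i. e i - d i) 1 \<odot>\<^bsub>F\<^esub> mvec k d z" if "gen k" "\<delta> k \<le> d" for k z
  proof (rule F_ext[OF mvec_F F.smult_closed[OF mterm_polys mvec_F]])
    fix t assume t: "t < m"
    have "(\<lambda>i. e i - d i + (d i - \<delta> k i)) = (\<lambda>i. e i - \<delta> k i)" by auto
    then show "mvec k e z t = (mterm n (\<lambda>i. e i - d i) 1 \<odot>\<^bsub>F\<^esub> mvec k d z) t"
      using t mterm_mult[OF ve vdeg_diff[OF d(3) gen_vdeg[OF that(1)] that(2)], of 1 z] by (simp add: mvec_def)
  qed
  then have "rel k l e z = mterm n (\<lambda>i. e i - d i) 1 \<odot>\<^bsub>F\<^esub> mvec k d (z / lam k) \<oplus>\<^bsub>F\<^esub> mterm n (\<lambda>i. e i - d i) 1 \<odot>\<^bsub>F\<^esub> mvec l d (- z / lam l)"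
    unfolding rel_def using k d by (simp only:)
  then show ?thesis unfolding rel_def F.smult_r_distr[OF mterm_polys mvec_F mvec_F] .
qed

lemma rel_scale:
  assumes "gen k" "gen l" "vdeg n d" "\<delta> k \<le> d" "\<delta> l \<le> d"
  shows "rel k l d z = mterm n (\<lambda>_. 0) z \<odot>\<^bsub>F\<^esub> rel k l d 1"
proof (rule F_ext[OF R_F[OF rel_R[OF assms]] F.smult_closed[OF mterm_polys R_F[OF rel_R[OF assms]]]])
  fix t assume t: "t < m"
  have v0: "vdeg n (\<lambda>_. 0)" by (simp add: vdeg_def)
  have mm: "mterm n (\<lambda>_. 0) z * mterm n e w = mterm n e (z * w)" for e w
    using mterm_mult[OF v0, of e z w] by (cases "vdeg n e") (simp_all, simp add: mterm_def)
  show "rel k l d z t = (mterm n (\<lambda>_. 0) z \<odot>\<^bsub>F\<^esub> rel k l d 1) t"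
    using t by (simp add: rel_def mvec_def distrib_left mm mterm_add[symmetric])
qed

context
  fixes g assumes g: "lin g" "homog g"
begin

lemma al_rel_up:
  assumes "gen k" "gen l" "\<delta> k \<le> d" "\<delta> l \<le> d" "vdeg n d" "d \<le> e" "L e"
  shows "al (g (rel k l e 1)) e = al (g (rel k l d 1)) d"
proof -
  have ve: "vdeg n e" using L_gen_vdeg[OF assms(1) _ assms(7)] assms(3,6) by auto
  have r: "rel k l d 1 \<in> R" by (rule rel_R[OF assms(1,2,5,3,4)])
  have "al (g (rel k l e 1)) e = al (cls (mterm n (\<lambda>i. e i - d i) 1) \<otimes>\<^bsub>A\<^esub> g (rel k l d 1)) e"
    unfolding rel_smult[OF assms(1-6) ve] linD(3)[OF g(1) mterm_polys r] ..
  also have "\<dots> = al (g (rel k l d 1)) (\<lambda>i. e i - (e i - d i))"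
    using al_mult[OF linD(1)[OF g(1) r] vdeg_diff[OF ve assms(5,6)], of 1 e] assms(7) by simp
  finally show ?thesis by simp
qed

lemma val_eq:
  assumes k: "gen k" "gen l" and d: "\<delta> k \<le> d" "\<delta> l \<le> d" "L d"
  shows "al (g (rel k l d 1)) d = val g k l"
proof -
  define e where "e = (SOME d. L d \<and> \<delta> k \<le> d \<and> \<delta> l \<le> d)"
  have "\<exists>d. L d \<and> \<delta> k \<le> d \<and> \<delta> l \<le> d" using d by blast
  then have e: "L e \<and> \<delta> k \<le> e \<and> \<delta> l \<le> e" unfolding e_def by (rule someI_ex)
  define f where "f = (\<lambda>i. min (d i) (e i))"
  have fd: "f \<le> d" "f \<le> e" by (auto simp: f_def le_fun_def)
  have kf: "\<delta> k \<le> f" "\<delta> l \<le> f" using d e by (auto simp: f_def le_fun_def)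
  have vd: "vdeg n d" and ve: "vdeg n e" using L_gen_vdeg[OF k(1)] d e by blast+
  then have vf: "vdeg n f" by (auto simp: vdeg_def f_def)
  show ?thesis unfolding val_def Let_def e_def[symmetric]
    using al_rel_up[OF k kf vf fd(1) d(3)] al_rel_up[OF k kf vf fd(2)] e by simp
qed

text \<open>A common multiple without room forces the image, and all multiples of it, to vanish.\<close>

lemma val_zero_not_L:
  assumes k: "gen k" "gen l" and p: "\<delta> k \<le> p" "\<delta> l \<le> p" "vdeg n p" "\<not> L p" and d: "p \<le> d" "L d"
  shows "val g k l = 0"
proof -
  have "\<delta> k \<le> d" "\<delta> l \<le> d" using p d by auto
  then have "val g k l = al (g (rel k l d 1)) d" using val_eq[OF k _ _ d(2)] by simp
  also have "\<dots> = al (g (rel k l p 1)) p" by (rule al_rel_up[OF k p(1,2,3) d])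
  also have "\<dots> = 0" by (rule al_not_L[OF p(4)])
  finally show ?thesis .
qed

text \<open>In the degree of a common multiple of three generators, the relations themselves add up.\<close>

lemma val_add:
  assumes k: "gen k" "gen l" "gen h" and d: "\<delta> k \<le> d" "\<delta> l \<le> d" "\<delta> h \<le> d" "L d"
  shows "val g k l + val g l h = val g k h"
proof -
  have vd: "vdeg n d" using L_gen_vdeg[OF k(1) d(1,4)] .
  have r1: "rel k l d 1 \<in> R" and r2: "rel l h d 1 \<in> R" and r3: "rel k h d 1 \<in> R"
    using rel_R[OF k(1,2) vd d(1,2)] rel_R[OF k(2,3) vd d(2,3)] rel_R[OF k(1,3) vd d(1,3)] .
  have "rel k l d 1 \<oplus>\<^bsub>F\<^esub> rel l h d 1 = rel k h d 1"
  proof (rule F_ext[OF F.a_closed[OF R_F[OF r1] R_F[OF r2]] R_F[OF r3]])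
    fix t assume t: "t < m"
    show "(rel k l d 1 \<oplus>\<^bsub>F\<^esub> rel l h d 1) t = rel k h d 1 t"
      using t by (simp add: rel_def mvec_def mterm_add[symmetric])
  qed
  then have "al (g (rel k h d 1)) d = al (g (rel k l d 1)) d + al (g (rel l h d 1)) d"
    using linD(2)[OF g(1) r1 r2] al_add[OF linD(1)[OF g(1) r1] linD(1)[OF g(1) r2]] by simp
  then show ?thesis unfolding val_eq[OF k(1,2) d(1,2,4)] val_eq[OF k(2,3) d(2,3,4)] val_eq[OF k(1,3) d(1,3,4)] by simp
qed

text \<open>If both generators lack room at the same coordinate \<open>i\<close>, then so does a common multiple.\<close>

lemma val_low:
  assumes k: "gen k" "gen l" and i: "i \<in> b" "\<delta> k i < int (bv i)" "\<delta> l i < int (bv i)"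
    and d: "\<delta> k \<le> d" "\<delta> l \<le> d" "L d"
  shows "val g k l = 0"
proof -
  have bd: "int (bv i) \<le> d i" by (rule L_ge_b[OF d(3) i(1)])
  have b0: "0 < bv i" using in_b[OF i(1)] by blast
  have vd: "vdeg n d" by (rule L_gen_vdeg[OF k(1) d(1,3)])
  \<comment> \<open>the largest exponent below \<open>d\<close> without room at \<open>i\<close>\<close>
  define p where "p = d(i := int (bv i) - 1)"
  have "\<delta> k \<le> p" "\<delta> l \<le> p" using d i by (auto simp: p_def le_fun_def)
  moreover have "vdeg n p" using vd b0 b_sub i(1) by (auto simp: vdeg_def p_def)
  moreover have "\<not> L p" by (rule not_L_I[OF i(1)]) (simp add: p_def)
  moreover have "p \<le> d" using bd by (auto simp: p_def le_fun_def)
  ultimately show ?thesis using val_zero_not_L[OF k _ _ _ _ _ d(3)] by blast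
qed

text \<open>In the degree \<open>\<delta> k + \<delta> l\<close> the relation between the two generators is a Koszul relation up to a
  scalar.\<close>

lemma val_koszul:
  assumes k: "gen k" "gen l" and d: "\<delta> k \<le> d" "\<delta> l \<le> d" "L d" and kl: "\<And>i. \<delta> k i + \<delta> l i \<le> d i"
  shows "val g k l = 0"
proof -
  have vd: "vdeg n d" by (rule L_gen_vdeg[OF k(1) d(1,3)])
  define s where "s = (\<lambda>i. \<delta> k i + \<delta> l i)"
  have vs: "vdeg n s" unfolding s_def by (rule vdeg_add[OF gen_vdeg[OF k(1)] gen_vdeg[OF k(2)]])
  have sd: "s \<le> d" using kl by (auto simp: s_def le_fun_def)
  have ks: "\<delta> k \<le> s" "\<delta> l \<le> s" using gen_vdeg[OF k(1)] gen_vdeg[OF k(2)] by (auto simp: s_def le_fun_def vdeg_def)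
  have km: "k < m" "l < m" and nz: "lam k \<noteq> 0" "lam l \<noteq> 0" using k by (auto simp: gen_def)
  have "val g k l = al (g (rel k l s 1)) s"
    using val_eq[OF k d] al_rel_up[OF k ks vs sd d(3)] by simp
  moreover have "rel k l s 1 \<in> K"
  proof -
    let ?e = "unit_vec P m k" and ?f = "unit_vec P m l"
    let ?g = "(j ?f \<odot>\<^bsub>F\<^esub> ?e) \<oplus>\<^bsub>F\<^esub> ((- j ?e) \<odot>\<^bsub>F\<^esub> ?f)"
    have gK: "?g \<in> K" using gensI[OF unit_vec_F unit_vec_F] gens_K by blast
    have v0: "vdeg n (\<lambda>_. 0)" by (simp add: vdeg_def)
    have "rel k l s 1 = mterm n (\<lambda>_. 0) (1 / (lam k * lam l)) \<odot>\<^bsub>F\<^esub> ?g"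
    proof (rule F_ext[OF R_F[OF rel_R[OF k vs ks]] F.smult_closed[OF mterm_polys]])
      show "?g \<in> carrier F" using gK K_R R_F by blast
      fix t assume t: "t < m"
      have e: "(\<lambda>i. s i - \<delta> k i) = \<delta> l" "(\<lambda>i. s i - \<delta> l i) = \<delta> k" by (auto simp: s_def)
      have mm: "mterm n (\<lambda>_. 0) z * mterm n e w = mterm n e (z * w)" for e z w
        using mterm_mult[OF v0, of e z w] by (cases "vdeg n e") (simp_all, simp add: mterm_def)
      have mneg: "- mterm n e w = mterm n e (- w)" for e w
        by (rule minus_unique) (simp add: mterm_add[symmetric])
      have ua: "unit_vec P m h t = (if t = h then 1 else 0)" for h using t by (simp add: unit_vec_def)
      show "rel k l s 1 t = (mterm n (\<lambda>_. 0) (1 / (lam k * lam l)) \<odot>\<^bsub>F\<^esub> ?g) t"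
        using t nz by (simp add: rel_def mvec_def ua j_unit[OF km(1)] j_unit[OF km(2)] e distrib_left mm mneg)
    qed
    then show ?thesis using K_smult[OF mterm_polys gK] by simp
  qed
  ultimately show ?thesis using linD(4)[OF g(1)] by simp
qed

text \<open>The support of a nonface is a nonface, so some generator divides the radical.\<close>

lemma gen_below_support:
  assumes "gen k"
  shows "\<exists>k'. gen k' \<and> \<delta> k' \<le> \<delta> k \<and> (\<forall>i. \<delta> k' i \<le> 1)"
proof -
  define s where "s = (\<lambda>i. if \<delta> k i = 0 then 0 else 1 :: int)"
  have v: "vdeg n (\<delta> k)" by (rule gen_vdeg[OF assms])
  have "{i. s i \<noteq> 0} = {i. \<delta> k i \<noteq> 0}" by (auto simp: s_def)
  moreover have "vdeg n s" using v by (auto simp: vdeg_def s_def)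
  ultimately have "ID s" using gen_ID[OF assms] by (simp add: ID_def)
  then obtain k' where k': "gen k'" "\<delta> k' \<le> s" using gen_below by blast
  have "s \<le> \<delta> k"
    unfolding le_fun_def
  proof
    fix i show "s i \<le> \<delta> k i" using v unfolding vdeg_def s_def by (smt (verit))
  qed
  then have 1: "\<delta> k' \<le> \<delta> k" using k'(2) by (rule order_trans[rotated])
  have 2: "\<delta> k' i \<le> 1" for i
    using k'(2) unfolding le_fun_def s_def by (smt (verit))
  show ?thesis using k'(1) 1 2 by blast
qed

lemma gen_not_L_low:
  assumes "gen k" "\<not> L (\<delta> k)" "\<delta> k \<le> d" "L d"
  obtains i where "i \<in> b" "\<delta> k i < int (bv i)"
  using not_L_witness[OF gen_ID[OF assms(1)] assms(2,3,4)] by blast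

text \<open>At a coordinate \<open>t\<close> with \<open>bv t > 1\<close> all generators below radicals lack room. So the chain from
  \<open>k\<close> to such a generator \<open>k'\<close> (through \<open>i\<close>), on to \<open>l'\<close> (through \<open>t\<close>) and to \<open>l\<close> (through \<open>i'\<close>)
  consists of vanishing coefficients.\<close>

lemma val_not_L_not_sqfree:
  assumes t: "1 < bv t" and k: "gen k" "gen l" "\<not> L (\<delta> k)" "\<not> L (\<delta> l)" and d: "\<delta> k \<le> d" "\<delta> l \<le> d" "L d"
  shows "val g k l = 0"
proof -
  have tb: "t \<in> b" using t by (simp add: b_def supp_def)
  obtain i where i: "i \<in> b" "\<delta> k i < int (bv i)" using gen_not_L_low[OF k(1,3) d(1,3)] .
  obtain i' where i': "i' \<in> b" "\<delta> l i' < int (bv i')" using gen_not_L_low[OF k(2,4) d(2,3)] .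
  obtain k' where k': "gen k'" "\<delta> k' \<le> \<delta> k" "\<And>i. \<delta> k' i \<le> 1" using gen_below_support[OF k(1)] by blast
  obtain l' where l': "gen l'" "\<delta> l' \<le> \<delta> l" "\<And>i. \<delta> l' i \<le> 1" using gen_below_support[OF k(2)] by blast
  have kd: "\<delta> k' \<le> d" "\<delta> l' \<le> d" using k' l' d by auto
  have ki: "\<delta> k' i < int (bv i)" using k'(2) i(2) unfolding le_fun_def by (meson le_less_trans)
  have li: "\<delta> l' i' < int (bv i')" using l'(2) i'(2) unfolding le_fun_def by (meson le_less_trans)
  have 1: "val g k k' = 0" by (rule val_low[OF k(1) k'(1) i(1,2) ki d(1) kd(1) d(3)])
  have 2: "val g k' l' = 0"
    by (rule val_low[OF k'(1) l'(1) tb _ _ kd d(3)]) (use k'(3)[of t] l'(3)[of t] t in auto)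
  have 3: "val g l' l = 0" by (rule val_low[OF l'(1) k(2) i'(1) li i'(2) kd(2) d(2,3)])
  show ?thesis
    using val_add[OF k(1) k'(1) l'(1) d(1) kd d(3)] val_add[OF k(1) l'(1) k(2) d(1) kd(2) d(2,3)] 1 2 3 by simp
qed

text \<open>Let \<open>k\<close> and \<open>l\<close> lack room at \<open>i \<noteq> i'\<close>, and let \<open>D\<close> be the support of a common multiple. If \<open>D
  - {i, i'}\<close> is not a face, then a generator below it lacks room at both coordinates and
  connects \<open>k\<close> with \<open>l\<close>. Otherwise the product of generators below the two radicals divides a
  monomial with room for its image, and the Koszul relation applies.\<close>

lemma val_not_L_sqfree:
  assumes sq: "\<forall>i. bv i \<in> {0, 1}" and k: "gen k" "gen l" "\<not> L (\<delta> k)" "\<not> L (\<delta> l)" and d: "\<delta> k \<le> d" "\<delta> l \<le> d" "L d"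
  shows "val g k l = 0"
proof -
  interpret S: sr_sqfree_degree n X av bv by unfold_locales (rule sq)
  obtain i where i: "i \<in> b" "\<delta> k i < int (bv i)" using gen_not_L_low[OF k(1,3) d(1,3)] .
  obtain i' where i': "i' \<in> b" "\<delta> l i' < int (bv i')" using gen_not_L_low[OF k(2,4) d(2,3)] .
  have bi: "bv i = 1" "bv i' = 1" using S.bv_1 i(1) i'(1) by auto
  have k0: "0 \<le> \<delta> k s" "0 \<le> \<delta> l s" for s using gen_vdeg[OF k(1)] gen_vdeg[OF k(2)] by (auto simp: vdeg_def)
  have ki0: "\<delta> k i = 0" using i(2) bi(1) k0(1)[of i] by simp
  have li0: "\<delta> l i' = 0" using i'(2) bi(2) k0(2)[of i'] by simp
  show ?thesis
  proof (cases "i = i'")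
    case True
    then show ?thesis using val_low[OF k(1,2) i(1,2) _ d] i'(2) by simp
  next
    case ne: False
    have vd: "vdeg n d" by (rule L_gen_vdeg[OF k(1) d(1,3)])
    have d0: "0 \<le> d s" for s using vd by (simp add: vdeg_def)
    define F where "F = {s. d s + c s \<noteq> 0}"
    have FX: "F \<in> X" unfolding F_def by (rule L_in_X[OF d(3)])
    have aF: "a \<subseteq> F"
    proof
      fix s assume "s \<in> a"
      then show "s \<in> F" using c_a[of s] d0[of s] by (simp add: F_def)
    qed
    \<comment> \<open>raising the exponent on \<open>a\<close> does not change the shifted support and gives \<open>a \<subseteq> D\<close>\<close>
    define d1 where "d1 = (\<lambda>s. d s + (if s \<in> a then 1 else 0))"
    have d1d: "d \<le> d1" by (auto simp: d1_def le_fun_def)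
    have Ld1: "L d1"
    proof (rule L_I)
      show "0 \<le> d1 s + c s" for s using L_nonneg[OF d(3), of s] by (auto simp: d1_def)
      show "n < s \<Longrightarrow> d1 s = 0" for s using av vd by (auto simp: d1_def a_def vdeg_def)
      have "{s. d1 s + c s \<noteq> 0} \<subseteq> F"
      proof
        fix s assume s: "s \<in> {s. d1 s + c s \<noteq> 0}"
        show "s \<in> F"
        proof (cases "s \<in> a")
          case True then show ?thesis using aF by blast
        next
          case False then show ?thesis using s by (simp add: d1_def F_def)
        qed
      qed
      then show "{s. d1 s + c s \<noteq> 0} \<in> X" by (rule X_down[OF FX])
    qed
    have k1: "\<delta> k \<le> d1" "\<delta> l \<le> d1" using d(1,2) d1d by auto
    have v1: "vdeg n d1" by (rule L_gen_vdeg[OF k(1) k1(1) Ld1])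
    define D where "D = {s. d1 s \<noteq> 0}"
    have Dn: "D \<subseteq> {0..n}" using v1 by (auto simp: D_def vdeg_def) (meson not_less)
    have d10: "0 \<le> d1 s" for s using v1 by (simp add: vdeg_def)
    have aD: "a \<subseteq> D" using d0 by (auto simp: D_def d1_def) (smt (verit))
    have bD: "b \<subseteq> D"
    proof
      fix s assume s: "s \<in> b"
      then show "s \<in> D" using L_ge_b[OF Ld1 s] S.bv_1[OF s] by (auto simp: D_def)
    qed
    show ?thesis
    proof (cases "D - {i, i'} \<in> X")
      case False
      define s where "s = (\<lambda>t. if t \<in> D - {i, i'} then 1 else 0 :: int)"
      have "{t. s t \<noteq> 0} = D - {i, i'}" by (auto simp: s_def)
      moreover have "vdeg n s" using Dn by (auto simp: vdeg_def s_def)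
      ultimately have "ID s" using False by (simp add: ID_def)
      then obtain h where h: "gen h" "\<delta> h \<le> s" using gen_below by blast
      have "s \<le> d1"
        unfolding le_fun_def
      proof
        fix t show "s t \<le> d1 t" using d10[of t] by (auto simp: s_def D_def)
      qed
      then have h1: "\<delta> h \<le> d1" using h(2) by (rule order_trans[rotated])
      have hs: "\<delta> h t \<le> s t" for t using h(2) by (simp add: le_fun_def)
      have hi: "\<delta> h i < int (bv i)" "\<delta> h i' < int (bv i')" using hs[of i] hs[of i'] bi by (auto simp: s_def)
      have "val g k h = 0" by (rule val_low[OF k(1) h(1) i(1,2) hi(1) k1(1) h1 Ld1])
      moreover have "val g h l = 0" by (rule val_low[OF h(1) k(2) i'(1) hi(2) i'(2) h1 k1(2) Ld1])
      ultimately show ?thesis using val_add[OF k(1) h(1) k(2) k1(1) h1 k1(2) Ld1] by simp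
    next
      case True
      obtain k' where k': "gen k'" "\<delta> k' \<le> \<delta> k" "\<And>i. \<delta> k' i \<le> 1" using gen_below_support[OF k(1)] by blast
      obtain l' where l': "gen l'" "\<delta> l' \<le> \<delta> l" "\<And>i. \<delta> l' i \<le> 1" using gen_below_support[OF k(2)] by blast
      have kd: "\<delta> k' \<le> d1" "\<delta> l' \<le> d1" using k'(2) l'(2) k1 by auto
      have k'0: "0 \<le> \<delta> k' s" "0 \<le> \<delta> l' s" for s using gen_vdeg[OF k'(1)] gen_vdeg[OF l'(1)] by (auto simp: vdeg_def)
      have k'k: "\<delta> k' s \<le> \<delta> k s" "\<delta> l' s \<le> \<delta> l s" for s using k'(2) l'(2) by (auto simp: le_fun_def)
      have k'i: "\<delta> k' i = 0" "\<delta> l' i' = 0" using k'k(1)[of i] k'k(2)[of i'] k'0(1)[of i] k'0(2)[of i'] ki0 li0 by auto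
      have k'D: "\<delta> k' s = 0" "\<delta> l' s = 0" if "s \<notin> D" for s
      proof -
        have "d1 s = 0" using that by (simp add: D_def)
        moreover have "\<delta> k' s \<le> d1 s" "\<delta> l' s \<le> d1 s" using kd by (auto simp: le_fun_def)
        ultimately show "\<delta> k' s = 0" "\<delta> l' s = 0" using k'0[of s] by auto
      qed
      \<comment> \<open>The exponent 1 at \<open>i\<close> and \<open>i'\<close> suffices because \<open>k'\<close> does not involve \<open>i\<close> and \<open>l'\<close> does
        not involve \<open>i'\<close>; the shift by \<open>c\<close> lowers it to 0, so that the shifted support avoids
        both.\<close>
      define e where "e = (\<lambda>s. if s \<in> D - {i, i'} then 2 else if s \<in> D then 1 else 0 :: int)"
      have cb: "c s = - 1" if "s \<in> b" for s by (rule S.c_b1[OF that])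
      have Le: "L e"
      proof (rule L_I)
        fix s
        show "0 \<le> e s + c s"
          using cb[of s] c_out[of s] bD by (cases "s \<in> b") (auto simp: e_def)
        show "n < s \<Longrightarrow> e s = 0" using Dn by (auto simp: e_def)
        have "{s. e s + c s \<noteq> 0} \<subseteq> D - {i, i'}"
        proof
          fix s assume s: "s \<in> {s. e s + c s \<noteq> 0}"
          have "s \<in> D"
          proof (rule ccontr)
            assume "s \<notin> D"
            then have "s \<notin> a" "s \<notin> b" using aD bD by auto
            then have "c s = 0" using not_in_a[of s] not_in_b[of s] by (simp add: c_def)
            then show False using s \<open>s \<notin> D\<close> by (simp add: e_def)
          qed
          moreover have "s \<noteq> i" "s \<noteq> i'" using s cb[OF i(1)] cb[OF i'(1)] bD i(1) i'(1) by (auto simp: e_def)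
          ultimately show "s \<in> D - {i, i'}" by blast
        qed
        then show "{s. e s + c s \<noteq> 0} \<in> X" by (rule X_down[OF True])
      qed
      have kle: "\<delta> k' s + \<delta> l' s \<le> e s" for s
      proof (cases "s \<in> D")
        case sD: True
        show ?thesis
        proof (cases "s = i \<or> s = i'")
          case True
          then show ?thesis using k'i k'(3)[of s] l'(3)[of s] sD by (auto simp: e_def)
        next
          case False
          then show ?thesis using k'(3)[of s] l'(3)[of s] sD by (auto simp: e_def)
        qed
      next
        case False
        then show ?thesis using k'D by (simp add: e_def)
      qed
      have ke: "\<delta> k' \<le> e" "\<delta> l' \<le> e"
        unfolding le_fun_def
      proof safe
        fix s
        show "\<delta> k' s \<le> e s" using kle[of s] k'0(2)[of s] by linarith
        show "\<delta> l' s \<le> e s" using kle[of s] k'0(1)[of s] by linarith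
      qed
      have 1: "val g k k' = 0"
        by (rule val_low[OF k(1) k'(1) i(1,2) _ k1(1) kd(1) Ld1]) (use k'i(1) bi(1) in simp)
      have 2: "val g k' l' = 0" by (rule val_koszul[OF k'(1) l'(1) ke Le kle])
      have 3: "val g l' l = 0"
        by (rule val_low[OF l'(1) k(2) i'(1) _ i'(2) kd(2) k1(2) Ld1]) (use k'i(2) bi(2) in simp)
      show ?thesis
        using val_add[OF k(1) k'(1) l'(1) k1(1) kd Ld1] val_add[OF k(1) l'(1) k(2) k1(1) kd(2) k1(2) Ld1] 1 2 3 by simp
    qed
  qed
qed

lemma val_not_L:
  assumes "gen k" "gen l" "\<not> L (\<delta> k)" "\<not> L (\<delta> l)" "\<delta> k \<le> d" "\<delta> l \<le> d" "L d"
  shows "val g k l = 0"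
proof (cases "\<forall>i. bv i \<in> {0, 1}")
  case True
  then show ?thesis by (rule val_not_L_sqfree[OF _ assms])
next
  case False
  then obtain t where "bv t \<notin> {0, 1}" by blast
  then have "1 < bv t" by simp
  then show ?thesis by (rule val_not_L_not_sqfree[OF _ assms])
qed

lemma al_rel_val:
  assumes "gen k" "gen l" "vdeg n d" "\<delta> k \<le> d" "\<delta> l \<le> d" "L d"
  shows "al (g (rel k l d z)) d = z * val g k l"
proof -
  have r: "rel k l d 1 \<in> R" by (rule rel_R[OF assms(1-5)])
  have v0: "vdeg n (\<lambda>_. 0)" by (simp add: vdeg_def)
  have "al (g (rel k l d z)) d = al (cls (mterm n (\<lambda>_. 0) z) \<otimes>\<^bsub>A\<^esub> g (rel k l d 1)) d"
    using rel_scale[OF assms(1-5), of z] linD(3)[OF g(1) mterm_polys r] by simp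
  also have "\<dots> = z * al (g (rel k l d 1)) d"
    using al_mult[OF linD(1)[OF g(1) r] v0, of z d] assms(6) by simp
  finally show ?thesis using val_eq[OF assms(1,2,4,5,6)] by simp
qed

text \<open>A reference generator \<open>\<kappa> d\<close> for each degree replaces the coefficients of pairs of generators
  by differences. What is left over after subtracting the cochain depends on one generator only,
  and so comes from the free module.\<close>

lemma normalise:
  assumes l: "degree_cocycle l"
    and ref: "\<And>d. M d \<Longrightarrow> gen (\<kappa> d) \<and> (\<exists>e. d \<le> e \<and> \<delta> (\<kappa> d) \<le> e \<and> L e)"
    and val: "\<And>k d. gen k \<Longrightarrow> \<delta> k \<le> d \<Longrightarrow> M d \<Longrightarrow>
       val g k (\<kappa> d) = l (\<delta> k) d + (if L (\<delta> k) then val g k (\<kappa> (\<delta> k)) else 0)"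
  shows "\<exists>r. (\<forall>k<m. r k \<noteq> 0 \<longrightarrow> L (\<delta> k)) \<and> (\<forall>v\<in>R. g v = cochain_hom l v \<oplus>\<^bsub>A\<^esub> free_hom r v)"
proof -
  \<comment> \<open>On relations between generators, \<open>r k / lam k\<close> has to be the coefficient \<open>s k\<close> against the
    reference generator of the degree \<open>\<delta> k\<close>. Generators mapped to 0 are relations themselves,
    and \<open>r k\<close> is their own coefficient.\<close>
  define s where "s k = (if L (\<delta> k) then val g k (\<kappa> (\<delta> k)) else 0)" for k
  define r where "r k = (if lam k = 0 then al (g (unit_vec P m k)) (\<delta> k) else lam k * s k)" for k
  have rL: "\<forall>k<m. r k \<noteq> 0 \<longrightarrow> L (\<delta> k)"
  proof (intro allI impI, rule ccontr)
    fix k assume "r k \<noteq> 0" and nL: "\<not> L (\<delta> k)"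
    moreover have "r k = 0" using al_not_L[OF nL] nL by (simp add: r_def s_def)
    ultimately show False by simp
  qed
  note G = lin_homog_add[OF cochain_hom_lin[OF l] cochain_hom_homog free_hom_lin free_hom_homog[OF rL]]
  have "g v = cochain_hom l v \<oplus>\<^bsub>A\<^esub> free_hom r v" if v: "v \<in> R" for v
  proof (rule lin_agree[OF g G _ _ v])
    fix k assume k: "k < m" "lam k = 0" "L (\<delta> k)"
    let ?u = "unit_vec P m k"
    have fc: "free_hom r ?u \<in> carrier A"
      using free_hom_mod_hom[of r] unit_vec_F[of k] by (auto simp: mod_hom_def)
    have cu: "cf n (?u t) (\<lambda>i. \<delta> k i - \<delta> t i) = (if t = k then 1 else 0)" if "t < m" for t
    proof -
      have "mterm n (\<lambda>i. 0) 1 = 1" using const_poly_mterm[of 1 n] by (simp add: const_poly_def)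
      then have "cf n 1 (\<lambda>i. 0) = 1" using cf_mterm[of n "\<lambda>i. 0" 1 "\<lambda>i. 0"] by (simp add: vdeg_def)
      then show ?thesis using that by (auto simp: unit_vec_def)
    qed
    have "al (cochain_hom l ?u) (\<delta> k) = 0"
      unfolding al_cochain_hom[OF unit_vec_F k(3)] using cu k(2) by (auto intro!: sum.neutral)
    moreover have "al (free_hom r ?u) (\<delta> k) = (\<Sum>t<m. if t = k then r t else 0)"
      unfolding al_free_hom[OF rL unit_vec_F k(3)] by (rule sum.cong) (use cu in auto)
    ultimately show "al (g ?u) (\<delta> k) = al (cochain_hom l ?u \<oplus>\<^bsub>A\<^esub> free_hom r ?u) (\<delta> k)"
      unfolding al_add[OF cochain_hom_carrier fc] using k by (simp add: r_def)
  next
    fix k h d z assume kh: "gen k" "gen h" "vdeg n d" "\<delta> k \<le> d" "\<delta> h \<le> d" "L d"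
    have Md: "M d" by (rule L_gen_M[OF kh(1,4,6)])
    obtain e where e: "gen (\<kappa> d)" "d \<le> e" "\<delta> (\<kappa> d) \<le> e" "L e" using ref[OF Md] by blast
    have ke: "\<delta> k \<le> e" "\<delta> h \<le> e" using kh(4,5) e(2) by auto
    have "val g k h + val g h (\<kappa> d) = val g k (\<kappa> d)" by (rule val_add[OF kh(1,2) e(1) ke e(3,4)])
    then have v: "val g k h = (l (\<delta> k) d + s k) - (l (\<delta> h) d + s h)"
      using val[OF kh(1,4) Md, folded s_def] val[OF kh(2,5) Md, folded s_def] by (simp only: eq_diff_eq)
    have fc: "free_hom r (rel k h d z) \<in> carrier A" by (rule linD(1)[OF free_hom_lin rel_R[OF kh(1-5)]])
    have rs: "r k / lam k = s k" "r h / lam h = s h" using kh(1,2) by (auto simp: r_def gen_def)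
    show "al (g (rel k h d z)) d = al (cochain_hom l (rel k h d z) \<oplus>\<^bsub>A\<^esub> free_hom r (rel k h d z)) d"
      unfolding al_add[OF cochain_hom_carrier fc] cochain_hom_rel[OF kh] free_hom_rel[OF rL kh] al_rel_val[OF kh] v rs
      by (simp add: algebra_simps)
  qed
  then show ?thesis using rL by blast
qed

end

end

section \<open>The second cotangent cohomology\<close>

context sr_presentation begin

lemma hom_R_A_abelian_group: "abelian_group (hom_R_A n I m j)"
  unfolding hom_R_A_simps by (rule HR.hom_module_abelian_group)

lemma desc_add:
  assumes "lin g" "lin g'" and gg: "lin (\<lambda>v. g v \<oplus>\<^bsub>A\<^esub> g' v)"
  shows "(\<lambda>\<xi>\<in>carrier RQ. desc g \<xi> \<oplus>\<^bsub>A\<^esub> desc g' \<xi>) = desc (\<lambda>v. g v \<oplus>\<^bsub>A\<^esub> g' v)"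
proof (rule extensionalityI[OF restrict_extensional desc_ext])
  fix \<xi> assume "\<xi> \<in> carrier RQ"
  then obtain v where v: "v \<in> R" "\<xi> = rcl v" unfolding RQ_carrier by blast
  have "rcl v \<in> carrier RQ" using v by (simp add: RQ_carrier)
  then show "(\<lambda>\<xi>\<in>carrier RQ. desc g \<xi> \<oplus>\<^bsub>A\<^esub> desc g' \<xi>) \<xi> = desc (\<lambda>v. g v \<oplus>\<^bsub>A\<^esub> g' v) \<xi>"
    unfolding v(2) using desc_rcl[OF assms(1) v(1)] desc_rcl[OF assms(2) v(1)] desc_rcl[OF gg v(1)] by simp
qed

lemma desc_map:
  assumes "lin g" "lin g'" "\<And>v. v \<in> R \<Longrightarrow> g' v = k (g v)"
  shows "(\<lambda>\<xi>\<in>carrier RQ. k (desc g \<xi>)) = desc g'"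
proof (rule extensionalityI[OF restrict_extensional desc_ext])
  fix \<xi> assume "\<xi> \<in> carrier RQ"
  then obtain v where v: "v \<in> R" "\<xi> = rcl v" unfolding RQ_carrier by blast
  have "rcl v \<in> carrier RQ" using v by (simp add: RQ_carrier)
  then show "(\<lambda>\<xi>\<in>carrier RQ. k (desc g \<xi>)) \<xi> = desc g' \<xi>"
    unfolding v(2) using desc_rcl[OF assms(1) v(1)] desc_rcl[OF assms(2) v(1)] assms(3)[OF v(1)] by simp
qed

lemma free_hom_target: "hom_target P F AP"
  by (rule hom_target.intro[OF AP_abelian_group])
     (simp_all add: A.r_distr A.m_lcomm cls_carrier F.a_closed F.smult_closed del: F_simps)

lemma free_image_sub: "free_image n I m j \<subseteq> mod_hom A RQ SA"
  unfolding free_image_eq using desc_mod_hom mod_hom_lin by blast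

lemma free_image_subgroup: "subgroup (free_image n I m j) (add_monoid (hom_R_A n I m j))"
  unfolding hom_R_A_simps
proof (rule HR.hom_subgroupI[OF free_image_sub])
  interpret FT: hom_target P F AP by (rule free_hom_target)
  let ?z = "\<lambda>v\<in>carrier F. \<zero>\<^bsub>AP\<^esub>"
  have z: "?z \<in> mod_hom P F AP" by (rule FT.hom_zero_closed)
  have "(\<lambda>\<xi>\<in>carrier RQ. \<zero>\<^bsub>SA\<^esub>) = desc ?z"
  proof (rule extensionalityI[OF restrict_extensional desc_ext])
    fix \<xi> assume "\<xi> \<in> carrier RQ"
    then obtain v where v: "v \<in> R" "\<xi> = rcl v" unfolding RQ_carrier by blast
    have "rcl v \<in> carrier RQ" using v by (simp add: RQ_carrier)
    then show "(\<lambda>\<xi>\<in>carrier RQ. \<zero>\<^bsub>SA\<^esub>) \<xi> = desc ?z \<xi>"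
      unfolding v(2) desc_rcl[OF mod_hom_lin[OF z] v(1)] using R_F[OF v(1)] by simp
  qed
  then show "(\<lambda>x\<in>carrier RQ. \<zero>\<^bsub>SA\<^esub>) \<in> free_image n I m j" unfolding free_image_eq using z by blast
  fix g h assume "g \<in> free_image n I m j"
  then obtain g' where g': "g' \<in> mod_hom P F AP" "g = desc g'" unfolding free_image_eq by blast
  note lg = mod_hom_lin[OF g'(1)]
  {
    assume "h \<in> free_image n I m j"
    then obtain h' where h': "h' \<in> mod_hom P F AP" "h = desc h'" unfolding free_image_eq by blast
    note lh = mod_hom_lin[OF h'(1)]
    let ?s = "\<lambda>v\<in>carrier F. g' v \<oplus>\<^bsub>AP\<^esub> h' v"
    have s: "?s \<in> mod_hom P F AP" by (rule FT.hom_add_closed[OF g'(1) h'(1)])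
    have "(\<lambda>\<xi>\<in>carrier RQ. desc g' \<xi> \<oplus>\<^bsub>SA\<^esub> desc h' \<xi>) = desc ?s"
    proof (rule extensionalityI[OF restrict_extensional desc_ext])
      fix \<xi> assume "\<xi> \<in> carrier RQ"
      then obtain v where v: "v \<in> R" "\<xi> = rcl v" unfolding RQ_carrier by blast
      have "rcl v \<in> carrier RQ" using v by (simp add: RQ_carrier)
      then show "(\<lambda>\<xi>\<in>carrier RQ. desc g' \<xi> \<oplus>\<^bsub>SA\<^esub> desc h' \<xi>) \<xi> = desc ?s \<xi>"
        unfolding v(2) desc_rcl[OF mod_hom_lin[OF s] v(1)]
        using desc_rcl[OF lg v(1)] desc_rcl[OF lh v(1)] R_F[OF v(1)] by simp
    qed
    then show "(\<lambda>x\<in>carrier RQ. g x \<oplus>\<^bsub>SA\<^esub> h x) \<in> free_image n I m j"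
      unfolding free_image_eq g'(2) h'(2) using s by blast
  }
  let ?n = "\<lambda>v\<in>carrier F. \<ominus>\<^bsub>AP\<^esub> g' v"
  have s: "?n \<in> mod_hom P F AP" by (rule FT.hom_neg_closed[OF g'(1)])
  have SA_inv: "\<ominus>\<^bsub>SA\<^esub> x = \<ominus>\<^bsub>AP\<^esub> x" if "x \<in> carrier A" for x
  proof -
    interpret SA: abelian_group SA by (rule SA_abelian_group)
    have "\<ominus>\<^bsub>SA\<^esub> x = \<ominus>\<^bsub>A\<^esub> x"
      by (rule SA.minus_equality) (use that A.l_neg[OF that] A.a_inv_closed[OF that] in simp_all)
    then show ?thesis using AP_a_inv[OF that] by simp
  qed
  have "(\<lambda>\<xi>\<in>carrier RQ. \<ominus>\<^bsub>SA\<^esub> desc g' \<xi>) = desc ?n"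
  proof (rule extensionalityI[OF restrict_extensional desc_ext])
    fix \<xi> assume "\<xi> \<in> carrier RQ"
    then obtain v where v: "v \<in> R" "\<xi> = rcl v" unfolding RQ_carrier by blast
    have "rcl v \<in> carrier RQ" using v by (simp add: RQ_carrier)
    then show "(\<lambda>\<xi>\<in>carrier RQ. \<ominus>\<^bsub>SA\<^esub> desc g' \<xi>) \<xi> = desc ?n \<xi>"
      unfolding v(2) desc_rcl[OF mod_hom_lin[OF s] v(1)]
      using desc_rcl[OF lg v(1)] R_F[OF v(1)] SA_inv[OF linD(1)[OF lg v(1)]] by simp
  qed
  then show "(\<lambda>x\<in>carrier RQ. \<ominus>\<^bsub>SA\<^esub> g x) \<in> free_image n I m j"
    unfolding free_image_eq g'(2) using s by blast
qed

lemma free_image_scale: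
  assumes "h \<in> free_image n I m j" "p \<in> polys n"
  shows "(\<lambda>\<xi>\<in>carrier RQ. cls p \<otimes>\<^bsub>A\<^esub> h \<xi>) \<in> free_image n I m j"
proof -
  interpret FT: hom_target P F AP by (rule free_hom_target)
  obtain g where g: "g \<in> mod_hom P F AP" "h = desc g" using assms unfolding free_image_eq by blast
  let ?s = "\<lambda>v\<in>carrier F. p \<odot>\<^bsub>AP\<^esub> g v"
  have s: "?s \<in> mod_hom P F AP" by (rule FT.hom_smult_closed[OF g(1) assms(2)])
  have "(\<lambda>\<xi>\<in>carrier RQ. cls p \<otimes>\<^bsub>A\<^esub> desc g \<xi>) = desc ?s"
    by (rule desc_map[OF mod_hom_lin[OF g(1)] mod_hom_lin[OF s]]) (simp add: R_F)
  then show ?thesis unfolding free_image_eq g(2) using s by blast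
qed

end

context sr_t2 begin

abbreviation part2 where
  "part2 \<equiv> hom_part (rel_quot_part n m \<delta> j) (quot_part n I) (mod_hom A RQ SA) c"

lemma T2_part_simps:
  "carrier (T2_part n I m \<delta> j c) = (\<lambda>h. free_image n I m j +>\<^bsub>hom_R_A n I m j\<^esub> h) ` part2"
  "add (T2_part n I m \<delta> j c) = set_add (hom_R_A n I m j)"
  "z \<odot>\<^bsub>T2_part n I m \<delta> j c\<^esub> x =
     (\<Union>h\<in>x. free_image n I m j +>\<^bsub>hom_R_A n I m j\<^esub> (cls (const_poly z) \<odot>\<^bsub>hom_R_A n I m j\<^esub> h))"
  "\<zero>\<^bsub>T2_part n I m \<delta> j c\<^esub> = free_image n I m j"
  by (simp_all add: T2_part_def restrict_scalars_def T2_def quot_module_def hom_R_A_simps HR.hom_module_simps cls_def)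

lemma part2E:
  assumes "h \<in> part2"
  shows "\<exists>g. lin g \<and> homog g \<and> h = desc g"
proof -
  have h: "h \<in> mod_hom A RQ SA" using assms by (simp add: hom_part_def)
  note d = mod_hom_desc[OF h]
  have "homog (\<lambda>v. h (rcl v))" using hom_R_part_iff[OF d(1)] assms d(2) by simp
  then show ?thesis using d by blast
qed

lemma part2I: "lin g \<Longrightarrow> homog g \<Longrightarrow> desc g \<in> part2"
  by (simp add: hom_R_part_iff)

lemma zero_cocycle: "degree_cocycle (\<lambda>_ _. 0)" by (simp add: degree_cocycle_def)

lemma cochain_hom_zero:
  assumes "v \<in> R" "\<And>k. gen k \<Longrightarrow> ID (\<delta> k) \<Longrightarrow> \<forall>D. M D \<longrightarrow> \<delta> k \<le> D \<longrightarrow> l (\<delta> k) D = 0"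
  shows "cochain_hom l v = \<zero>\<^bsub>A\<^esub>"
proof (rule al_ext[OF cochain_hom_carrier A.zero_closed])
  fix D assume D: "L D"
  have "lam k * l (\<delta> k) D * cf n (v k) (\<lambda>i. D i - \<delta> k i) = 0" if k: "k < m" for k
  proof (cases "lam k * cf n (v k) (\<lambda>i. D i - \<delta> k i) = 0")
    case False
    then have g: "gen k" using k by (auto simp: gen_def)
    have "vdeg n (\<lambda>i. D i - \<delta> k i)" using False cf_invalid by fastforce
    then have kD: "\<delta> k \<le> D" by (auto simp: vdeg_def le_fun_def)
    then show ?thesis using assms(2)[OF g gen_ID[OF g]] L_gen_M[OF g kD D] by simp
  qed auto
  then show "al (cochain_hom l v) D = al \<zero>\<^bsub>A\<^esub> D"
    unfolding al_cochain_hom[OF R_F[OF assms(1)] D] al_zero by (intro sum.neutral ballI) simp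
qed

text \<open>For every degree there is a generator dividing the radical, which lacks room at a coordinate
  \<open>t\<close> with \<open>bv t > 1\<close>. With these as reference generators the cochain can be taken to be 0.\<close>

lemma T2_part_not_sqfree:
  assumes "\<not> (\<forall>i. bv i \<in> {0, 1})"
  shows "carrier (T2_part n I m \<delta> j c) = {\<zero>\<^bsub>T2_part n I m \<delta> j c\<^esub>}"
proof -
  interpret H: abelian_group "hom_R_A n I m j" by (rule hom_R_A_abelian_group)
  have fs: "free_image n I m j \<subseteq> carrier (hom_R_A n I m j)"
    using free_image_sub by (simp add: hom_R_A_simps HR.hom_module_simps)
  obtain t where "bv t \<notin> {0, 1}" using assms by blast
  then have t: "1 < bv t" by simp
  then have tb: "t \<in> b" by (simp add: b_def supp_def)
  have "\<exists>k. gen k \<and> \<delta> k \<le> d \<and> \<delta> k t \<le> 1" if d: "M d" for d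
  proof -
    define s where "s = (\<lambda>i. if d i = 0 then 0 else 1 :: int)"
    have v: "vdeg n d" by (rule M_vdeg[OF d])
    have "{i. s i \<noteq> 0} = {i. d i \<noteq> 0}" by (auto simp: s_def)
    moreover have "vdeg n s" using v by (auto simp: vdeg_def s_def)
    ultimately have "ID s" using d by (simp add: M_def ID_def)
    then obtain k where k: "gen k" "\<delta> k \<le> s" using gen_below by blast
    have "s \<le> d" unfolding le_fun_def
    proof
      fix i show "s i \<le> d i" using v unfolding vdeg_def s_def by (smt (verit))
    qed
    then have "\<delta> k \<le> d" using k(2) by (rule order_trans[rotated])
    moreover have "\<delta> k t \<le> 1" using k(2) unfolding le_fun_def s_def by (smt (verit))
    ultimately show ?thesis using k by blast
  qed
  then obtain \<kappa> where \<kappa>: "\<And>d. M d \<Longrightarrow> gen (\<kappa> d) \<and> \<delta> (\<kappa> d) \<le> d \<and> \<delta> (\<kappa> d) t \<le> 1" by metis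
  have nL: "\<not> L (\<delta> (\<kappa> d))" if "M d" for d
    using \<kappa>[OF that] t by (intro not_L_I[OF tb]) auto
  have in_fi: "h \<in> free_image n I m j" if h: "h \<in> part2" for h
  proof -
    obtain g where g: "lin g" "homog g" "h = desc g" using part2E[OF h] by blast
    have "\<exists>r. (\<forall>k<m. r k \<noteq> 0 \<longrightarrow> L (\<delta> k)) \<and> (\<forall>v\<in>R. g v = cochain_hom (\<lambda>_ _. 0) v \<oplus>\<^bsub>A\<^esub> free_hom r v)"
    proof (rule normalise[OF g(1,2) zero_cocycle, where \<kappa>=\<kappa>])
      fix d assume d: "M d"
      have "L d" using d by (simp add: M_def)
      then show "gen (\<kappa> d) \<and> (\<exists>e. d \<le> e \<and> \<delta> (\<kappa> d) \<le> e \<and> L e)" using \<kappa>[OF d] by blast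
      fix k assume k: "gen k" "\<delta> k \<le> d"
      show "val g k (\<kappa> d) = 0 + (if L (\<delta> k) then val g k (\<kappa> (\<delta> k)) else 0)"
      proof (cases "L (\<delta> k)")
        case True
        then have Mk: "M (\<delta> k)" using gen_ID[OF k(1)] by (simp add: M_def)
        have kk: "\<delta> (\<kappa> (\<delta> k)) \<le> d" using \<kappa>[OF Mk] k(2) by auto
        have "val g k (\<kappa> (\<delta> k)) + val g (\<kappa> (\<delta> k)) (\<kappa> d) = val g k (\<kappa> d)"
          by (rule val_add[OF g(1,2) k(1) _ _ k(2) kk _ \<open>L d\<close>]) (use \<kappa>[OF Mk] \<kappa>[OF d] in auto)
        moreover have "val g (\<kappa> (\<delta> k)) (\<kappa> d) = 0"
          by (rule val_not_L[OF g(1,2) _ _ nL[OF Mk] nL[OF d] kk _ \<open>L d\<close>]) (use \<kappa>[OF Mk] \<kappa>[OF d] in auto)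
        ultimately show ?thesis using True by simp
      next
        case False
        then show ?thesis using val_not_L[OF g(1,2) k(1) _ False nL[OF d] k(2) _ \<open>L d\<close>] \<kappa>[OF d] by simp
      qed
    qed
    then obtain r where r: "\<And>v. v \<in> R \<Longrightarrow> g v = cochain_hom (\<lambda>_ _. 0) v \<oplus>\<^bsub>A\<^esub> free_hom r v" by blast
    have "g v = free_hom r v" if v: "v \<in> R" for v
      unfolding r[OF v] using cochain_hom_zero[OF v, of "\<lambda>_ _. 0"] linD(1)[OF free_hom_lin v] by simp
    then have "desc g = desc (free_hom r)" using desc_cong[OF g(1) free_hom_lin] by blast
    then show ?thesis unfolding g(3) free_image_eq using free_hom_mod_hom by blast
  qed
  have coset: "free_image n I m j +>\<^bsub>hom_R_A n I m j\<^esub> h = free_image n I m j" if h: "h \<in> part2" for h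
  proof -
    have hf: "h \<in> free_image n I m j" by (rule in_fi[OF h])
    then have hc: "h \<in> carrier (hom_R_A n I m j)" using fs by blast
    have "\<ominus>\<^bsub>hom_R_A n I m j\<^esub> \<zero>\<^bsub>hom_R_A n I m j\<^esub> = \<zero>\<^bsub>hom_R_A n I m j\<^esub>" by (rule H.minus_equality) simp_all
    then have "h \<ominus>\<^bsub>hom_R_A n I m j\<^esub> \<zero>\<^bsub>hom_R_A n I m j\<^esub> = h \<oplus>\<^bsub>hom_R_A n I m j\<^esub> \<zero>\<^bsub>hom_R_A n I m j\<^esub>" by (simp only: a_minus_def)
    then have "h \<ominus>\<^bsub>hom_R_A n I m j\<^esub> \<zero>\<^bsub>hom_R_A n I m j\<^esub> \<in> free_image n I m j" using hf H.r_zero[OF hc] by (simp only:)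
    then show ?thesis
      using H.a_rcos_eq_iff[OF free_image_subgroup hc H.zero_closed] H.a_coset_add_zero[OF fs] by simp
  qed
  have "desc (free_hom (\<lambda>_. 0)) \<in> part2" by (rule part2I[OF free_hom_lin free_hom_homog]) simp
  then show ?thesis unfolding T2_part_simps using coset by blast
qed

end

locale sr_t2_sqfree = sr_sqfree_degree + sr_presentation
sublocale sr_t2_sqfree \<subseteq> sr_t2 ..

context sr_t2_sqfree begin

definition deg_cochain :: "(nat set \<times> nat set \<Rightarrow> complex) \<Rightarrow> (nat \<Rightarrow> int) \<Rightarrow> (nat \<Rightarrow> int) \<Rightarrow> complex" where
  "deg_cochain l p d = (if M p then l (cell_of p, cell_of d) else 0)"

text \<open>A degree outside \<open>M\<close> below \<open>d\<close> puts the face of \<open>d\<close> into \<open>Nt\<close>, where the cocycle vanishes.\<close>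

lemma deg_cochain_cocycle:
  assumes l: "l \<in> face_cocycles N Nt" shows "degree_cocycle (deg_cochain l)"
  unfolding degree_cocycle_def
proof (intro conjI allI impI)
  fix p d e assume p: "ID p" and pd: "p \<le> d" and de: "d \<le> e" and d: "M d" and e: "M e"
  note cd = cell_of_N[OF d] and ce = cell_of_N[OF e] and cde = cell_of_mono[OF d e de]
  show "deg_cochain l p e = deg_cochain l p d + deg_cochain l d e"
  proof (cases "M p")
    case True
    from face_cocycles_add[OF l cell_of_N[OF True] cd ce cell_of_mono[OF True d pd] cde]
    show ?thesis using True d by (simp add: deg_cochain_def)
  next
    case False
    then have "cell_of d \<in> Nt" using not_L_imp_Nt[OF p _ pd d] p by (simp add: M_def)
    from face_cocycles_zero[OF l this ce cde] show ?thesis using False d by (simp add: deg_cochain_def)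
  qed
next
  fix p d assume "\<not> L p" then show "deg_cochain l p d = 0" by (simp add: deg_cochain_def M_def)
qed

text \<open>For faces in \<open>Nt\<close> the generator is chosen to lack room, so that \<open>val_not_L\<close> applies to it.\<close>

definition ref_gen :: "nat set \<Rightarrow> nat" where
  "ref_gen f = (SOME k. gen k \<and> \<delta> k \<le> deg_of f \<and> (f \<in> Nt \<longrightarrow> \<not> L (\<delta> k)))"

lemma ref_gen:
  assumes f: "f \<in> N"
  shows "gen (ref_gen f)" "\<delta> (ref_gen f) \<le> deg_of f" "f \<in> Nt \<Longrightarrow> \<not> L (\<delta> (ref_gen f))"
proof -
  have "\<exists>k. gen k \<and> \<delta> k \<le> deg_of f \<and> (f \<in> Nt \<longrightarrow> \<not> L (\<delta> k))"
  proof (cases "f \<in> Nt")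
    case True
    then obtain i where i: "i \<in> b" "f \<union> (b - {i}) \<notin> X" using Nt_iff by blast
    define s where "s = (\<lambda>j. if j \<in> f \<union> (b - {i}) then 1 else 0 :: int)"
    have sd: "{j. s j \<noteq> 0} = f \<union> (b - {i})" by (auto simp: s_def)
    have "f \<subseteq> {0..n}" using N_D[OF f] X_sub by blast
    then have "vdeg n s" using b_sub by (auto simp: vdeg_def s_def)
    then have "ID s" using i sd by (simp add: ID_def)
    then obtain k where k: "gen k" "\<delta> k \<le> s" using gen_below by blast
    have "s \<le> deg_of f" by (auto simp: s_def deg_of_def le_fun_def)
    then have "\<delta> k \<le> deg_of f" using k(2) by (rule order_trans[rotated])
    have "\<delta> k i \<le> s i" using k(2) by (simp add: le_fun_def)
    moreover have "i \<notin> f" using N_D[OF f] i(1) by blast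
    ultimately have "\<delta> k i < int (bv i)" using bv_1[OF i(1)] by (simp add: s_def)
    then have "\<not> L (\<delta> k)" by (rule not_L_I[OF i(1)])
    then show ?thesis using k \<open>\<delta> k \<le> deg_of f\<close> by blast
  next
    case False
    have "ID (deg_of f)" using deg_of_M[OF f] by (simp add: M_def)
    then show ?thesis using gen_below False by blast
  qed
  then have "gen (ref_gen f) \<and> \<delta> (ref_gen f) \<le> deg_of f \<and> (f \<in> Nt \<longrightarrow> \<not> L (\<delta> (ref_gen f)))"
    unfolding ref_gen_def by (rule someI_ex)
  then show "gen (ref_gen f)" "\<delta> (ref_gen f) \<le> deg_of f" "f \<in> Nt \<Longrightarrow> \<not> L (\<delta> (ref_gen f))" by blast+
qed

lemma L_deg_of: "f \<in> N \<Longrightarrow> L (deg_of f)" using deg_of_M by (simp add: M_def)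

lemma ref_gen_le: "f \<in> N \<Longrightarrow> f \<subseteq> g \<Longrightarrow> \<delta> (ref_gen f) \<le> deg_of g"
  using ref_gen(2) deg_of_mono order_trans by blast

text \<open>The coefficients between the reference generators of faces form a cocycle on faces, because
  three of them have a common multiple in the degree of the largest face.\<close>

lemma part2_normal_form:
  assumes g: "lin g" "homog g"
  shows "\<exists>l\<in>face_cocycles N Nt. \<exists>r. \<forall>v\<in>R. g v = cochain_hom (deg_cochain l) v \<oplus>\<^bsub>A\<^esub> free_hom r v"
proof -
  define l where "l = (\<lambda>(f, h). val g (ref_gen f) (ref_gen h))"
  have lc: "l \<in> face_cocycles N Nt"
    unfolding face_cocycles_def
  proof (intro CollectI conjI ballI impI)
    fix f h k assume f: "f \<in> N" and h: "h \<in> N" and k: "k \<in> N" and fh: "f \<subseteq> h" and hk: "h \<subseteq> k"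
    show "l (f, h) + l (h, k) = l (f, k)"
      using val_add[OF g ref_gen(1)[OF f] ref_gen(1)[OF h] ref_gen(1)[OF k]
          ref_gen_le[OF f subset_trans[OF fh hk]] ref_gen_le[OF h hk] ref_gen(2)[OF k] L_deg_of[OF k]]
      by (simp add: l_def)
  next
    fix f h assume f: "f \<in> Nt" and h: "h \<in> N" and fh: "f \<subseteq> h"
    have fN: "f \<in> N" by (rule Nt_N[OF f])
    show "l (f, h) = 0"
      using val_not_L[OF g ref_gen(1)[OF fN] ref_gen(1)[OF h] ref_gen(3)[OF fN f] ref_gen(3)[OF h Nt_up[OF f fh h]]
          ref_gen_le[OF fN fh] ref_gen(2)[OF h] L_deg_of[OF h]]
      by (simp add: l_def)
  qed
  have "\<exists>r. (\<forall>k<m. r k \<noteq> 0 \<longrightarrow> L (\<delta> k)) \<and> (\<forall>v\<in>R. g v = cochain_hom (deg_cochain l) v \<oplus>\<^bsub>A\<^esub> free_hom r v)"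
  proof (rule normalise[OF g deg_cochain_cocycle[OF lc], where \<kappa>="\<lambda>d. ref_gen (cell_of d)"])
    fix d assume d: "M d"
    define e where "e = (\<lambda>i. max (d i) (deg_of (cell_of d) i))"
    note e = sup_deg_of[OF d, folded e_def]
    have cd: "cell_of d \<in> N" by (rule cell_of_N[OF d])
    have re: "\<delta> (ref_gen (cell_of d)) \<le> e" using ref_gen(2)[OF cd] e(3) by (rule order_trans)
    have Le: "L e" using e(1) by (simp add: M_def)
    show "gen (ref_gen (cell_of d)) \<and> (\<exists>e. d \<le> e \<and> \<delta> (ref_gen (cell_of d)) \<le> e \<and> L e)"
      using ref_gen(1)[OF cd] re e(2) Le by blast
    fix k assume k: "gen k" "\<delta> k \<le> d"
    have ke: "\<delta> k \<le> e" using k(2) e(2) by (rule order_trans)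
    show "val g k (ref_gen (cell_of d)) = deg_cochain l (\<delta> k) d + (if L (\<delta> k) then val g k (ref_gen (cell_of (\<delta> k))) else 0)"
    proof (cases "L (\<delta> k)")
      case True
      then have Mk: "M (\<delta> k)" using gen_ID[OF k(1)] by (simp add: M_def)
      have ck: "cell_of (\<delta> k) \<in> N" by (rule cell_of_N[OF Mk])
      have "\<delta> (ref_gen (cell_of (\<delta> k))) \<le> deg_of (cell_of d)" by (rule ref_gen_le[OF ck cell_of_mono[OF Mk d k(2)]])
      then have rke: "\<delta> (ref_gen (cell_of (\<delta> k))) \<le> e" using e(3) by (rule order_trans)
      show ?thesis
        using val_add[OF g k(1) ref_gen(1)[OF ck] ref_gen(1)[OF cd] ke rke re Le, symmetric] True Mk
        by (simp add: deg_cochain_def l_def)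
    next
      case False
      then have nt: "cell_of d \<in> Nt" by (rule not_L_imp_Nt[OF gen_ID[OF k(1)] _ k(2) d])
      show ?thesis
        using val_not_L[OF g k(1) ref_gen(1)[OF cd] False ref_gen(3)[OF cd nt] ke re Le] False
        by (simp add: deg_cochain_def M_def)
    qed
  qed
  then show ?thesis using lc by blast
qed

text \<open>A homomorphism on the free module has one coefficient \<open>s k\<close> for each generator, and it acts on
  a relation by the difference of two of these. Normalised at the reference generators, they
  give the 0-cochain whose coboundary is \<open>l\<close>.\<close>

lemma coboundary_free_image:
  assumes l: "l \<in> face_cocycles N Nt"
  shows "desc (cochain_hom (deg_cochain l)) \<in> free_image n I m j \<longleftrightarrow> l \<in> face_coboundaries N Nt"
proof
  note lc = deg_cochain_cocycle[OF l]
  assume "desc (cochain_hom (deg_cochain l)) \<in> free_image n I m j"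
  then obtain h where h: "h \<in> mod_hom P F AP" "desc (cochain_hom (deg_cochain l)) = desc h"
    unfolding free_image_eq by blast
  have eq: "cochain_hom (deg_cochain l) v = h v" if "v \<in> R" for v
    using h(2) desc_cong[OF cochain_hom_lin[OF lc] mod_hom_lin[OF h(1)]] that by blast
  define s where "s k = al (h (unit_vec P m k)) (\<delta> k) / lam k" for k
  have hF: "h v \<in> carrier A" if "v \<in> carrier F" for v using h(1) that by (auto simp: mod_hom_def)
  have hadd: "h (v \<oplus>\<^bsub>F\<^esub> w) = h v \<oplus>\<^bsub>A\<^esub> h w" if "v \<in> carrier F" "w \<in> carrier F" for v w
    using h(1) that by (simp add: mod_hom_def)
  have hsm: "h (r \<odot>\<^bsub>F\<^esub> v) = cls r \<otimes>\<^bsub>A\<^esub> h v" if "r \<in> polys n" "v \<in> carrier F" for r v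
    using h(1) that by (simp add: mod_hom_def)
  have mv: "al (h (mvec k d z)) d = z * al (h (unit_vec P m k)) (\<delta> k)"
    if k: "gen k" and d: "vdeg n d" "\<delta> k \<le> d" "L d" for k d z
  proof -
    have e: "(\<lambda>i. d i - (d i - \<delta> k i)) = \<delta> k" by simp
    show ?thesis
      unfolding mvec_smult hsm[OF mterm_polys unit_vec_F]
        al_mult[OF hF[OF unit_vec_F] vdeg_diff[OF d(1) gen_vdeg[OF k] d(2)]] e using d(3) by simp
  qed
  have diff: "deg_cochain l (\<delta> k) d - deg_cochain l (\<delta> k') d = s k - s k'"
    if k: "gen k" "gen k'" and d: "\<delta> k \<le> d" "\<delta> k' \<le> d" "L d" for k k' d
  proof -
    have vd: "vdeg n d" by (rule L_gen_vdeg[OF k(1) d(1,3)])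
    have "deg_cochain l (\<delta> k) d - deg_cochain l (\<delta> k') d = al (h (rel k k' d 1)) d"
      using cochain_hom_rel[OF k vd d, of "deg_cochain l" 1] eq[OF rel_R[OF k vd d(1,2)]] by simp
    also have "\<dots> = s k - s k'"
      unfolding rel_def hadd[OF mvec_F mvec_F] al_add[OF hF[OF mvec_F] hF[OF mvec_F]]
        mv[OF k(1) vd d(1,3)] mv[OF k(2) vd d(2,3)] by (simp add: s_def)
    finally show ?thesis .
  qed
  \<comment> \<open>by \<open>diff\<close>, any generator below \<open>deg_of f\<close> gives the same value\<close>
  define \<mu> where "\<mu> f = deg_cochain l (\<delta> (ref_gen f)) (deg_of f) - s (ref_gen f)" for f
  have "l (f, g) = \<mu> g - \<mu> f" if f: "f \<in> N" and g: "g \<in> N" and fg: "f \<subseteq> g" for f g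
  proof -
    let ?k = "ref_gen f"
    have Mf: "M (deg_of f)" and Mg: "M (deg_of g)" by (rule deg_of_M[OF f], rule deg_of_M[OF g])
    have "deg_cochain l (\<delta> ?k) (deg_of g) = deg_cochain l (\<delta> ?k) (deg_of f) + deg_cochain l (deg_of f) (deg_of g)"
      using lc gen_ID[OF ref_gen(1)[OF f]] ref_gen(2)[OF f] deg_of_mono[OF fg] Mf Mg
      unfolding degree_cocycle_def by blast
    moreover have "deg_cochain l (deg_of f) (deg_of g) = l (f, g)"
      using Mf cell_of_deg_of[OF f] cell_of_deg_of[OF g] by (simp add: deg_cochain_def)
    moreover have "deg_cochain l (\<delta> ?k) (deg_of g) - deg_cochain l (\<delta> (ref_gen g)) (deg_of g) = s ?k - s (ref_gen g)"
      by (rule diff[OF ref_gen(1)[OF f] ref_gen(1)[OF g] ref_gen_le[OF f fg] ref_gen(2)[OF g] L_deg_of[OF g]])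
    ultimately show ?thesis by (simp add: \<mu>_def algebra_simps)
  qed
  moreover have "\<mu> f = 0" if f: "f \<in> Nt" for f
  proof -
    have "\<not> L (\<delta> (ref_gen f))" by (rule ref_gen(3)[OF Nt_N[OF f] f])
    then show ?thesis using al_not_L by (simp add: \<mu>_def deg_cochain_def M_def s_def)
  qed
  ultimately show "l \<in> face_coboundaries N Nt" unfolding face_coboundaries_def by blast
next
  note lc = deg_cochain_cocycle[OF l]
  assume "l \<in> face_coboundaries N Nt"
  then obtain \<mu> where \<mu>0: "\<And>f. f \<in> Nt \<Longrightarrow> \<mu> f = 0" and \<mu>: "\<And>f g. f \<in> N \<Longrightarrow> g \<in> N \<Longrightarrow> f \<subseteq> g \<Longrightarrow> l (f, g) = \<mu> g - \<mu> f"
    unfolding face_coboundaries_def by blast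
  \<comment> \<open>by \<open>val\<close> below, this cancels the part of the coboundary that depends on the generator only\<close>
  define r where "r k = (if lam k \<noteq> 0 \<and> L (\<delta> k) then - lam k * \<mu> (cell_of (\<delta> k)) else 0)" for k
  have rL: "\<forall>k<m. r k \<noteq> 0 \<longrightarrow> L (\<delta> k)" by (simp add: r_def)
  have val: "deg_cochain l (\<delta> k) d = \<mu> (cell_of d) + r k / lam k" if k: "gen k" "\<delta> k \<le> d" "M d" for k d
  proof (cases "L (\<delta> k)")
    case True
    then have Mk: "M (\<delta> k)" using gen_ID[OF k(1)] by (simp add: M_def)
    then show ?thesis
      using \<mu>[OF cell_of_N[OF Mk] cell_of_N[OF k(3)] cell_of_mono[OF Mk k(3,2)]] k(1) True
      by (simp add: deg_cochain_def r_def gen_def)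
  next
    case False
    then have "cell_of d \<in> Nt" by (rule not_L_imp_Nt[OF gen_ID[OF k(1)] _ k(2,3)])
    then show ?thesis using False \<mu>0 by (simp add: deg_cochain_def r_def M_def)
  qed
  have "cochain_hom (deg_cochain l) v = free_hom r v" if v: "v \<in> R" for v
  proof (rule lin_agree[OF cochain_hom_lin[OF lc] cochain_hom_homog free_hom_lin free_hom_homog[OF rL] _ _ v])
    fix k assume k: "k < m" "lam k = 0" "L (\<delta> k)"
    let ?u = "unit_vec P m k"
    have zt: "cf n (?u t) e = 0" if "t < m" "t \<noteq> k" for t e using that by (simp add: unit_vec_def)
    have "al (cochain_hom (deg_cochain l) ?u) (\<delta> k) = 0"
      unfolding al_cochain_hom[OF unit_vec_F k(3)]
    proof (rule sum.neutral, rule ballI)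
      fix t assume "t \<in> {..<m}"
      then show "lam t * deg_cochain l (\<delta> t) (\<delta> k) * cf n (?u t) (\<lambda>i. \<delta> k i - \<delta> t i) = 0"
        using zt k(2) by (cases "t = k") auto
    qed
    moreover have "al (free_hom r ?u) (\<delta> k) = 0"
      unfolding al_free_hom[OF rL unit_vec_F k(3)]
    proof (rule sum.neutral, rule ballI)
      fix t assume "t \<in> {..<m}"
      then show "r t * cf n (?u t) (\<lambda>i. \<delta> k i - \<delta> t i) = 0"
        using zt k(2) by (cases "t = k") (auto simp: r_def)
    qed
    ultimately show "al (cochain_hom (deg_cochain l) ?u) (\<delta> k) = al (free_hom r ?u) (\<delta> k)" by simp
  next
    fix k h d z assume kh: "gen k" "gen h" "vdeg n d" "\<delta> k \<le> d" "\<delta> h \<le> d" "L d"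
    have Md: "M d" by (rule L_gen_M[OF kh(1,4,6)])
    show "al (cochain_hom (deg_cochain l) (rel k h d z)) d = al (free_hom r (rel k h d z)) d"
      unfolding cochain_hom_rel[OF kh] free_hom_rel[OF rL kh] val[OF kh(1,4) Md] val[OF kh(2,5) Md] by simp
  qed
  then have "desc (cochain_hom (deg_cochain l)) = desc (free_hom r)"
    using desc_cong[OF cochain_hom_lin[OF lc] free_hom_lin] by blast
  then show "desc (cochain_hom (deg_cochain l)) \<in> free_image n I m j"
    unfolding free_image_eq using free_hom_mod_hom by blast
qed

lemma cochain_hom_sum:
  assumes v: "v \<in> R"
  shows "cochain_hom (deg_cochain (\<lambda>x. l x + l' x)) v = cochain_hom (deg_cochain l) v \<oplus>\<^bsub>A\<^esub> cochain_hom (deg_cochain l') v"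
proof (rule al_ext[OF cochain_hom_carrier A.a_closed[OF cochain_hom_carrier cochain_hom_carrier]])
  fix D assume D: "L D"
  show "al (cochain_hom (deg_cochain (\<lambda>x. l x + l' x)) v) D = al (cochain_hom (deg_cochain l) v \<oplus>\<^bsub>A\<^esub> cochain_hom (deg_cochain l') v) D"
    unfolding al_add[OF cochain_hom_carrier cochain_hom_carrier] al_cochain_hom[OF R_F[OF v] D] sum.distrib[symmetric]
    by (intro sum.cong refl) (simp add: deg_cochain_def algebra_simps)
qed

lemma cochain_hom_scale:
  assumes v: "v \<in> R"
  shows "cochain_hom (deg_cochain (\<lambda>x. z * l x)) v = cls (const_poly z) \<otimes>\<^bsub>A\<^esub> cochain_hom (deg_cochain l) v"
  unfolding const_poly_mterm[of z n]
proof (rule al_ext[OF cochain_hom_carrier A.m_closed[OF cls_carrier[OF mterm_polys] cochain_hom_carrier]])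
  fix D assume D: "L D"
  have v0: "vdeg n (\<lambda>_. 0)" by (simp add: vdeg_def)
  have "al (cls (mterm n (\<lambda>_. 0) z) \<otimes>\<^bsub>A\<^esub> cochain_hom (deg_cochain l) v) D = z * al (cochain_hom (deg_cochain l) v) D"
    using al_mult[OF cochain_hom_carrier v0] D by simp
  then show "al (cochain_hom (deg_cochain (\<lambda>x. z * l x)) v) D = al (cls (mterm n (\<lambda>_. 0) z) \<otimes>\<^bsub>A\<^esub> cochain_hom (deg_cochain l) v) D"
    unfolding al_cochain_hom[OF R_F[OF v] D] sum_distrib_left
    by (auto intro!: sum.cong simp: deg_cochain_def)
qed

lemma presents_T2_part: "presents (face_cocycles N Nt) (face_coboundaries N Nt) (T2_part n I m \<delta> j c)"
proof (rule presents_quotient[where M="hom_R_A n I m j" and N="free_image n I m j" and f="\<lambda>z. cls (const_poly z)"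
      and S=part2 and t="\<lambda>l. desc (cochain_hom (deg_cochain l))"])
  show "abelian_group (hom_R_A n I m j)" by (rule hom_R_A_abelian_group)
  show "subgroup (free_image n I m j) (add_monoid (hom_R_A n I m j))" by (rule free_image_subgroup)
  show "part2 \<subseteq> carrier (hom_R_A n I m j)" by (auto simp: hom_part_def hom_R_A_simps HR.hom_module_simps)
  show "carrier (T2_part n I m \<delta> j c) = (+>\<^bsub>hom_R_A n I m j\<^esub>) (free_image n I m j) ` part2"
    by (rule T2_part_simps)
  show "add (T2_part n I m \<delta> j c) = set_add (hom_R_A n I m j)" by (rule T2_part_simps)
  show "z \<odot>\<^bsub>T2_part n I m \<delta> j c\<^esub> x =
     (\<Union>h\<in>x. free_image n I m j +>\<^bsub>hom_R_A n I m j\<^esub> (cls (const_poly z) \<odot>\<^bsub>hom_R_A n I m j\<^esub> h))" for z x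
    by (rule T2_part_simps)
  show "cls (const_poly z) \<odot>\<^bsub>hom_R_A n I m j\<^esub> h \<in> carrier (hom_R_A n I m j)" if "h \<in> carrier (hom_R_A n I m j)" for z h
    using that HR.hom_smult_closed[of h "cls (const_poly z)"] by (simp add: hom_R_A_simps HR.hom_module_simps cls_carrier)
  show "cls (const_poly z) \<odot>\<^bsub>hom_R_A n I m j\<^esub> (g \<oplus>\<^bsub>hom_R_A n I m j\<^esub> h) =
      cls (const_poly z) \<odot>\<^bsub>hom_R_A n I m j\<^esub> g \<oplus>\<^bsub>hom_R_A n I m j\<^esub> cls (const_poly z) \<odot>\<^bsub>hom_R_A n I m j\<^esub> h"
    if "g \<in> carrier (hom_R_A n I m j)" "h \<in> carrier (hom_R_A n I m j)" for z g h
    using that HR.hom_smult_add[of g h "cls (const_poly z)"] by (simp add: hom_R_A_simps HR.hom_module_simps(1) cls_carrier)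
  show "cls (const_poly z) \<odot>\<^bsub>hom_R_A n I m j\<^esub> h \<in> free_image n I m j" if "h \<in> free_image n I m j" for z h
    using free_image_scale[OF that const_poly_polys] by (simp add: hom_R_A_simps HR.hom_module_simps)
  show "fun_subspace (face_cocycles N Nt)" by (rule face_cocycles_subspace)
  fix l assume l: "l \<in> face_cocycles N Nt"
  note ll = cochain_hom_lin[OF deg_cochain_cocycle[OF l]]
  show "desc (cochain_hom (deg_cochain l)) \<in> part2" by (rule part2I[OF ll cochain_hom_homog])
  show "desc (cochain_hom (deg_cochain l)) \<in> free_image n I m j \<longleftrightarrow> l \<in> face_coboundaries N Nt"
    by (rule coboundary_free_image[OF l])
  show "desc (cochain_hom (deg_cochain (\<lambda>x. z * l x))) = cls (const_poly z) \<odot>\<^bsub>hom_R_A n I m j\<^esub> desc (cochain_hom (deg_cochain l))" for z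
  proof -
    have "lin (cochain_hom (deg_cochain (\<lambda>x. z * l x)))"
      by (rule cochain_hom_lin[OF deg_cochain_cocycle[OF fun_subspace_scale[OF face_cocycles_subspace l]]])
    from desc_map[OF ll this, of "\<lambda>y. cls (const_poly z) \<otimes>\<^bsub>A\<^esub> y"] cochain_hom_scale
    show ?thesis by (simp add: hom_R_A_simps HR.hom_module_simps)
  qed
  fix l' assume l': "l' \<in> face_cocycles N Nt"
  note ll' = cochain_hom_lin[OF deg_cochain_cocycle[OF l']]
  show "desc (cochain_hom (deg_cochain (\<lambda>x. l x + l' x))) =
      desc (cochain_hom (deg_cochain l)) \<oplus>\<^bsub>hom_R_A n I m j\<^esub> desc (cochain_hom (deg_cochain l'))"
  proof -
    note s = lin_homog_add(1)[OF ll cochain_hom_homog ll' cochain_hom_homog]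
    have t: "lin (cochain_hom (deg_cochain (\<lambda>x. l x + l' x)))"
      by (rule cochain_hom_lin[OF deg_cochain_cocycle[OF fun_subspace_add[OF face_cocycles_subspace l l']]])
    have "desc (cochain_hom (deg_cochain (\<lambda>x. l x + l' x))) = desc (\<lambda>v. cochain_hom (deg_cochain l) v \<oplus>\<^bsub>A\<^esub> cochain_hom (deg_cochain l') v)"
      using desc_cong[OF t s] cochain_hom_sum by blast
    then show ?thesis using desc_add[OF ll ll' s] by (simp add: hom_R_A_simps HR.hom_module_simps)
  qed
next
  interpret H: abelian_group "hom_R_A n I m j" by (rule hom_R_A_abelian_group)
  fix h assume h: "h \<in> part2"
  obtain g where g: "lin g" "homog g" "h = desc g" using part2E[OF h] by blast
  obtain l r where l: "l \<in> face_cocycles N Nt"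
    and r: "\<forall>v\<in>R. g v = cochain_hom (deg_cochain l) v \<oplus>\<^bsub>A\<^esub> free_hom r v"
    using part2_normal_form[OF g(1,2)] by blast
  note ll = cochain_hom_lin[OF deg_cochain_cocycle[OF l]]
  have s: "lin (\<lambda>v. free_hom r v \<oplus>\<^bsub>A\<^esub> cochain_hom (deg_cochain l) v)"
    unfolding lin_def
  proof (intro conjI ballI)
    have e: "free_hom r v \<oplus>\<^bsub>A\<^esub> cochain_hom (deg_cochain l) v = g v" if "v \<in> R" for v
      using r that A.a_comm[OF linD(1)[OF free_hom_lin that] cochain_hom_carrier] by simp
    fix v assume v: "v \<in> R"
    show "free_hom r v \<oplus>\<^bsub>A\<^esub> cochain_hom (deg_cochain l) v \<in> carrier A" unfolding e[OF v] by (rule linD(1)[OF g(1) v])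
    show "free_hom r (v \<oplus>\<^bsub>F\<^esub> w) \<oplus>\<^bsub>A\<^esub> cochain_hom (deg_cochain l) (v \<oplus>\<^bsub>F\<^esub> w) =
        free_hom r v \<oplus>\<^bsub>A\<^esub> cochain_hom (deg_cochain l) v \<oplus>\<^bsub>A\<^esub> (free_hom r w \<oplus>\<^bsub>A\<^esub> cochain_hom (deg_cochain l) w)" if w: "w \<in> R" for w
      unfolding e[OF v] e[OF w] e[OF R_add[OF v w]] by (rule linD(2)[OF g(1) v w])
    show "free_hom r (p \<odot>\<^bsub>F\<^esub> v) \<oplus>\<^bsub>A\<^esub> cochain_hom (deg_cochain l) (p \<odot>\<^bsub>F\<^esub> v) =
        cls p \<otimes>\<^bsub>A\<^esub> (free_hom r v \<oplus>\<^bsub>A\<^esub> cochain_hom (deg_cochain l) v)" if p: "p \<in> polys n" for p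
      unfolding e[OF v] e[OF R_smult[OF p v]] by (rule linD(3)[OF g(1) p v])
  next
    fix v assume "v \<in> K"
    then show "free_hom r v \<oplus>\<^bsub>A\<^esub> cochain_hom (deg_cochain l) v = \<zero>\<^bsub>A\<^esub>"
      using linD(4)[OF free_hom_lin] linD(4)[OF ll] by simp
  qed
  have "desc g = desc (\<lambda>v. free_hom r v \<oplus>\<^bsub>A\<^esub> cochain_hom (deg_cochain l) v)"
    unfolding desc_cong[OF g(1) s]
  proof
    fix v assume v: "v \<in> R"
    show "g v = free_hom r v \<oplus>\<^bsub>A\<^esub> cochain_hom (deg_cochain l) v"
      using r v A.a_comm[OF linD(1)[OF free_hom_lin v] cochain_hom_carrier] by simp
  qed
  also have "\<dots> = desc (free_hom r) \<oplus>\<^bsub>hom_R_A n I m j\<^esub> desc (cochain_hom (deg_cochain l))"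
    using desc_add[OF free_hom_lin ll s] by (simp add: hom_R_A_simps HR.hom_module_simps)
  finally have "h = desc (free_hom r) \<oplus>\<^bsub>hom_R_A n I m j\<^esub> desc (cochain_hom (deg_cochain l))" unfolding g(3) .
  moreover have "desc (free_hom r) \<in> free_image n I m j" unfolding free_image_eq using free_hom_mod_hom by blast
  ultimately show "\<exists>l\<in>face_cocycles N Nt. \<exists>k\<in>free_image n I m j. h = k \<oplus>\<^bsub>hom_R_A n I m j\<^esub> desc (cochain_hom (deg_cochain l))"
    using l by blast
qed

end

section \<open>Singular cochains\<close>

definition pair :: "('s \<Rightarrow> complex) \<Rightarrow> ('s \<Rightarrow>\<^sub>0 int) \<Rightarrow> complex" where
  "pair w c = (\<Sum>\<sigma>\<in>Poly_Mapping.keys c. of_int (Poly_Mapping.lookup c \<sigma>) * w \<sigma>)"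

lemma pair_superset:
  assumes "finite S" "Poly_Mapping.keys c \<subseteq> S"
  shows "pair w c = (\<Sum>\<sigma>\<in>S. of_int (Poly_Mapping.lookup c \<sigma>) * w \<sigma>)"
  unfolding pair_def by (rule sum.mono_neutral_left[OF assms]) (auto simp: in_keys_iff)

lemma pair_0 [simp]: "pair w 0 = 0" by (simp add: pair_def)

lemma pair_of [simp]: "pair w (frag_of \<sigma>) = w \<sigma>"
  by (simp add: pair_def keys_frag_of)

lemma pair_diff: "pair w (c - d) = pair w c - pair w d"
proof -
  let ?S = "Poly_Mapping.keys c \<union> Poly_Mapping.keys d"
  have "pair w (c - d) = (\<Sum>\<sigma>\<in>?S. of_int (Poly_Mapping.lookup (c - d) \<sigma>) * w \<sigma>)"
    by (rule pair_superset) (use keys_diff[of c d] in auto)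
  also have "\<dots> = (\<Sum>\<sigma>\<in>?S. of_int (Poly_Mapping.lookup c \<sigma>) * w \<sigma>) - (\<Sum>\<sigma>\<in>?S. of_int (Poly_Mapping.lookup d \<sigma>) * w \<sigma>)"
    by (simp add: lookup_minus sum_subtractf[symmetric] left_diff_distrib)
  also have "\<dots> = pair w c - pair w d"
    using pair_superset[of ?S c w] pair_superset[of ?S d w] by simp
  finally show ?thesis .
qed

lemma pair_uminus: "pair w (- c) = - pair w c" using pair_diff[of w 0 c] by simp

lemma pair_add: "pair w (c + d) = pair w c + pair w d"
  using pair_diff[of w c "- d"] by (simp add: pair_uminus)

lemma pair_fun_add: "pair (\<lambda>\<sigma>. w \<sigma> + w' \<sigma>) c = pair w c + pair w' c"
  by (simp add: pair_def sum.distrib distrib_left)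

lemma pair_fun_scale: "pair (\<lambda>\<sigma>. z * w \<sigma>) c = z * pair w c"
  by (simp add: pair_def sum_distrib_left mult.left_commute)

lemma pair_cong: "(\<And>\<sigma>. \<sigma> \<in> Poly_Mapping.keys c \<Longrightarrow> w \<sigma> = w' \<sigma>) \<Longrightarrow> pair w c = pair w' c"
  unfolding pair_def by (intro sum.cong) simp_all

lemma pair_eq_0: "(\<And>\<sigma>. \<sigma> \<in> Poly_Mapping.keys c \<Longrightarrow> w \<sigma> = 0) \<Longrightarrow> pair w c = 0"
  unfolding pair_def by (intro sum.neutral) simp

lemma cochains_simps [simp]:
  "add (cochains p X S) \<phi> \<psi> = (\<lambda>c\<in>singular_chain_set p X. \<phi> c + \<psi> c)"
  "z \<odot>\<^bsub>cochains p X S\<^esub> \<phi> = (\<lambda>c\<in>singular_chain_set p X. z * \<phi> c)"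
  "\<zero>\<^bsub>cochains p X S\<^esub> = (\<lambda>c\<in>singular_chain_set p X. 0)"
  by (simp_all add: cochains_def)

lemma cocycles_simps [simp]:
  "add (cocycles p X S) \<phi> \<psi> = (\<lambda>c\<in>singular_chain_set p X. \<phi> c + \<psi> c)"
  "z \<odot>\<^bsub>cocycles p X S\<^esub> \<phi> = (\<lambda>c\<in>singular_chain_set p X. z * \<phi> c)"
  "\<zero>\<^bsub>cocycles p X S\<^esub> = (\<lambda>c\<in>singular_chain_set p X. 0)"
  by (simp_all add: cocycles_def)

lemma cochains_iff: "\<phi> \<in> carrier (cochains p X S) \<longleftrightarrow>
    \<phi> \<in> extensional (singular_chain_set p X) \<and>
    (\<forall>a b. singular_chain p X a \<longrightarrow> singular_chain p X b \<longrightarrow> \<phi> (a + b) = \<phi> a + \<phi> b) \<and>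
    (\<forall>c. singular_chain p (subtopology X S) c \<longrightarrow> \<phi> c = 0)"
  by (simp add: cochains_def hom_def complex_ring_def Pi_def)

lemma cochain_add: "\<phi> \<in> carrier (cochains p X S) \<Longrightarrow> singular_chain p X a \<Longrightarrow> singular_chain p X b \<Longrightarrow> \<phi> (a + b) = \<phi> a + \<phi> b"
  unfolding cochains_iff by blast

lemma cochain_ext: "\<phi> \<in> carrier (cochains p X S) \<Longrightarrow> \<phi> \<in> extensional (singular_chain_set p X)"
  unfolding cochains_iff by blast

lemma cochain_vanish: "\<phi> \<in> carrier (cochains p X S) \<Longrightarrow> singular_chain p (subtopology X S) c \<Longrightarrow> \<phi> c = 0"
  unfolding cochains_iff by blast

lemma cochain_0: "\<phi> \<in> carrier (cochains p X S) \<Longrightarrow> \<phi> 0 = 0"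
  using cochain_add[of \<phi> p X S 0 0] by simp

lemma cochain_diff:
  assumes "\<phi> \<in> carrier (cochains p X S)" "singular_chain p X a" "singular_chain p X b"
  shows "\<phi> (a - b) = \<phi> a - \<phi> b"
  using cochain_add[OF assms(1) singular_chain_diff[OF assms(2,3)] assms(3)] by simp

lemma cochain_agree:
  assumes \<phi>: "\<phi> \<in> carrier (cochains p X S)"
    and w: "\<And>\<sigma>. singular_simplex p X \<sigma> \<Longrightarrow> \<phi> (frag_of \<sigma>) = w \<sigma>"
    and c: "singular_chain p X c"
  shows "\<phi> c = pair w c"
proof -
  have "singular_chain p X c \<and> \<phi> c = pair w c"
    using c[unfolded singular_chain_def]
  proof (induction rule: frag_induction)
    case zero
    then show ?case using cochain_0[OF \<phi>] by simp
  next
    case (one \<sigma>)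
    then show ?case using w by (simp add: singular_chain_of)
  next
    case (diff a b)
    then show ?case using cochain_diff[OF \<phi>, of a b] singular_chain_diff[of p X a b] by (simp add: pair_diff)
  qed
  then show ?thesis ..
qed

lemma pair_cochain:
  assumes "\<And>\<sigma>. singular_simplex p (subtopology X S) \<sigma> \<Longrightarrow> w \<sigma> = 0"
  shows "(\<lambda>c\<in>singular_chain_set p X. pair w c) \<in> carrier (cochains p X S)"
  unfolding cochains_iff
proof (intro conjI allI impI)
  fix c assume c: "singular_chain p (subtopology X S) c"
  have "pair w c = 0" by (rule pair_eq_0, rule assms) (use c in \<open>auto simp: singular_chain_def\<close>)
  then show "(\<lambda>c\<in>singular_chain_set p X. pair w c) c = 0"
    using c by (simp add: singular_chain_subtopology)
qed (simp_all add: pair_add singular_chain_add)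

lemma cocycles_iff: "\<phi> \<in> carrier (cocycles p X S) \<longleftrightarrow> \<phi> \<in> carrier (cochains p X S) \<and>
    (\<forall>c. singular_chain (Suc p) X c \<longrightarrow> \<phi> (chain_boundary (Suc p) c) = 0)"
  by (auto simp: cocycles_def coboundary_def fun_eq_iff restrict_def)

lemma chain_closed_comb:
  assumes "\<phi> \<in> carrier (cocycles p X S)" "\<psi> \<in> carrier (cocycles p X S)"
  shows "(\<lambda>c\<in>singular_chain_set p X. y * \<phi> c + z * \<psi> c) \<in> carrier (cocycles p X S)"
proof -
  have \<phi>: "\<phi> \<in> carrier (cochains p X S)" and \<psi>: "\<psi> \<in> carrier (cochains p X S)"
    using assms by (auto simp: cocycles_iff)
  have s: "singular_chain p X c" if "singular_chain p (subtopology X S) c" for c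
    using that by (simp add: singular_chain_subtopology)
  have b: "singular_chain p X (chain_boundary (Suc p) c)" if "singular_chain (Suc p) X c" for c
    by (rule singular_chain_boundary_alt[OF that])
  show ?thesis
    unfolding cocycles_iff cochains_iff
    using assms s b cochain_vanish[OF \<phi>] cochain_vanish[OF \<psi>]
    by (simp add: cocycles_iff cochain_add[OF \<phi>] cochain_add[OF \<psi>] singular_chain_add algebra_simps)
qed

lemma cocycle_ext: "\<phi> \<in> carrier (cocycles p X S) \<Longrightarrow> \<phi> \<in> extensional (singular_chain_set p X)"
  unfolding cocycles_iff using cochain_ext by blast

lemma cocycles_zero: "(\<lambda>c\<in>singular_chain_set p X. 0) \<in> carrier (cocycles p X S)"
proof -
  have "(\<lambda>c\<in>singular_chain_set p X. 0) \<in> carrier (cochains p X S)"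
    unfolding cochains_iff by (simp add: singular_chain_add singular_chain_subtopology)
  then show ?thesis by (simp add: cocycles_iff singular_chain_boundary_alt)
qed

lemma restrict_extensional_eq: "f \<in> extensional A \<Longrightarrow> (\<lambda>x\<in>A. f x) = f"
  by (rule extensionalityI[OF restrict_extensional]) simp_all

lemma cocycles_abelian_group: "abelian_group (cocycles p X S)"
proof (rule abelian_groupI)
  fix \<phi> \<psi> \<theta> assume \<phi>: "\<phi> \<in> carrier (cocycles p X S)" and \<psi>: "\<psi> \<in> carrier (cocycles p X S)" and \<theta>: "\<theta> \<in> carrier (cocycles p X S)"
  show "\<phi> \<oplus>\<^bsub>cocycles p X S\<^esub> \<psi> \<in> carrier (cocycles p X S)" using chain_closed_comb[OF \<phi> \<psi>, of 1 1] by simp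
  show "\<phi> \<oplus>\<^bsub>cocycles p X S\<^esub> \<psi> = \<psi> \<oplus>\<^bsub>cocycles p X S\<^esub> \<phi>"
    unfolding cocycles_simps by (rule restrict_ext) (simp add: add.commute)
  show "\<phi> \<oplus>\<^bsub>cocycles p X S\<^esub> \<psi> \<oplus>\<^bsub>cocycles p X S\<^esub> \<theta> = \<phi> \<oplus>\<^bsub>cocycles p X S\<^esub> (\<psi> \<oplus>\<^bsub>cocycles p X S\<^esub> \<theta>)"
    unfolding cocycles_simps by (rule restrict_ext) (simp add: add.assoc)
  show "\<zero>\<^bsub>cocycles p X S\<^esub> \<oplus>\<^bsub>cocycles p X S\<^esub> \<phi> = \<phi>"
    using restrict_extensional_eq[OF cocycle_ext[OF \<phi>]] unfolding cocycles_simps by (simp cong: restrict_cong)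
  have "(\<lambda>c\<in>singular_chain_set p X. - \<phi> c) \<in> carrier (cocycles p X S)" using chain_closed_comb[OF \<phi> \<phi>, of "- 1" 0] by simp
  moreover have "(\<lambda>c\<in>singular_chain_set p X. - \<phi> c) \<oplus>\<^bsub>cocycles p X S\<^esub> \<phi> = \<zero>\<^bsub>cocycles p X S\<^esub>"
    unfolding cocycles_simps by (rule restrict_ext) simp
  ultimately show "\<exists>\<psi>\<in>carrier (cocycles p X S). \<psi> \<oplus>\<^bsub>cocycles p X S\<^esub> \<phi> = \<zero>\<^bsub>cocycles p X S\<^esub>" by blast
next
  show "\<zero>\<^bsub>cocycles p X S\<^esub> \<in> carrier (cocycles p X S)" using cocycles_zero by simp
qed

lemma cocycles_subgroupI:
  assumes sub: "B \<subseteq> carrier (cocycles p X S)" and zero: "(\<lambda>c\<in>singular_chain_set p X. 0) \<in> B"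
    and comb: "\<And>\<phi> \<psi> y z. \<phi> \<in> B \<Longrightarrow> \<psi> \<in> B \<Longrightarrow> (\<lambda>c\<in>singular_chain_set p X. y * \<phi> c + z * \<psi> c) \<in> B"
  shows "subgroup B (add_monoid (cocycles p X S))"
proof -
  interpret abelian_group "cocycles p X S" by (rule cocycles_abelian_group)
  show ?thesis
  proof (rule add.subgroupI[OF sub])
    show "B \<noteq> {}" using zero by blast
    show "\<ominus>\<^bsub>cocycles p X S\<^esub> \<phi> \<in> B" if \<phi>: "\<phi> \<in> B" for \<phi>
    proof -
      have m: "(\<lambda>c\<in>singular_chain_set p X. - \<phi> c) \<in> B" using comb[OF \<phi> \<phi>, of "- 1" 0] by simp
      have "\<ominus>\<^bsub>cocycles p X S\<^esub> \<phi> = (\<lambda>c\<in>singular_chain_set p X. - \<phi> c)"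
      proof (rule minus_equality)
        show "(\<lambda>c\<in>singular_chain_set p X. - \<phi> c) \<oplus>\<^bsub>cocycles p X S\<^esub> \<phi> = \<zero>\<^bsub>cocycles p X S\<^esub>"
          unfolding cocycles_simps by (rule restrict_ext) simp
      qed (use m \<phi> sub in blast)+
      then show ?thesis using m by simp
    qed
    show "\<phi> \<oplus>\<^bsub>cocycles p X S\<^esub> \<psi> \<in> B" if "\<phi> \<in> B" "\<psi> \<in> B" for \<phi> \<psi> using comb[OF that, of 1 1] by simp
  qed
qed

text \<open>The subgroup \<open>B\<close> stands for the coboundaries of relative cohomology as well as for the
  augmentation in reduced cohomology.\<close>

lemma presents_cocycle_quotient:
  assumes sub: "B \<subseteq> carrier (cocycles p X S)" and zero: "(\<lambda>c\<in>singular_chain_set p X. 0) \<in> B"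
    and comb: "\<And>\<phi> \<psi> y z. \<phi> \<in> B \<Longrightarrow> \<psi> \<in> B \<Longrightarrow> (\<lambda>c\<in>singular_chain_set p X. y * \<phi> c + z * \<psi> c) \<in> B"
    and V: "fun_subspace V"
    and t: "\<And>u. u \<in> V \<Longrightarrow> (\<lambda>c\<in>singular_chain_set p X. t u c) \<in> carrier (cocycles p X S)"
    and tadd: "\<And>u v c. u \<in> V \<Longrightarrow> v \<in> V \<Longrightarrow> singular_chain p X c \<Longrightarrow> t (\<lambda>x. u x + v x) c = t u c + t v c"
    and tsm: "\<And>u z c. u \<in> V \<Longrightarrow> singular_chain p X c \<Longrightarrow> t (\<lambda>x. z * u x) c = z * t u c"
    and surj: "\<And>\<phi>. \<phi> \<in> carrier (cocycles p X S) \<Longrightarrow>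
       \<exists>u\<in>V. \<exists>\<beta>\<in>B. \<forall>c. singular_chain p X c \<longrightarrow> \<phi> c = \<beta> c + t u c"
    and ker: "\<And>u. u \<in> V \<Longrightarrow> (\<lambda>c\<in>singular_chain_set p X. t u c) \<in> B \<longleftrightarrow> u \<in> C"
  shows "presents V C (quot_module (cocycles p X S) B)"
proof (rule presents_quotient[where M="cocycles p X S" and N=B and S="carrier (cocycles p X S)" and f="\<lambda>z. z"
      and t="\<lambda>u. (\<lambda>c\<in>singular_chain_set p X. t u c)"])
  show "abelian_group (cocycles p X S)" by (rule cocycles_abelian_group)
  show "subgroup B (add_monoid (cocycles p X S))" by (rule cocycles_subgroupI[OF sub zero comb])
  show "carrier (quot_module (cocycles p X S) B) = (+>\<^bsub>cocycles p X S\<^esub>) B ` carrier (cocycles p X S)"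
    by (auto simp: quot_module_def A_RCOSETS_def')
  show "z \<odot>\<^bsub>cocycles p X S\<^esub> \<phi> \<in> carrier (cocycles p X S)" if "\<phi> \<in> carrier (cocycles p X S)" for z \<phi>
    using chain_closed_comb[OF that that, of z 0] by simp
  show "z \<odot>\<^bsub>cocycles p X S\<^esub> (\<phi> \<oplus>\<^bsub>cocycles p X S\<^esub> \<psi>) = z \<odot>\<^bsub>cocycles p X S\<^esub> \<phi> \<oplus>\<^bsub>cocycles p X S\<^esub> z \<odot>\<^bsub>cocycles p X S\<^esub> \<psi>" for z \<phi> \<psi>
    unfolding cocycles_simps by (rule restrict_ext) (simp add: distrib_left)
  show "z \<odot>\<^bsub>cocycles p X S\<^esub> \<phi> \<in> B" if "\<phi> \<in> B" for z \<phi> using comb[OF that that, of z 0] by simp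
  show "fun_subspace V" by (rule V)
  fix u assume u: "u \<in> V"
  show "(\<lambda>c\<in>singular_chain_set p X. t u c) \<in> carrier (cocycles p X S)" by (rule t[OF u])
  show "(\<lambda>c\<in>singular_chain_set p X. t u c) \<in> B \<longleftrightarrow> u \<in> C" by (rule ker[OF u])
  show "(\<lambda>c\<in>singular_chain_set p X. t (\<lambda>x. z * u x) c) = z \<odot>\<^bsub>cocycles p X S\<^esub> (\<lambda>c\<in>singular_chain_set p X. t u c)" for z
    unfolding cocycles_simps by (rule restrict_ext) (simp add: tsm[OF u])
  show "(\<lambda>c\<in>singular_chain_set p X. t (\<lambda>x. u x + v x) c) =
      (\<lambda>c\<in>singular_chain_set p X. t u c) \<oplus>\<^bsub>cocycles p X S\<^esub> (\<lambda>c\<in>singular_chain_set p X. t v c)" if v: "v \<in> V" for v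
    unfolding cocycles_simps by (rule restrict_ext) (simp add: tadd[OF u v])
next
  fix \<phi> assume \<phi>: "\<phi> \<in> carrier (cocycles p X S)"
  obtain u \<beta> where u: "u \<in> V" "\<beta> \<in> B" "\<forall>c. singular_chain p X c \<longrightarrow> \<phi> c = \<beta> c + t u c" using surj[OF \<phi>] by blast
  have "\<phi> = \<beta> \<oplus>\<^bsub>cocycles p X S\<^esub> (\<lambda>c\<in>singular_chain_set p X. t u c)"
    unfolding cocycles_simps by (rule extensionalityI[OF cocycle_ext[OF \<phi>] restrict_extensional]) (use u in simp)
  then show "\<exists>u\<in>V. \<exists>k\<in>B. \<phi> = k \<oplus>\<^bsub>cocycles p X S\<^esub> (\<lambda>c\<in>singular_chain_set p X. t u c)" using u by blast
qed (simp_all add: quot_module_def)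

lemma coboundaries_1:
  "\<beta> \<in> coboundaries 1 X S \<longleftrightarrow> (\<exists>\<psi>\<in>carrier (cochains 0 X S). \<beta> = (\<lambda>c\<in>singular_chain_set 1 X. \<psi> (chain_boundary 1 c)))"
  by (auto simp: coboundaries_def coboundary_def)

lemma coboundaries_1_sub: "coboundaries 1 X S \<subseteq> carrier (cocycles 1 X S)"
proof
  fix \<beta> assume "\<beta> \<in> coboundaries 1 X S"
  then obtain \<psi> where \<psi>: "\<psi> \<in> carrier (cochains 0 X S)" and \<beta>: "\<beta> = (\<lambda>c\<in>singular_chain_set 1 X. \<psi> (chain_boundary 1 c))"
    unfolding coboundaries_1 by blast
  have b: "singular_chain 0 Y (chain_boundary 1 c)" if "singular_chain 1 Y c" for Y and c :: "'a chain"
    using singular_chain_boundary[OF that] by simp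
  have s: "singular_chain 1 X c" if "singular_chain 1 (subtopology X S) c" for c
    using that by (simp add: singular_chain_subtopology)
  have "\<beta> \<in> carrier (cochains 1 X S)"
    unfolding cochains_iff \<beta>
    using b s cochain_add[OF \<psi>] cochain_vanish[OF \<psi>] by (simp add: singular_chain_add chain_boundary_add)
  moreover have "chain_boundary 1 (chain_boundary (Suc 1) c) = 0" if "singular_chain (Suc 1) X c" for c
    using chain_boundary_boundary[OF that] by simp
  then have "\<beta> (chain_boundary (Suc 1) c) = 0" if "singular_chain (Suc 1) X c" for c
    using that singular_chain_boundary_alt[OF that] cochain_0[OF \<psi>] by (simp add: \<beta>)
  ultimately show "\<beta> \<in> carrier (cocycles 1 X S)" unfolding cocycles_iff by blast
qed

lemma coboundaries_1_comb:
  assumes "\<phi> \<in> coboundaries 1 X S" "\<psi> \<in> coboundaries 1 X S"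
  shows "(\<lambda>c\<in>singular_chain_set 1 X. y * \<phi> c + z * \<psi> c) \<in> coboundaries 1 X S"
proof -
  obtain f where f: "f \<in> carrier (cochains 0 X S)" "\<phi> = (\<lambda>c\<in>singular_chain_set 1 X. f (chain_boundary 1 c))"
    using assms(1) unfolding coboundaries_1 by blast
  obtain g where g: "g \<in> carrier (cochains 0 X S)" "\<psi> = (\<lambda>c\<in>singular_chain_set 1 X. g (chain_boundary 1 c))"
    using assms(2) unfolding coboundaries_1 by blast
  have s: "singular_chain 0 X c" if "singular_chain 0 (subtopology X S) c" for c
    using that by (simp add: singular_chain_subtopology)
  have b: "singular_chain 0 X (chain_boundary 1 c)" if "singular_chain 1 X c" for c
    using singular_chain_boundary[OF that] by simp
  let ?h = "\<lambda>c\<in>singular_chain_set 0 X. y * f c + z * g c"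
  have "?h \<in> carrier (cochains 0 X S)"
    unfolding cochains_iff
    using s cochain_add[OF f(1)] cochain_vanish[OF f(1)] cochain_add[OF g(1)] cochain_vanish[OF g(1)]
    by (simp add: singular_chain_add algebra_simps)
  moreover have "(\<lambda>c\<in>singular_chain_set 1 X. y * \<phi> c + z * \<psi> c) = (\<lambda>c\<in>singular_chain_set 1 X. ?h (chain_boundary 1 c))"
    by (rule restrict_ext) (use b in \<open>simp add: f(2) g(2)\<close>)
  ultimately show ?thesis unfolding coboundaries_1 by blast
qed

lemma coboundaries_1_zero: "(\<lambda>c\<in>singular_chain_set 1 X. 0) \<in> coboundaries 1 X S"
proof -
  have z: "(\<lambda>c\<in>singular_chain_set 0 X. 0) \<in> carrier (cochains 0 X S)"
    unfolding cochains_iff by (simp add: singular_chain_add singular_chain_subtopology)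
  have b: "singular_chain 0 X (chain_boundary 1 c)" if "singular_chain 1 X c" for c
    using singular_chain_boundary[OF that] by simp
  have "(\<lambda>c\<in>singular_chain_set 1 X. 0) = (\<lambda>c\<in>singular_chain_set 1 X. (\<lambda>c\<in>singular_chain_set 0 X. 0) (chain_boundary 1 c))"
    by (rule restrict_ext) (use b in simp)
  then show ?thesis unfolding coboundaries_1 using z by blast
qed

text \<open>The vertices of the standard simplices, and the constant 0-simplices; a 0-simplex is
  identified with the image of its only point.\<close>

definition vtx :: "nat \<Rightarrow> nat \<Rightarrow> real" where "vtx i = (\<lambda>j. if j = i then 1 else 0)"

definition point :: "'a \<Rightarrow> (nat \<Rightarrow> real) \<Rightarrow> 'a" where "point y = (\<lambda>x\<in>standard_simplex 0. y)"

lemma vtx_std [simp]: "vtx i \<in> standard_simplex p \<longleftrightarrow> i \<le> p" unfolding vtx_def by simp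

lemma std_0: "standard_simplex 0 = {vtx 0}" unfolding vtx_def by (rule standard_simplex_0)

lemma point_apply [simp]: "point y (vtx 0) = y" by (simp add: point_def)

lemma singular_0_eq: "singular_simplex 0 X \<sigma> \<Longrightarrow> \<sigma> = point (\<sigma> (vtx 0))"
  unfolding singular_simplex_def point_def std_0 by (auto simp: extensional_def restrict_def)

lemma singular_point: "y \<in> topspace X \<Longrightarrow> singular_simplex 0 X (point y)"
  by (simp add: singular_simplex_def point_def)

lemma singular_0_topspace: "singular_simplex 0 X \<sigma> \<Longrightarrow> \<sigma> (vtx 0) \<in> topspace X"
  unfolding singular_simplex_def continuous_map_def by (auto simp: Pi_def)

lemma face_vtx: "i \<le> p \<Longrightarrow> k \<le> Suc p \<Longrightarrow> singular_face (Suc p) k \<sigma> (vtx i) = \<sigma> (vtx (if i < k then i else Suc i))"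
proof -
  assume "i \<le> p" "k \<le> Suc p"
  have "simplical_face k (vtx i) = vtx (if i < k then i else Suc i)"
    by (auto simp: simplical_face_def vtx_def fun_eq_iff)
  then show ?thesis using \<open>i \<le> p\<close> by (simp add: singular_face_def)
qed

lemma face_1:
  assumes "singular_simplex 1 X \<sigma>" "k \<le> 1"
  shows "singular_face 1 k \<sigma> = point (\<sigma> (vtx (1 - k)))"
proof -
  have "singular_simplex 0 X (singular_face 1 k \<sigma>)"
    using singular_simplex_singular_face[OF assms(1) _ assms(2)] by simp
  then have "singular_face 1 k \<sigma> = point (singular_face 1 k \<sigma> (vtx 0))" by (rule singular_0_eq)
  also have "singular_face 1 k \<sigma> (vtx 0) = \<sigma> (vtx (1 - k))"
    using face_vtx[of 0 0 k \<sigma>] assms(2) by (cases k) auto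
  finally show ?thesis .
qed

lemma boundary_1:
  assumes "singular_simplex 1 X \<sigma>"
  shows "chain_boundary 1 (frag_of \<sigma>) = frag_of (point (\<sigma> (vtx 1))) - frag_of (point (\<sigma> (vtx 0)))"
proof -
  have "chain_boundary 1 (frag_of \<sigma>) = (\<Sum>k\<le>1. frag_cmul ((- 1) ^ k) (frag_of (singular_face 1 k \<sigma>)))"
    by (simp add: chain_boundary_of)
  also have "\<dots> = frag_of (singular_face 1 0 \<sigma>) - frag_of (singular_face 1 1 \<sigma>)" by simp
  finally show ?thesis using face_1[OF assms, of 0] face_1[OF assms, of 1] by simp
qed

lemma boundary_2: "chain_boundary 2 (frag_of \<rho>) =
    frag_of (singular_face 2 0 \<rho>) - frag_of (singular_face 2 1 \<rho>) + frag_of (singular_face 2 2 \<rho>)"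
proof -
  have "{..2::nat} = {0, 1, 2}" by auto
  then show ?thesis by (simp add: chain_boundary_of)
qed

lemma face_2_vtx:
  "singular_face 2 0 \<rho> (vtx 0) = \<rho> (vtx 1)" "singular_face 2 0 \<rho> (vtx 1) = \<rho> (vtx 2)"
  "singular_face 2 1 \<rho> (vtx 0) = \<rho> (vtx 0)" "singular_face 2 1 \<rho> (vtx 1) = \<rho> (vtx 2)"
  "singular_face 2 2 \<rho> (vtx 0) = \<rho> (vtx 0)" "singular_face 2 2 \<rho> (vtx 1) = \<rho> (vtx 1)"
  using face_vtx[of _ 1 _ \<rho>] by (simp_all add: numeral_2_eq_2)

section \<open>The space of a family of faces\<close>

abbreviation T where "T \<equiv> powertop_real (UNIV :: nat set)"

definition face_of :: "nat \<Rightarrow> (nat \<Rightarrow> real) \<Rightarrow> nat set" where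
  "face_of n y = {i \<in> {0..n}. y i \<noteq> 0}"

text \<open>An explicit form of the realisation: the coordinate \<open>Suc n\<close> is the height in the cone, and the
  apex is the only point with empty face.\<close>

definition cell_space :: "nat \<Rightarrow> nat set set \<Rightarrow> (nat \<Rightarrow> real) set" where
  "cell_space n W = {y \<in> standard_simplex (Suc n). face_of n y \<in> W \<and> ({} \<notin> W \<longrightarrow> y (Suc n) = 0)}"

lemma std_nonneg: "y \<in> standard_simplex p \<Longrightarrow> 0 \<le> y i"
  and std_le_1: "y \<in> standard_simplex p \<Longrightarrow> y i \<le> 1"
  and std_above: "y \<in> standard_simplex p \<Longrightarrow> p < i \<Longrightarrow> y i = 0"
  and std_sum: "y \<in> standard_simplex p \<Longrightarrow> (\<Sum>i\<le>p. y i) = 1"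
  by (auto simp: standard_simplex_def)

lemma cell_in_cell_space:
  assumes f: "f \<in> W" "f \<subseteq> {0..n}" and y: "y \<in> cell n X f"
  shows "y \<in> standard_simplex (Suc n)" "face_of n y = f" "y (Suc n) = 0"
proof -
  have yn: "y \<in> standard_simplex n" and yf: "\<And>i. y i \<noteq> 0 \<longleftrightarrow> i \<in> f" using y by (auto simp: cell_def realization_def)
  show "y \<in> standard_simplex (Suc n)" using standard_simplex_mono[of n "Suc n"] yn by auto
  show "face_of n y = f" using f(2) yf by (auto simp: face_of_def)
  show "y (Suc n) = 0" using std_above[OF yn] by simp
qed

lemma apex_std: "apex n \<in> standard_simplex (Suc n)"
  using basis_in_standard_simplex[of "Suc n" "Suc n"] by (simp add: apex_def)

lemma face_of_apex: "face_of n (apex n) = {}" by (auto simp: face_of_def apex_def)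

lemma std_lower:
  assumes y: "y \<in> standard_simplex (Suc n)" and t: "y (Suc n) < 1"
    and \<alpha>_def: "\<alpha> = (\<lambda>i. if i \<le> n then y i / (1 - y (Suc n)) else 0)"
  shows "\<alpha> \<in> standard_simplex n" "y = (\<lambda>i. (1 - y (Suc n)) * \<alpha> i + y (Suc n) * apex n i)"
proof -
  have s: "(\<Sum>i\<le>n. y i) = 1 - y (Suc n)" using std_sum[OF y] by simp
  have le: "y i \<le> 1 - y (Suc n)" if "i \<le> n" for i
    unfolding s[symmetric] by (rule member_le_sum) (use that std_nonneg[OF y] in auto)
  have "(\<Sum>i\<le>n. \<alpha> i) = (\<Sum>i\<le>n. y i) / (1 - y (Suc n))" by (simp add: \<alpha>_def sum_divide_distrib)
  then have "(\<Sum>i\<le>n. \<alpha> i) = 1" using t s by simp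
  then show "\<alpha> \<in> standard_simplex n"
    using t le std_nonneg[OF y] by (auto simp: standard_simplex_def \<alpha>_def)
  show "y = (\<lambda>i. (1 - y (Suc n)) * \<alpha> i + y (Suc n) * apex n i)"
  proof
    fix i
    consider "i \<le> n" | "i = Suc n" | "Suc n < i" by linarith
    then show "y i = (1 - y (Suc n)) * \<alpha> i + y (Suc n) * apex n i"
      using t std_above[OF y] by cases (auto simp: \<alpha>_def apex_def)
  qed
qed

text \<open>Scaling the base coordinates of a point below the apex of the cone gives its projection to the
  base.\<close>

lemma space_of_eq:
  assumes W: "W \<subseteq> X" "W \<subseteq> Pow {0..n}"
  shows "space_of n X W = cell_space n W"
proof -
  define U where "U = (\<Union>f\<in>W - {{}}. cell n X f)"
  have Wn: "f \<in> W \<Longrightarrow> f \<subseteq> {0..n}" for f using W by auto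
  have US: "y \<in> standard_simplex (Suc n) \<and> face_of n y \<in> W - {{}} \<and> y (Suc n) = 0" if y: "y \<in> U" for y
  proof -
    obtain f where f: "f \<in> W" "f \<noteq> {}" "y \<in> cell n X f" using y unfolding U_def by blast
    then show ?thesis using cell_in_cell_space[OF f(1) Wn[OF f(1)] f(3)] by simp
  qed
  have SU: "y \<in> U" if y: "y \<in> standard_simplex n" "face_of n y \<in> W" "face_of n y \<noteq> {}" for y
  proof -
    have "{i. y i \<noteq> 0} = face_of n y" using std_above[OF y(1)] by (auto simp: face_of_def not_less[symmetric])
    then have "y \<in> cell n X (face_of n y)" using y W by (auto simp: cell_def realization_def)
    then show ?thesis unfolding U_def using y by blast
  qed
  show ?thesis
  proof (cases "{} \<in> W")
    case False
    have "y \<in> U" if y: "y \<in> cell_space n W" for y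
    proof (rule SU)
      have y': "y \<in> standard_simplex (Suc n)" "face_of n y \<in> W" "y (Suc n) = 0"
        using y False by (auto simp: cell_space_def)
      show "face_of n y \<in> W" by fact
      show "face_of n y \<noteq> {}" using y'(2) False by metis
      have "y i = 0" if "n < i" for i using std_above[OF y'(1), of i] y'(3) that by (cases "i = Suc n") auto
      then show "y \<in> standard_simplex n" using y'(1,3) by (auto simp: standard_simplex_def)
    qed
    moreover have "y \<in> cell_space n W" if "y \<in> U" for y
      using US[OF that] False by (simp add: cell_space_def)
    ultimately show ?thesis unfolding space_of_def U_def[symmetric] Let_def using False by auto
  next
    case True
    have "y \<in> cell_space n W" if y: "y \<in> geom_cone n U" for y
    proof -
      have "y \<in> standard_simplex (Suc n) \<and> face_of n y \<in> W"
      proof (cases "y = apex n")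
        case True
        then show ?thesis using apex_std face_of_apex \<open>{} \<in> W\<close> by simp
      next
        case False
        then obtain \<alpha> t where \<alpha>: "\<alpha> \<in> U" "0 \<le> t" "t \<le> 1" "y = (\<lambda>i. (1 - t) * \<alpha> i + t * apex n i)"
          using y unfolding geom_cone_def by blast
        note \<alpha>S = US[OF \<alpha>(1)]
        have "y \<in> standard_simplex (Suc n)"
          unfolding \<alpha>(4) by (rule convex_standard_simplex) (use \<alpha>S apex_std \<alpha> in auto)
        moreover have "face_of n y = (if t = 1 then {} else face_of n \<alpha>)"
          unfolding \<alpha>(4) by (auto simp: face_of_def apex_def)
        ultimately show ?thesis using \<alpha>S \<open>{} \<in> W\<close> by simp
      qed
      then show ?thesis using True by (simp add: cell_space_def)
    qed
    moreover have "y \<in> geom_cone n U" if y: "y \<in> cell_space n W" for y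
    proof -
      have y': "y \<in> standard_simplex (Suc n)" "face_of n y \<in> W" using y by (auto simp: cell_space_def)
      show ?thesis
      proof (cases "face_of n y = {}")
        case True
        then have z: "y i = 0" if "i \<le> n" for i using that by (auto simp: face_of_def)
        then have "y (Suc n) = 1" using std_sum[OF y'(1)] by simp
        moreover have "y i = 0" if "i \<noteq> Suc n" for i
          using z[of i] std_above[OF y'(1), of i] that by (cases "i \<le> n") auto
        ultimately have "y = apex n" by (auto simp: apex_def fun_eq_iff)
        then show ?thesis by (simp add: geom_cone_def)
      next
        case False
        \<comment> \<open>at height 1 all base coordinates vanish\<close>
        have "y (Suc n) \<noteq> 1"
        proof
          assume 1: "y (Suc n) = 1"
          then have "(\<Sum>i\<le>n. y i) = 0" using std_sum[OF y'(1)] by simp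
          then have "\<forall>i\<le>n. y i = 0" using sum_nonneg_eq_0_iff[of "{..n}" y] std_nonneg[OF y'(1)] by auto
          then show False using False by (auto simp: face_of_def)
        qed
        then have t1: "y (Suc n) < 1" using std_le_1[OF y'(1), of "Suc n"] by simp
        define \<alpha> where "\<alpha> = (\<lambda>i. if i \<le> n then y i / (1 - y (Suc n)) else 0)"
        note low = std_lower[OF y'(1) t1 \<alpha>_def]
        have "face_of n \<alpha> = face_of n y" using t1 by (auto simp: face_of_def \<alpha>_def)
        then have \<alpha>: "\<alpha> \<in> U" using SU[OF low(1)] y'(2) False by simp
        have "\<exists>\<alpha>' t. y = (\<lambda>i. (1 - t) * \<alpha>' i + t * apex n i) \<and> \<alpha>' \<in> U \<and> 0 \<le> t \<and> t \<le> 1"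
          by (rule exI[of _ \<alpha>], rule exI[of _ "y (Suc n)"], intro conjI,
              rule low(2), rule \<alpha>, rule std_nonneg[OF y'(1)], rule std_le_1[OF y'(1)])
        then show ?thesis unfolding geom_cone_def by (intro insertI2 CollectI)
      qed
    qed
    ultimately show ?thesis unfolding space_of_def U_def[symmetric] Let_def using True by auto
  qed
qed

lemma cell_spaceD: "y \<in> cell_space n W \<Longrightarrow> y \<in> standard_simplex (Suc n)" "y \<in> cell_space n W \<Longrightarrow> face_of n y \<in> W"
  by (simp_all add: cell_space_def)

text \<open>The face of a convex combination is the union of the faces of the points that occur in it. It
  lies between one of them and \<open>h\<close>.\<close>

lemma cell_space_combination:
  assumes conv: "\<And>f g h. f \<in> W \<Longrightarrow> h \<in> W \<Longrightarrow> f \<subseteq> g \<Longrightarrow> g \<subseteq> h \<Longrightarrow> g \<in> W"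
    and l: "\<And>j. j \<le> p \<Longrightarrow> l j \<in> cell_space n W" "\<And>j. j \<le> p \<Longrightarrow> face_of n (l j) \<subseteq> h" and h: "h \<in> W"
    and x: "x \<in> standard_simplex p"
  shows "(\<lambda>i. \<Sum>j\<le>p. l j i * x j) \<in> cell_space n W"
    and "(\<And>j. j \<le> p \<Longrightarrow> f \<subseteq> face_of n (l j)) \<Longrightarrow> f \<subseteq> face_of n (\<lambda>i. \<Sum>j\<le>p. l j i * x j)"
proof -
  let ?y = "\<lambda>i. \<Sum>j\<le>p. l j i * x j"
  have x0: "0 \<le> x j" for j by (rule std_nonneg[OF x])
  have x1: "(\<Sum>j\<le>p. x j) = 1" by (rule std_sum[OF x])
  have ls: "l j \<in> standard_simplex (Suc n)" if "j \<le> p" for j by (rule cell_spaceD(1)[OF l(1)[OF that]])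
  have l0: "0 \<le> l j i" "l j i \<le> 1" if "j \<le> p" for i j using std_nonneg[OF ls[OF that]] std_le_1[OF ls[OF that]] by auto
  have y0: "?y i = 0 \<longleftrightarrow> (\<forall>j\<le>p. l j i = 0 \<or> x j = 0)" for i
    by (subst sum_nonneg_eq_0_iff) (use l0 x0 in auto)
  have "(\<Sum>i\<le>Suc n. ?y i) = (\<Sum>j\<le>p. (\<Sum>i\<le>Suc n. l j i) * x j)"
    by (subst sum.swap) (simp only: sum_distrib_right)
  also have "\<dots> = (\<Sum>j\<le>p. x j)" by (rule sum.cong) (use std_sum[OF ls] in auto)
  finally have ysum: "(\<Sum>i\<le>Suc n. ?y i) = 1" using x1 by simp
  have ystd: "?y \<in> standard_simplex (Suc n)"
    unfolding standard_simplex_def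
  proof (intro CollectI conjI allI impI)
    fix i
    show "0 \<le> ?y i" by (rule sum_nonneg) (use l0 x0 in auto)
    have "?y i \<le> (\<Sum>j\<le>p. 1 * x j)" by (rule sum_mono, rule mult_right_mono) (use l0 x0 in auto)
    then show "?y i \<le> 1" using x1 by simp
    show "?y i = 0" if "Suc n < i" unfolding y0 using std_above[OF ls that] by blast
  next
    show "(\<Sum>i\<le>Suc n. ?y i) = 1" by (rule ysum)
  qed
  obtain j0 where j0: "j0 \<le> p" "x j0 \<noteq> 0"
  proof (rule ccontr)
    assume "\<not> thesis"
    then have "\<forall>j\<le>p. x j = 0" using that by blast
    then show False using x1 by simp
  qed
  have lo: "face_of n (l j0) \<subseteq> face_of n ?y" using j0 by (auto simp: face_of_def y0)
  have hi: "face_of n ?y \<subseteq> h"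
  proof
    fix i assume i: "i \<in> face_of n ?y"
    then obtain j where "j \<le> p" "l j i \<noteq> 0" by (auto simp: face_of_def y0)
    then have "i \<in> face_of n (l j)" using i by (simp add: face_of_def)
    then show "i \<in> h" using l(2) \<open>j \<le> p\<close> by blast
  qed
  have "face_of n ?y \<in> W" by (rule conv[OF cell_spaceD(2)[OF l(1)[OF j0(1)]] h lo hi])
  moreover have "?y (Suc n) = 0" if "{} \<notin> W"
    using l(1) that by (simp add: y0 cell_space_def)
  ultimately show "?y \<in> cell_space n W" using ystd by (simp add: cell_space_def)
  show "f \<subseteq> face_of n ?y" if "\<And>j. j \<le> p \<Longrightarrow> f \<subseteq> face_of n (l j)"
    using that[OF j0(1)] lo by blast
qed

text \<open>The barycentre of a face; the empty face is represented by the apex.\<close>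

definition bary :: "nat \<Rightarrow> nat set \<Rightarrow> nat \<Rightarrow> real" where
  "bary n f = (if f = {} then apex n else (\<lambda>i. if i \<in> f then 1 / real (card f) else 0))"

lemma bary_cell:
  assumes f: "f \<subseteq> {0..n}"
  shows "face_of n (bary n f) = f" "f \<in> W \<Longrightarrow> bary n f \<in> cell_space n W"
proof -
  have fin: "finite f" using f finite_subset by blast
  show fo: "face_of n (bary n f) = f"
    using f fin face_of_apex by (auto simp: bary_def face_of_def apex_def)
  assume fW: "f \<in> W"
  show "bary n f \<in> cell_space n W"
  proof (cases "f = {}")
    case True
    then show ?thesis using apex_std face_of_apex fW by (simp add: bary_def cell_space_def)
  next
    case False
    have c: "0 < card f" using False fin by (simp add: card_gt_0_iff)
    have "(\<Sum>i\<le>Suc n. if i \<in> f then 1 / real (card f) else 0) = (\<Sum>i\<in>f. 1 / real (card f))"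
      by (rule sum.mono_neutral_cong_right) (use f in auto)
    also have "\<dots> = 1" using c by simp
    finally have "bary n f \<in> standard_simplex (Suc n)"
      using False c f by (auto simp: bary_def standard_simplex_def)
    moreover have "bary n f (Suc n) = 0" using False f by (auto simp: bary_def)
    ultimately show ?thesis using fo fW by (simp add: cell_space_def)
  qed
qed

definition seg :: "(nat \<Rightarrow> real) \<Rightarrow> (nat \<Rightarrow> real) \<Rightarrow> (nat \<Rightarrow> real) \<Rightarrow> nat \<Rightarrow> real" where
  "seg y z = oriented_simplex 1 (\<lambda>j. if j = 0 then y else z)"

definition tri :: "(nat \<Rightarrow> real) \<Rightarrow> (nat \<Rightarrow> real) \<Rightarrow> (nat \<Rightarrow> real) \<Rightarrow> (nat \<Rightarrow> real) \<Rightarrow> nat \<Rightarrow> real" where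
  "tri w y z = oriented_simplex 2 (\<lambda>j. if j = 0 then w else if j = 1 then y else z)"

lemma tri_faces:
  "singular_face 2 0 (tri w y z) = seg y z" "singular_face 2 1 (tri w y z) = seg w z"
  "singular_face 2 2 (tri w y z) = seg w y"
  unfolding tri_def seg_def
  by (simp_all add: singular_face_oriented_simplex oriented_simplex_eq)

lemma oriented_simplex_vtx: "i \<le> p \<Longrightarrow> oriented_simplex p l (vtx i) = l i"
proof -
  assume i: "i \<le> p"
  have "(\<Sum>j\<le>p. l j k * vtx i j) = (\<Sum>j\<le>p. if j = i then l j k else 0)" for k
    by (rule sum.cong) (auto simp: vtx_def)
  then show ?thesis using i by (simp add: oriented_simplex_def fun_eq_iff)
qed

lemma seg_vtx [simp]: "seg y z (vtx 0) = y" "seg y z (vtx 1) = z"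
  by (simp_all add: seg_def oriented_simplex_vtx del: One_nat_def)

lemma oriented_simplex_cell_space:
  assumes "\<And>f g h. f \<in> W \<Longrightarrow> h \<in> W \<Longrightarrow> f \<subseteq> g \<Longrightarrow> g \<subseteq> h \<Longrightarrow> g \<in> W"
    "\<And>j. j \<le> p \<Longrightarrow> l j \<in> cell_space n W" "\<And>j. j \<le> p \<Longrightarrow> face_of n (l j) \<subseteq> h" "h \<in> W"
  shows "singular_simplex p (subtopology T (cell_space n W)) (oriented_simplex p l)"
proof (rule simplicial_imp_singular_simplex)
  have "(\<lambda>i. \<Sum>j\<le>p. l j i * x j) \<in> cell_space n W" if "x \<in> standard_simplex p" for x
    by (rule cell_space_combination(1)[OF assms that])
  then show "simplicial_simplex p (cell_space n W) (oriented_simplex p l)"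
    unfolding simplicial_simplex_oriented_simplex by blast
qed

lemma openin_face_of:
  assumes f: "f \<subseteq> {0..n}"
  shows "openin (subtopology T S) {y \<in> S. f \<subseteq> face_of n y}"
proof -
  have fin: "finite f" using f finite_subset by blast
  have "continuous_map T euclideanreal (\<lambda>y. \<Prod>i\<in>f. y i)"
    by (rule continuous_map_prod[OF fin]) (rule continuous_map_product_projection, simp)
  then have c: "continuous_map (subtopology T S) euclideanreal (\<lambda>y. \<Prod>i\<in>f. y i)"
    by (rule continuous_map_from_subtopology)
  have "open (- {0 :: real})" by (intro open_Compl closed_singleton)
  then have "openin euclideanreal (- {0})" by simp
  from openin_continuous_map_preimage[OF c this]
  have "openin (subtopology T S) {y \<in> S. (\<Prod>i\<in>f. y i) \<in> - {0}}" by simp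
  moreover have "f \<subseteq> face_of n y \<longleftrightarrow> (\<Prod>i\<in>f. y i) \<in> - {0}" for y :: "nat \<Rightarrow> real"
    using f fin by (auto simp: face_of_def)
  ultimately show ?thesis by simp
qed

section \<open>Cohomology in degree zero\<close>

text \<open>The sets \<open>N\<close> and \<open>Nt\<close> of a degree are of this kind. Convexity of \<open>F\<close> keeps segments inside the
  space, and \<open>G\<close> is upward closed in \<open>F\<close>.\<close>

locale face_pair =
  fixes n :: nat and F G :: "nat set set"
  assumes F_sub: "F \<subseteq> Pow {0..n}" and G_F: "G \<subseteq> F"
    and F_conv: "f \<in> F \<Longrightarrow> h \<in> F \<Longrightarrow> f \<subseteq> g \<Longrightarrow> g \<subseteq> h \<Longrightarrow> g \<in> F"
    and G_up: "f \<in> G \<Longrightarrow> f \<subseteq> g \<Longrightarrow> g \<in> F \<Longrightarrow> g \<in> G"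
begin

abbreviation YS where "YS \<equiv> cell_space n F"
abbreviation ZS where "ZS \<equiv> cell_space n G"
abbreviation Y where "Y \<equiv> subtopology T YS"
abbreviation fo where "fo \<equiv> face_of n"
abbreviation bar where "bar \<equiv> bary n"
abbreviation coc where "coc \<equiv> face_cocycles F G"

lemma G_conv: "f \<in> G \<Longrightarrow> h \<in> G \<Longrightarrow> f \<subseteq> g \<Longrightarrow> g \<subseteq> h \<Longrightarrow> g \<in> G"
  using G_up[of f g] F_conv[of f h g] subsetD[OF G_F, of f] subsetD[OF G_F, of h] by blast

lemma Z_Y: "ZS \<subseteq> YS"
  using G_F by (auto simp: cell_space_def)

end

lemma restrict_cocycleI:
  assumes "\<And>a b. singular_chain p X a \<Longrightarrow> singular_chain p X b \<Longrightarrow> t (a + b) = t a + t b"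
    and "\<And>c. singular_chain p (subtopology X S) c \<Longrightarrow> t c = 0"
    and "\<And>c. singular_chain (Suc p) X c \<Longrightarrow> t (chain_boundary (Suc p) c) = 0"
  shows "(\<lambda>c\<in>singular_chain_set p X. t c) \<in> carrier (cocycles p X S)"
proof -
  have "singular_chain p X c" if "singular_chain p (subtopology X S) c" for c
    using that by (simp add: singular_chain_subtopology)
  then have "(\<lambda>c\<in>singular_chain_set p X. t c) \<in> carrier (cochains p X S)"
    unfolding cochains_iff using assms(1,2) by (simp add: singular_chain_add)
  then show ?thesis unfolding cocycles_iff using assms(3) by (simp add: singular_chain_boundary_alt)
qed

context face_pair begin

lemma F_n: "f \<in> F \<Longrightarrow> f \<subseteq> {0..n}" using F_sub by blast
lemma G_in_F: "f \<in> G \<Longrightarrow> f \<in> F" using G_F by blast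

lemma Z_sub: "subtopology Y ZS = subtopology T ZS"
  using Z_Y by (simp add: subtopology_subtopology Int_absorb1)

lemma bar_Y: "f \<in> F \<Longrightarrow> bar f \<in> YS" using bary_cell(2)[OF F_n] by blast
lemma bar_Z: "f \<in> G \<Longrightarrow> bar f \<in> ZS" using bary_cell(2)[OF F_n[OF G_in_F]] by blast
lemma fo_bar: "f \<in> F \<Longrightarrow> fo (bar f) = f" by (rule bary_cell(1)[OF F_n])
lemma fo_F: "y \<in> YS \<Longrightarrow> fo y \<in> F" by (rule cell_spaceD(2))
lemma fo_G: "y \<in> ZS \<Longrightarrow> fo y \<in> G" by (rule cell_spaceD(2))

lemma seg_Y:
  assumes "y \<in> YS" "z \<in> YS" "fo y \<subseteq> fo z"
  shows "singular_simplex 1 Y (seg y z)"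
  unfolding seg_def
  by (rule oriented_simplex_cell_space[where h="fo z", OF F_conv]) (use assms fo_F in auto)

lemma seg_Z:
  assumes "y \<in> ZS" "z \<in> ZS" "fo y \<subseteq> fo z"
  shows "singular_simplex 1 (subtopology T ZS) (seg y z)"
  unfolding seg_def
  by (rule oriented_simplex_cell_space[where h="fo z", OF G_conv]) (use assms fo_G in auto)

lemma tri_Y:
  assumes "w \<in> YS" "y \<in> YS" "z \<in> YS" "fo w \<subseteq> fo z" "fo y \<subseteq> fo z"
  shows "singular_simplex 2 Y (tri w y z)"
  unfolding tri_def
  by (rule oriented_simplex_cell_space[where h="fo z", OF F_conv]) (use assms fo_F in auto)

definition face_val :: "(nat set \<Rightarrow> complex) \<Rightarrow> ((nat \<Rightarrow> real) \<Rightarrow> nat \<Rightarrow> real) \<Rightarrow> complex" where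
  "face_val \<mu> \<sigma> = \<mu> (fo (\<sigma> (vtx 0)))"

text \<open>The function is continuous to a discrete space because the sets of points whose face contains
  \<open>f\<close> are open, and a path is connected.\<close>

lemma face_constant_on_paths:
  assumes \<mu>: "\<mu> \<in> face_constants F G" and \<sigma>: "singular_simplex 1 Y \<sigma>"
  shows "\<mu> (fo (\<sigma> (vtx 0))) = \<mu> (fo (\<sigma> (vtx 1)))"
proof -
  have con: "continuous_map Y (discrete_topology UNIV) (\<lambda>y. \<mu> (fo y))"
    unfolding continuous_map_def
  proof (intro conjI allI impI)
    fix A :: "complex set"
    have "{y \<in> topspace Y. \<mu> (fo y) \<in> A} = (\<Union>f\<in>{f \<in> F. \<mu> f \<in> A}. {y \<in> YS. f \<subseteq> fo y})"
    proof (rule Set.set_eqI)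
      fix y
      have "y \<in> YS \<and> \<mu> (fo y) \<in> A \<longleftrightarrow> (\<exists>f\<in>{f \<in> F. \<mu> f \<in> A}. y \<in> YS \<and> f \<subseteq> fo y)"
      proof
        assume "y \<in> YS \<and> \<mu> (fo y) \<in> A"
        then show "\<exists>f\<in>{f \<in> F. \<mu> f \<in> A}. y \<in> YS \<and> f \<subseteq> fo y"
          by (intro bexI[of _ "fo y"]) (simp_all add: fo_F)
      next
        assume "\<exists>f\<in>{f \<in> F. \<mu> f \<in> A}. y \<in> YS \<and> f \<subseteq> fo y"
        then obtain f where f: "f \<in> F" "\<mu> f \<in> A" "y \<in> YS" "f \<subseteq> fo y" by blast
        have "\<mu> f = \<mu> (fo y)" by (rule face_constants_eq[OF \<mu> f(1) fo_F[OF f(3)] f(4)])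
        then show "y \<in> YS \<and> \<mu> (fo y) \<in> A" using f(2,3) by simp
      qed
      then show "y \<in> {y \<in> topspace Y. \<mu> (fo y) \<in> A} \<longleftrightarrow> y \<in> (\<Union>f\<in>{f \<in> F. \<mu> f \<in> A}. {y \<in> YS. f \<subseteq> fo y})"
        by simp
    qed
    moreover have "openin Y (\<Union>f\<in>{f \<in> F. \<mu> f \<in> A}. {y \<in> YS. f \<subseteq> fo y})"
      by (intro openin_Union ballI) (use openin_face_of F_n in auto)
    ultimately show "openin Y {y \<in> topspace Y. \<mu> (fo y) \<in> A}" by simp
  qed simp
  have "connectedin (subtopology T (standard_simplex 1)) (standard_simplex 1)"
    using connectedin_standard_simplex by (simp add: connectedin_subtopology)
  then have "connectedin Y (\<sigma> ` standard_simplex 1)"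
    using \<sigma> connectedin_continuous_map_image unfolding singular_simplex_def by blast
  then have "connectedin (discrete_topology UNIV) ((\<lambda>y. \<mu> (fo y)) ` \<sigma> ` standard_simplex 1)"
    by (rule connectedin_continuous_map_image[OF con])
  then obtain z where "(\<lambda>y. \<mu> (fo y)) ` \<sigma> ` standard_simplex 1 \<subseteq> {z}"
    unfolding connectedin_discrete_topology by blast
  moreover have "vtx 0 \<in> standard_simplex 1" "vtx 1 \<in> standard_simplex 1" by simp_all
  ultimately show ?thesis by blast
qed

lemma face_val_cochain:
  assumes "\<And>f. f \<in> G \<Longrightarrow> \<mu> f = 0"
  shows "(\<lambda>c\<in>singular_chain_set 0 Y. pair (face_val \<mu>) c) \<in> carrier (cochains 0 Y ZS)"
proof (rule pair_cochain)
  fix \<sigma> assume "singular_simplex 0 (subtopology Y ZS) \<sigma>"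
  then have "\<sigma> (vtx 0) \<in> ZS" unfolding Z_sub using singular_0_topspace by fastforce
  then show "face_val \<mu> \<sigma> = 0" using assms fo_G by (simp add: face_val_def)
qed

lemma face_val_cocycle:
  assumes \<mu>: "\<mu> \<in> face_constants F G"
  shows "(\<lambda>c\<in>singular_chain_set 0 Y. pair (face_val \<mu>) c) \<in> carrier (cocycles 0 Y ZS)"
  unfolding cocycles_iff
proof (intro conjI allI impI)
  show "(\<lambda>c\<in>singular_chain_set 0 Y. pair (face_val \<mu>) c) \<in> carrier (cochains 0 Y ZS)"
    by (rule face_val_cochain) (rule face_constants_zero[OF \<mu>])
  fix c assume c: "singular_chain (Suc 0) Y c"
  have "pair (face_val \<mu>) (chain_boundary 1 c) = 0"
    using c[unfolded singular_chain_def]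
  proof (induction rule: frag_induction)
    case (one \<sigma>)
    then have s: "singular_simplex 1 Y \<sigma>" by simp
    show ?case
      unfolding boundary_1[OF s] pair_diff pair_of face_val_def point_apply
      using face_constant_on_paths[OF \<mu> s] by simp
  qed (simp_all add: chain_boundary_diff pair_diff)
  then show "(\<lambda>c\<in>singular_chain_set 0 Y. pair (face_val \<mu>) c) (chain_boundary (Suc 0) c) = 0"
    using singular_chain_boundary_alt[OF c] by simp
qed

text \<open>A 0-cocycle takes the same value at a point and at the centre of its face, since the segment
  between them stays in the space.\<close>

lemma cocycle_0_face:
  assumes \<phi>: "\<phi> \<in> carrier (cocycles 0 Y ZS)"
  shows "\<exists>\<mu>\<in>face_constants F G. \<forall>c. singular_chain 0 Y c \<longrightarrow> \<phi> c = pair (face_val \<mu>) c"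
proof -
  have \<phi>c: "\<phi> \<in> carrier (cochains 0 Y ZS)" using \<phi> cocycles_iff by blast
  define p where "p y = \<phi> (frag_of (point y))" for y
  have eq: "p y = p z" if yz: "y \<in> YS" "z \<in> YS" "fo y \<subseteq> fo z" for y z
  proof -
    have s: "singular_simplex 1 Y (seg y z)" by (rule seg_Y[OF yz])
    have "\<phi> (chain_boundary 1 (frag_of (seg y z))) = 0"
      using \<phi> s unfolding cocycles_iff by (simp add: singular_chain_of)
    then have "\<phi> (frag_of (point z) - frag_of (point y)) = 0" unfolding boundary_1[OF s] seg_vtx .
    moreover have "singular_chain 0 Y (frag_of (point z))" "singular_chain 0 Y (frag_of (point y))"
      using singular_point[of z Y] singular_point[of y Y] yz(1,2) by (simp_all add: singular_chain_of)
    ultimately show ?thesis using cochain_diff[OF \<phi>c] by (simp add: p_def)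
  qed
  \<comment> \<open>the value at the centre of a face\<close>
  define \<mu> where "\<mu> f = p (bar f)" for f
  have \<mu>: "\<mu> \<in> face_constants F G"
    unfolding face_constants_def
  proof (intro CollectI conjI ballI impI)
    fix f g assume "f \<in> F" "g \<in> F" "f \<subseteq> g"
    then show "\<mu> f = \<mu> g" unfolding \<mu>_def by (intro eq bar_Y) (simp_all add: fo_bar)
  next
    fix f assume f: "f \<in> G"
    have "singular_chain 0 (subtopology Y ZS) (frag_of (point (bar f)))"
      unfolding Z_sub using singular_point[of "bar f" "subtopology T ZS"] bar_Z[OF f] by (simp add: singular_chain_of)
    then show "\<mu> f = 0" unfolding \<mu>_def p_def by (rule cochain_vanish[OF \<phi>c])
  qed
  have "\<phi> c = pair (face_val \<mu>) c" if c: "singular_chain 0 Y c" for c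
  proof (rule cochain_agree[OF \<phi>c _ c])
    fix \<sigma> assume s: "singular_simplex 0 Y \<sigma>"
    have y: "\<sigma> (vtx 0) \<in> YS" using singular_0_topspace[OF s] by simp
    have "\<phi> (frag_of \<sigma>) = p (\<sigma> (vtx 0))" unfolding p_def using singular_0_eq[OF s] by simp
    also have "\<dots> = p (bar (fo (\<sigma> (vtx 0))))"
      by (rule eq[symmetric, OF bar_Y[OF fo_F[OF y]] y]) (simp add: fo_bar[OF fo_F[OF y]])
    finally show "\<phi> (frag_of \<sigma>) = face_val \<mu> \<sigma>" by (simp add: face_val_def \<mu>_def)
  qed
  then show ?thesis using \<mu> by blast
qed

lemma face_val_bar: "f \<in> F \<Longrightarrow> pair (face_val \<mu>) (frag_of (point (bar f))) = \<mu> f"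
  by (simp add: face_val_def fo_bar)

lemma bar_chain: "f \<in> F \<Longrightarrow> singular_chain 0 Y (frag_of (point (bar f)))"
  using singular_point[of "bar f" Y] bar_Y by (simp add: singular_chain_of)

lemma face_val_add: "pair (face_val (\<lambda>x. u x + v x)) c = pair (face_val u) c + pair (face_val v) c"
  unfolding pair_fun_add[symmetric] by (rule pair_cong) (simp add: face_val_def)

lemma face_val_scale: "pair (face_val (\<lambda>x. z * u x)) c = z * pair (face_val u) c"
  unfolding pair_fun_scale[symmetric] by (rule pair_cong) (simp add: face_val_def)

lemma presents_cohomology_0: "presents (face_constants F G) (vanishing F) (cohomology 0 Y ZS)"
  unfolding cohomology_def
proof (rule presents_cocycle_quotient[where t="\<lambda>\<mu>. pair (face_val \<mu>)"])
  have B: "coboundaries 0 Y ZS = {\<lambda>c\<in>singular_chain_set 0 Y. 0}" by (simp add: coboundaries_def)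
  show "coboundaries 0 Y ZS \<subseteq> carrier (cocycles 0 Y ZS)" unfolding B using cocycles_zero by blast
  show "(\<lambda>c\<in>singular_chain_set 0 Y. 0) \<in> coboundaries 0 Y ZS" unfolding B by blast
  show "(\<lambda>c\<in>singular_chain_set 0 Y. y * \<phi> c + z * \<psi> c) \<in> coboundaries 0 Y ZS"
    if "\<phi> \<in> coboundaries 0 Y ZS" "\<psi> \<in> coboundaries 0 Y ZS" for \<phi> \<psi> y z
    using that unfolding B by (auto intro!: restrict_ext)
  show "\<exists>u\<in>face_constants F G. \<exists>\<beta>\<in>coboundaries 0 Y ZS. \<forall>c. singular_chain 0 Y c \<longrightarrow> \<phi> c = \<beta> c + pair (face_val u) c"
    if \<phi>: "\<phi> \<in> carrier (cocycles 0 Y ZS)" for \<phi>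
    using cocycle_0_face[OF \<phi>] unfolding B by simp
  show "(\<lambda>c\<in>singular_chain_set 0 Y. pair (face_val \<mu>) c) \<in> coboundaries 0 Y ZS \<longleftrightarrow> \<mu> \<in> vanishing F"
    if \<mu>: "\<mu> \<in> face_constants F G" for \<mu>
  proof
    assume "(\<lambda>c\<in>singular_chain_set 0 Y. pair (face_val \<mu>) c) \<in> coboundaries 0 Y ZS"
    then have z: "(\<lambda>c\<in>singular_chain_set 0 Y. pair (face_val \<mu>) c) = (\<lambda>c\<in>singular_chain_set 0 Y. 0)" unfolding B by (rule singletonD)
    have "\<mu> f = 0" if f: "f \<in> F" for f
      using fun_cong[OF z, of "frag_of (point (bar f))"] bar_chain[OF f] face_val_bar[OF f, of \<mu>] by simp
    then show "\<mu> \<in> vanishing F" unfolding vanishing_def by blast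
  next
    assume v: "\<mu> \<in> vanishing F"
    have "pair (face_val \<mu>) c = 0" if c: "singular_chain 0 Y c" for c
    proof (rule pair_eq_0)
      fix \<sigma> assume "\<sigma> \<in> Poly_Mapping.keys c"
      then have "singular_simplex 0 Y \<sigma>" using c by (auto simp: singular_chain_def)
      then have "fo (\<sigma> (vtx 0)) \<in> F" using singular_0_topspace fo_F by fastforce
      then show "face_val \<mu> \<sigma> = 0" using v by (simp add: face_val_def vanishing_def)
    qed
    then show "(\<lambda>c\<in>singular_chain_set 0 Y. pair (face_val \<mu>) c) \<in> coboundaries 0 Y ZS"
      unfolding B by (auto intro!: restrict_ext)
  qed
qed (simp_all only: face_constants_subspace face_val_cocycle face_val_add face_val_scale)

text \<open>The augmentation consists of the constant functions.\<close>

lemma presents_reduced_cohomology_0: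
  assumes G0: "G = {}"
  shows "presents (face_constants F G) (constants F) (reduced_cohomology 0 Y)"
proof -
  have Z0: "ZS = {}" by (simp add: cell_space_def G0)
  have red: "reduced_cohomology 0 Y = quot_module (cocycles 0 Y ZS) (range (augmentation Y))"
    by (simp add: reduced_cohomology_def Z0)
  have aug: "augmentation Y z = (\<lambda>c\<in>singular_chain_set 0 Y. pair (\<lambda>_. z) c)" for z
    unfolding augmentation_def
    by (rule restrict_ext) (simp add: pair_def sum_distrib_left[symmetric] sum_distrib_right[symmetric] mult.commute)
  have const: "(\<lambda>c\<in>singular_chain_set 0 Y. pair (\<lambda>_. z) c) = (\<lambda>c\<in>singular_chain_set 0 Y. pair (face_val (\<lambda>_. z)) c)" for z
    by (rule restrict_ext, rule pair_cong) (simp add: face_val_def)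
  have cc: "(\<lambda>_. z) \<in> face_constants F G" for z by (simp add: face_constants_def G0)
  show ?thesis
    unfolding red
  proof (rule presents_cocycle_quotient[where t="\<lambda>\<mu>. pair (face_val \<mu>)"])
    show "range (augmentation Y) \<subseteq> carrier (cocycles 0 Y ZS)"
      unfolding aug const using face_val_cocycle[OF cc] by blast
    have "(\<lambda>c\<in>singular_chain_set 0 Y. 0) = augmentation Y 0"
      unfolding aug by (rule restrict_ext) (simp add: pair_def)
    then show z: "(\<lambda>c\<in>singular_chain_set 0 Y. 0) \<in> range (augmentation Y)" by blast
    show "(\<lambda>c\<in>singular_chain_set 0 Y. y * \<phi> c + z * \<psi> c) \<in> range (augmentation Y)"
      if \<phi>\<psi>: "\<phi> \<in> range (augmentation Y)" "\<psi> \<in> range (augmentation Y)" for \<phi> \<psi> y z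
    proof -
      obtain r s where rs: "\<phi> = augmentation Y r" "\<psi> = augmentation Y s" using \<phi>\<psi> by blast
      have "(\<lambda>c\<in>singular_chain_set 0 Y. y * \<phi> c + z * \<psi> c) = augmentation Y (y * r + z * s)"
        unfolding rs aug
        by (rule restrict_ext) (simp add: pair_fun_add pair_fun_scale)
      then show ?thesis by blast
    qed
    show "\<exists>u\<in>face_constants F G. \<exists>\<beta>\<in>range (augmentation Y). \<forall>c. singular_chain 0 Y c \<longrightarrow> \<phi> c = \<beta> c + pair (face_val u) c"
      if \<phi>: "\<phi> \<in> carrier (cocycles 0 Y ZS)" for \<phi>
    proof -
      obtain \<mu> where \<mu>: "\<mu> \<in> face_constants F G" "\<forall>c. singular_chain 0 Y c \<longrightarrow> \<phi> c = pair (face_val \<mu>) c"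
        using cocycle_0_face[OF \<phi>] by blast
      have "\<forall>c. singular_chain 0 Y c \<longrightarrow> \<phi> c = (\<lambda>c\<in>singular_chain_set 0 Y. 0) c + pair (face_val \<mu>) c"
        using \<mu>(2) by simp
      then show ?thesis by (intro bexI[OF _ \<mu>(1)] bexI[OF _ z])
    qed
    show "(\<lambda>c\<in>singular_chain_set 0 Y. pair (face_val \<mu>) c) \<in> range (augmentation Y) \<longleftrightarrow> \<mu> \<in> constants F"
      if \<mu>: "\<mu> \<in> face_constants F G" for \<mu>
    proof
      assume "(\<lambda>c\<in>singular_chain_set 0 Y. pair (face_val \<mu>) c) \<in> range (augmentation Y)"
      then obtain z where z: "(\<lambda>c\<in>singular_chain_set 0 Y. pair (face_val \<mu>) c) = (\<lambda>c\<in>singular_chain_set 0 Y. pair (\<lambda>_. z) c)"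
        unfolding aug by blast
      have "\<mu> f = z" if f: "f \<in> F" for f
        using fun_cong[OF z, of "frag_of (point (bar f))"] face_val_bar[OF f, of \<mu>] bar_chain[OF f] by simp
      then show "\<mu> \<in> constants F" unfolding constants_def by blast
    next
      assume "\<mu> \<in> constants F"
      then obtain z where z: "\<And>f. f \<in> F \<Longrightarrow> \<mu> f = z" unfolding constants_def by blast
      have "pair (face_val \<mu>) c = pair (\<lambda>_. z) c" if c: "singular_chain 0 Y c" for c
      proof (rule pair_cong)
        fix \<sigma> assume "\<sigma> \<in> Poly_Mapping.keys c"
        then have "singular_simplex 0 Y \<sigma>" using c by (auto simp: singular_chain_def)
        then have "fo (\<sigma> (vtx 0)) \<in> F" using singular_0_topspace fo_F by fastforce
        then show "face_val \<mu> \<sigma> = z" using z by (simp add: face_val_def)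
      qed
      then have "(\<lambda>c\<in>singular_chain_set 0 Y. pair (face_val \<mu>) c) = augmentation Y z"
        unfolding aug by (intro restrict_ext) simp
      then show "(\<lambda>c\<in>singular_chain_set 0 Y. pair (face_val \<mu>) c) \<in> range (augmentation Y)" by blast
    qed
  qed (simp_all only: face_constants_subspace face_val_cocycle face_val_add face_val_scale)
qed

section \<open>Cohomology in degree one\<close>

text \<open>An open neighbourhood of the open cell of \<open>f\<close> that is star-shaped around its barycentre.\<close>

definition star :: "nat set \<Rightarrow> (nat \<Rightarrow> real) set" where "star f = {y \<in> YS. f \<subseteq> fo y}"

definition small :: "nat \<Rightarrow> nat set set \<Rightarrow> ((nat \<Rightarrow> real) \<Rightarrow> nat \<Rightarrow> real) \<Rightarrow> bool" where
  "small p W \<sigma> \<longleftrightarrow> (\<exists>f\<in>W. \<sigma> ` standard_simplex p \<subseteq> star f)"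

lemma simplex_in_star:
  "singular_simplex p Y \<sigma> \<Longrightarrow> \<sigma> ` standard_simplex p \<subseteq> star f \<Longrightarrow> singular_simplex p (subtopology Y (star f)) \<sigma>"
  by (rule singular_simplex_subtopology[THEN iffD2], rule conjI)

lemma star_simplexD:
  assumes "singular_simplex p (subtopology Y (star f)) \<sigma>" shows "\<sigma> ` standard_simplex p \<subseteq> star f"
  using iffD1[OF singular_simplex_subtopology assms] by (rule conjunct2)

text \<open>The increment of \<open>l\<close> from the face of the starting point to that of the end point, measured
  through their intersection. Inside a star any common face gives the same value
  (\<open>path_val_star\<close>).\<close>

definition path_val :: "(nat set \<times> nat set \<Rightarrow> complex) \<Rightarrow> ((nat \<Rightarrow> real) \<Rightarrow> nat \<Rightarrow> real) \<Rightarrow> complex" where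
  "path_val l \<sigma> = (let f = fo (\<sigma> (vtx 0)); g = fo (\<sigma> (vtx 1)) in l (f \<inter> g, g) - l (f \<inter> g, f))"

lemma path_val_star:
  assumes l: "l \<in> coc" and f: "f \<in> F" and \<sigma>: "\<sigma> (vtx 0) \<in> star f" "\<sigma> (vtx 1) \<in> star f"
  shows "path_val l \<sigma> = l (f, fo (\<sigma> (vtx 1))) - l (f, fo (\<sigma> (vtx 0)))"
proof -
  let ?g = "fo (\<sigma> (vtx 0))" and ?h = "fo (\<sigma> (vtx 1))"
  have g: "?g \<in> F" "f \<subseteq> ?g" and h: "?h \<in> F" "f \<subseteq> ?h" using \<sigma> fo_F by (auto simp: star_def)
  have i: "?g \<inter> ?h \<in> F" by (rule F_conv[OF f g(1)]) (use g h in auto)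
  have fi: "f \<subseteq> ?g \<inter> ?h" using g h by blast
  have "l (f, ?g \<inter> ?h) + l (?g \<inter> ?h, ?g) = l (f, ?g)" by (rule face_cocycles_add[OF l f i g(1) fi]) blast
  moreover have "l (f, ?g \<inter> ?h) + l (?g \<inter> ?h, ?h) = l (f, ?h)" by (rule face_cocycles_add[OF l f i h(1) fi]) blast
  moreover have "z - y = t - s" if "x + y = s" "x + z = t" for x y z s t :: complex using that by auto
  ultimately show ?thesis unfolding path_val_def Let_def by blast
qed

lemma path_val_same: "fo (\<sigma> (vtx 0)) = fo (\<sigma> (vtx 1)) \<Longrightarrow> path_val l \<sigma> = 0"
  by (simp add: path_val_def Let_def)

lemma small_vtx: "\<sigma> ` standard_simplex p \<subseteq> star f \<Longrightarrow> i \<le> p \<Longrightarrow> \<sigma> (vtx i) \<in> star f"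
  using vtx_std by blast

text \<open>Inside one star the increments are differences of a function of the end points.\<close>

lemma path_val_boundary:
  assumes l: "l \<in> coc" and c: "\<And>\<rho>. \<rho> \<in> Poly_Mapping.keys c \<Longrightarrow> small 2 F \<rho>"
  shows "pair (path_val l) (chain_boundary 2 c) = 0"
proof -
  have "Poly_Mapping.keys c \<subseteq> Collect (small 2 F)" using c by blast
  then show ?thesis
  proof (induction rule: frag_induction)
    case (one \<rho>)
    then obtain f where f: "f \<in> F" "\<rho> ` standard_simplex 2 \<subseteq> star f" by (auto simp: small_def)
    have v: "\<rho> (vtx 0) \<in> star f" "\<rho> (vtx 1) \<in> star f" "\<rho> (vtx 2) \<in> star f"
      using small_vtx[OF f(2)] by auto
    show ?case
      unfolding boundary_2 pair_diff pair_add pair_of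
      using path_val_star[OF l f(1), of "singular_face 2 0 \<rho>"] path_val_star[OF l f(1), of "singular_face 2 1 \<rho>"]
        path_val_star[OF l f(1), of "singular_face 2 2 \<rho>"] v
      by (simp only: face_2_vtx) (simp add: algebra_simps)
  qed (simp_all add: chain_boundary_diff pair_diff)
qed

abbreviation sd where "sd p k \<equiv> singular_subdivision p ^^ k"

lemma sd_chain: "singular_chain p X c \<Longrightarrow> singular_chain p X (sd p k c)"
  by (induction k) (simp_all add: singular_chain_singular_subdivision)

lemma sd_diff: "sd p k (c - d) = sd p k c - sd p k d"
  by (rule singular_subdivision_power_diff)

lemma sd_add: "sd p k (c + d) = sd p k c + sd p k d"
  using sd_diff[where p=p and k=k and c=c and d="0 - d"] sd_diff[where p=p and k=k and c=0 and d=d] by (simp add: singular_subdivision_power_0)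

lemma sd_boundary: "singular_chain (Suc p) X c \<Longrightarrow> chain_boundary (Suc p) (sd (Suc p) k c) = sd p k (chain_boundary (Suc p) c)"
proof (induction k)
  case (Suc k)
  then show ?case
    using chain_boundary_singular_subdivision[OF sd_chain[OF Suc.prems, of k]] by simp
qed simp

lemma sd_0: "singular_chain 0 X c \<Longrightarrow> sd 0 k c = c"
  by (induction k) (simp_all add: singular_subdivision_zero)

text \<open>A natural chain homotopy maps a 0-simplex to chains in the one-point space of its image, which
  are multiples of the constant simplex.\<close>

lemma homotopy_on_points:
  assumes hz: "h 0 = 0" and hd: "\<And>c d. h (c - d) = h c - h d"
    and hc: "\<And>X c. singular_chain 0 X c \<Longrightarrow> singular_chain 1 X (h c)"
    and w: "\<And>y. y \<in> topspace X \<Longrightarrow> w (\<lambda>x\<in>standard_simplex 1. y) = 0"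
    and c: "singular_chain 0 X c"
  shows "pair w (h c) = 0"
  using c[unfolded singular_chain_def]
proof (induction rule: frag_induction)
  case zero then show ?case by (simp add: hz)
next
  case (one \<sigma>)
  then have s: "singular_simplex 0 X \<sigma>" by simp
  define y where "y = \<sigma> (vtx 0)"
  have yX: "y \<in> topspace X" unfolding y_def by (rule singular_0_topspace[OF s])
  have t: "topspace (subtopology X {y}) = {y}" using yX by simp
  have "singular_chain 0 (subtopology X {y}) (frag_of \<sigma>)"
    unfolding singular_chain_of using singular_point[of y "subtopology X {y}"] t singular_0_eq[OF s] yX by (simp add: y_def)
  then have "singular_chain 1 (subtopology X {y}) (h (frag_of \<sigma>))" by (rule hc)
  then have k: "Poly_Mapping.keys (h (frag_of \<sigma>)) \<subseteq> {\<lambda>x\<in>standard_simplex 1. y}"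
    using singular_simplex_singleton[OF t] unfolding singular_chain_def by blast
  show ?case by (rule pair_eq_0) (use k w[OF yX] in auto)
next
  case (diff a b) then show ?case by (simp add: hd pair_diff)
qed

text \<open>The subdivision homotopy is natural, so for a simplex inside a star it stays inside the star,
  where boundaries have value 0; its other term consists of constant paths.\<close>

lemma path_val_sd:
  assumes l: "l \<in> coc" and c: "singular_chain 1 Y c" "\<And>\<sigma>. \<sigma> \<in> Poly_Mapping.keys c \<Longrightarrow> small 1 F \<sigma>"
  shows "pair (path_val l) (singular_subdivision 1 c) = pair (path_val l) c"
proof -
  obtain h :: "nat \<Rightarrow> (nat \<Rightarrow> real) chain \<Rightarrow> (nat \<Rightarrow> real) chain" where h:
    "\<And>p. h p 0 = 0" "\<And>p c1 c2. h p (c1 - c2) = h p c1 - h p c2"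
    "\<And>p X c. singular_chain p X c \<Longrightarrow> singular_chain (Suc p) X (h p c)"
    "\<And>p X c. singular_chain p X c \<Longrightarrow>
       chain_boundary (Suc p) (h p c) + h (p - Suc 0) (chain_boundary p c) = singular_subdivision p c - c"
    using chain_homotopic_singular_subdivision by blast
  have "Poly_Mapping.keys c \<subseteq> {\<sigma>. singular_simplex 1 Y \<sigma> \<and> small 1 F \<sigma>}"
    using c by (auto simp: singular_chain_def)
  then show ?thesis
  proof (induction rule: frag_induction)
    case (one \<sigma>)
    then have s: "singular_simplex 1 Y \<sigma>" and "small 1 F \<sigma>" by auto
    then obtain f where f: "f \<in> F" "\<sigma> ` standard_simplex 1 \<subseteq> star f" by (auto simp: small_def)
    let ?U = "subtopology Y (star f)"
    have su: "singular_chain 1 ?U (frag_of \<sigma>)"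
      unfolding singular_chain_of by (rule simplex_in_star[OF s f(2)])
    have "pair (path_val l) (chain_boundary (Suc 1) (h 1 (frag_of \<sigma>))) = 0"
    proof -
      have h1: "singular_chain (Suc 1) ?U (h 1 (frag_of \<sigma>))" by (rule h(3)[OF su])
      have "small 2 F \<rho>" if "\<rho> \<in> Poly_Mapping.keys (h 1 (frag_of \<sigma>))" for \<rho>
      proof -
        have "singular_simplex (Suc 1) ?U \<rho>" using h1 that by (auto simp: singular_chain_def)
        then have "\<rho> ` standard_simplex 2 \<subseteq> star f" using star_simplexD by (simp add: numeral_2_eq_2)
        then show ?thesis unfolding small_def using f(1) by blast
      qed
      then show ?thesis using path_val_boundary[OF l] by (simp add: numeral_2_eq_2)
    qed
    moreover have "pair (path_val l) (h (1 - Suc 0) (chain_boundary 1 (frag_of \<sigma>))) = 0"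
    proof -
      have "pair (path_val l) (h 0 (chain_boundary 1 (frag_of \<sigma>))) = 0"
      proof (rule homotopy_on_points[where X=Y and h="h 0"])
        show "singular_chain 0 Y (chain_boundary 1 (frag_of \<sigma>))"
          using singular_chain_boundary[of 1 Y "frag_of \<sigma>"] s by (simp add: singular_chain_of)
        show "path_val l (\<lambda>x\<in>standard_simplex 1. y) = 0" for y by (rule path_val_same) simp
        show "singular_chain 1 X (h 0 c)" if "singular_chain 0 X c" for X c using h(3)[OF that] by simp
      qed (rule h)+
      then show ?thesis by simp
    qed
    moreover have "singular_subdivision 1 (frag_of \<sigma>) =
       frag_of \<sigma> + (chain_boundary (Suc 1) (h 1 (frag_of \<sigma>)) + h (1 - Suc 0) (chain_boundary 1 (frag_of \<sigma>)))"
      using h(4)[OF su] by simp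
    ultimately show ?case by (simp add: pair_add)
  qed (simp_all add: singular_subdivision_diff pair_diff)
qed

lemma eventually_small:
  assumes W: "W \<subseteq> F" and c: "singular_chain p (subtopology T (cell_space n W)) c" and S: "cell_space n W \<subseteq> YS"
  shows "\<exists>K. \<forall>k\<ge>K. \<forall>\<sigma>\<in>Poly_Mapping.keys (sd p k c). small p W \<sigma>"
proof -
  let ?C = "(\<lambda>f. {y \<in> cell_space n W. f \<subseteq> fo y}) ` W"
  have 1: "openin (subtopology T (cell_space n W)) U" if U: "U \<in> ?C" for U
  proof -
    obtain f where "f \<in> W" "U = {y \<in> cell_space n W. f \<subseteq> fo y}" using U by blast
    then show ?thesis using openin_face_of[OF F_n] W by blast
  qed
  have 2: "topspace (subtopology T (cell_space n W)) \<subseteq> \<Union> ?C"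
    using cell_spaceD(2) by fastforce
  have "\<exists>K. \<forall>k \<sigma>. K \<le> k \<longrightarrow> \<sigma> \<in> Poly_Mapping.keys (sd p k c) \<longrightarrow> (\<exists>V\<in>?C. \<sigma> \<in> standard_simplex p \<rightarrow> V)"
  proof (rule sufficient_iterated_singular_subdivision_exists[OF 1 2 c])
    fix K assume "\<And>k \<sigma>. K \<le> k \<Longrightarrow> \<sigma> \<in> Poly_Mapping.keys (sd p k c) \<Longrightarrow> \<exists>V\<in>?C. \<sigma> \<in> standard_simplex p \<rightarrow> V"
    then show ?thesis by (intro exI[of _ K] allI impI)
  qed
  then obtain K where K: "\<forall>k \<sigma>. K \<le> k \<longrightarrow> \<sigma> \<in> Poly_Mapping.keys (sd p k c) \<longrightarrow> (\<exists>V\<in>?C. \<sigma> \<in> standard_simplex p \<rightarrow> V)" ..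
  have "small p W \<sigma>" if k\<sigma>: "K \<le> k" "\<sigma> \<in> Poly_Mapping.keys (sd p k c)" for k \<sigma>
  proof -
    obtain f where f: "f \<in> W" "\<sigma> \<in> standard_simplex p \<rightarrow> {y \<in> cell_space n W. f \<subseteq> fo y}" using K k\<sigma> by blast
    then have "\<sigma> ` standard_simplex p \<subseteq> star f" using S by (auto simp: star_def)
    then show ?thesis unfolding small_def using f(1) by blast
  qed
  then show ?thesis by blast
qed

text \<open>The values become constant after finitely many subdivisions, and the limit is this eventual
  value.\<close>

definition path_cochain :: "(nat set \<times> nat set \<Rightarrow> complex) \<Rightarrow> (nat \<Rightarrow> real) chain \<Rightarrow> complex" where
  "path_cochain l c = lim (\<lambda>k. pair (path_val l) (sd 1 k c))"

lemma lim_eventually_const: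
  fixes f :: "nat \<Rightarrow> complex"
  assumes "\<And>k. K \<le> k \<Longrightarrow> f k = z" shows "lim f = z"
proof (rule limI, rule tendsto_eventually)
  show "\<forall>\<^sub>F k in sequentially. f k = z" unfolding eventually_sequentially using assms by blast
qed

lemma path_cochain_eventually:
  assumes l: "l \<in> coc" and c: "singular_chain 1 Y c"
  shows "\<exists>K. \<forall>k\<ge>K. path_cochain l c = pair (path_val l) (sd 1 k c) \<and> (\<forall>\<sigma>\<in>Poly_Mapping.keys (sd 1 k c). small 1 F \<sigma>)"
proof -
  obtain K where K: "\<And>k \<sigma>. K \<le> k \<Longrightarrow> \<sigma> \<in> Poly_Mapping.keys (sd 1 k c) \<Longrightarrow> small 1 F \<sigma>"
    using eventually_small[OF order_refl c order_refl] by blast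
  have step: "pair (path_val l) (sd 1 (Suc k) c) = pair (path_val l) (sd 1 k c)" if "K \<le> k" for k
    using path_val_sd[OF l sd_chain[OF c] K[OF that]] by simp
  have const: "pair (path_val l) (sd 1 k c) = pair (path_val l) (sd 1 K c)" if "K \<le> k" for k
    using that
  proof (induction k rule: dec_induct)
    case (step i) then show ?case using \<open>\<And>k. K \<le> k \<Longrightarrow> _ (sd 1 (Suc k) c) = _\<close> by simp
  qed simp
  have "path_cochain l c = pair (path_val l) (sd 1 K c)"
    unfolding path_cochain_def by (rule lim_eventually_const[OF const])
  then show ?thesis using const K by metis
qed

lemma path_cochain_small:
  assumes l: "l \<in> coc" and s: "singular_simplex 1 Y \<sigma>" and f: "f \<in> F" "\<sigma> ` standard_simplex 1 \<subseteq> star f"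
  shows "path_cochain l (frag_of \<sigma>) = path_val l \<sigma>"
proof -
  let ?U = "subtopology Y (star f)"
  have su: "singular_chain 1 ?U (frag_of \<sigma>)"
    unfolding singular_chain_of by (rule simplex_in_star[OF s f(2)])
  have c: "singular_chain 1 Y (sd 1 k (frag_of \<sigma>))" for k
    by (rule sd_chain) (use s in \<open>simp add: singular_chain_of\<close>)
  have sm: "small 1 F \<tau>" if t: "\<tau> \<in> Poly_Mapping.keys (sd 1 k (frag_of \<sigma>))" for \<tau> k
  proof -
    have "singular_simplex 1 ?U \<tau>" using sd_chain[OF su, of k] t by (auto simp: singular_chain_def)
    then show ?thesis unfolding small_def using f(1) star_simplexD by blast
  qed
  have "pair (path_val l) (sd 1 k (frag_of \<sigma>)) = path_val l \<sigma>" for k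
  proof (induction k)
    case (Suc k)
    then show ?case using path_val_sd[OF l c sm] by simp
  qed simp
  then show ?thesis unfolding path_cochain_def by (intro lim_eventually_const[of 0])
qed

lemma path_cochain_add:
  assumes l: "l \<in> coc" and a: "singular_chain 1 Y a" and b: "singular_chain 1 Y b"
  shows "path_cochain l (a + b) = path_cochain l a + path_cochain l b"
proof -
  obtain K where K: "\<And>k. K \<le> k \<Longrightarrow> path_cochain l a = pair (path_val l) (sd 1 k a)" using path_cochain_eventually[OF l a] by blast
  obtain J where J: "\<And>k. J \<le> k \<Longrightarrow> path_cochain l b = pair (path_val l) (sd 1 k b)" using path_cochain_eventually[OF l b] by blast
  show ?thesis
    unfolding path_cochain_def[of l "a + b"]
    by (rule lim_eventually_const[of "max K J"]) (simp add: sd_add pair_add K[symmetric] J[symmetric] del: One_nat_def)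
qed

lemma path_cochain_cocycle:
  assumes l: "l \<in> coc"
  shows "(\<lambda>c\<in>singular_chain_set 1 Y. path_cochain l c) \<in> carrier (cocycles 1 Y ZS)"
proof (rule restrict_cocycleI[OF path_cochain_add[OF l]])
  show "path_cochain l c = 0" if c: "singular_chain 1 (subtopology Y ZS) c" for c
  proof -
    have cZ: "singular_chain 1 (subtopology T (cell_space n G)) c" using c unfolding Z_sub .
    obtain K where K: "\<And>k \<sigma>. K \<le> k \<Longrightarrow> \<sigma> \<in> Poly_Mapping.keys (sd 1 k c) \<Longrightarrow> small 1 G \<sigma>"
      using eventually_small[OF G_F cZ Z_Y] by blast
    show ?thesis
      unfolding path_cochain_def
    proof (rule lim_eventually_const[of K], rule pair_eq_0)
      fix k \<sigma> assume k: "K \<le> k" and \<sigma>: "\<sigma> \<in> Poly_Mapping.keys (sd 1 k c)"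
      obtain g where g: "g \<in> G" "\<sigma> ` standard_simplex 1 \<subseteq> star g" using K[OF k \<sigma>] by (auto simp: small_def)
      have v: "\<sigma> (vtx 0) \<in> star g" "\<sigma> (vtx 1) \<in> star g" using small_vtx[OF g(2)] by auto
      then have "fo (\<sigma> (vtx 0)) \<in> F" "g \<subseteq> fo (\<sigma> (vtx 0))" "fo (\<sigma> (vtx 1)) \<in> F" "g \<subseteq> fo (\<sigma> (vtx 1))"
        using fo_F by (auto simp: star_def)
      then show "path_val l \<sigma> = 0"
        using path_val_star[OF l G_in_F[OF g(1)] v] face_cocycles_zero[OF l g(1)] by simp
    qed
  qed
  fix c assume c: "singular_chain (Suc 1) Y c"
  obtain K where K: "\<And>k \<sigma>. K \<le> k \<Longrightarrow> \<sigma> \<in> Poly_Mapping.keys (sd (Suc 1) k c) \<Longrightarrow> small (Suc 1) F \<sigma>"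
    using eventually_small[OF order_refl c order_refl] by blast
  show "path_cochain l (chain_boundary (Suc 1) c) = 0"
    unfolding path_cochain_def
  proof (rule lim_eventually_const[of K])
    fix k assume k: "K \<le> k"
    show "pair (path_val l) (sd 1 k (chain_boundary (Suc 1) c)) = 0"
      unfolding sd_boundary[OF c, symmetric]
      using path_val_boundary[OF l, of "sd (Suc 1) k c"] K[OF k] by (simp add: numeral_2_eq_2)
  qed
qed

lemma seg_star:
  assumes f: "f \<in> F" "f \<subseteq> fo y" "fo y \<subseteq> fo z" and y: "y \<in> YS" "z \<in> YS"
  shows "seg y z ` standard_simplex 1 \<subseteq> star f"
proof
  fix w assume "w \<in> seg y z ` standard_simplex 1"
  then obtain x where x: "x \<in> standard_simplex 1" "w = (\<lambda>i. \<Sum>j\<le>1. (if j = 0 then y else z) i * x j)"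
    by (auto simp: seg_def oriented_simplex_def)
  have l: "(if j = 0 then y else z) \<in> YS" "fo (if j = 0 then y else z) \<subseteq> fo z" "f \<subseteq> fo (if j = 0 then y else z)" for j :: nat
    using assms by auto
  have "(\<lambda>i. \<Sum>j\<le>1. (if j = 0 then y else z) i * x j) \<in> YS"
    by (rule cell_space_combination(1)[where l="\<lambda>j. if j = 0 then y else z" and h="fo z", OF F_conv l(1,2) fo_F[OF y(2)] x(1)])
  moreover have "f \<subseteq> fo (\<lambda>i. \<Sum>j\<le>1. (if j = 0 then y else z) i * x j)"
    by (rule cell_space_combination(2)[where l="\<lambda>j. if j = 0 then y else z" and h="fo z", OF F_conv l(1,2) fo_F[OF y(2)] x(1) l(3)])
  ultimately show "w \<in> star f" unfolding x(2) star_def by simp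
qed

lemma path_cochain_seg:
  assumes l: "l \<in> coc" and f: "f \<in> F" "g \<in> F" "f \<subseteq> g"
  shows "path_cochain l (frag_of (seg (bar f) (bar g))) = l (f, g)"
proof -
  have b: "bar f \<in> YS" "bar g \<in> YS" "fo (bar f) = f" "fo (bar g) = g" using bar_Y fo_bar f by auto
  have s: "singular_simplex 1 Y (seg (bar f) (bar g))" by (rule seg_Y) (use b f in auto)
  have st: "seg (bar f) (bar g) ` standard_simplex 1 \<subseteq> star f" by (rule seg_star) (use b f in auto)
  have l0: "l (f, f) = 0" using face_cocycles_add[OF l f(1) f(1) f(1)] by simp
  have "path_cochain l (frag_of (seg (bar f) (bar g))) = path_val l (seg (bar f) (bar g))"
    by (rule path_cochain_small[OF l s f(1) st])
  also have "\<dots> = l (f, fo (seg (bar f) (bar g) (vtx 1))) - l (f, fo (seg (bar f) (bar g) (vtx 0)))"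
    by (rule path_val_star[OF l f(1)]; rule small_vtx[OF st]) simp_all
  also have "\<dots> = l (f, g)" unfolding seg_vtx b(3,4) l0 by simp
  finally show ?thesis .
qed

text \<open>On the segments between barycentres the cochain has the values of \<open>l\<close>, so a primitive of it
  restricts to the barycentres. Conversely, a 0-cochain on faces extends to all points, and
  subdivision does not move the end points of a chain.\<close>

lemma path_cochain_coboundary:
  assumes l: "l \<in> coc"
  shows "(\<lambda>c\<in>singular_chain_set 1 Y. path_cochain l c) \<in> coboundaries 1 Y ZS \<longleftrightarrow> l \<in> face_coboundaries F G"
proof
  assume "(\<lambda>c\<in>singular_chain_set 1 Y. path_cochain l c) \<in> coboundaries 1 Y ZS"
  then obtain \<psi> where \<psi>: "\<psi> \<in> carrier (cochains 0 Y ZS)"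
    and eq: "(\<lambda>c\<in>singular_chain_set 1 Y. path_cochain l c) = (\<lambda>c\<in>singular_chain_set 1 Y. \<psi> (chain_boundary 1 c))"
    unfolding coboundaries_1 by blast
  define \<mu> where "\<mu> f = \<psi> (frag_of (point (bar f)))" for f
  have "l (f, g) = \<mu> g - \<mu> f" if fg: "f \<in> F" "g \<in> F" "f \<subseteq> g" for f g
  proof -
    have s: "singular_simplex 1 Y (seg (bar f) (bar g))"
      by (rule seg_Y) (use bar_Y fo_bar fg in auto)
    have "path_cochain l (frag_of (seg (bar f) (bar g))) = \<psi> (chain_boundary 1 (frag_of (seg (bar f) (bar g))))"
      using fun_cong[OF eq, of "frag_of (seg (bar f) (bar g))"] s by (simp add: singular_chain_of)
    also have "\<dots> = \<mu> g - \<mu> f"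
      unfolding boundary_1[OF s] seg_vtx \<mu>_def by (rule cochain_diff[OF \<psi> bar_chain[OF fg(2)] bar_chain[OF fg(1)]])
    finally show ?thesis using path_cochain_seg[OF l fg] by simp
  qed
  moreover have "\<mu> f = 0" if f: "f \<in> G" for f
  proof -
    have "singular_chain 0 (subtopology Y ZS) (frag_of (point (bar f)))"
      unfolding Z_sub using singular_point[of "bar f" "subtopology T ZS"] bar_Z[OF f] by (simp add: singular_chain_of)
    then show ?thesis unfolding \<mu>_def by (rule cochain_vanish[OF \<psi>])
  qed
  ultimately show "l \<in> face_coboundaries F G" unfolding face_coboundaries_def by blast
next
  assume "l \<in> face_coboundaries F G"
  then obtain \<mu> where \<mu>0: "\<And>f. f \<in> G \<Longrightarrow> \<mu> f = 0" and \<mu>: "\<And>f g. f \<in> F \<Longrightarrow> g \<in> F \<Longrightarrow> f \<subseteq> g \<Longrightarrow> l (f, g) = \<mu> g - \<mu> f"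
    unfolding face_coboundaries_def by blast
  let ?\<psi> = "\<lambda>c\<in>singular_chain_set 0 Y. pair (face_val \<mu>) c"
  have \<psi>: "?\<psi> \<in> carrier (cochains 0 Y ZS)" by (rule face_val_cochain[OF \<mu>0])
  have "path_cochain l c = ?\<psi> (chain_boundary 1 c)" if c: "singular_chain 1 Y c" for c
  proof -
    obtain K where K: "path_cochain l c = pair (path_val l) (sd 1 K c)" "\<And>\<sigma>. \<sigma> \<in> Poly_Mapping.keys (sd 1 K c) \<Longrightarrow> small 1 F \<sigma>"
      using path_cochain_eventually[OF l c] by blast
    have b: "singular_chain 0 Y (chain_boundary 1 c)" using singular_chain_boundary[OF c] by simp
    have "Poly_Mapping.keys (sd 1 K c) \<subseteq> {\<sigma>. singular_simplex 1 Y \<sigma> \<and> small 1 F \<sigma>}"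
      using K(2) sd_chain[OF c, of K] by (auto simp: singular_chain_def)
    then have "pair (path_val l) (sd 1 K c) = pair (face_val \<mu>) (chain_boundary 1 (sd 1 K c))"
    proof (induction rule: frag_induction)
      case (one \<sigma>)
      then have s: "singular_simplex 1 Y \<sigma>" and "small 1 F \<sigma>" by auto
      then obtain f where f: "f \<in> F" "\<sigma> ` standard_simplex 1 \<subseteq> star f" by (auto simp: small_def)
      have v: "\<sigma> (vtx 0) \<in> star f" "\<sigma> (vtx 1) \<in> star f" using small_vtx[OF f(2)] by auto
      then have "fo (\<sigma> (vtx 0)) \<in> F" "f \<subseteq> fo (\<sigma> (vtx 0))" "fo (\<sigma> (vtx 1)) \<in> F" "f \<subseteq> fo (\<sigma> (vtx 1))"
        using fo_F by (auto simp: star_def)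
      then show ?case
        unfolding boundary_1[OF s] pair_diff pair_of face_val_def point_apply path_val_star[OF l f(1) v]
        using \<mu> f(1) by simp
    qed (simp_all add: chain_boundary_diff pair_diff)
    also have "chain_boundary 1 (sd 1 K c) = chain_boundary 1 c"
      using sd_boundary[of 0 Y c K] c sd_0[OF b, of K] by simp
    finally show ?thesis using K(1) b by simp
  qed
  then have "(\<lambda>c\<in>singular_chain_set 1 Y. path_cochain l c) = (\<lambda>c\<in>singular_chain_set 1 Y. ?\<psi> (chain_boundary 1 c))"
    by (intro restrict_ext) simp
  then show "(\<lambda>c\<in>singular_chain_set 1 Y. path_cochain l c) \<in> coboundaries 1 Y ZS"
    unfolding coboundaries_1 using \<psi> by blast
qed

end

context face_pair begin

lemma path_cochain_plus:
  assumes u: "u \<in> coc" and v: "v \<in> coc" and c: "singular_chain 1 Y c"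
  shows "path_cochain (\<lambda>x. u x + v x) c = path_cochain u c + path_cochain v c"
proof -
  obtain K where K: "\<And>k. K \<le> k \<Longrightarrow> path_cochain u c = pair (path_val u) (sd 1 k c)" using path_cochain_eventually[OF u c] by blast
  obtain J where J: "\<And>k. J \<le> k \<Longrightarrow> path_cochain v c = pair (path_val v) (sd 1 k c)" using path_cochain_eventually[OF v c] by blast
  have p: "pair (path_val (\<lambda>x. u x + v x)) d = pair (path_val u) d + pair (path_val v) d" for d
    unfolding pair_fun_add[symmetric] by (rule pair_cong) (simp add: path_val_def Let_def)
  show ?thesis
    unfolding path_cochain_def[of "\<lambda>x. u x + v x"]
    by (rule lim_eventually_const[of "max K J"]) (simp add: p K[symmetric] J[symmetric] del: One_nat_def)
qed

lemma path_cochain_scale: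
  assumes u: "u \<in> coc" and c: "singular_chain 1 Y c"
  shows "path_cochain (\<lambda>x. z * u x) c = z * path_cochain u c"
proof -
  obtain K where K: "\<And>k. K \<le> k \<Longrightarrow> path_cochain u c = pair (path_val u) (sd 1 k c)" using path_cochain_eventually[OF u c] by blast
  have p: "pair (path_val (\<lambda>x. z * u x)) d = z * pair (path_val u) d" for d
    unfolding pair_fun_scale[symmetric] by (rule pair_cong) (simp add: path_val_def Let_def right_diff_distrib)
  show ?thesis
    unfolding path_cochain_def[of "\<lambda>x. z * u x"]
    by (rule lim_eventually_const[of K]) (simp add: p K[symmetric] del: One_nat_def)
qed

lemma cocycle_2_simplex:
  assumes \<phi>: "\<phi> \<in> carrier (cocycles 1 X S)" and \<tau>: "singular_simplex 2 X \<tau>"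
  shows "\<phi> (frag_of (singular_face 2 1 \<tau>)) = \<phi> (frag_of (singular_face 2 0 \<tau>)) + \<phi> (frag_of (singular_face 2 2 \<tau>))"
proof -
  have \<phi>c: "\<phi> \<in> carrier (cochains 1 X S)" using \<phi> cocycles_iff by blast
  have s: "singular_chain 1 X (frag_of (singular_face 2 k \<tau>))" if "k \<le> 2" for k
    using singular_simplex_singular_face[OF \<tau> _ that] by (simp add: singular_chain_of)
  have "singular_chain (Suc 1) X (frag_of \<tau>)" using \<tau> by (simp add: singular_chain_of numeral_2_eq_2)
  then have "\<phi> (chain_boundary (Suc 1) (frag_of \<tau>)) = 0" using \<phi> unfolding cocycles_iff by blast
  then have "\<phi> (chain_boundary 2 (frag_of \<tau>)) = 0" by (simp add: numeral_2_eq_2)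
  moreover have "\<phi> (chain_boundary 2 (frag_of \<tau>)) =
      \<phi> (frag_of (singular_face 2 0 \<tau>)) - \<phi> (frag_of (singular_face 2 1 \<tau>)) + \<phi> (frag_of (singular_face 2 2 \<tau>))"
    unfolding boundary_2
    using cochain_add[OF \<phi>c singular_chain_diff[OF s[of 0] s[of 1]] s[of 2]] cochain_diff[OF \<phi>c s[of 0] s[of 1]] by simp
  ultimately show ?thesis by (simp add: algebra_simps)
qed

lemma seg_same: "seg y y = (\<lambda>x\<in>standard_simplex 1. y)"
  unfolding seg_def oriented_simplex_def
proof (rule restrict_ext, rule ext)
  fix x i assume x: "x \<in> standard_simplex 1"
  have "(\<Sum>j\<le>1. (if j = 0 then y else y) i * x j) = y i * (\<Sum>j\<le>1. x j)"
    by (simp only: sum_distrib_left if_cancel)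
  then show "(\<Sum>j\<le>1. (if j = 0 then y else y) i * x j) = y i" using std_sum[OF x] by simp
qed

lemma cocycle_constant_path:
  assumes \<phi>: "\<phi> \<in> carrier (cocycles 1 Y ZS)" and y: "y \<in> YS"
  shows "\<phi> (frag_of (seg y y)) = 0"
  using cocycle_2_simplex[OF \<phi> tri_Y[OF y y y order_refl order_refl]] unfolding tri_faces by simp

text \<open>Subdivision is homotopic to the identity, and cocycles vanish on the constant paths that the
  homotopy produces from the end points.\<close>

lemma cocycle_sd:
  assumes \<phi>: "\<phi> \<in> carrier (cocycles 1 Y ZS)" and c: "singular_chain 1 Y c"
  shows "\<phi> (sd 1 k c) = \<phi> c"
proof -
  have \<phi>c: "\<phi> \<in> carrier (cochains 1 Y ZS)" using \<phi> cocycles_iff by blast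
  obtain h :: "nat \<Rightarrow> (nat \<Rightarrow> real) chain \<Rightarrow> (nat \<Rightarrow> real) chain" where h:
    "\<And>p. h p 0 = 0" "\<And>p c1 c2. h p (c1 - c2) = h p c1 - h p c2"
    "\<And>p X c. singular_chain p X c \<Longrightarrow> singular_chain (Suc p) X (h p c)"
    "\<And>p X c. singular_chain p X c \<Longrightarrow>
       chain_boundary (Suc p) (h p c) + h (p - Suc 0) (chain_boundary p c) = singular_subdivision p c - c"
    using chain_homotopic_singular_subdivision by blast
  have step: "\<phi> (singular_subdivision 1 d) = \<phi> d" if d: "singular_chain 1 Y d" for d
  proof -
    let ?e = "h (1 - Suc 0) (chain_boundary 1 d)"
    have b: "singular_chain 0 Y (chain_boundary 1 d)" using singular_chain_boundary[OF d] by simp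
    have e: "singular_chain 1 Y ?e" using h(3)[OF b] by simp
    have hd: "singular_chain (Suc 1) Y (h 1 d)" by (rule h(3)[OF d])
    have bd: "singular_chain 1 Y (chain_boundary (Suc 1) (h 1 d))" by (rule singular_chain_boundary_alt[OF hd])
    have "\<phi> (chain_boundary (Suc 1) (h 1 d)) = 0" using \<phi> hd unfolding cocycles_iff by blast
    moreover have "\<phi> ?e = 0"
    proof -
      have "\<phi> ?e = pair (\<lambda>\<sigma>. \<phi> (frag_of \<sigma>)) ?e" by (rule cochain_agree[OF \<phi>c refl e])
      also have "pair (\<lambda>\<sigma>. \<phi> (frag_of \<sigma>)) (h 0 (chain_boundary 1 d)) = 0"
      proof (rule homotopy_on_points[where X=Y and h="h 0", OF h(1) h(2)])
        show "singular_chain 1 X (h 0 c)" if "singular_chain 0 X c" for X c using h(3)[OF that] by simp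
        show "\<phi> (frag_of (\<lambda>x\<in>standard_simplex 1. y)) = 0" if "y \<in> topspace Y" for y
          using cocycle_constant_path[OF \<phi>, of y] that by (simp add: seg_same)
      qed (rule b)
      then have "pair (\<lambda>\<sigma>. \<phi> (frag_of \<sigma>)) ?e = 0" by simp
      finally show ?thesis .
    qed
    moreover have "singular_subdivision 1 d = d + (chain_boundary (Suc 1) (h 1 d) + ?e)"
      using h(4)[OF d] by (simp add: algebra_simps)
    ultimately show ?thesis
      using cochain_add[OF \<phi>c d singular_chain_add[OF bd e]] cochain_add[OF \<phi>c bd e] by simp
  qed
  show ?thesis
  proof (induction k)
    case (Suc k)
    then show ?case using step[OF sd_chain[OF c, of k]] by simp
  qed simp
qed

definition interval_point :: "real \<Rightarrow> nat \<Rightarrow> real" where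
  "interval_point t = (\<lambda>i. if i = 0 then 1 - t else if i = 1 then t else 0)"

lemma interval_point_std: "0 \<le> t \<Longrightarrow> t \<le> 1 \<Longrightarrow> interval_point t \<in> standard_simplex 1"
  by (simp add: standard_simplex_def interval_point_def)

lemma interval_point_eq:
  assumes x: "x \<in> standard_simplex 1" shows "interval_point (x 1) = x"
proof
  fix i
  have "x 0 + x 1 = 1" using std_sum[OF x] by simp
  then show "interval_point (x 1) i = x i" using std_above[OF x, of i] by (auto simp: interval_point_def)
qed

lemma interval_point_vtx: "interval_point 0 = vtx 0" "interval_point 1 = vtx 1"
  by (auto simp: interval_point_def vtx_def)

text \<open>The point at height \<open>u x\<close> on the segment from the barycentre of \<open>f\<close> to the point of the path
  \<open>\<sigma>\<close> at time \<open>t x\<close>.\<close>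

definition cone_simplex :: "nat set \<Rightarrow> ((nat \<Rightarrow> real) \<Rightarrow> nat \<Rightarrow> real) \<Rightarrow> ((nat \<Rightarrow> real) \<Rightarrow> real) \<Rightarrow> ((nat \<Rightarrow> real) \<Rightarrow> real) \<Rightarrow> (nat \<Rightarrow> real) \<Rightarrow> nat \<Rightarrow> real" where
  "cone_simplex f \<sigma> u t = (\<lambda>x\<in>standard_simplex 2. \<lambda>i. (1 - u x) * bar f i + u x * \<sigma> (interval_point (t x)) i)"

lemma cone_simplex_singular:
  assumes f: "f \<in> F" and s: "singular_simplex 1 Y \<sigma>" and st: "\<sigma> ` standard_simplex 1 \<subseteq> star f"
    and u: "continuous_map T euclideanreal u" "\<And>x. x \<in> standard_simplex 2 \<Longrightarrow> 0 \<le> u x \<and> u x \<le> 1"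
    and t: "continuous_map T euclideanreal t" "\<And>x. x \<in> standard_simplex 2 \<Longrightarrow> 0 \<le> t x \<and> t x \<le> 1"
  shows "singular_simplex 2 Y (cone_simplex f \<sigma> u t)"
proof -
  let ?S = "subtopology T (standard_simplex 2)"
  let ?g = "\<lambda>x i. (1 - u x) * bar f i + u x * \<sigma> (interval_point (t x)) i"
  have uc: "continuous_map ?S euclideanreal u" and tc: "continuous_map ?S euclideanreal t"
    using u(1) t(1) by (simp_all add: continuous_map_from_subtopology)
  have "continuous_map ?S euclideanreal (\<lambda>x. interval_point (t x) i)" for i
  proof -
    consider "i = 0" | "i = 1" | "i \<noteq> 0" "i \<noteq> 1" by blast
    then show ?thesis
      by cases (simp_all add: interval_point_def tc continuous_map_diff)
  qed
  then have "continuous_map ?S T (\<lambda>x. interval_point (t x))"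
    by (simp add: continuous_map_componentwise_UNIV)
  moreover have tp: "interval_point (t x) \<in> standard_simplex 1" if "x \<in> standard_simplex 2" for x
    using t(2)[OF that] by (intro interval_point_std) auto
  ultimately have ip: "continuous_map ?S (subtopology T (standard_simplex 1)) (\<lambda>x. interval_point (t x))"
    unfolding continuous_map_in_subtopology by auto
  have sc: "continuous_map (subtopology T (standard_simplex 1)) T \<sigma>"
    using s unfolding singular_simplex_def by (auto simp: continuous_map_in_subtopology)
  have comp: "continuous_map ?S T (\<lambda>x. \<sigma> (interval_point (t x)))"
    using continuous_map_compose[OF ip sc] by (simp add: o_def)
  have "continuous_map ?S euclideanreal (\<lambda>x. \<sigma> (interval_point (t x)) i)" for i
    using comp unfolding continuous_map_componentwise_UNIV by blast
  then have "continuous_map ?S euclideanreal (\<lambda>x. ?g x i)" for i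
    by (intro continuous_map_add continuous_map_real_mult continuous_map_diff uc) simp_all
  then have gc: "continuous_map ?S T ?g" by (simp add: continuous_map_componentwise_UNIV)
  have gY: "?g x \<in> YS" if x: "x \<in> standard_simplex 2" for x
  proof -
    let ?w = "\<sigma> (interval_point (t x))"
    let ?l = "\<lambda>j::nat. if j = 0 then bar f else ?w"
    have "?w \<in> star f" using st tp[OF x] by blast
    then have w: "?w \<in> YS" "f \<subseteq> fo ?w" by (auto simp: star_def)
    have l: "?l j \<in> YS" "fo (?l j) \<subseteq> fo ?w" for j using w bar_Y[OF f] fo_bar[OF f] by auto
    have "(\<lambda>i. \<Sum>j\<le>1. ?l j i * interval_point (u x) j) \<in> YS"
      by (rule cell_space_combination(1)[where l="?l" and h="fo ?w", OF F_conv l fo_F[OF w(1)]])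
         (use interval_point_std u(2)[OF x] in auto)
    moreover have "(\<lambda>i. \<Sum>j\<le>1. ?l j i * interval_point (u x) j) = ?g x"
      by (rule ext) (simp add: interval_point_def mult.commute)
    ultimately show ?thesis by simp
  qed
  have "continuous_map ?S Y ?g" using gc gY by (auto simp: continuous_map_in_subtopology)
  then have "continuous_map ?S Y (cone_simplex f \<sigma> u t)"
    by (rule continuous_map_eq) (simp add: cone_simplex_def)
  then show ?thesis by (simp add: singular_simplex_def cone_simplex_def)
qed

lemma cone_simplex_face:
  assumes k: "k \<le> 2"
    and g: "\<And>x i. x \<in> standard_simplex 1 \<Longrightarrow>
      (1 - u (simplical_face k x)) * bar f i + u (simplical_face k x) * \<sigma> (interval_point (t (simplical_face k x))) i = g x i"
    and e: "g \<in> extensional (standard_simplex 1)"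
  shows "singular_face 2 k (cone_simplex f \<sigma> u t) = g"
proof (rule extensionalityI[OF _ e])
  show "singular_face 2 k (cone_simplex f \<sigma> u t) \<in> extensional (standard_simplex 1)" by (simp add: singular_face_def)
  fix x assume x: "x \<in> standard_simplex 1"
  have "simplical_face k x \<in> standard_simplex 2"
    using simplical_face_in_standard_simplex[of 2 k x] k x by simp
  then show "singular_face 2 k (cone_simplex f \<sigma> u t) x = g x"
    using x g[OF x] by (simp add: singular_face_def cone_simplex_def fun_eq_iff)
qed

lemma seg_ext: "seg y z \<in> extensional (standard_simplex 1)"
  by (simp add: seg_def oriented_simplex_def)

lemma seg_apply: "x \<in> standard_simplex 1 \<Longrightarrow> seg y z x i = (1 - x 1) * y i + x 1 * z i"
proof -
  assume x: "x \<in> standard_simplex 1"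
  have "x 0 = 1 - x 1" using std_sum[OF x] by simp
  then show ?thesis using x by (simp add: seg_def oriented_simplex_def mult.commute)
qed

text \<open>The cone from the barycentre over the path is cut into two triangles along the diagonal that
  moves along the path while leaving the barycentre. One has the path and the segment to its
  start as its other edges, the other has the segment to its end and a constant path.\<close>

lemma cocycle_small_path:
  assumes \<phi>: "\<phi> \<in> carrier (cocycles 1 Y ZS)" and f: "f \<in> F" and s: "singular_simplex 1 Y \<sigma>" and st: "\<sigma> ` standard_simplex 1 \<subseteq> star f"
  shows "\<phi> (frag_of \<sigma>) = \<phi> (frag_of (seg (bar f) (\<sigma> (vtx 1)))) - \<phi> (frag_of (seg (bar f) (\<sigma> (vtx 0))))"
proof -
  let ?p = "\<lambda>k x::nat \<Rightarrow> real. x k"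
  let ?q = "\<lambda>x::nat \<Rightarrow> real. x 1 + x 2"
  \<comment> \<open>the vertices of \<open>?L\<close> are the barycentre, the start and the end of the path; \<open>?R\<close> has two
    vertices at the barycentre and one at the end\<close>
  let ?L = "cone_simplex f \<sigma> ?q (?p 2)" and ?R = "cone_simplex f \<sigma> (?p 2) ?q"
  have pc: "continuous_map T euclideanreal (?p k)" for k by (rule continuous_map_product_projection) simp
  have qc: "continuous_map T euclideanreal ?q" by (intro continuous_map_add pc)
  have p01: "0 \<le> ?p 2 x \<and> ?p 2 x \<le> 1" and q01: "0 \<le> ?q x \<and> ?q x \<le> 1" if x: "x \<in> standard_simplex 2" for x
  proof -
    show "0 \<le> ?p 2 x \<and> ?p 2 x \<le> 1" using std_nonneg[OF x] std_le_1[OF x] by simp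
    have "{..2::nat} = {0, 1, 2}" by auto
    then have "x 0 + (x 1 + x 2) = 1" using std_sum[OF x] by simp
    then show "0 \<le> ?q x \<and> ?q x \<le> 1" using std_nonneg[OF x, of 0] std_nonneg[OF x, of 1] std_nonneg[OF x, of 2] by simp
  qed
  have L: "singular_simplex 2 Y ?L" by (rule cone_simplex_singular[OF f s st qc q01 pc p01])
  have R: "singular_simplex 2 Y ?R" by (rule cone_simplex_singular[OF f s st pc p01 qc q01])
  have x01: "x 0 + x 1 = 1" if "x \<in> standard_simplex 1" for x :: "nat \<Rightarrow> real" using std_sum[OF that] by simp
  have se: "\<sigma> \<in> extensional (standard_simplex 1)" using s by (simp add: singular_simplex_def)
  define diag where "diag = (\<lambda>x\<in>standard_simplex 1. \<lambda>i. (1 - x 1) * bar f i + x 1 * \<sigma> (interval_point (x 1)) i)"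
  have de: "diag \<in> extensional (standard_simplex 1)" by (simp add: diag_def)
  have L0: "singular_face 2 0 ?L = \<sigma>"
    by (rule cone_simplex_face[OF _ _ se]) (use x01 interval_point_eq in \<open>simp_all add: simplical_face_def\<close>)
  have L1: "singular_face 2 1 ?L = diag"
    by (rule cone_simplex_face[OF _ _ de]) (simp_all add: simplical_face_def diag_def)
  have L2: "singular_face 2 2 ?L = seg (bar f) (\<sigma> (vtx 0))"
    by (rule cone_simplex_face[OF _ _ seg_ext]) (simp_all add: simplical_face_def seg_apply interval_point_vtx)
  have R0: "singular_face 2 0 ?R = seg (bar f) (\<sigma> (vtx 1))"
    by (rule cone_simplex_face[OF _ _ seg_ext]) (use x01 in \<open>simp_all add: simplical_face_def seg_apply interval_point_vtx(2)[unfolded One_nat_def]\<close>)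
  have R1: "singular_face 2 1 ?R = diag"
    by (rule cone_simplex_face[OF _ _ de]) (simp_all add: simplical_face_def diag_def)
  have R2: "singular_face 2 2 ?R = seg (bar f) (bar f)"
    by (rule cone_simplex_face[OF _ _ seg_ext]) (simp_all add: simplical_face_def seg_apply algebra_simps)
  show ?thesis
    using cocycle_2_simplex[OF \<phi> L] cocycle_2_simplex[OF \<phi> R] cocycle_constant_path[OF \<phi> bar_Y[OF f]]
    unfolding L0 L1 L2 R0 R1 R2 by simp
qed

text \<open>The values of a cocycle on the segments between barycentres define a cocycle on faces, and
  those from the barycentre to a point of its face define a 0-cochain; together they determine
  the class.\<close>

definition edge_values :: "((nat \<Rightarrow> real) chain \<Rightarrow> complex) \<Rightarrow> nat set \<times> nat set \<Rightarrow> complex" where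
  "edge_values \<phi> = (\<lambda>(f, g). \<phi> (frag_of (seg (bar f) (bar g))))"

definition ray_value :: "((nat \<Rightarrow> real) chain \<Rightarrow> complex) \<Rightarrow> (nat \<Rightarrow> real) \<Rightarrow> complex" where
  "ray_value \<phi> y = \<phi> (frag_of (seg (bar (fo y)) y))"

lemma cocycle_seg_Z:
  assumes \<phi>: "\<phi> \<in> carrier (cocycles 1 Y ZS)" and "y \<in> ZS" "z \<in> ZS" "fo y \<subseteq> fo z"
  shows "\<phi> (frag_of (seg y z)) = 0"
proof -
  have \<phi>c: "\<phi> \<in> carrier (cochains 1 Y ZS)" using \<phi> cocycles_iff by blast
  have "singular_chain 1 (subtopology Y ZS) (frag_of (seg y z))"
    unfolding Z_sub singular_chain_of by (rule seg_Z[OF assms(2-4)])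
  then show ?thesis by (rule cochain_vanish[OF \<phi>c])
qed

lemma edge_values_cocycle:
  assumes \<phi>: "\<phi> \<in> carrier (cocycles 1 Y ZS)"
  shows "edge_values \<phi> \<in> coc"
  unfolding face_cocycles_def
proof (intro CollectI conjI ballI impI)
  fix f g h assume a: "f \<in> F" "g \<in> F" "h \<in> F" "f \<subseteq> g" "g \<subseteq> h"
  have "singular_simplex 2 Y (tri (bar f) (bar g) (bar h))"
    by (rule tri_Y) (use a bar_Y fo_bar in auto)
  from cocycle_2_simplex[OF \<phi> this]
  show "edge_values \<phi> (f, g) + edge_values \<phi> (g, h) = edge_values \<phi> (f, h)"
    unfolding tri_faces edge_values_def by simp
next
  fix f g assume a: "f \<in> G" "g \<in> F" "f \<subseteq> g"
  then have "g \<in> G" using G_up by blast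
  then show "edge_values \<phi> (f, g) = 0"
    unfolding edge_values_def using cocycle_seg_Z[OF \<phi> bar_Z bar_Z] a fo_bar G_in_F by simp
qed

lemma cocycle_from_center:
  assumes \<phi>: "\<phi> \<in> carrier (cocycles 1 Y ZS)" and f: "f \<in> F" and y: "y \<in> star f"
  shows "\<phi> (frag_of (seg (bar f) y)) = edge_values \<phi> (f, fo y) + ray_value \<phi> y"
proof -
  have y': "y \<in> YS" "f \<subseteq> fo y" "fo y \<in> F" using y fo_F by (auto simp: star_def)
  have "singular_simplex 2 Y (tri (bar f) (bar (fo y)) y)"
    by (rule tri_Y) (use y' f bar_Y fo_bar in auto)
  from cocycle_2_simplex[OF \<phi> this] show ?thesis
    unfolding tri_faces edge_values_def ray_value_def by simp
qed

lemma ray_value_cochain: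
  assumes \<phi>: "\<phi> \<in> carrier (cocycles 1 Y ZS)"
  shows "(\<lambda>c\<in>singular_chain_set 0 Y. pair (\<lambda>\<sigma>. ray_value \<phi> (\<sigma> (vtx 0))) c) \<in> carrier (cochains 0 Y ZS)"
proof (rule pair_cochain)
  fix \<sigma> assume "singular_simplex 0 (subtopology Y ZS) \<sigma>"
  then have y: "\<sigma> (vtx 0) \<in> ZS" unfolding Z_sub using singular_0_topspace by fastforce
  note g = fo_G[OF y]
  show "ray_value \<phi> (\<sigma> (vtx 0)) = 0"
    unfolding ray_value_def by (rule cocycle_seg_Z[OF \<phi> bar_Z[OF g] y]) (simp add: fo_bar[OF G_in_F[OF g]])
qed

text \<open>After subdivision every path lies in a star and is replaced by segments from its centre. Each
  of these is homologous to a segment between barycentres followed by one inside a cell.\<close>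

lemma cocycle_1_decomposition:
  assumes \<phi>: "\<phi> \<in> carrier (cocycles 1 Y ZS)" and c: "singular_chain 1 Y c"
  shows "\<phi> c = pair (\<lambda>\<sigma>. ray_value \<phi> (\<sigma> (vtx 0))) (chain_boundary 1 c) + path_cochain (edge_values \<phi>) c"
proof -
  let ?l = "edge_values \<phi>" and ?e = "\<lambda>\<sigma>. ray_value \<phi> (\<sigma> (vtx 0))"
  have \<phi>c: "\<phi> \<in> carrier (cochains 1 Y ZS)" using \<phi> cocycles_iff by blast
  obtain K where K: "path_cochain ?l c = pair (path_val ?l) (sd 1 K c)" "\<And>\<sigma>. \<sigma> \<in> Poly_Mapping.keys (sd 1 K c) \<Longrightarrow> small 1 F \<sigma>"
    using path_cochain_eventually[OF edge_values_cocycle[OF \<phi>] c] by blast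
  have b: "singular_chain 0 Y (chain_boundary 1 c)" using singular_chain_boundary[OF c] by simp
  have "Poly_Mapping.keys (sd 1 K c) \<subseteq> {\<sigma>. singular_simplex 1 Y \<sigma> \<and> small 1 F \<sigma>}"
    using K(2) sd_chain[OF c, of K] by (auto simp: singular_chain_def)
  then have "pair (\<lambda>\<sigma>. \<phi> (frag_of \<sigma>)) (sd 1 K c) = pair ?e (chain_boundary 1 (sd 1 K c)) + pair (path_val ?l) (sd 1 K c)"
  proof (induction rule: frag_induction)
    case (one \<sigma>)
    then have s: "singular_simplex 1 Y \<sigma>" and "small 1 F \<sigma>" by auto
    then obtain f where f: "f \<in> F" "\<sigma> ` standard_simplex 1 \<subseteq> star f" by (auto simp: small_def)
    have v: "\<sigma> (vtx 0) \<in> star f" "\<sigma> (vtx 1) \<in> star f" using small_vtx[OF f(2)] by auto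
    show ?case
      unfolding boundary_1[OF s] pair_diff pair_of point_apply path_val_star[OF edge_values_cocycle[OF \<phi>] f(1) v]
        cocycle_small_path[OF \<phi> f(1) s f(2)] cocycle_from_center[OF \<phi> f(1) v(1)] cocycle_from_center[OF \<phi> f(1) v(2)]
      by simp
  qed (simp_all add: chain_boundary_diff pair_diff)
  moreover have "\<phi> c = pair (\<lambda>\<sigma>. \<phi> (frag_of \<sigma>)) (sd 1 K c)"
    using cocycle_sd[OF \<phi> c, of K] cochain_agree[OF \<phi>c refl sd_chain[OF c, of K]] by simp
  moreover have "chain_boundary 1 (sd 1 K c) = chain_boundary 1 c"
    using sd_boundary[of 0 Y c K] c sd_0[OF b, of K] by simp
  ultimately show ?thesis using K(1) by simp
qed

lemma presents_cohomology_1: "presents (face_cocycles F G) (face_coboundaries F G) (cohomology 1 Y ZS)"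
  unfolding cohomology_def
proof (rule presents_cocycle_quotient[where t=path_cochain, OF coboundaries_1_sub coboundaries_1_zero coboundaries_1_comb face_cocycles_subspace])
  show "\<exists>u\<in>coc. \<exists>\<beta>\<in>coboundaries 1 Y ZS. \<forall>c. singular_chain 1 Y c \<longrightarrow> \<phi> c = \<beta> c + path_cochain u c"
    if \<phi>: "\<phi> \<in> carrier (cocycles 1 Y ZS)" for \<phi>
  proof (rule bexI[OF _ edge_values_cocycle[OF \<phi>]])
    let ?\<psi> = "\<lambda>c\<in>singular_chain_set 0 Y. pair (\<lambda>\<sigma>. ray_value \<phi> (\<sigma> (vtx 0))) c"
    let ?\<beta> = "\<lambda>c\<in>singular_chain_set 1 Y. ?\<psi> (chain_boundary 1 c)"
    have b: "singular_chain 0 Y (chain_boundary 1 c)" if "singular_chain 1 Y c" for c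
      using singular_chain_boundary[OF that] by simp
    have "?\<beta> \<in> coboundaries 1 Y ZS" unfolding coboundaries_1 using ray_value_cochain[OF \<phi>] by blast
    moreover have "\<phi> c = ?\<beta> c + path_cochain (edge_values \<phi>) c" if c: "singular_chain 1 Y c" for c
      using cocycle_1_decomposition[OF \<phi> c] c b[OF c] by simp
    ultimately show "\<exists>\<beta>\<in>coboundaries 1 Y ZS. \<forall>c. singular_chain 1 Y c \<longrightarrow> \<phi> c = \<beta> c + path_cochain (edge_values \<phi>) c" by blast
  qed
qed (simp_all only: path_cochain_cocycle path_cochain_plus path_cochain_scale path_cochain_coboundary)

lemma presents_reduced_cohomology_1:
  assumes "G = {}"
  shows "presents (face_cocycles F G) (face_coboundaries F G) (reduced_cohomology 1 Y)"
proof -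
  have "ZS = {}" by (simp add: cell_space_def assms)
  then show ?thesis using presents_cohomology_1 by (simp add: reduced_cohomology_def cohomology_def)
qed

end

section \<open>Cotangent cohomology as the cohomology of a pair of spaces\<close>

context sr_degree begin

lemma face_pair: "face_pair n N Nt"
proof
  have X: "f \<subseteq> {0..n}" "g \<in> X" if "f \<in> X" "g \<subseteq> f" for f g
    using complex that unfolding simplicial_complex_on_def by auto
  show "N \<subseteq> Pow {0..n}" using X(1) by (auto simp: N_set_def)
  show "Nt \<subseteq> N" by (auto simp: N_tilde_def)
  fix f g h
  show "g \<in> N" if "f \<in> N" "h \<in> N" "f \<subseteq> g" "g \<subseteq> h"
  proof -
    have "f \<union> b \<notin> X" "a \<subseteq> f" "h \<in> X" "h \<inter> b = {}" using that(1,2) by (auto simp: N_set_def)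
    moreover have "g \<union> b \<notin> X" using X(2)[of "g \<union> b" "f \<union> b"] \<open>f \<union> b \<notin> X\<close> that(3) by blast
    ultimately show ?thesis using X(2)[of h g] that(3,4) by (auto simp: N_set_def)
  qed
  show "g \<in> Nt" if g: "f \<in> Nt" "f \<subseteq> g" "g \<in> N"
  proof -
    obtain b' where b': "b' \<subset> b" "f \<union> b' \<notin> X" using g(1) by (auto simp: N_tilde_def)
    have "g \<union> b' \<notin> X" using X(2)[of "g \<union> b'" "f \<union> b'"] b'(2) g(2) by blast
    then show ?thesis using g(3) b'(1) by (auto simp: N_tilde_def)
  qed
qed

text \<open>Both families consist of faces, so the realisations are the explicit spaces.\<close>

lemma space_of_N: "space_of n X N = cell_space n N" and space_of_Nt: "space_of n X Nt = cell_space n Nt"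
proof -
  interpret face_pair n N Nt by (rule face_pair)
  have "N \<subseteq> X" by (auto simp: N_set_def)
  then show "space_of n X N = cell_space n N" "space_of n X Nt = cell_space n Nt"
    using F_sub G_F by (auto intro!: space_of_eq)
qed

end

theorem theorem9:
  fixes n m :: nat and X :: "nat set set" and av bv :: "nat \<Rightarrow> nat"
    and \<delta> :: "nat \<Rightarrow> nat \<Rightarrow> int" and j :: "(nat \<Rightarrow> cpoly) \<Rightarrow> cpoly"
    and I :: "cpoly set" and c :: "nat \<Rightarrow> int"
    and Y :: "(nat \<Rightarrow> real) topology" and Z :: "(nat \<Rightarrow> real) set"
  assumes "simplicial_complex_on n X"
    and "supp av \<subseteq> {0..n}" and "supp bv \<subseteq> {0..n}" and "supp av \<inter> supp bv = {}"
    and "I = SR_ideal n X"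
    and "c = (\<lambda>i. int (av i) - int (bv i))"
    and "graded_presentation n I m \<delta> j"
    and "Y = subtopology (powertop_real UNIV) (space_of n X (N_set X (supp av) (supp bv)))"
    and "Z = space_of n X (N_tilde X (supp av) (supp bv))"
  shows "(\<not> (\<forall>i. bv i \<in> {0, 1}) \<longrightarrow>
            carrier (T1_part n I c) = {\<zero>\<^bsub>T1_part n I c\<^esub>} \<and>
            carrier (T2_part n I m \<delta> j c) = {\<zero>\<^bsub>T2_part n I m \<delta> j c\<^esub>}) \<and>
         ((\<forall>i. bv i \<in> {0, 1}) \<longrightarrow>
            (\<forall>av'. supp av' = supp av \<longrightarrow>
               mod_iso complex_ring (T1_part n I (\<lambda>i. int (av' i) - int (bv i))) (T1_part n I c) \<and>
               mod_iso complex_ring (T2_part n I m \<delta> j (\<lambda>i. int (av' i) - int (bv i))) (T2_part n I m \<delta> j c)) \<and>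
            (card (supp bv) \<noteq> 1 \<longrightarrow>
               mod_iso complex_ring (T1_part n I c) (cohomology 0 Y Z) \<and>
               mod_iso complex_ring (T2_part n I m \<delta> j c) (cohomology 1 Y Z)) \<and>
            (card (supp bv) = 1 \<longrightarrow>
               N_tilde X (supp av) (supp bv) = {} \<and>
               mod_iso complex_ring (T1_part n I c) (reduced_cohomology 0 Y) \<and>
               mod_iso complex_ring (T2_part n I m \<delta> j c) (reduced_cohomology 1 Y)) \<and>
            mod_iso complex_ring (hom_I_A_part n I c) (cohomology 0 Y Z))"
proof -
  let ?N = "N_set X (supp av) (supp bv)" and ?Nt = "N_tilde X (supp av) (supp bv)"
  have loc: "sr_t2 n X av' bv m \<delta> j" if "supp av' = supp av" for av'
    by unfold_locales (use assms that in auto)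
  have degree: "sr_degree n X av bv" using loc[OF refl] by (rule sr_t2.axioms)
  have c_eq: "sr_degree.c av' bv = (\<lambda>i. int (av' i) - int (bv i))" if "supp av' = supp av" for av'
    by (rule sr_degree.c_def) (rule sr_t2.axioms(1)[OF loc[OF that]])
  have vanish: "carrier (T1_part n I c) = {\<zero>\<^bsub>T1_part n I c\<^esub>} \<and> carrier (T2_part n I m \<delta> j c) = {\<zero>\<^bsub>T2_part n I m \<delta> j c\<^esub>}"
    if "\<not> (\<forall>i. bv i \<in> {0, 1})"
    using sr_degree.T1_part_not_sqfree[OF degree that] sr_t2.T2_part_not_sqfree[OF loc[OF refl] that]
    unfolding c_eq[OF refl] assms(5,6) by blast
  show ?thesis
  proof (intro conjI impI allI)
    assume sq: "\<forall>i. bv i \<in> {0, 1}"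
    have sloc: "sr_t2_sqfree n X av' bv m \<delta> j" if "supp av' = supp av" for av'
      by (intro sr_t2_sqfree.intro sr_sqfree_degree.intro sr_sqfree_degree_axioms.intro
          sr_t2.axioms[OF loc[OF that]] sq)
    have T1: "presents (face_constants ?N ?Nt) (if card (supp bv) = 1 then constants ?N else vanishing ?N)
        (T1_part n I (\<lambda>i. int (av' i) - int (bv i)))"
      and T2: "presents (face_cocycles ?N ?Nt) (face_coboundaries ?N ?Nt)
        (T2_part n I m \<delta> j (\<lambda>i. int (av' i) - int (bv i)))"
      if av': "supp av' = supp av" for av'
    proof -
      interpret D: sr_t2_sqfree n X av' bv m \<delta> j by (rule sloc[OF av'])
      show "presents (face_constants ?N ?Nt) (if card (supp bv) = 1 then constants ?N else vanishing ?N)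
          (T1_part n I (\<lambda>i. int (av' i) - int (bv i)))"
        using D.presents_T1_part unfolding D.a_def D.b_def D.c_def av' assms(5) .
      show "presents (face_cocycles ?N ?Nt) (face_coboundaries ?N ?Nt)
          (T2_part n I m \<delta> j (\<lambda>i. int (av' i) - int (bv i)))"
        using D.presents_T2_part unfolding D.a_def D.b_def D.c_def av' assms(5) .
    qed
    note T1c = T1[OF refl, folded assms(6)] and T2c = T2[OF refl, folded assms(6)]
    interpret D: sr_t2_sqfree n X av bv m \<delta> j by (rule sloc[OF refl])
    have hom: "presents (face_constants ?N ?Nt) (vanishing ?N) (hom_I_A_part n I c)"
      using D.presents_hom_I_A_part unfolding D.a_def D.b_def D.c_def assms(5,6) .
    have Nt0: "card (supp bv) = 1 \<Longrightarrow> ?Nt = {}"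
      using D.Nt_single unfolding D.a_def D.b_def .
    interpret face_pair n ?N ?Nt
      using D.face_pair unfolding D.a_def D.b_def .
    have Y: "Y = subtopology (powertop_real UNIV) (cell_space n ?N)" and Z: "Z = cell_space n ?Nt"
      using D.space_of_N D.space_of_Nt unfolding D.a_def D.b_def assms(8,9) by simp_all
    note iso0 = presents_imp_mod_iso[OF face_constants_subspace]
      and iso1 = presents_imp_mod_iso[OF face_cocycles_subspace]
    show "mod_iso complex_ring (hom_I_A_part n I c) (cohomology 0 Y Z)"
      unfolding Y Z by (rule iso0[OF hom presents_cohomology_0])
    { fix av' assume "supp av' = supp av"
      note T = T1[OF this] T2[OF this]
      show "mod_iso complex_ring (T1_part n I (\<lambda>i. int (av' i) - int (bv i))) (T1_part n I c)"
        by (rule iso0[OF T(1) T1c])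
      show "mod_iso complex_ring (T2_part n I m \<delta> j (\<lambda>i. int (av' i) - int (bv i))) (T2_part n I m \<delta> j c)"
        by (rule iso1[OF T(2) T2c]) }
    { assume b: "card (supp bv) \<noteq> 1"
      show "mod_iso complex_ring (T1_part n I c) (cohomology 0 Y Z)"
        unfolding Y Z by (rule iso0[OF _ presents_cohomology_0]) (use T1c b in simp)
      show "mod_iso complex_ring (T2_part n I m \<delta> j c) (cohomology 1 Y Z)"
        unfolding Y Z by (rule iso1[OF T2c presents_cohomology_1]) }
    { assume b: "card (supp bv) = 1"
      note Nt = Nt0[OF b]
      show "?Nt = {}" by (rule Nt)
      show "mod_iso complex_ring (T1_part n I c) (reduced_cohomology 0 Y)"
        unfolding Y by (rule iso0[OF _ presents_reduced_cohomology_0[OF Nt]]) (use T1c b in simp)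
      show "mod_iso complex_ring (T2_part n I m \<delta> j c) (reduced_cohomology 1 Y)"
        unfolding Y by (rule iso1[OF T2c presents_reduced_cohomology_1[OF Nt]]) }
  qed (use vanish in blast)+
qed

end
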